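(* Let $s\in(0,1)$, $N>2s$, $q>p>2$ and $\varepsilon>0$. Let $u\in H^s(\mathbb R^N)$ be a weak solution of $$(\mathcal P_\varepsilon)\qquad (-\Delta)^s u+\varepsilon u=|u|^{p-2}u-|u|^{q-2}u\ \text{ in }\mathbb R^N,\qquad u\ge 0,\ u\not\equiv 0,\qquad u\in H^s(\mathbb R^N).$$ Then $u$ is radially symmetric and strictly decreasing about some point in $\mathbb R^N$.
   Context: $\widehat{(-\Delta)^s\varphi}(\xi)=|\xi|^{2s}\hat\varphi(\xi)$ for Schwartz functions $\varphi$ (unitary Fourier transform). $\dot H^s(\mathbb R^N)$ is the completion of $C_c^\infty(\mathbb R^N)$ for $\|u\|_{\dot H^s}^2=\int_{\mathbb R^N}|\xi|^{2s}|\hat u(\xi)|^2d\xi$, with scalar product $\langle\cdot,\cdot\rangle_{\dot H^s}$; $H^s(\mathbb R^N)=\dot H^s(\mathbb R^N)\cap L^2(\mathbb R^N)$. A weak solution of $(\mathcal P_\varepsilon)$ is a function $u\in H^s(\mathbb R^N)\cap L^q(\mathbb R^N)$, $u\ge0$, $u\not\equiv0$, such that $\langle u,\varphi\rangle_{\dot H^s}+\varepsilon\int u\varphi\,dx=\int u^{p-1}\varphi\,dx-\int u^{q-1}\varphi\,dx$ for all $\varphi\in H^s(\mathbb R^N)\cap L^q(\mathbb R^N)$. (Weak solutions have continuous representatives; "radially symmetric and strictly decreasing about $x_0$" means that $u(x)=g(|x-x_0|)$ with $g$ strictly decreasing on $[0,\infty)$.) *)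

theory Defs
  imports "HOL-Analysis.Analysis"
begin

text \<open>The ambient space is \<open>real ^ 'n\<close>, so the dimension N is \<open>CARD('n)\<close>. All functions are
  real-valued; functions in Lebesgue and Sobolev spaces are represented by Lebesgue measurable
  functions; \<open>in_Lp\<close>, \<open>in_dotH\<close>, \<open>dotH_inner\<close> and \<open>weak_solution\<close> are invariant under
  changes on null sets.\<close>

primrec Ck :: "nat \<Rightarrow> (real ^ 'n \<Rightarrow> real) \<Rightarrow> bool" where
  "Ck 0 f \<longleftrightarrow> continuous_on UNIV f"
| "Ck (Suc k) f \<longleftrightarrow> (\<forall>x. f differentiable (at x)) \<and>
     (\<forall>v. Ck k (\<lambda>x. frechet_derivative f (at x) v))"

definition test_function :: "(real ^ 'n \<Rightarrow> real) \<Rightarrow> bool" where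
  "test_function \<phi> \<longleftrightarrow> (\<forall>k. Ck k \<phi>) \<and> compact (closure {x. \<phi> x \<noteq> 0})"

definition in_Lp :: "real \<Rightarrow> (real ^ 'n \<Rightarrow> real) \<Rightarrow> bool" where
  "in_Lp r u \<longleftrightarrow> u \<in> borel_measurable lebesgue \<and> integrable lebesgue (\<lambda>x. \<bar>u x\<bar> powr r)"

definition fourier :: "(real ^ 'n \<Rightarrow> real) \<Rightarrow> real ^ 'n \<Rightarrow> complex" where
  "fourier \<phi> \<xi> = complex_of_real ((2 * pi) powr (- real CARD('n) / 2)) *
     (LINT x|lebesgue. exp (- \<i> * complex_of_real (x \<bullet> \<xi>)) * complex_of_real (\<phi> x))"

text \<open>The integral in \<open>test_inner\<close> is already real, because the Fourier transforms of
  real-valued functions are Hermitian; \<open>Re\<close> only adjusts the type.\<close>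

definition test_inner :: "real \<Rightarrow> (real ^ 'n \<Rightarrow> real) \<Rightarrow> (real ^ 'n \<Rightarrow> real) \<Rightarrow> real" where
  "test_inner s \<phi> \<psi> = Re (LINT \<xi>|lebesgue.
     complex_of_real (norm \<xi> powr (2 * s)) * (fourier \<phi> \<xi> * cnj (fourier \<psi> \<xi>)))"

definition test_norm :: "real \<Rightarrow> (real ^ 'n \<Rightarrow> real) \<Rightarrow> real" where
  "test_norm s \<phi> = sqrt (LINT \<xi>|lebesgue. norm \<xi> powr (2 * s) * (cmod (fourier \<phi> \<xi>))\<^sup>2)"

text \<open>For \<open>0 < s\<close> and \<open>2 * s < N\<close>, the Sobolev inequality turns a sequence of test functions that
  is Cauchy for \<open>test_norm s\<close> into one that converges in the Lebesgue space with exponent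
  \<open>2 * N / (N - 2 * s)\<close>, and the limit determines the equivalence class of the Cauchy sequence.
  The completion of the test functions is therefore realized, as usual, as the space of these
  limits. The definitions below are meaningful only in this range of s.\<close>

definition critical_exponent :: "'n::finite itself \<Rightarrow> real \<Rightarrow> real" where
  "critical_exponent _ s = 2 * real CARD('n) / (real CARD('n) - 2 * s)"

definition dotH_approx :: "real \<Rightarrow> (nat \<Rightarrow> real ^ 'n \<Rightarrow> real) \<Rightarrow> (real ^ 'n \<Rightarrow> real) \<Rightarrow> bool" where
  "dotH_approx s \<phi> u \<longleftrightarrow>
     (\<forall>k. test_function (\<phi> k)) \<and>
     (\<forall>e>0. \<exists>M. \<forall>k\<ge>M. \<forall>l\<ge>M. test_norm s (\<lambda>x. \<phi> k x - \<phi> l x) < e) \<and>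
     in_Lp (critical_exponent TYPE('n) s) u \<and>
     (\<lambda>k. LINT x|lebesgue. \<bar>\<phi> k x - u x\<bar> powr critical_exponent TYPE('n) s) \<longlonglongrightarrow> 0"

definition in_dotH :: "real \<Rightarrow> (real ^ 'n \<Rightarrow> real) \<Rightarrow> bool" where
  "in_dotH s u \<longleftrightarrow> (\<exists>\<phi>. dotH_approx s \<phi> u)"

text \<open>The scalar product of the completion: the continuous extension of \<open>test_inner s\<close>. The limit
  exists and does not depend on the approximating sequences.\<close>

definition dotH_inner :: "real \<Rightarrow> (real ^ 'n \<Rightarrow> real) \<Rightarrow> (real ^ 'n \<Rightarrow> real) \<Rightarrow> real" where
  "dotH_inner s u v = (THE c. \<forall>\<phi> \<psi>. dotH_approx s \<phi> u \<longrightarrow> dotH_approx s \<psi> v \<longrightarrow>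
     (\<lambda>k. test_inner s (\<phi> k) (\<psi> k)) \<longlonglongrightarrow> c)"

definition in_Hs :: "real \<Rightarrow> (real ^ 'n \<Rightarrow> real) \<Rightarrow> bool" where
  "in_Hs s u \<longleftrightarrow> in_dotH s u \<and> in_Lp 2 u"

text \<open>Since \<open>u \<ge> 0\<close> almost everywhere, \<open>u x powr (p - 1)\<close> is the nonlinearity |u|^(p-2) u.\<close>

definition weak_solution ::
  "real \<Rightarrow> real \<Rightarrow> real \<Rightarrow> real \<Rightarrow> (real ^ 'n \<Rightarrow> real) \<Rightarrow> bool" where
  "weak_solution s p q \<epsilon> u \<longleftrightarrow>
     in_Hs s u \<and> in_Lp q u \<and>
     (AE x in lebesgue. u x \<ge> 0) \<and>
     \<not> (AE x in lebesgue. u x = 0) \<and>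
     (\<forall>\<phi>. in_Hs s \<phi> \<and> in_Lp q \<phi> \<longrightarrow>
        dotH_inner s u \<phi> + \<epsilon> * (LINT x|lebesgue. u x * \<phi> x) =
        (LINT x|lebesgue. u x powr (p - 1) * \<phi> x) - (LINT x|lebesgue. u x powr (q - 1) * \<phi> x))"

definition radially_strictly_decreasing_about :: "real ^ 'n \<Rightarrow> (real ^ 'n \<Rightarrow> real) \<Rightarrow> bool" where
  "radially_strictly_decreasing_about x0 v \<longleftrightarrow>
     (\<exists>g. strict_antimono_on {0..} g \<and> (\<forall>x. v x = g (norm (x - x0))))"

end

(* Plancherel, with the rotation invariance and homogeneity of the kernel norm h powr (- N - 2 s),
   identifies the form of dotH s with kappa times the Gagliardo form, so the equation reads
   kappa * energy s u phi = integral of f(u) * phi with f(t) = t^(p-1) - t^(q-1) - epsilon * t.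
   Testing with a truncation of u - 1 gives u <= 1; testing with truncated increments of u gives
   uniform continuity. Then the planes are moved: for a hyperplane with reflection R, the antisymmetric
   function u - u o R is tested against its own positive part on the half-space. As f is decreasing
   near 0, this forces u <= u o R as soon as the set where u > delta and u > u o R has small measure;
   a barrier gives the strong maximum principle for the antisymmetric difference. Hence every direction
   has exactly one plane of symmetry, and all these planes meet in one point. *)
theory Submission
  imports Defs "HOL-Probability.Characteristic_Functions"
begin

section \<open>Reflections and the fractional kernel\<close>

text \<open>Truncation arguments need pointwise signs, which the double integral shows and the
  Fourier integral hides. Neither decay at infinity nor regularity of \<open>u\<close> is given, and
  \<open>q\<close> may exceed the critical exponent. Hence only bounded test functions of finite
  energy are used, and the sign of the \<open>q\<close>-term yields the bound 1. Decay is replaced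
  by integrability: the sets where \<open>u\<close> exceeds a positive level have finite measure,
  and this is what starts the planes at infinity. The Sobolev inequality is replaced by an
  elementary estimate that compares a function on a small set with its values at nearby points
  outside the set. The interaction across a hyperplane is controlled by comparing the kernel at
  \<open>y\<close> and at its mirror image, which reduces to an inequality in two signed values and
  two weights. A direction has at most one plane of symmetry because two parallel ones would make a
  nonzero \<open>L^2\<close> function periodic. The common point comes from the coordinate planes:
  their reflections compose to a point reflection, which maps planes of symmetry to planes of
  symmetry.\<close>

lemma translation_invariant_measure_unique:
  fixes M :: "'a::euclidean_space measure"
  assumes sets: "sets M = sets borel" and "sigma_finite_measure M"
    and inv: "\<And>v. distr M borel (\<lambda>x. x + v) = M"
    and ball: "emeasure M (ball 0 1) = emeasure lborel (ball (0::'a) 1)"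
  shows "M = lborel"
proof (rule measure_eqI)
  show "sets M = sets lborel" using sets by simp
  fix A assume "A \<in> sets M"
  then have A[measurable]: "A \<in> sets borel" using sets by simp
  interpret M: sigma_finite_measure M by fact
  interpret P: pair_sigma_finite M lborel ..
  have [measurable_cong]: "sets M = sets borel" by fact
  let ?B = "ball (0::'a) 1"
  let ?b = "indicator ?B :: 'a \<Rightarrow> ennreal" and ?a = "indicator A :: 'a \<Rightarrow> ennreal"
  have [measurable]: "?B \<in> sets borel" by simp
  have sh: "(\<integral>\<^sup>+y. f (y + x) \<partial>lborel) = (\<integral>\<^sup>+y. f y \<partial>lborel)"
    if [measurable]: "f \<in> borel_measurable borel" for f :: "'a \<Rightarrow> ennreal" and x
    by (subst (2) lborel_distr_plus[of x, symmetric]) (simp add: nn_integral_distr add.commute)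
  have shM: "(\<integral>\<^sup>+y. f (y + x) \<partial>M) = (\<integral>\<^sup>+y. f y \<partial>M)"
    if [measurable]: "f \<in> borel_measurable borel" for f :: "'a \<Rightarrow> ennreal" and x
    by (subst (2) inv[of x, symmetric]) (simp add: nn_integral_distr)
  have bsym: "?b (- x) = ?b x" for x by (simp add: indicator_def)
  \<comment> \<open>Uniqueness of Haar measure by Fubini: the double integral of 1_A(x) 1_B(y - x)
    against M(dx) dy is M(A) |B| when y is integrated first. Integrating x first and shifting x by y
    gives |A| M(B), because the ball B is symmetric.\<close>
  have "emeasure M A * emeasure lborel ?B = (\<integral>\<^sup>+x. ?a x * (\<integral>\<^sup>+y. ?b (y - x) \<partial>lborel) \<partial>M)"
    using sh[of ?b "- x" for x] by (simp add: nn_integral_multc sets)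
  also have "\<dots> = (\<integral>\<^sup>+x. (\<integral>\<^sup>+y. ?a x * ?b (y - x) \<partial>lborel) \<partial>M)"
    by (simp add: nn_integral_cmult)
  also have "\<dots> = (\<integral>\<^sup>+y. (\<integral>\<^sup>+x. ?a x * ?b (y - x) \<partial>M) \<partial>lborel)"
    by (rule P.Fubini'[symmetric]) measurable
  also have "\<dots> = (\<integral>\<^sup>+y. (\<integral>\<^sup>+x. ?a (x + y) * ?b x \<partial>M) \<partial>lborel)"
  proof (rule nn_integral_cong)
    fix y
    have "(\<integral>\<^sup>+x. ?a x * ?b (y - x) \<partial>M) = (\<integral>\<^sup>+x. ?a (x + y) * ?b (y - (x + y)) \<partial>M)"
      by (rule shM[symmetric]) measurable
    then show "(\<integral>\<^sup>+x. ?a x * ?b (y - x) \<partial>M) = (\<integral>\<^sup>+x. ?a (x + y) * ?b x \<partial>M)"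
      by (simp add: bsym del: indicator_simps)
  qed
  also have "\<dots> = (\<integral>\<^sup>+x. (\<integral>\<^sup>+y. ?a (x + y) * ?b x \<partial>lborel) \<partial>M)"
    by (rule P.Fubini') measurable
  also have "\<dots> = (\<integral>\<^sup>+x. emeasure lborel A * ?b x \<partial>M)"
    using sh[of ?a] by (simp add: nn_integral_multc add.commute)
  also have "\<dots> = emeasure lborel A * emeasure lborel ?B"
    using ball by (simp add: nn_integral_cmult sets)
  finally have eq: "emeasure M A * emeasure lborel ?B = emeasure lborel A * emeasure lborel ?B" .
  have "emeasure lborel ?B \<noteq> 0" "emeasure lborel ?B \<noteq> top"
    using emeasure_lborel_ball_finite[of "0::'a" 1] unit_ball_vol_pos[of "real DIM('a)"]
    by (auto simp: emeasure_ball simp del: unit_ball_vol_pos)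
  with eq show "emeasure M A = emeasure lborel A"
    using ennreal_mult_cancel_left[of "emeasure lborel ?B" "emeasure M A" "emeasure lborel A"]
    by (simp add: mult.commute[of "emeasure lborel ?B"])
qed

text \<open>No determinant enters. The image measure is translation invariant because
  \<open>T\<close> is linear and onto, and it gives balls around 0 their Lebesgue measure because
  \<open>T\<close> preserves norms, so it is Lebesgue measure by uniqueness.\<close>

lemma lborel_distr_orthogonal:
  fixes T :: "'a::euclidean_space \<Rightarrow> 'a"
  assumes T: "orthogonal_transformation T"
  shows "distr lborel borel T = lborel"
proof -
  have lin: "linear T" using T by (simp add: orthogonal_transformation_def)
  have meas[measurable]: "T \<in> borel_measurable borel"
    using lin by (simp add: borel_measurable_continuous_onI linear_continuous_on linear_linear)
  have bij: "bij T" using T by (rule orthogonal_transformation_bij)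
  have T': "orthogonal_transformation (inv T)" using T by (rule orthogonal_transformation_inv)
  have lin': "linear (inv T)" using T' by (simp add: orthogonal_transformation_def)
  have [measurable]: "inv T \<in> borel_measurable borel"
    using lin' by (simp add: borel_measurable_continuous_onI linear_continuous_on linear_linear)
  show ?thesis
  proof (rule translation_invariant_measure_unique)
    show "sets (distr lborel borel T) = sets borel" by simp
    have pre: "T -` ball 0 r = ball 0 r" for r
      using orthogonal_transformation_norm[OF T] by auto
    show "emeasure (distr lborel borel T) (ball 0 1) = emeasure lborel (ball (0::'a) 1)"
      by (simp add: emeasure_distr pre)
    show "sigma_finite_measure (distr lborel borel T)"
    proof
      show "\<exists>A. countable A \<and> A \<subseteq> sets (distr lborel borel T) \<and> \<Union> A = space (distr lborel borel T) \<and>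
          (\<forall>a\<in>A. emeasure (distr lborel borel T) a \<noteq> \<infinity>)"
      proof (intro exI[of _ "range (\<lambda>n::nat. ball (0::'a) (real n))"] conjI ballI)
        show "\<Union> (range (\<lambda>n::nat. ball (0::'a) (real n))) = space (distr lborel borel T)"
          by (auto intro: reals_Archimedean2)
      qed (use emeasure_lborel_ball_finite[of "0::'a"] in \<open>auto simp: emeasure_distr pre less_top\<close>)
    qed
    fix v
    have eq: "(\<lambda>x. x + v) \<circ> T = T \<circ> (\<lambda>x. inv T v + x)"
      using lin bij by (auto simp: fun_eq_iff linear_add bij_is_surj surj_f_inv_f)
    have "distr (distr lborel borel T) borel (\<lambda>x. x + v) = distr lborel borel ((\<lambda>x. x + v) \<circ> T)"
      by (simp add: distr_distr)
    also have "\<dots> = distr (distr lborel borel (\<lambda>x. inv T v + x)) borel T"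
      unfolding eq by (subst distr_distr) auto
    also have "\<dots> = distr lborel borel T"
      by (simp add: lborel_distr_plus)
    finally show "distr (distr lborel borel T) borel (\<lambda>x. x + v) = distr lborel borel T" .
  qed
qed

text \<open>The mirror is the hyperplane \<open>x \<bullet> e = l\<close>; the formula is a
  reflection only for a unit normal \<open>e\<close>.\<close>

definition hyp_reflect :: "'a::euclidean_space \<Rightarrow> real \<Rightarrow> 'a \<Rightarrow> 'a" where
  "hyp_reflect e l x = x + (2 * (l - x \<bullet> e)) *\<^sub>R e"

lemma hyp_reflect_inner: "norm e = 1 \<Longrightarrow> hyp_reflect e l x \<bullet> e = 2 * l - x \<bullet> e"
  by (simp add: hyp_reflect_def inner_add_left norm_eq_1 algebra_simps)

lemma hyp_reflect_involution [simp]: "norm e = 1 \<Longrightarrow> hyp_reflect e l (hyp_reflect e l x) = x"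
  unfolding hyp_reflect_def[of e l "hyp_reflect e l x"]
  by (simp add: hyp_reflect_inner) (simp add: hyp_reflect_def algebra_simps)

lemma orthogonal_hyp_reflect0: "norm e = 1 \<Longrightarrow> orthogonal_transformation (hyp_reflect e 0)"
  unfolding orthogonal_transformation_def
  by (auto intro!: linearI simp: hyp_reflect_def inner_add_left inner_add_right norm_eq_1
      inner_commute algebra_simps)

lemma hyp_reflect_split: "hyp_reflect e l x = (2 * l) *\<^sub>R e + hyp_reflect e 0 x"
  by (simp add: hyp_reflect_def algebra_simps)

lemma norm_hyp_reflect_diff:
  "norm e = 1 \<Longrightarrow> norm (hyp_reflect e l x - hyp_reflect e l y) = norm (x - y)"
  using orthogonal_transformation_norm[OF orthogonal_hyp_reflect0, of e "x - y"]
  by (simp add: hyp_reflect_def inner_diff_left algebra_simps)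

lemma continuous_hyp_reflect: "continuous_on UNIV (hyp_reflect e l)"
  unfolding hyp_reflect_def by (intro continuous_intros)

lemma measurable_hyp_reflect [measurable]: "hyp_reflect e l \<in> borel_measurable borel"
  by (rule borel_measurable_continuous_onI[OF continuous_hyp_reflect])

lemma lborel_distr_hyp_reflect:
  assumes "norm e = 1"
  shows "distr lborel borel (hyp_reflect e l) = lborel"
proof -
  have "distr lborel borel (hyp_reflect e l) =
      distr (distr lborel borel (hyp_reflect e 0)) borel ((+) ((2 * l) *\<^sub>R e))"
    by (subst distr_distr) (auto simp: o_def hyp_reflect_split[of e l, symmetric])
  then show ?thesis
    by (simp add: lborel_distr_orthogonal orthogonal_hyp_reflect0 assms lborel_distr_plus)
qed

lemma nn_integral_lborel_scaleR:
  fixes f :: "'a::euclidean_space \<Rightarrow> ennreal"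
  assumes [measurable]: "f \<in> borel_measurable borel" and c: "c > 0"
  shows "(\<integral>\<^sup>+x. f x \<partial>lborel) = ennreal (c ^ DIM('a)) * (\<integral>\<^sup>+x. f (c *\<^sub>R x) \<partial>lborel)"
  by (subst lborel_affine[of c 0])
    (use c in \<open>simp_all add: nn_integral_density nn_integral_distr nn_integral_cmult\<close>)

lemma integral_lborel_scaleR:
  fixes f :: "'a::euclidean_space \<Rightarrow> 'b::{banach, second_countable_topology}"
  assumes [measurable]: "f \<in> borel_measurable borel" and c: "c > 0"
  shows "(\<integral>x. f x \<partial>lborel) = (c ^ DIM('a)) *\<^sub>R (\<integral>x. f (c *\<^sub>R x) \<partial>lborel)"
  by (subst lborel_affine[of c 0])
    (use c in \<open>simp_all add: integral_density integral_distr\<close>)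

text \<open>At the origin the value is 0, since \<open>0 powr a = 0\<close>. Monotonicity in the
  norm therefore has to exclude \<open>z = 0\<close>, and kernel comparisons at coinciding points
  need separate care.\<close>

definition frac_kernel :: "real \<Rightarrow> 'a::euclidean_space \<Rightarrow> real" where
  "frac_kernel s z = norm z powr (- (real DIM('a) + 2 * s))"

lemma frac_kernel_nonneg [simp]: "frac_kernel s z \<ge> 0"
  by (simp add: frac_kernel_def)

lemma frac_kernel_minus [simp]: "frac_kernel s (- z) = frac_kernel s z"
  by (simp add: frac_kernel_def)

lemma frac_kernel_commute: "frac_kernel s (x - y) = frac_kernel s (y - x)"
  by (simp add: frac_kernel_def norm_minus_commute)

lemma measurable_frac_kernel [measurable]: "frac_kernel s \<in> borel_measurable borel"
  unfolding frac_kernel_def by measurable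

lemma frac_kernel_pos: "z \<noteq> 0 \<Longrightarrow> frac_kernel s z > 0"
  by (simp add: frac_kernel_def)

lemma frac_kernel_mono:
  "s > 0 \<Longrightarrow> z \<noteq> 0 \<Longrightarrow> norm z \<le> norm w \<Longrightarrow> frac_kernel s (w::'a) \<le> frac_kernel s (z::'a::euclidean_space)"
  unfolding frac_kernel_def by (intro powr_mono2') auto

lemma frac_kernel_strict_mono:
  "s > 0 \<Longrightarrow> z \<noteq> 0 \<Longrightarrow> norm z < norm w \<Longrightarrow> frac_kernel s (w::'a) < frac_kernel s (z::'a::euclidean_space)"
  unfolding frac_kernel_def by (intro powr_less_mono2_neg) (auto simp: add_pos_pos)

lemma frac_kernel_scaleR:
  "c > 0 \<Longrightarrow> frac_kernel s (c *\<^sub>R z) = c powr (- (real DIM('a) + 2 * s)) * frac_kernel s (z::'a::euclidean_space)"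
  by (simp add: frac_kernel_def powr_mult)

lemma suminf_geometric_powr_finite:
  assumes "a > 0" "C \<ge> 0"
  shows "(\<Sum>n. ennreal (C * 2 powr (- a * real n))) < \<infinity>"
proof -
  have eq: "C * 2 powr (- a * real n) = C * (2 powr (- a)) ^ n" for n
    by (simp add: powr_realpow[symmetric] powr_powr)
  have "2 powr (- a) < 1" using \<open>a > 0\<close> by (simp add: powr_less_one)
  then have "summable (\<lambda>n. C * (2 powr (- a)) ^ n)"
    by (intro summable_mult summable_geometric) auto
  then show ?thesis
    unfolding eq using \<open>C \<ge> 0\<close> by (subst suminf_ennreal2) auto
qed

lemma ennreal_le_suminf: "(f n :: ennreal) \<le> (\<Sum>n. f n)"
  using sum_le_suminf[OF summableI, of "{n}" f] by simp

text \<open>Dyadic shells: on \<open>2 ^ n \<le> norm h < 2 ^ (n + 1)\<close> the kernel has mass of order \<open>2 ^ (- 2 s n)\<close>,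
  on \<open>2 ^ (- n - 1) < norm h \<le> 2 ^ (- n)\<close> the integrand has mass of order \<open>2 ^ (- (2 - 2 s) n)\<close>.\<close>

lemma frac_kernel_levy:
  assumes s: "0 < s" "s < 1"
  shows "integrable lborel (\<lambda>h::'a::euclidean_space. min 1 ((norm h)\<^sup>2) * frac_kernel s h)"
proof (rule integrableI_nonneg)
  let ?N = "real DIM('a)"
  let ?V = "unit_ball_vol ?N"
  let ?a = "\<lambda>n::nat. 2 powr (- (?N + 2 * s) * real n)"
  let ?b = "\<lambda>n::nat. 2 powr (- 2 * real n) * 2 powr ((?N + 2 * s) * (real n + 1))"
  \<comment> \<open>The shells are enlarged to closed balls, whose volumes are explicit; this
    changes the masses by constant factors only, so both series stay geometric.\<close>
  let ?A = "\<lambda>n::nat. cball (0::'a) (2 powr (real n + 1))"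
  let ?B = "\<lambda>n::nat. cball (0::'a) (2 powr (- real n))"
  let ?f = "\<lambda>h::'a. min 1 ((norm h)\<^sup>2) * frac_kernel s h"
  show "?f \<in> borel_measurable lborel" by measurable
  have pt: "ennreal (?f h) \<le> (\<Sum>n. ennreal (?a n) * indicator (?A n) h) + (\<Sum>n. ennreal (?b n) * indicator (?B n) h)" for h
  proof (cases "h = 0")
    case False
    then have h0: "norm h > 0" by simp
    show ?thesis
    proof (cases "norm h \<ge> 1")
      case True
      define n where "n = nat \<lfloor>log 2 (norm h)\<rfloor>"
      have "log 2 (norm h) \<ge> 0" using True h0 by simp
      then have n: "real n \<le> log 2 (norm h)" "log 2 (norm h) \<le> real n + 1"
        unfolding n_def by linarith+
      have lo: "2 powr real n \<le> norm h" using n(1) h0 by (simp add: le_log_iff)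
      have hi: "norm h \<le> 2 powr (real n + 1)" using n(2) h0 by (simp add: log_le_iff)
      have "?f h \<le> 1 * frac_kernel s h" by (intro mult_right_mono) auto
      also have "\<dots> \<le> (2 powr real n) powr (- (?N + 2 * s))"
        unfolding frac_kernel_def using lo s by (simp add: powr_mono2')
      also have "\<dots> = ?a n" by (simp add: powr_powr mult.commute)
      finally have "ennreal (?f h) \<le> ennreal (?a n) * indicator (?A n) h"
        using hi by (simp add: ennreal_leI)
      also have "\<dots> \<le> (\<Sum>n. ennreal (?a n) * indicator (?A n) h)"
        by (rule ennreal_le_suminf)
      finally show ?thesis by (meson order_trans le_add_same_cancel1 zero_le add_increasing2 order_refl)
    next
      case False
      define n where "n = nat \<lfloor>- log 2 (norm h)\<rfloor>"
      have "log 2 (norm h) < 0" using False h0 by simp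
      then have n: "real n \<le> - log 2 (norm h)" "- log 2 (norm h) \<le> real n + 1"
        unfolding n_def by linarith+
      have hi: "norm h \<le> 2 powr (- real n)" using n(1) h0 by (simp add: log_le_iff[symmetric])
      have lo: "2 powr (- (real n + 1)) \<le> norm h" using n(2) h0 by (simp add: le_log_iff[symmetric])
      have "(norm h)\<^sup>2 \<le> (2 powr (- real n))\<^sup>2" using hi by (intro power_mono) auto
      also have "\<dots> = 2 powr (- 2 * real n)" by (simp add: powr_powr[symmetric] powr_realpow[symmetric] powr_numeral power2_eq_square powr_add[symmetric])
      finally have h2: "(norm h)\<^sup>2 \<le> 2 powr (- 2 * real n)" .
      have "frac_kernel s h \<le> (2 powr (- (real n + 1))) powr (- (?N + 2 * s))"
        unfolding frac_kernel_def using lo s by (simp add: powr_mono2')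
      also have "\<dots> = 2 powr ((?N + 2 * s) * (real n + 1))" by (simp add: powr_powr algebra_simps)
      finally have "?f h \<le> ?b n" using h2 by (intro mult_mono) auto
      then have "ennreal (?f h) \<le> ennreal (?b n) * indicator (?B n) h"
        using hi by (simp add: ennreal_leI)
      also have "\<dots> \<le> (\<Sum>n. ennreal (?b n) * indicator (?B n) h)"
        by (rule ennreal_le_suminf)
      finally show ?thesis by (meson order_trans add_increasing zero_le order_refl)
    qed
  qed simp
  have A: "(\<Sum>n. ennreal (?a n) * emeasure lborel (?A n)) < \<infinity>"
  proof -
    have "ennreal (?a n) * emeasure lborel (?A n) = ennreal (?V * 2 powr ?N * 2 powr (- (2 * s) * real n))" for n
    proof -
      have "?a n * (2 powr (real n + 1)) ^ DIM('a) = 2 powr (- (?N + 2 * s) * real n + (real n + 1) * ?N)"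
        by (simp add: powr_realpow[symmetric] powr_powr powr_add[symmetric])
      also have "\<dots> = 2 powr ?N * 2 powr (- (2 * s) * real n)"
        by (simp add: powr_add[symmetric] algebra_simps)
      finally show ?thesis
        by (simp add: emeasure_cball ennreal_mult[symmetric] mult_ac)
    qed
    then show ?thesis
      by (simp only:) (rule suminf_geometric_powr_finite, use s in auto)
  qed
  have B: "(\<Sum>n. ennreal (?b n) * emeasure lborel (?B n)) < \<infinity>"
  proof -
    have "ennreal (?b n) * emeasure lborel (?B n) = ennreal (?V * 2 powr (?N + 2 * s) * 2 powr (- (2 - 2 * s) * real n))" for n
    proof -
      have "?b n * (2 powr (- real n)) ^ DIM('a) = 2 powr (- 2 * real n + (?N + 2 * s) * (real n + 1) + (- real n) * ?N)"
        by (simp add: powr_realpow[symmetric] powr_powr powr_add[symmetric])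
      also have "\<dots> = 2 powr (?N + 2 * s) * 2 powr (- (2 - 2 * s) * real n)"
        by (simp add: powr_add[symmetric] algebra_simps)
      finally show ?thesis
        by (simp add: emeasure_cball ennreal_mult[symmetric] mult_ac)
    qed
    then show ?thesis
      by (simp only:) (rule suminf_geometric_powr_finite, use s in auto)
  qed
  have meas: "(\<lambda>h. \<Sum>n. c n * indicator (cball (0::'a) (r n)) h) \<in> borel_measurable lborel"
    for c :: "nat \<Rightarrow> ennreal" and r
    by (auto intro!: borel_measurable_suminf_order borel_measurable_times_ennreal borel_measurable_indicator)
  have series: "(\<integral>\<^sup>+h. (\<Sum>n. c n * indicator (cball (0::'a) (r n)) h) \<partial>lborel) =
      (\<Sum>n. c n * emeasure lborel (cball (0::'a) (r n)))" for c :: "nat \<Rightarrow> ennreal" and r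
    by (subst nn_integral_suminf)
      (auto intro!: borel_measurable_times_ennreal borel_measurable_indicator simp: nn_integral_cmult_indicator)
  have "(\<integral>\<^sup>+h. ennreal (?f h) \<partial>lborel) \<le>
    (\<integral>\<^sup>+h. (\<Sum>n. ennreal (?a n) * indicator (?A n) h) + (\<Sum>n. ennreal (?b n) * indicator (?B n) h) \<partial>lborel)"
    by (intro nn_integral_mono pt)
  also have "\<dots> = (\<Sum>n. ennreal (?a n) * emeasure lborel (?A n)) + (\<Sum>n. ennreal (?b n) * emeasure lborel (?B n))"
    by (simp only: nn_integral_add[OF meas meas] series)
  also have "\<dots> < \<infinity>" using A B by simp
  finally show "(\<integral>\<^sup>+h. ennreal (?f h) \<partial>lborel) < \<infinity>" .
qed simp

section \<open>Square integrable functions\<close>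

lemma integral_lborel_preserving:
  fixes T :: "'a::euclidean_space \<Rightarrow> 'a" and f :: "'a \<Rightarrow> 'b::{banach, second_countable_topology}"
  assumes T: "distr lborel borel T = lborel" "T \<in> borel_measurable borel" and f: "f \<in> borel_measurable borel"
  shows "(\<integral>x. f (T x) \<partial>lborel) = (\<integral>x. f x \<partial>lborel)"
  by (subst (2) T(1)[symmetric]) (use T(2) f in \<open>simp add: integral_distr\<close>)

lemma integrable_lborel_preserving:
  fixes T :: "'a::euclidean_space \<Rightarrow> 'a" and f :: "'a \<Rightarrow> 'b::{banach, second_countable_topology}"
  assumes T: "distr lborel borel T = lborel" "T \<in> borel_measurable borel" and f: "f \<in> borel_measurable borel"
  shows "integrable lborel (\<lambda>x. f (T x)) \<longleftrightarrow> integrable lborel f"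
  by (subst (2) T(1)[symmetric]) (use T(2) f in \<open>simp add: integrable_distr_eq\<close>)

lemma nn_integral_lborel_preserving:
  fixes T :: "'a::euclidean_space \<Rightarrow> 'a"
  assumes T: "distr lborel borel T = lborel" "T \<in> borel_measurable borel" and f: "f \<in> borel_measurable borel"
  shows "(\<integral>\<^sup>+x. f (T x) \<partial>lborel) = (\<integral>\<^sup>+x. f x \<partial>lborel)"
  by (subst (2) T(1)[symmetric]) (use T(2) f in \<open>simp add: nn_integral_distr\<close>)

lemma AE_lborel_preserving:
  fixes T :: "'a::euclidean_space \<Rightarrow> 'a"
  assumes T: "distr lborel borel T = lborel" "T \<in> borel_measurable borel" and P: "AE x in lborel. P x"
  shows "AE x in lborel. P (T x)"
  using P by (subst (asm) T(1)[symmetric]) (auto dest: AE_distrD[rotated] simp: T(2))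

lemma lborel_distr_add: "distr lborel borel (\<lambda>x. x + (c::'a::euclidean_space)) = lborel"
  using lborel_distr_plus[of c] by (simp add: add.commute[of _ c] cong: distr_cong)

lemma lborel_distr_reflect_point: "distr lborel borel (\<lambda>x. (c::'a::euclidean_space) - x) = lborel"
proof -
  have "distr lborel borel uminus = (lborel :: 'a measure)"
    by (rule lborel_distr_orthogonal) (auto simp: orthogonal_transformation_def intro!: linearI)
  then have "distr lborel borel (\<lambda>x. c - x) = distr (distr lborel borel uminus) borel ((+) c)"
    by (subst distr_distr) (auto simp: o_def)
  then show ?thesis
    using \<open>distr lborel borel uminus = lborel\<close> by (simp add: lborel_distr_plus)
qed

lemma lborel_distr_prod:
  fixes T :: "'a::euclidean_space \<Rightarrow> 'a" and U :: "'b::euclidean_space \<Rightarrow> 'b"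
  assumes T: "distr lborel borel T = lborel" "T \<in> borel_measurable borel"
    and U: "distr lborel borel U = lborel" "U \<in> borel_measurable borel"
  shows "distr lborel borel (\<lambda>p. (T (fst p), U (snd p))) = lborel"
proof -
  have "distr lborel borel T \<Otimes>\<^sub>M distr lborel borel U =
      distr (lborel \<Otimes>\<^sub>M lborel) (borel \<Otimes>\<^sub>M borel) (\<lambda>(x, y). (T x, U y))"
    using T U lborel.sigma_finite_measure_axioms by (intro pair_measure_distr) auto
  then show ?thesis
    unfolding T(1) U(1) lborel_prod borel_prod by (simp add: case_prod_unfold)
qed

lemma lborel_distr_swap:
  "distr lborel borel (prod.swap :: 'a::euclidean_space \<times> 'a \<Rightarrow> 'a \<times> 'a) = lborel"
  using lborel_pair.distr_pair_swap[where 'a = 'a and 'b = 'a]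
  unfolding lborel_prod by (simp add: prod.swap_def[abs_def] case_prod_unfold cong: distr_cong)

lemma measurable_swap [measurable]:
  "(prod.swap :: 'a::euclidean_space \<times> 'a \<Rightarrow> 'a \<times> 'a) \<in> borel_measurable borel"
  unfolding prod.swap_def[abs_def] borel_prod[symmetric] by measurable

text \<open>Borel rather than Lebesgue measurability, so that compositions and product measures need
  no completion; a weak solution enters through a Borel representative.\<close>

definition sq_integrable :: "('a::euclidean_space \<Rightarrow> real) \<Rightarrow> bool" where
  "sq_integrable f \<longleftrightarrow> f \<in> borel_measurable borel \<and> integrable lborel (\<lambda>x. (f x)\<^sup>2)"

lemma sq_integrable_measurable: "sq_integrable f \<Longrightarrow> f \<in> borel_measurable borel"
  and sq_integrable_square: "sq_integrable f \<Longrightarrow> integrable lborel (\<lambda>x. (f x)\<^sup>2)"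
  by (auto simp: sq_integrable_def)

lemma sq_integrable_bound:
  assumes g: "sq_integrable g" and f[measurable]: "f \<in> borel_measurable borel"
    and le: "\<And>x. \<bar>f x\<bar> \<le> C * \<bar>g x\<bar>"
  shows "sq_integrable f"
  unfolding sq_integrable_def
proof
  show "integrable lborel (\<lambda>x. (f x)\<^sup>2)"
  proof (rule Bochner_Integration.integrable_bound)
    show "integrable lborel (\<lambda>x. C\<^sup>2 * (g x)\<^sup>2)" using sq_integrable_square[OF g] by simp
    show "AE x in lborel. norm ((f x)\<^sup>2) \<le> norm (C\<^sup>2 * (g x)\<^sup>2)"
    proof (rule AE_I2)
      fix x
      have "\<bar>f x\<bar>\<^sup>2 \<le> (C * \<bar>g x\<bar>)\<^sup>2" using le[of x] by (intro power_mono) auto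
      then show "norm ((f x)\<^sup>2) \<le> norm (C\<^sup>2 * (g x)\<^sup>2)" by (simp add: power_mult_distrib)
    qed
  qed simp
qed simp

lemma sq_integrable_mult:
  assumes f: "sq_integrable f" and g: "sq_integrable g"
  shows "integrable lborel (\<lambda>x. f x * g x)"
proof (rule Bochner_Integration.integrable_bound)
  show "integrable lborel (\<lambda>x. (f x)\<^sup>2 + (g x)\<^sup>2)"
    using f g by (simp add: sq_integrable_square)
  show "(\<lambda>x. f x * g x) \<in> borel_measurable lborel"
    using f g by (auto intro!: borel_measurable_times dest: sq_integrable_measurable)
  show "AE x in lborel. norm (f x * g x) \<le> norm ((f x)\<^sup>2 + (g x)\<^sup>2)"
  proof (rule AE_I2)
    fix x
    have "2 * (\<bar>f x\<bar> * \<bar>g x\<bar>) \<le> (f x)\<^sup>2 + (g x)\<^sup>2"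
      using sum_squares_bound[of "\<bar>f x\<bar>" "\<bar>g x\<bar>"] by (simp add: mult.assoc)
    moreover have "0 \<le> \<bar>f x\<bar> * \<bar>g x\<bar>" by simp
    ultimately have "\<bar>f x\<bar> * \<bar>g x\<bar> \<le> (f x)\<^sup>2 + (g x)\<^sup>2" by linarith
    then show "norm (f x * g x) \<le> norm ((f x)\<^sup>2 + (g x)\<^sup>2)" by (simp add: abs_mult)
  qed
qed

lemma sq_integrable_cmult: "sq_integrable f \<Longrightarrow> sq_integrable (\<lambda>x. c * f x)"
  by (auto simp: sq_integrable_def power_mult_distrib)

lemma sq_integrable_add:
  assumes f: "sq_integrable f" and g: "sq_integrable g"
  shows "sq_integrable (\<lambda>x. f x + g x)"
proof -
  have "(f x + g x)\<^sup>2 = (f x)\<^sup>2 + 2 * (f x * g x) + (g x)\<^sup>2" for x by (simp add: power2_sum)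
  then show ?thesis
    using f g by (auto simp: sq_integrable_def sq_integrable_mult[OF f g])
qed

lemma sq_integrable_diff:
  assumes f: "sq_integrable f" and g: "sq_integrable g"
  shows "sq_integrable (\<lambda>x. f x - g x)"
  using sq_integrable_add[OF f sq_integrable_cmult[OF g, of "-1"]] by simp

lemma sq_integrable_comp:
  fixes T :: "'a::euclidean_space \<Rightarrow> 'a"
  assumes "distr lborel borel T = lborel" "T \<in> borel_measurable borel" "sq_integrable f"
  shows "sq_integrable (\<lambda>x. f (T x))"
  using assms integrable_lborel_preserving[OF assms(1,2), of "\<lambda>x. (f x)\<^sup>2"]
  by (auto simp: sq_integrable_def)

lemma L2_triangle:
  assumes f: "sq_integrable f" and g: "sq_integrable g"
  shows "(\<integral>x. (f x + g x)\<^sup>2 \<partial>lborel) \<le> 2 * (\<integral>x. (f x)\<^sup>2 \<partial>lborel) + 2 * (\<integral>x. (g x)\<^sup>2 \<partial>lborel)"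
proof -
  have "(\<integral>x. (f x + g x)\<^sup>2 \<partial>lborel) \<le> (\<integral>x. 2 * (f x)\<^sup>2 + 2 * (g x)\<^sup>2 \<partial>lborel)"
  proof (rule integral_mono)
    show "integrable lborel (\<lambda>x. (f x + g x)\<^sup>2)" using sq_integrable_square[OF sq_integrable_add[OF f g]] .
    show "(f x + g x)\<^sup>2 \<le> 2 * (f x)\<^sup>2 + 2 * (g x)\<^sup>2" for x
      using sum_squares_bound[of "f x" "g x"] by (simp add: power2_sum)
  qed (use f g in \<open>auto simp: sq_integrable_square\<close>)
  then show ?thesis using f g by (simp add: sq_integrable_square)
qed

lemma L2_Cauchy_Schwarz:
  assumes f: "sq_integrable f" and g: "sq_integrable g"
  shows "(\<integral>x. f x * g x \<partial>lborel)\<^sup>2 \<le> (\<integral>x. (f x)\<^sup>2 \<partial>lborel) * (\<integral>x. (g x)\<^sup>2 \<partial>lborel)"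
proof -
  define a where "a = (\<integral>x. (f x)\<^sup>2 \<partial>lborel)"
  define b where "b = (\<integral>x. f x * g x \<partial>lborel)"
  define c where "c = (\<integral>x. (g x)\<^sup>2 \<partial>lborel)"
  have "(\<lambda>x. (f x + t * g x)\<^sup>2) = (\<lambda>x. (f x)\<^sup>2 + 2 * t * (f x * g x) + t\<^sup>2 * (g x)\<^sup>2)" for t
    by (simp add: fun_eq_iff power2_eq_square algebra_simps)
  then have eq: "(\<integral>x. (f x + t * g x)\<^sup>2 \<partial>lborel) = a + 2 * t * b + t\<^sup>2 * c" for t
    unfolding a_def b_def c_def using f g by (simp add: sq_integrable_square sq_integrable_mult)
  have pos: "0 \<le> a + 2 * t * b + t\<^sup>2 * c" for t
    unfolding eq[symmetric] by simp
  have "c \<ge> 0" unfolding c_def by simp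
  have "b\<^sup>2 \<le> a * c"
  proof (cases "c = 0")
    case True
    have "b = 0"
    proof (rule ccontr)
      assume "b \<noteq> 0"
      \<comment> \<open>With \<open>c = 0\<close> the quadratic in \<open>t\<close> is affine, and
        this \<open>t\<close> gives it the value -1.\<close>
      then show False using pos[of "- (a + 1) / (2 * b)"] True by (simp add: field_simps)
    qed
    then show ?thesis using True by simp
  next
    case False
    then have "c > 0" using \<open>c \<ge> 0\<close> by simp
    then show ?thesis using pos[of "- b / c"]
      by (simp add: power2_eq_square field_simps)
  qed
  then show ?thesis by (simp add: a_def b_def c_def)
qed

definition clamp_real :: "real \<Rightarrow> real \<Rightarrow> real" where
  "clamp_real M t = max (- M) (min M t)"

text \<open>The truncated function lies between 0 and \<open>f\<close>, so the error is dominated by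
  \<open>f\<close> itself, and at each point it is eventually 0.\<close>

lemma L2_approx_truncate:
  fixes f :: "'a::euclidean_space \<Rightarrow> real"
  assumes f: "sq_integrable f"
  shows "(\<lambda>n. \<integral>x. (max 0 (min 1 (real n + 1 - norm x)) * clamp_real (real n) (f x) - f x)\<^sup>2 \<partial>lborel) \<longlonglongrightarrow> 0"
proof -
  have [measurable]: "f \<in> borel_measurable borel" using f by (rule sq_integrable_measurable)
  let ?F = "\<lambda>n x. max 0 (min 1 (real n + 1 - norm x)) * clamp_real (real n) (f x)"
  have le: "\<bar>?F n x - f x\<bar> \<le> \<bar>f x\<bar>" for n x
  proof -
    define a c where "a = max 0 (min 1 (real n + 1 - norm x))" and "c = clamp_real (real n) (f x)"
    have a: "0 \<le> a" "a \<le> 1" by (auto simp: a_def)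
    have c: "0 \<le> c \<and> c \<le> f x \<or> f x \<le> c \<and> c \<le> 0" by (auto simp: c_def clamp_real_def)
    have "0 \<le> a * c \<and> a * c \<le> c \<or> c \<le> a * c \<and> a * c \<le> 0"
      using c a mult_left_le_one_le[of c a] mult_left_le_one_le[of "- c" a] mult_nonneg_nonneg[of a c]
        mult_nonneg_nonneg[of a "- c"] by auto
    then show ?thesis using c unfolding a_def[symmetric] c_def[symmetric] by linarith
  qed
  have "(\<lambda>n. \<integral>x. (?F n x - f x)\<^sup>2 \<partial>lborel) \<longlonglongrightarrow> (\<integral>x. 0 \<partial>(lborel :: 'a measure))"
  proof (rule integral_dominated_convergence)
    show "integrable lborel (\<lambda>x. (f x)\<^sup>2)" using f by (rule sq_integrable_square)
    show "AE x in lborel. (\<lambda>n. (?F n x - f x)\<^sup>2) \<longlonglongrightarrow> 0"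
    proof (rule AE_I2)
      fix x
      have "\<forall>\<^sub>F n in sequentially. (?F n x - f x)\<^sup>2 = 0"
        using eventually_ge_at_top[of "nat \<lceil>norm x\<rceil>"] eventually_ge_at_top[of "nat \<lceil>\<bar>f x\<bar>\<rceil>"]
      proof eventually_elim
        case (elim n)
        then have "norm x \<le> real n" "\<bar>f x\<bar> \<le> real n" by linarith+
        then show ?case by (simp add: clamp_real_def)
      qed
      then show "(\<lambda>n. (?F n x - f x)\<^sup>2) \<longlonglongrightarrow> 0" by (rule tendsto_eventually)
    qed
    show "AE x in lborel. norm ((?F n x - f x)\<^sup>2) \<le> (f x)\<^sup>2" for n
      using le[of n] by (simp add: abs_le_square_iff)
  qed (auto simp: clamp_real_def)
  then show ?thesis by simp
qed

lemma sq_integrable_bounded_support: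
  fixes f :: "'a::euclidean_space \<Rightarrow> real"
  assumes [measurable]: "f \<in> borel_measurable borel"
    and bd: "\<And>x. \<bar>f x\<bar> \<le> M" and supp: "\<And>x. norm x \<ge> R \<Longrightarrow> f x = 0"
  shows "sq_integrable f" and "integrable lborel f"
proof -
  have ind: "integrable lborel (\<lambda>x. c * indicator (cball (0::'a) R) x)" for c :: real
    using emeasure_lborel_cball_finite[of "0::'a" R] by (auto simp: integrable_indicator_iff)
  have "integrable lborel (\<lambda>x. (f x)\<^sup>2)"
  proof (rule Bochner_Integration.integrable_bound[OF ind[of "M\<^sup>2"]])
    show "AE x in lborel. norm ((f x)\<^sup>2) \<le> norm (M\<^sup>2 * indicator (cball 0 R) x)"
      using supp power_mono[OF bd abs_ge_zero, of _ 2] by (auto simp: indicator_def not_le less_imp_le)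
  qed simp
  then show "sq_integrable f" by (simp add: sq_integrable_def)
  show "integrable lborel f"
  proof (rule Bochner_Integration.integrable_bound[OF ind[of M]])
    show "AE x in lborel. norm (f x) \<le> norm (M * indicator (cball 0 R) x)"
      using supp bd order_trans[OF bd abs_ge_self] by (auto simp: indicator_def not_le less_imp_le)
  qed simp
qed

text \<open>After cutting off and clamping \<open>f\<close>, use that a measurable function is an
  a.e. limit of continuous ones. The same cutoff and clamp applied to the approximants keep them
  continuous and supply the dominating function.\<close>

lemma L2_approx_continuous:
  fixes f :: "'a::euclidean_space \<Rightarrow> real"
  assumes f: "sq_integrable f" and "e > 0"
  obtains g R M where "continuous_on UNIV g" "\<And>x. \<bar>g x\<bar> \<le> M" "\<And>x. norm x \<ge> R \<Longrightarrow> g x = 0"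
    "sq_integrable g" "(\<integral>x. (g x - f x)\<^sup>2 \<partial>lborel) < e"
proof -
  have [measurable]: "f \<in> borel_measurable borel" using f by (rule sq_integrable_measurable)
  define cut where "cut n x = max 0 (min 1 (real n + 1 - norm x))" for n and x :: 'a
  have chi_cont: "continuous_on UNIV (cut n)" for n unfolding cut_def by (intro continuous_intros)
  have chi_meas[measurable]: "cut n \<in> borel_measurable borel" for n
    using chi_cont by (rule borel_measurable_continuous_onI)
  have chi: "0 \<le> cut n x" "cut n x \<le> 1" "norm x \<ge> real n + 1 \<Longrightarrow> cut n x = 0" for n x
    by (auto simp: cut_def)
  have clamp_cont: "continuous_on UNIV (clamp_real M)" for M
    unfolding clamp_real_def[abs_def] by (intro continuous_intros)
  have [measurable]: "clamp_real M \<in> borel_measurable borel" for M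
    using clamp_cont by (rule borel_measurable_continuous_onI)
  have clamp: "\<bar>clamp_real (real n) t\<bar> \<le> real n" for n t by (auto simp: clamp_real_def)
  have bd: "\<bar>cut n x * clamp_real (real n) t\<bar> \<le> real n" for n x t
    using mult_mono[OF chi(2)[of n x] clamp[of n t]] chi(1)[of n x] by (simp add: abs_mult)
  obtain n where n: "(\<integral>x. (cut n x * clamp_real (real n) (f x) - f x)\<^sup>2 \<partial>lborel) < e / 4"
    using order_tendstoD(2)[OF L2_approx_truncate[OF f], of "e / 4"] \<open>e > 0\<close>
    unfolding cut_def[symmetric] by (auto simp: eventually_sequentially)
  let ?F = "\<lambda>x. cut n x * clamp_real (real n) (f x)"
  have sqF: "sq_integrable ?F"
    by (rule sq_integrable_bounded_support[of _ "real n" "real n + 1"]) (auto simp: bd chi)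
  have "f measurable_on UNIV"
    by (rule lebesgue_measurable_imp_measurable_on_real) (auto intro: measurable_completion)
  then obtain N g where N: "negligible N" and g: "\<And>m. continuous_on UNIV (g m)"
    and lim: "\<And>x. x \<notin> N \<Longrightarrow> (\<lambda>m::nat. g m x) \<longlonglongrightarrow> f x"
    unfolding measurable_on_def by auto
  have gm[measurable]: "g m \<in> borel_measurable borel" for m
    using g by (rule borel_measurable_continuous_onI)
  let ?G = "\<lambda>m x. cut n x * clamp_real (real n) (g m x)"
  have sqG: "sq_integrable (?G m)" for m
    by (rule sq_integrable_bounded_support[of _ "real n" "real n + 1"]) (auto simp: bd chi)
  have Gcont: "continuous_on UNIV (?G m)" for m
    by (intro continuous_intros chi_cont continuous_on_compose2[OF clamp_cont] g) auto
  have "AE x in lebesgue. x \<notin> N"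
    using N by (simp add: negligible_iff_null_sets AE_not_in)
  then have AEN: "AE x in lborel. (\<lambda>m. g m x) \<longlonglongrightarrow> f x"
    unfolding AE_completion_iff by eventually_elim (rule lim)
  have "(\<lambda>m. \<integral>x. (?G m x - ?F x)\<^sup>2 \<partial>lborel) \<longlonglongrightarrow> (\<integral>x. 0 \<partial>(lborel :: 'a measure))"
  proof (rule integral_dominated_convergence)
    show "integrable lborel (\<lambda>x. (2 * real n)\<^sup>2 * indicator (cball (0::'a) (real n + 1)) x)"
      using emeasure_lborel_cball_finite[of "0::'a" "real n + 1"] by (auto simp: integrable_indicator_iff)
    show "AE x in lborel. (\<lambda>m. (?G m x - ?F x)\<^sup>2) \<longlonglongrightarrow> 0"
      using AEN
    proof eventually_elim
      case (elim x)
      have "(\<lambda>m. (?G m x - ?F x)\<^sup>2) \<longlonglongrightarrow> (?F x - ?F x)\<^sup>2"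
        using continuous_on_tendsto_compose[OF clamp_cont elim] by (intro tendsto_intros) auto
      then show ?case by simp
    qed
    show "AE x in lborel. norm ((?G m x - ?F x)\<^sup>2) \<le> (2 * real n)\<^sup>2 * indicator (cball 0 (real n + 1)) x" for m
    proof (rule AE_I2)
      fix x
      have "\<bar>?G m x - ?F x\<bar> \<le> 2 * real n" using bd[of n x "g m x"] bd[of n x "f x"] by linarith
      then have "(?G m x - ?F x)\<^sup>2 \<le> (2 * real n)\<^sup>2" by (intro iffD1[OF abs_le_square_iff]) simp
      then show "norm ((?G m x - ?F x)\<^sup>2) \<le> (2 * real n)\<^sup>2 * indicator (cball 0 (real n + 1)) x"
        using chi(3)[of n x] by (cases "norm x \<le> real n + 1") auto
    qed
  qed auto
  then have "(\<lambda>m. \<integral>x. (?G m x - ?F x)\<^sup>2 \<partial>lborel) \<longlonglongrightarrow> 0" by simp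
  then obtain m where m: "(\<integral>x. (?G m x - ?F x)\<^sup>2 \<partial>lborel) < e / 4"
    using order_tendstoD(2)[of _ 0 sequentially "e / 4"] \<open>e > 0\<close> by (auto simp: eventually_sequentially)
  have "(\<integral>x. (?G m x - f x)\<^sup>2 \<partial>lborel) < e"
    using L2_triangle[OF sq_integrable_diff[OF sqG[of m] sqF] sq_integrable_diff[OF sqF f]] n m by simp
  then show thesis
    by (intro that[of "?G m" "real n" "real n + 1"] Gcont sqG) (auto simp: bd chi)
qed

lemma L2_translation:
  fixes f :: "'a::euclidean_space \<Rightarrow> real"
  assumes f: "sq_integrable f" and "e > 0"
  obtains d where "d > 0" "\<And>z. norm z < d \<Longrightarrow> (\<integral>x. (f (x + z) - f x)\<^sup>2 \<partial>lborel) < e"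
proof -
  \<comment> \<open>Splitting into three differences by two uses of \<open>L2_triangle\<close> costs
    2 + 4 + 4 = 10 times the small error.\<close>
  have e16: "e / 16 > 0" using \<open>e > 0\<close> by simp
  obtain g R M where g: "continuous_on UNIV g" "\<And>x. \<bar>g x\<bar> \<le> M" "\<And>x. norm x \<ge> R \<Longrightarrow> g x = 0"
    "sq_integrable g" "(\<integral>x. (g x - f x)\<^sup>2 \<partial>lborel) < e / 16"
    by (rule L2_approx_continuous[OF f e16]) (rule that; assumption)
  have meas[measurable]: "f \<in> borel_measurable borel" "g \<in> borel_measurable borel"
    using f g(4) by (auto dest: sq_integrable_measurable)
  have sh: "sq_integrable (\<lambda>x. h (x + z))" if "sq_integrable h" for h :: "'a \<Rightarrow> real" and z
    by (rule sq_integrable_comp[OF lborel_distr_add _ that]) simp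
  have "((\<lambda>z. \<integral>x. (g (x + z) - g x)\<^sup>2 \<partial>lborel) \<longlongrightarrow> 0) (at 0)"
    unfolding tendsto_at_iff_sequentially o_def
  proof (intro allI impI)
    fix X :: "nat \<Rightarrow> 'a" assume "X \<longlonglongrightarrow> 0"
    then have "Bseq X" by (intro convergent_imp_Bseq) (auto simp: convergent_def)
    then obtain K where K: "\<And>n. norm (X n) \<le> K" by (auto simp: Bseq_def)
    have "(\<lambda>n. \<integral>x. (g (x + X n) - g x)\<^sup>2 \<partial>lborel) \<longlonglongrightarrow> (\<integral>x. 0 \<partial>(lborel :: 'a measure))"
    proof (rule integral_dominated_convergence)
      show "integrable lborel (\<lambda>x. (2 * M)\<^sup>2 * indicator (cball (0::'a) (R + K)) x)"
        using emeasure_lborel_cball_finite[of "0::'a" "R + K"] by (auto simp: integrable_indicator_iff)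
      show "AE x in lborel. (\<lambda>n. (g (x + X n) - g x)\<^sup>2) \<longlonglongrightarrow> 0"
      proof (rule AE_I2)
        fix x
        have "(\<lambda>n. x + X n) \<longlonglongrightarrow> x + 0" using \<open>X \<longlonglongrightarrow> 0\<close> by (intro tendsto_intros)
        then have "(\<lambda>n. g (x + X n)) \<longlonglongrightarrow> g x"
          using continuous_on_tendsto_compose[OF g(1)] by simp
        then have "(\<lambda>n. (g (x + X n) - g x)\<^sup>2) \<longlonglongrightarrow> (g x - g x)\<^sup>2" by (intro tendsto_intros)
        then show "(\<lambda>n. (g (x + X n) - g x)\<^sup>2) \<longlonglongrightarrow> 0" by simp
      qed
      show "AE x in lborel. norm ((g (x + X n) - g x)\<^sup>2) \<le> (2 * M)\<^sup>2 * indicator (cball 0 (R + K)) x" for n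
      proof (rule AE_I2)
        fix x
        have "\<bar>g (x + X n) - g x\<bar> \<le> 2 * M" using g(2)[of x] g(2)[of "x + X n"] by linarith
        then have "(g (x + X n) - g x)\<^sup>2 \<le> (2 * M)\<^sup>2" by (intro iffD1[OF abs_le_square_iff]) simp
        moreover have "g (x + X n) = 0" "g x = 0" if "\<not> norm x \<le> R + K"
        proof -
          have "norm x \<le> norm (x + X n) + norm (X n)" using norm_triangle_ineq4[of "x + X n" "X n"] by simp
          then show "g (x + X n) = 0" using that K[of n] by (intro g(3)) simp
          have "K \<ge> 0" using K[of 0] norm_ge_zero[of "X 0"] by linarith
          then show "g x = 0" using that by (intro g(3)) simp
        qed
        ultimately show "norm ((g (x + X n) - g x)\<^sup>2) \<le> (2 * M)\<^sup>2 * indicator (cball 0 (R + K)) x"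
          by (cases "norm x \<le> R + K") auto
      qed
    qed auto
    then show "(\<lambda>n. \<integral>x. (g (x + X n) - g x)\<^sup>2 \<partial>lborel) \<longlonglongrightarrow> 0" by simp
  qed
  then have "\<forall>\<^sub>F z in at 0. (\<integral>x. (g (x + z) - g x)\<^sup>2 \<partial>lborel) < e / 16"
    using \<open>e > 0\<close> by (intro order_tendstoD(2)) auto
  then obtain d where d: "d > 0" "\<And>z. z \<noteq> 0 \<Longrightarrow> norm z < d \<Longrightarrow> (\<integral>x. (g (x + z) - g x)\<^sup>2 \<partial>lborel) < e / 16"
    unfolding eventually_at by auto
  show thesis
  proof (rule that[OF d(1)])
    fix z :: 'a assume z: "norm z < d"
    have 1: "(\<integral>x. (g (x + z) - g x)\<^sup>2 \<partial>lborel) < e / 16"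
      using d(2)[of z] z \<open>e > 0\<close> by (cases "z = 0") auto
    have 2: "(\<integral>x. (g (x + z) - f (x + z))\<^sup>2 \<partial>lborel) = (\<integral>x. (g x - f x)\<^sup>2 \<partial>lborel)"
      by (rule integral_lborel_preserving[OF lborel_distr_add]) measurable
    have 3: "(\<integral>x. (f (x + z) - g (x + z))\<^sup>2 \<partial>lborel) = (\<integral>x. (g x - f x)\<^sup>2 \<partial>lborel)"
      using 2 by (simp add: power2_commute)
    have "(\<integral>x. (f (x + z) - f x)\<^sup>2 \<partial>lborel) = (\<integral>x. ((f (x + z) - g (x + z)) + ((g (x + z) - g x) + (g x - f x)))\<^sup>2 \<partial>lborel)"
      by simp
    also have "\<dots> \<le> 2 * (\<integral>x. (f (x + z) - g (x + z))\<^sup>2 \<partial>lborel) + 2 * (\<integral>x. ((g (x + z) - g x) + (g x - f x))\<^sup>2 \<partial>lborel)"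
      by (intro L2_triangle sq_integrable_diff sq_integrable_add sh f g(4))
    also have "(\<integral>x. ((g (x + z) - g x) + (g x - f x))\<^sup>2 \<partial>lborel) \<le>
        2 * (\<integral>x. (g (x + z) - g x)\<^sup>2 \<partial>lborel) + 2 * (\<integral>x. (g x - f x)\<^sup>2 \<partial>lborel)"
      by (intro L2_triangle sq_integrable_diff sh f g(4))
    finally show "(\<integral>x. (f (x + z) - f x)\<^sup>2 \<partial>lborel) < e" using 1 3 g(5) \<open>e > 0\<close> by simp
  qed
qed

section \<open>The Gagliardo energy\<close>

lemma nn_integral_lborel_pair:
  fixes f :: "'a::euclidean_space \<times> 'b::euclidean_space \<Rightarrow> ennreal"
  assumes "f \<in> borel_measurable borel"
  shows "(\<integral>\<^sup>+p. f p \<partial>lborel) = (\<integral>\<^sup>+x. (\<integral>\<^sup>+y. f (x, y) \<partial>lborel) \<partial>lborel)"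
  using assms lborel.nn_integral_fst[of f lborel] by (simp add: lborel_prod)

lemma nn_integral_lborel_pair_snd:
  fixes f :: "'a::euclidean_space \<times> 'b::euclidean_space \<Rightarrow> ennreal"
  assumes "f \<in> borel_measurable borel"
  shows "(\<integral>\<^sup>+p. f p \<partial>lborel) = (\<integral>\<^sup>+y. (\<integral>\<^sup>+x. f (x, y) \<partial>lborel) \<partial>lborel)"
  using assms lborel_pair.nn_integral_snd[of f] by (simp add: lborel_prod)

lemma integral_lborel_pair:
  fixes f :: "'a::euclidean_space \<times> 'b::euclidean_space \<Rightarrow> 'c::{banach, second_countable_topology}"
  assumes "integrable lborel f"
  shows "(\<integral>p. f p \<partial>lborel) = (\<integral>x. (\<integral>y. f (x, y) \<partial>lborel) \<partial>lborel)"
  using assms lborel_pair.integral_fst'[of f] by (simp add: lborel_prod)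

lemma AE_lborel_fst:
  assumes "AE x in lborel. P x"
  shows "AE p in (lborel :: ('a::euclidean_space \<times> 'b::euclidean_space) measure). P (fst p)"
proof -
  obtain N where N: "{x. \<not> P x} \<subseteq> N" "emeasure lborel N = 0" "N \<in> sets lborel"
    using AE_E[OF assms] by auto
  have [measurable]: "N \<in> sets borel" using N by simp
  have "AE p in lborel \<Otimes>\<^sub>M (lborel :: 'b measure). fst p \<notin> N"
  proof (rule lborel_pair.AE_pair_measure)
    have "AE x in lborel. x \<notin> N" using N by (intro AE_not_in) auto
    then show "AE x in lborel. AE y in (lborel :: 'b measure). fst (x, y) \<notin> N" by eventually_elim simp
  qed measurable
  then have "AE p in (lborel :: ('a \<times> 'b) measure). fst p \<notin> N" unfolding lborel_prod .
  then show ?thesis by eventually_elim (use N in auto)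
qed

lemma AE_lborel_snd:
  assumes "AE x in lborel. P x"
  shows "AE p in (lborel :: ('a::euclidean_space \<times> 'a) measure). P (snd p)"
  using AE_lborel_preserving[OF lborel_distr_swap measurable_swap AE_lborel_fst[OF assms, where 'b = 'a]]
  by (simp add: prod.swap_def)

text \<open>This is the substitution h = x - y in double integrals: on each fibre over x it is the
  point reflection y -> x - y.\<close>

lemma lborel_distr_shear:
  "distr lborel borel (\<lambda>p::'a::euclidean_space \<times> 'a. (fst p, fst p - snd p)) = lborel"
proof (rule measure_eqI)
  fix A :: "('a \<times> 'a) set"
  assume "A \<in> sets (distr lborel borel (\<lambda>p::'a \<times> 'a. (fst p, fst p - snd p)))"
  then have A[measurable]: "A \<in> sets borel" by simp
  have [measurable]: "indicator A \<in> borel_measurable (borel \<Otimes>\<^sub>M borel)" by (simp add: borel_prod)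
  have m[measurable]: "(\<lambda>p::'a \<times> 'a. (fst p, fst p - snd p)) \<in> borel_measurable borel"
    unfolding borel_prod[symmetric] by measurable
  have "emeasure (distr lborel borel (\<lambda>p::'a \<times> 'a. (fst p, fst p - snd p))) A =
      (\<integral>\<^sup>+p. indicator A (fst p, fst p - snd p) \<partial>lborel)"
    using m by (subst nn_integral_indicator[symmetric], simp, subst nn_integral_distr) auto
  also have "\<dots> = (\<integral>\<^sup>+x. (\<integral>\<^sup>+y. indicator A (x, x - y) \<partial>lborel) \<partial>lborel)"
    by (subst nn_integral_lborel_pair) auto
  also have "\<dots> = (\<integral>\<^sup>+x. (\<integral>\<^sup>+y. indicator A (x, y) \<partial>lborel) \<partial>lborel)"
    by (intro nn_integral_cong nn_integral_lborel_preserving[OF lborel_distr_reflect_point]) measurable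
  also have "\<dots> = (\<integral>\<^sup>+p. indicator A p \<partial>lborel)"
    by (subst nn_integral_lborel_pair) auto
  finally show "emeasure (distr lborel borel (\<lambda>p::'a \<times> 'a. (fst p, fst p - snd p))) A = emeasure lborel A"
    by simp
qed simp

lemma measurable_shear [measurable]:
  "(\<lambda>p::'a::euclidean_space \<times> 'a. (fst p, fst p - snd p)) \<in> borel_measurable borel"
  unfolding borel_prod[symmetric] by measurable

lemma integrable_lborel_fst_times_snd:
  fixes f :: "'a::euclidean_space \<Rightarrow> real" and K :: "'b::euclidean_space \<Rightarrow> real"
  assumes f: "integrable lborel f" and K: "integrable lborel K"
  shows "integrable lborel (\<lambda>p. f (fst p) * K (snd p))"
proof -
  have [measurable]: "f \<in> borel_measurable borel" "K \<in> borel_measurable borel"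
    using f K by (auto dest: borel_measurable_integrable)
  have "integrable (lborel \<Otimes>\<^sub>M lborel) (\<lambda>p. f (fst p) * K (snd p))"
    by (rule lborel_pair.Fubini_integrable) (use f K in \<open>auto simp: abs_mult\<close>)
  then show ?thesis by (simp add: lborel_prod)
qed

lemma integrable_lborel_fst_kernel:
  fixes f :: "'a::euclidean_space \<Rightarrow> real" and K :: "'a \<Rightarrow> real"
  assumes f: "integrable lborel f" and K: "integrable lborel K"
  shows "integrable lborel (\<lambda>p. f (fst p) * K (fst p - snd p))"
    and "(\<integral>p. f (fst p) * K (fst p - snd p) \<partial>lborel) = (\<integral>x. f x \<partial>lborel) * (\<integral>x. K x \<partial>lborel)"
proof -
  let ?F = "\<lambda>p. f (fst p) * K (snd p)"
  have F: "integrable lborel ?F" by (rule integrable_lborel_fst_times_snd[OF f K])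
  have "integrable lborel (\<lambda>p::'a \<times> 'a. ?F (fst p, fst p - snd p))"
    by (subst integrable_lborel_preserving[OF lborel_distr_shear measurable_shear])
      (use F in \<open>auto dest: borel_measurable_integrable\<close>)
  then show "integrable lborel (\<lambda>p. f (fst p) * K (fst p - snd p))" by simp
  have "(\<integral>p. ?F (fst p, fst p - snd p) \<partial>(lborel :: ('a \<times> 'a) measure)) = (\<integral>p. ?F p \<partial>lborel)"
    by (rule integral_lborel_preserving[OF lborel_distr_shear measurable_shear])
      (use F in \<open>auto dest: borel_measurable_integrable\<close>)
  also have "\<dots> = (\<integral>x. f x \<partial>lborel) * (\<integral>x. K x \<partial>lborel)"
    by (subst integral_lborel_pair[OF F]) simp
  finally show "(\<integral>p. f (fst p) * K (fst p - snd p) \<partial>lborel) = (\<integral>x. f x \<partial>lborel) * (\<integral>x. K x \<partial>lborel)"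
    by simp
qed

lemma integrable_lborel_snd_kernel:
  fixes f :: "'a::euclidean_space \<Rightarrow> real" and K :: "'a \<Rightarrow> real"
  assumes f: "integrable lborel f" and K: "integrable lborel K" and even: "\<And>z. K (- z) = K z"
  shows "integrable lborel (\<lambda>p. f (snd p) * K (fst p - snd p))"
    and "(\<integral>p. f (snd p) * K (fst p - snd p) \<partial>lborel) = (\<integral>x. f x \<partial>lborel) * (\<integral>x. K x \<partial>lborel)"
proof -
  let ?F = "\<lambda>p. f (fst p) * K (fst p - snd p)"
  have F: "integrable lborel ?F" by (rule integrable_lborel_fst_kernel[OF f K])
  have eq: "(\<lambda>p. f (snd p) * K (fst p - snd p)) = (\<lambda>p. ?F (prod.swap p))"
    using even by (metis (no_types, opaque_lifting) fst_swap snd_swap minus_diff_eq)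
  show "integrable lborel (\<lambda>p. f (snd p) * K (fst p - snd p))"
    unfolding eq using F
    by (subst integrable_lborel_preserving[OF lborel_distr_swap measurable_swap])
       (auto dest: borel_measurable_integrable)
  show "(\<integral>p. f (snd p) * K (fst p - snd p) \<partial>lborel) = (\<integral>x. f x \<partial>lborel) * (\<integral>x. K x \<partial>lborel)"
    unfolding eq using F integrable_lborel_fst_kernel(2)[OF f K]
    by (subst integral_lborel_preserving[OF lborel_distr_swap measurable_swap])
       (auto dest: borel_measurable_integrable)
qed

text \<open>With the square root of the kernel built in, the energy is the \<open>L^2\<close>
  product of difference quotients on the product space, so Cauchy-Schwarz, the triangle inequality
  and continuity of translations carry over directly.\<close>

definition diff_quot :: "real \<Rightarrow> ('a::euclidean_space \<Rightarrow> real) \<Rightarrow> 'a \<times> 'a \<Rightarrow> real" where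
  "diff_quot s f p = (f (fst p) - f (snd p)) * sqrt (frac_kernel s (fst p - snd p))"

definition finite_energy :: "real \<Rightarrow> ('a::euclidean_space \<Rightarrow> real) \<Rightarrow> bool" where
  "finite_energy s f \<longleftrightarrow> f \<in> borel_measurable borel \<and> sq_integrable (diff_quot s f)"

definition energy :: "real \<Rightarrow> ('a::euclidean_space \<Rightarrow> real) \<Rightarrow> ('a \<Rightarrow> real) \<Rightarrow> real" where
  "energy s f g = (\<integral>p. diff_quot s f p * diff_quot s g p \<partial>lborel)"

lemma measurable_diff_quot [measurable]:
  assumes [measurable]: "f \<in> borel_measurable borel"
  shows "diff_quot s f \<in> borel_measurable borel"
  unfolding diff_quot_def[abs_def] borel_prod[symmetric] by measurable

lemma diff_quot_mult:
  "diff_quot s f p * diff_quot s g p =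
    (f (fst p) - f (snd p)) * (g (fst p) - g (snd p)) * frac_kernel s (fst p - snd p)"
  by (simp add: diff_quot_def mult_ac flip: mult.assoc[of "sqrt _" "sqrt _"])

lemma finite_energy_measurable: "finite_energy s f \<Longrightarrow> f \<in> borel_measurable borel"
  and finite_energy_diff_quot: "finite_energy s f \<Longrightarrow> sq_integrable (diff_quot s f)"
  by (auto simp: finite_energy_def)

lemma diff_quot_add: "diff_quot s (\<lambda>x. f x + g x) = (\<lambda>p. diff_quot s f p + diff_quot s g p)"
  and diff_quot_diff: "diff_quot s (\<lambda>x. f x - g x) = (\<lambda>p. diff_quot s f p - diff_quot s g p)"
  and diff_quot_cmult: "diff_quot s (\<lambda>x. c * f x) = (\<lambda>p. c * diff_quot s f p)"
  by (auto simp: diff_quot_def fun_eq_iff algebra_simps)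

lemma finite_energy_add: "finite_energy s f \<Longrightarrow> finite_energy s g \<Longrightarrow> finite_energy s (\<lambda>x. f x + g x)"
  by (auto simp: finite_energy_def diff_quot_add intro: sq_integrable_add)

lemma finite_energy_diff: "finite_energy s f \<Longrightarrow> finite_energy s g \<Longrightarrow> finite_energy s (\<lambda>x. f x - g x)"
  by (auto simp: finite_energy_def diff_quot_diff intro: sq_integrable_diff)

lemma finite_energy_cmult: "finite_energy s f \<Longrightarrow> finite_energy s (\<lambda>x. c * f x)"
  by (auto simp: finite_energy_def diff_quot_cmult intro: sq_integrable_cmult)

lemma energy_integrable:
  assumes "finite_energy s f" "finite_energy s g"
  shows "integrable lborel (\<lambda>p. diff_quot s f p * diff_quot s g p)"
  using assms by (simp add: sq_integrable_mult finite_energy_diff_quot)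

lemma energy_commute: "energy s f g = energy s g f"
  by (simp add: energy_def mult.commute)

lemma energy_add_left:
  assumes "finite_energy s f" "finite_energy s g" "finite_energy s h"
  shows "energy s (\<lambda>x. f x + g x) h = energy s f h + energy s g h"
  using assms by (simp add: energy_def diff_quot_add distrib_right energy_integrable)

lemma energy_diff_left:
  assumes "finite_energy s f" "finite_energy s g" "finite_energy s h"
  shows "energy s (\<lambda>x. f x - g x) h = energy s f h - energy s g h"
  using assms by (simp add: energy_def diff_quot_diff left_diff_distrib energy_integrable)

lemma energy_cmult_left: "energy s (\<lambda>x. c * f x) h = c * energy s f h"
  by (simp add: energy_def diff_quot_cmult mult.assoc)

lemma energy_diff_right:
  assumes "finite_energy s f" "finite_energy s g" "finite_energy s h"
  shows "energy s h (\<lambda>x. f x - g x) = energy s h f - energy s h g"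
  using energy_diff_left[OF assms] by (simp add: energy_commute)

lemma energy_self: "energy s f f = (\<integral>p. (diff_quot s f p)\<^sup>2 \<partial>lborel)"
  by (simp add: energy_def power2_eq_square)

lemma energy_nonneg [simp]: "0 \<le> energy s f f"
  by (simp add: energy_self)

lemma energy_triangle:
  assumes "finite_energy s f" "finite_energy s g"
  shows "energy s (\<lambda>x. f x + g x) (\<lambda>x. f x + g x) \<le> 2 * energy s f f + 2 * energy s g g"
  using assms by (simp add: energy_self diff_quot_add L2_triangle finite_energy_diff_quot)

lemma energy_Cauchy_Schwarz:
  assumes "finite_energy s f" "finite_energy s g"
  shows "\<bar>energy s f g\<bar> \<le> sqrt (energy s f f) * sqrt (energy s g g)"
proof -
  have "(energy s f g)\<^sup>2 \<le> energy s f f * energy s g g"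
    unfolding energy_self unfolding energy_def
    using assms by (intro L2_Cauchy_Schwarz finite_energy_diff_quot)
  then show ?thesis by (metis real_sqrt_abs real_sqrt_le_iff real_sqrt_mult)
qed

text \<open>Normal contractions operate on the energy space; this admits all the truncations used as
  test functions below.\<close>

lemma finite_energy_contraction:
  assumes f: "finite_energy s f" and [measurable]: "g \<in> borel_measurable borel"
    and le: "\<And>x y. \<bar>g x - g y\<bar> \<le> \<bar>f x - f y\<bar>"
  shows "finite_energy s g"
  unfolding finite_energy_def
proof
  show "sq_integrable (diff_quot s g)"
    by (rule sq_integrable_bound[OF finite_energy_diff_quot[OF f], of _ 1])
      (auto simp: diff_quot_def abs_mult le intro!: mult_right_mono)
qed simp

lemma finite_energy_comp:
  fixes T :: "'a::euclidean_space \<Rightarrow> 'a"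
  assumes T: "distr lborel borel T = lborel" "T \<in> borel_measurable borel"
    and iso: "\<And>x y. norm (T x - T y) = norm (x - y)"
  shows "finite_energy s f \<Longrightarrow> finite_energy s (\<lambda>x. f (T x))"
    and "finite_energy s f \<Longrightarrow> finite_energy s g \<Longrightarrow>
      energy s (\<lambda>x. f (T x)) (\<lambda>x. g (T x)) = energy s f g"
proof -
  let ?T = "\<lambda>p. (T (fst p), T (snd p))"
  have T2: "distr lborel borel ?T = lborel" by (rule lborel_distr_prod[OF T T])
  have T2m: "?T \<in> borel_measurable borel"
    using T(2) unfolding borel_prod[symmetric] by measurable
  have eq: "diff_quot s (\<lambda>x. h (T x)) = (\<lambda>p. diff_quot s h (?T p))" for h
    by (simp add: diff_quot_def fun_eq_iff frac_kernel_def iso)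
  show "finite_energy s f \<Longrightarrow> finite_energy s (\<lambda>x. f (T x))"
    unfolding finite_energy_def eq using T(2) by (auto intro!: sq_integrable_comp[OF T2 T2m])
  assume f: "finite_energy s f" and g: "finite_energy s g"
  show "energy s (\<lambda>x. f (T x)) (\<lambda>x. g (T x)) = energy s f g"
    unfolding energy_def eq using energy_integrable[OF f g]
    by (intro integral_lborel_preserving[OF T2 T2m]) (auto dest: borel_measurable_integrable)
qed

lemmas finite_energy_translate = finite_energy_comp(1)[OF lborel_distr_add, simplified]
lemmas energy_translate = finite_energy_comp(2)[OF lborel_distr_add, simplified]

lemma diff_quot_AE_cong:
  assumes "AE x in lborel. f x = g x"
  shows "AE p in lborel. diff_quot s f p = diff_quot s g p"
  using AE_lborel_fst[OF assms] AE_lborel_snd[OF assms] by eventually_elim (simp add: diff_quot_def)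

lemma finite_energy_AE_cong:
  assumes f: "finite_energy s f" and [measurable]: "g \<in> borel_measurable borel"
    and eq: "AE x in lborel. f x = g x"
  shows "finite_energy s g"
proof -
  have [measurable]: "f \<in> borel_measurable borel" using f by (rule finite_energy_measurable)
  have "integrable lborel (\<lambda>p. (diff_quot s g p)\<^sup>2) \<longleftrightarrow> integrable lborel (\<lambda>p. (diff_quot s f p)\<^sup>2)"
    using diff_quot_AE_cong[OF eq, of s] by (intro integrable_cong_AE) (auto elim: eventually_mono)
  then show ?thesis using f by (simp add: finite_energy_def sq_integrable_def)
qed

lemma energy_AE_cong:
  assumes [measurable]: "f \<in> borel_measurable borel" "f' \<in> borel_measurable borel"
      "g \<in> borel_measurable borel" "g' \<in> borel_measurable borel"
    and "AE x in lborel. f x = f' x" "AE x in lborel. g x = g' x"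
  shows "energy s f g = energy s f' g'"
  unfolding energy_def
  using diff_quot_AE_cong[OF assms(5), of s] diff_quot_AE_cong[OF assms(6), of s]
  by (intro integral_cong_AE) auto

lemma frac_kernel_levy_const:
  assumes s: "0 < s" "s < 1" and ab: "a \<ge> 0" "b \<ge> 0"
  shows "integrable lborel (\<lambda>h::'a::euclidean_space. min a (b * (norm h)\<^sup>2) * frac_kernel s h)"
proof (rule Bochner_Integration.integrable_bound)
  show "integrable lborel (\<lambda>h::'a. (a + b) * (min 1 ((norm h)\<^sup>2) * frac_kernel s h))"
    by (intro integrable_mult_right frac_kernel_levy[OF s])
  show "AE h in lborel. norm (min a (b * (norm h)\<^sup>2) * frac_kernel s h) \<le>
      norm ((a + b) * (min 1 ((norm (h::'a))\<^sup>2) * frac_kernel s h))"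
  proof (rule AE_I2)
    fix h :: 'a
    have "min a (b * (norm h)\<^sup>2) \<le> (a + b) * min 1 ((norm h)\<^sup>2)"
    proof (cases "(norm h)\<^sup>2 \<le> 1")
      case True
      have "min a (b * (norm h)\<^sup>2) \<le> b * (norm h)\<^sup>2" by simp
      also have "\<dots> \<le> (a + b) * (norm h)\<^sup>2" using ab by (intro mult_right_mono) auto
      finally show ?thesis using True by simp
    next
      case False
      then show ?thesis using ab by simp
    qed
    moreover have "0 \<le> min a (b * (norm h)\<^sup>2)" using ab by simp
    ultimately show "norm (min a (b * (norm h)\<^sup>2) * frac_kernel s h) \<le>
        norm ((a + b) * (min 1 ((norm h)\<^sup>2) * frac_kernel s h))"
      using ab by (simp add: abs_mult mult_right_mono flip: mult.assoc)
  qed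
qed measurable

text \<open>The squared increment is at most \<open>min (4 M^2) (L^2 |x - y|^2)\<close> and vanishes
  unless one of the two points lies in the ball of radius \<open>R\<close>. So the energy density is
  bounded by an indicator times an integrable kernel, in either variable.\<close>

lemma finite_energy_Lipschitz:
  fixes f :: "'a::euclidean_space \<Rightarrow> real"
  assumes s: "0 < s" "s < 1"
    and lip: "\<And>x y. \<bar>f x - f y\<bar> \<le> L * norm (x - y)"
    and supp: "\<And>x. norm x \<ge> R \<Longrightarrow> f x = 0"
  shows "finite_energy s f" "sq_integrable f" "continuous_on UNIV f"
proof -
  \<comment> \<open>The sign of \<open>L\<close> is forced by any two distinct points, and the space
    has a nonzero basis vector.\<close>
  have "L \<ge> 0" if "x \<noteq> y" for x y :: 'a
    using lip[of x y] that order_trans[OF abs_ge_zero lip[of x y]] by (simp add: zero_le_mult_iff)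
  then have "L \<ge> 0" using nonempty_Basis nonzero_Basis by (metis all_not_in_conv)
  then have "L-lipschitz_on UNIV f"
    using lip by (auto simp: lipschitz_on_def dist_real_def dist_norm)
  then show cont: "continuous_on UNIV f" by (rule lipschitz_on_continuous_on)
  then have fm[measurable]: "f \<in> borel_measurable borel" by (rule borel_measurable_continuous_onI)
  have "compact (f ` cball 0 R)"
    using cont by (intro compact_continuous_image continuous_on_subset[OF cont]) auto
  then obtain M where M': "\<forall>y\<in>f ` cball 0 R. norm y \<le> M" and "M > 0"
    using compact_imp_bounded[of "f ` cball 0 R"] unfolding bounded_pos by blast
  have M: "\<bar>f x\<bar> \<le> M" if "x \<in> cball 0 R" for x
    using bspec[OF M' imageI[OF that]] by simp
  have bd: "\<bar>f x\<bar> \<le> M" for x using M[of x] supp[of x] \<open>M > 0\<close> by (cases "norm x \<le> R") auto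
  show "sq_integrable f" by (rule sq_integrable_bounded_support[OF fm bd supp])
  let ?K = "\<lambda>h::'a. min (4 * M\<^sup>2) (L\<^sup>2 * (norm h)\<^sup>2) * frac_kernel s h"
  let ?I = "indicator (cball (0::'a) R) :: 'a \<Rightarrow> real"
  have K: "integrable lborel ?K" using s by (intro frac_kernel_levy_const) auto
  have I: "integrable lborel ?I" using emeasure_lborel_cball_finite[of "0::'a" R] by (auto simp: integrable_indicator_iff)
  have "integrable lborel (\<lambda>p. (diff_quot s f p)\<^sup>2)"
  proof (rule Bochner_Integration.integrable_bound)
    show "integrable lborel (\<lambda>p. ?I (fst p) * ?K (fst p - snd p) + ?I (snd p) * ?K (fst p - snd p))"
      by (intro Bochner_Integration.integrable_add integrable_lborel_fst_kernel integrable_lborel_snd_kernel I K) auto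
    show "AE p in lborel. norm ((diff_quot s f p)\<^sup>2) \<le>
        norm (?I (fst p) * ?K (fst p - snd p) + ?I (snd p) * ?K (fst p - snd p))"
    proof (rule AE_I2, clarify)
      fix x y :: 'a
      have K0: "?K (x - y) \<ge> 0" by simp
      have "(diff_quot s f (x, y))\<^sup>2 \<le> (?I x + ?I y) * ?K (x - y)"
      proof (cases "norm x \<le> R \<or> norm y \<le> R")
        case True
        have "\<bar>f x - f y\<bar> \<le> 2 * M" using bd[of x] bd[of y] by linarith
        then have "\<bar>f x - f y\<bar>\<^sup>2 \<le> (2 * M)\<^sup>2" by (intro power_mono) auto
        moreover have "\<bar>f x - f y\<bar>\<^sup>2 \<le> (L * norm (x - y))\<^sup>2" using lip[of x y] by (intro power_mono) auto
        ultimately have "(diff_quot s f (x, y))\<^sup>2 \<le> ?K (x - y)"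
          by (auto simp: diff_quot_def power_mult_distrib intro!: mult_right_mono)
        also have "\<dots> \<le> (?I x + ?I y) * ?K (x - y)" using True K0 by (auto simp: indicator_def)
        finally show ?thesis .
      next
        case False
        then have "f x = 0" "f y = 0" using supp by auto
        then show ?thesis by (simp add: diff_quot_def)
      qed
      then show "norm ((diff_quot s f (x, y))\<^sup>2) \<le>
          norm (?I (fst (x, y)) * ?K (fst (x, y) - snd (x, y)) + ?I (snd (x, y)) * ?K (fst (x, y) - snd (x, y)))"
        using K0 by (simp add: distrib_right)
    qed
  qed measurable
  then show "finite_energy s f" by (simp add: finite_energy_def sq_integrable_def)
qed

text \<open>Translating \<open>g\<close> by \<open>z\<close> translates its difference quotient by
  \<open>(z, z)\<close>, so this is \<open>L2_translation\<close> on the product space.\<close>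

lemma energy_translation_continuous:
  fixes g :: "'a::euclidean_space \<Rightarrow> real"
  assumes g: "finite_energy s g" and "e > 0"
  obtains d where "d > 0"
    "\<And>z. norm z < d \<Longrightarrow> energy s (\<lambda>x. g (x + z) - g x) (\<lambda>x. g (x + z) - g x) < e"
proof -
  obtain d where d: "d > 0"
    "\<And>w. norm w < d \<Longrightarrow> (\<integral>p. (diff_quot s g (p + w) - diff_quot s g p)\<^sup>2 \<partial>lborel) < e"
    using L2_translation[OF finite_energy_diff_quot[OF g] \<open>e > 0\<close>] by metis
  show thesis
  proof (rule that[of "d / 2"])
    fix z :: 'a assume "norm z < d / 2"
    then have "norm (z, z) < d"
      using norm_Pair_le[of z z] by simp
    from d(2)[OF this] show "energy s (\<lambda>x. g (x + z) - g x) (\<lambda>x. g (x + z) - g x) < e"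
      by (simp add: energy_self diff_quot_def algebra_simps)
  qed (use d in simp)
qed

section \<open>The energy on the Fourier side\<close>

text \<open>The standard normal density on the whole space. Written as a product over coordinates,
  its Fourier transform factors into characteristic functions of the one-dimensional normal
  distribution.\<close>

definition gaussian :: "'a::euclidean_space \<Rightarrow> real" where
  "gaussian z = (\<Prod>b\<in>Basis. std_normal_density (z \<bullet> b))"

lemma gaussian_nonneg [simp]: "0 \<le> gaussian z"
  unfolding gaussian_def by (intro prod_nonneg) (simp add: normal_density_nonneg)

lemma sum_Basis_squares: "(\<Sum>b\<in>Basis. (z \<bullet> b)\<^sup>2) = (norm (z::'a::euclidean_space))\<^sup>2"
  unfolding power2_norm_eq_inner by (subst euclidean_inner) (simp add: power2_eq_square)

lemma gaussian_eq: "gaussian (z::'a::euclidean_space) = gaussian (0::'a) * exp (- (norm z)\<^sup>2 / 2)"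
proof -
  have "gaussian z = (\<Prod>b\<in>Basis. std_normal_density 0 * exp (- (z \<bullet> b)\<^sup>2 / 2))"
    by (simp add: gaussian_def std_normal_density_def)
  also have "\<dots> = gaussian (0::'a) * exp (\<Sum>b\<in>Basis. - (z \<bullet> b)\<^sup>2 / 2)"
    by (simp add: gaussian_def prod.distrib exp_sum)
  also have "(\<Sum>b\<in>Basis. - (z \<bullet> b)\<^sup>2 / 2) = - (norm z)\<^sup>2 / 2"
    by (simp add: sum_Basis_squares[symmetric] sum_divide_distrib sum_negf)
  finally show ?thesis .
qed

lemma gaussian_0: "gaussian (0::'a::euclidean_space) = (2 * pi) powr (- real DIM('a) / 2)"
proof -
  have "gaussian (0::'a) = (1 / sqrt (2 * pi)) ^ DIM('a)"
    by (simp add: gaussian_def std_normal_density_def)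
  also have "1 / sqrt (2 * pi) = (2 * pi) powr (- 1 / 2)"
    by (simp add: powr_minus_divide powr_half_sqrt)
  finally show ?thesis by (simp add: powr_realpow[symmetric] powr_powr)
qed

lemma measurable_gaussian [measurable]: "gaussian \<in> borel_measurable borel"
  unfolding gaussian_def by measurable

lemma gaussian_Fourier:
  fixes a :: "'a::euclidean_space"
  shows "integrable lborel (\<lambda>z. complex_of_real (gaussian z) * iexp (a \<bullet> z))"
    and "(\<integral>z. complex_of_real (gaussian z) * iexp (a \<bullet> z) \<partial>lborel) = exp (- (norm a)\<^sup>2 / 2)"
proof -
  interpret product_sigma_finite "\<lambda>_::'a. lborel :: real measure" ..
  let ?f = "\<lambda>b x. complex_of_real (std_normal_density x) * iexp ((a \<bullet> b) * x)"
  have f: "integrable lborel (?f b)" for b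
  proof (rule Bochner_Integration.integrable_bound)
    show "integrable lborel std_normal_density" by (rule integrable_normal_density) simp
  qed (simp_all add: norm_mult)
  have F: "(\<integral>x. ?f b x \<partial>lborel) = exp (- (a \<bullet> b)\<^sup>2 / 2)" for b
  proof -
    have "(\<integral>x. ?f b x \<partial>lborel) = char std_normal_distribution (a \<bullet> b)"
      unfolding char_def by (subst integral_density) (auto simp: scaleR_conv_of_real normal_density_nonneg)
    then show ?thesis by (simp add: char_std_normal_distribution)
  qed
  have prod: "complex_of_real (gaussian z) * iexp (a \<bullet> z) = (\<Prod>b\<in>Basis. ?f b (z \<bullet> b))" for z
    unfolding gaussian_def
    by (subst euclidean_inner) (simp add: prod.distrib exp_sum[symmetric] sum_distrib_left)
  have m: "(\<lambda>f. \<Sum>b\<in>Basis. f b *\<^sub>R b) \<in> borel_measurable (\<Pi>\<^sub>M b\<in>Basis. (lborel :: real measure))"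
    by measurable
  have m2: "(\<lambda>z. complex_of_real (gaussian z) * iexp (a \<bullet> z)) \<in> borel_measurable borel" by measurable
  have pull: "complex_of_real (gaussian (\<Sum>b\<in>Basis. f b *\<^sub>R b)) * iexp (a \<bullet> (\<Sum>b\<in>Basis. f b *\<^sub>R b)) =
      (\<Prod>b\<in>Basis. ?f b (f b))" for f :: "'a \<Rightarrow> real"
    unfolding prod by (intro prod.cong) (simp_all del: of_real_mult)
  show "integrable lborel (\<lambda>z. complex_of_real (gaussian z) * iexp (a \<bullet> z))"
    unfolding lborel_eq[where 'a = 'a]
    by (subst integrable_distr_eq[OF m m2], unfold pull, rule product_integrable_prod) (rule finite_Basis, rule f)
  have "(\<integral>z. complex_of_real (gaussian z) * iexp (a \<bullet> z) \<partial>lborel) = (\<Prod>b\<in>Basis. \<integral>x. ?f b x \<partial>lborel)"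
    unfolding lborel_eq[where 'a = 'a]
    by (subst integral_distr[OF m m2], unfold pull, rule product_integral_prod) (rule finite_Basis, rule f)
  also have "\<dots> = complex_of_real (exp (\<Sum>b\<in>Basis. - (a \<bullet> b)\<^sup>2 / 2))"
    unfolding F by (simp add: exp_sum)
  also have "(\<Sum>b\<in>Basis. - (a \<bullet> b)\<^sup>2 / 2) = - (norm a)\<^sup>2 / 2"
    by (simp add: sum_Basis_squares[symmetric] sum_divide_distrib sum_negf)
  finally show "(\<integral>z. complex_of_real (gaussian z) * iexp (a \<bullet> z) \<partial>lborel) = exp (- (norm a)\<^sup>2 / 2)"
    by simp
qed

lemma integrable_gaussian: "integrable lborel (gaussian :: 'a::euclidean_space \<Rightarrow> real)"
  using integrable_Re[OF gaussian_Fourier(1)[of "0::'a"]] by simp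

lemma gaussian_cos:
  fixes a :: "'a::euclidean_space"
  shows "(\<integral>z. gaussian z * cos (a \<bullet> z) \<partial>lborel) = exp (- (norm a)\<^sup>2 / 2)"
proof -
  have "(\<integral>z. gaussian z * cos (a \<bullet> z) \<partial>lborel) =
      (\<integral>z. Re (complex_of_real (gaussian z) * iexp (a \<bullet> z)) \<partial>lborel)"
    by (simp add: cis_conv_exp[symmetric])
  also have "\<dots> = Re (\<integral>z. complex_of_real (gaussian z) * iexp (a \<bullet> z) \<partial>lborel)"
    by (rule integral_Re[OF gaussian_Fourier(1)])
  finally show ?thesis by (simp add: gaussian_Fourier(2))
qed

lemma integral_gaussian: "(\<integral>z. gaussian z \<partial>lborel) = 1"
  using gaussian_cos[of 0] by simp

text \<open>The squared modulus of the Fourier transform of a real function, without the unitary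
  factor, in real terms.\<close>

definition fourier_density :: "('a::euclidean_space \<Rightarrow> real) \<Rightarrow> 'a \<Rightarrow> real" where
  "fourier_density f \<xi> = (\<integral>x. cos (x \<bullet> \<xi>) * f x \<partial>lborel)\<^sup>2 + (\<integral>x. sin (x \<bullet> \<xi>) * f x \<partial>lborel)\<^sup>2"

lemma integrable_trig_times:
  fixes f :: "'a::euclidean_space \<Rightarrow> real"
  assumes f: "integrable lborel f"
  shows "integrable lborel (\<lambda>x. cos (x \<bullet> \<xi>) * f x)" "integrable lborel (\<lambda>x. sin (x \<bullet> \<xi>) * f x)"
  by (rule Bochner_Integration.integrable_bound[OF f];
      use borel_measurable_integrable[OF f] in \<open>auto simp: abs_mult intro!: mult_left_le_one_le\<close>)+

text \<open>cos a cos b + sin a sin b = cos (a - b) merges the two squares into one double integral,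
  in which \<open>\<xi>\<close> occurs only through a cosine.\<close>

lemma fourier_density_pair:
  fixes f :: "'a::euclidean_space \<Rightarrow> real"
  assumes f: "integrable lborel f"
  shows "fourier_density f \<xi> =
    (\<integral>p. cos ((fst p - snd p) \<bullet> \<xi>) * (f (fst p) * f (snd p)) \<partial>lborel)"
proof -
  note int = integrable_trig_times[OF f, of \<xi>]
  have sq: "integrable lborel (\<lambda>p. g (fst p) * g (snd p))"
      "(\<integral>p. g (fst p) * g (snd p) \<partial>lborel) = (\<integral>x. g x \<partial>lborel)\<^sup>2"
    if "integrable lborel g" for g :: "'a \<Rightarrow> real"
  proof -
    show *: "integrable lborel (\<lambda>p. g (fst p) * g (snd p))"
      by (rule integrable_lborel_fst_times_snd[OF that that])
    show "(\<integral>p. g (fst p) * g (snd p) \<partial>lborel) = (\<integral>x. g x \<partial>lborel)\<^sup>2"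
      by (subst integral_lborel_pair[OF *]) (simp add: power2_eq_square)
  qed
  show ?thesis
    unfolding fourier_density_def sq(2)[OF int(1), symmetric] sq(2)[OF int(2), symmetric]
    by (subst Bochner_Integration.integral_add[OF sq(1)[OF int(1)] sq(1)[OF int(2)], symmetric])
      (auto intro!: Bochner_Integration.integral_cong simp: inner_diff_left cos_diff algebra_simps)
qed

lemma fourier_density_measurable [measurable]:
  fixes f :: "'a::euclidean_space \<Rightarrow> real"
  assumes [measurable]: "f \<in> borel_measurable borel"
  shows "fourier_density f \<in> borel_measurable borel"
  unfolding fourier_density_def[abs_def] by measurable

lemma fourier_density_nonneg [simp]: "0 \<le> fourier_density f \<xi>"
  by (simp add: fourier_density_def)

lemma gaussian_mono_scale: "0 \<le> t \<Longrightarrow> t \<le> u \<Longrightarrow> gaussian (u *\<^sub>R \<xi>) \<le> gaussian (t *\<^sub>R \<xi>)"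
  by (subst (1 2) gaussian_eq) (auto intro!: mult_left_mono power_mono mult_right_mono)

lemma gaussian_cos_scale:
  fixes a :: "'a::euclidean_space"
  assumes t: "t > 0"
  shows "(\<integral>\<xi>. cos (a \<bullet> \<xi>) * gaussian (t *\<^sub>R \<xi>) \<partial>lborel) =
    (2 * pi) powr (real DIM('a) / 2) / t ^ DIM('a) * gaussian ((1 / t) *\<^sub>R a)"
proof -
  have "(\<integral>\<xi>. cos (a \<bullet> \<xi>) * gaussian (t *\<^sub>R \<xi>) \<partial>lborel) =
      (1 / t) ^ DIM('a) * (\<integral>\<xi>. cos (a \<bullet> ((1 / t) *\<^sub>R \<xi>)) * gaussian (t *\<^sub>R ((1 / t) *\<^sub>R \<xi>)) \<partial>lborel)"
    using t by (subst integral_lborel_scaleR[of _ "1 / t"]) auto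
  also have "(\<integral>\<xi>. cos (a \<bullet> ((1 / t) *\<^sub>R \<xi>)) * gaussian (t *\<^sub>R ((1 / t) *\<^sub>R \<xi>)) \<partial>lborel) =
      (\<integral>\<xi>. gaussian \<xi> * cos (((1 / t) *\<^sub>R a) \<bullet> \<xi>) \<partial>lborel)"
    using t by (simp add: mult.commute)
  also have "\<dots> = exp (- (norm ((1 / t) *\<^sub>R a))\<^sup>2 / 2)" by (rule gaussian_cos)
  also have "\<dots> = gaussian ((1 / t) *\<^sub>R a) / gaussian (0::'a)"
    by (subst gaussian_eq[of "(1 / t) *\<^sub>R a"]) (simp add: gaussian_0)
  finally show ?thesis
    by (simp add: gaussian_0 powr_minus field_simps)
qed

text \<open>The Gaussian weight makes the triple integral absolutely convergent, so Fubini applies.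
  As the transform of a Gaussian is again a Gaussian, integrating out \<open>\<xi>\<close> leaves
  \<open>f\<close> paired with its own mollification at scale \<open>t\<close>.\<close>

lemma Plancherel_gaussian:
  fixes f :: "'a::euclidean_space \<Rightarrow> real"
  assumes f: "integrable lborel f" and [measurable]: "f \<in> borel_measurable borel" and t: "t > 0"
  shows "integrable lborel (\<lambda>\<xi>. fourier_density f \<xi> * gaussian (t *\<^sub>R \<xi>))"
    and "(\<integral>\<xi>. fourier_density f \<xi> * gaussian (t *\<^sub>R \<xi>) \<partial>lborel) =
      (2 * pi) powr (real DIM('a) / 2) * (\<integral>x. f x * (\<integral>z. f (x - t *\<^sub>R z) * gaussian z \<partial>lborel) \<partial>lborel)"
proof -
  let ?N = "DIM('a)" and ?c = "(2 * pi) powr (real DIM('a) / 2)"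
  let ?g = "\<lambda>p::'a \<times> 'a. f (fst p) * f (snd p)"
  let ?G = "\<lambda>q::('a \<times> 'a) \<times> 'a. ?g (fst q) * (cos ((fst (fst q) - snd (fst q)) \<bullet> snd q) * gaussian (t *\<^sub>R snd q))"
  have "integrable lborel (\<lambda>x. \<bar>t ^ ?N\<bar> *\<^sub>R gaussian (t *\<^sub>R x :: 'a))"
    using integrable_gaussian[where 'a = 'a] t
    by (subst (asm) lborel_affine[of t 0]) (simp_all add: integrable_density integrable_distr_eq)
  then have gt: "integrable lborel (\<lambda>\<xi>::'a. gaussian (t *\<^sub>R \<xi>))"
    using t by simp
  have g: "integrable lborel ?g" by (rule integrable_lborel_fst_times_snd[OF f f])
  have [measurable]: "?g \<in> borel_measurable borel" unfolding borel_prod[symmetric] by measurable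
  have G: "integrable lborel ?G"
  proof (rule Bochner_Integration.integrable_bound)
    show "integrable lborel (\<lambda>q::('a \<times> 'a) \<times> 'a. ?g (fst q) * gaussian (t *\<^sub>R snd q))"
      by (rule integrable_lborel_fst_times_snd[OF g gt])
    have "?G \<in> borel_measurable ((borel \<Otimes>\<^sub>M borel) \<Otimes>\<^sub>M borel)" by measurable
    then show "?G \<in> borel_measurable lborel" by (simp add: borel_prod)
    show "AE q in lborel. norm (?G q) \<le> norm (?g (fst q) * gaussian (t *\<^sub>R snd q))"
      by (auto simp: abs_mult intro!: mult_left_mono mult_left_le_one_le)
  qed
  have G': "integrable (lborel \<Otimes>\<^sub>M lborel) (case_prod (\<lambda>p \<xi>. ?G (p, \<xi>)))"
    using G by (simp add: lborel_prod case_prod_unfold)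
  have inner: "(\<integral>p. ?G (p, \<xi>) \<partial>lborel) = fourier_density f \<xi> * gaussian (t *\<^sub>R \<xi>)" for \<xi>
    unfolding fourier_density_pair[OF f]
    by (subst integral_mult_left_zero[symmetric]) (simp add: mult_ac)
  have "integrable lborel (\<lambda>\<xi>. \<integral>p. ?G (p, \<xi>) \<partial>lborel)"
    using lborel_pair.integrable_snd[OF G'] by simp
  then show "integrable lborel (\<lambda>\<xi>. fourier_density f \<xi> * gaussian (t *\<^sub>R \<xi>))"
    unfolding inner .
  have "(\<integral>\<xi>. fourier_density f \<xi> * gaussian (t *\<^sub>R \<xi>) \<partial>lborel) = (\<integral>\<xi>. (\<integral>p. ?G (p, \<xi>) \<partial>lborel) \<partial>lborel)"
    unfolding inner ..
  also have "\<dots> = (\<integral>p. (\<integral>\<xi>. ?G (p, \<xi>) \<partial>lborel) \<partial>lborel)"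
    by (rule lborel_pair.Fubini_integral[OF G'])
  also have "\<dots> = (\<integral>p. ?g p * (?c / t ^ ?N * gaussian ((1 / t) *\<^sub>R (fst p - snd p))) \<partial>lborel)"
    by (simp add: gaussian_cos_scale[OF t])
  also have "\<dots> = (\<integral>x. (\<integral>y. ?g (x, y) * (?c / t ^ ?N * gaussian ((1 / t) *\<^sub>R (x - y))) \<partial>lborel) \<partial>lborel)"
  proof (subst integral_lborel_pair)
    show "integrable lborel (\<lambda>p::'a \<times> 'a. ?g p * (?c / t ^ ?N * gaussian ((1 / t) *\<^sub>R (fst p - snd p))))"
      using lborel_pair.integrable_fst[OF G'] by (simp add: gaussian_cos_scale[OF t])
  qed simp
  also have "\<dots> = (\<integral>x. ?c * (f x * (\<integral>z. f (x - t *\<^sub>R z) * gaussian z \<partial>lborel)) \<partial>lborel)"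
  proof (rule Bochner_Integration.integral_cong[OF refl])
    fix x
    let ?h = "\<lambda>y. ?g (x, y) * (?c / t ^ ?N * gaussian ((1 / t) *\<^sub>R (x - y)))"
    have "(\<integral>y. ?h y \<partial>lborel) = (\<integral>y. ?h (x - y) \<partial>lborel)"
      by (rule integral_lborel_preserving[OF lborel_distr_reflect_point, symmetric]) simp_all
    also have "\<dots> = t ^ ?N * (\<integral>z. ?h (x - t *\<^sub>R z) \<partial>lborel)"
      using t by (subst integral_lborel_scaleR[of _ t]) auto
    also have "\<dots> = t ^ ?N * (\<integral>z. (?c / t ^ ?N * f x) * (f (x - t *\<^sub>R z) * gaussian z) \<partial>lborel)"
      using t by (simp add: mult_ac)
    also have "\<dots> = ?c * (f x * (\<integral>z. f (x - t *\<^sub>R z) * gaussian z \<partial>lborel))"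
      using t by (subst integral_mult_right_zero) simp
    finally show "(\<integral>y. ?h y \<partial>lborel) = ?c * (f x * (\<integral>z. f (x - t *\<^sub>R z) * gaussian z \<partial>lborel))" .
  qed
  finally show "(\<integral>\<xi>. fourier_density f \<xi> * gaussian (t *\<^sub>R \<xi>) \<partial>lborel) =
      ?c * (\<integral>x. f x * (\<integral>z. f (x - t *\<^sub>R z) * gaussian z \<partial>lborel) \<partial>lborel)"
    by simp
qed

text \<open>Let t tend to 0 in the weighted identity. On the right, continuity and boundedness of
  \<open>f\<close> give dominated convergence; on the left the weights increase, so monotone
  convergence yields integrability and the value together. The constant is the square of
  \<open>1 / gaussian 0\<close>.\<close>

lemma Plancherel:
  fixes f :: "'a::euclidean_space \<Rightarrow> real"
  assumes cont: "continuous_on UNIV f" and bd: "\<And>x. \<bar>f x\<bar> \<le> M" and supp: "\<And>x. norm x \<ge> R \<Longrightarrow> f x = 0"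
  shows "integrable lborel (fourier_density f)"
    and "(\<integral>\<xi>. fourier_density f \<xi> \<partial>lborel) = (2 * pi) ^ DIM('a) * (\<integral>x. (f x)\<^sup>2 \<partial>lborel)"
proof -
  have fm[measurable]: "f \<in> borel_measurable borel" using cont by (rule borel_measurable_continuous_onI)
  have f: "integrable lborel f" and "sq_integrable f"
    using sq_integrable_bounded_support[OF fm bd supp] by auto
  let ?c = "(2 * pi) powr (real DIM('a) / 2)"
  let ?t = "\<lambda>n::nat. 1 / (real n + 1)"
  have tpos: "?t n > 0" for n by simp
  have tlim: "?t \<longlonglongrightarrow> 0" using LIMSEQ_inverse_real_of_nat by (simp add: inverse_eq_divide add.commute)
  have lim: "(\<lambda>n. \<integral>\<xi>. fourier_density f \<xi> * gaussian (?t n *\<^sub>R \<xi>) \<partial>lborel) \<longlonglongrightarrow> ?c * (\<integral>x. f x * f x \<partial>lborel)"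
    unfolding Plancherel_gaussian(2)[OF f fm tpos]
  proof (intro tendsto_mult_left integral_dominated_convergence)
    show "integrable lborel (\<lambda>x. \<bar>f x\<bar> * M)" using f by auto
    have int: "integrable lborel (\<lambda>z. M * gaussian (z::'a))" by (intro integrable_mult_right integrable_gaussian)
    show "AE x in lborel. (\<lambda>n. f x * (\<integral>z. f (x - ?t n *\<^sub>R z) * gaussian z \<partial>lborel)) \<longlonglongrightarrow> f x * f x"
    proof (intro AE_I2 tendsto_mult_left)
      fix x
      have "(\<lambda>n. \<integral>z. f (x - ?t n *\<^sub>R z) * gaussian z \<partial>lborel) \<longlonglongrightarrow> (\<integral>z. f x * gaussian (z::'a) \<partial>lborel)"
      proof (rule integral_dominated_convergence)
        show "integrable lborel (\<lambda>z. M * gaussian (z::'a))" by (rule int)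
        show "AE z in lborel. (\<lambda>n. f (x - ?t n *\<^sub>R z) * gaussian z) \<longlonglongrightarrow> f x * gaussian z"
        proof (intro AE_I2 tendsto_mult_right)
          fix z
          have "(\<lambda>n. x - ?t n *\<^sub>R z) \<longlonglongrightarrow> x - 0 *\<^sub>R z" by (intro tendsto_intros tlim)
          then show "(\<lambda>n. f (x - ?t n *\<^sub>R z)) \<longlonglongrightarrow> f x"
            using continuous_on_tendsto_compose[OF cont] by simp
        qed
        show "AE z in lborel. norm (f (x - ?t n *\<^sub>R z) * gaussian z) \<le> M * gaussian z" for n
          using bd by (auto simp: abs_mult intro!: mult_right_mono)
      qed auto
      then show "(\<lambda>n. \<integral>z. f (x - ?t n *\<^sub>R z) * gaussian z \<partial>lborel) \<longlonglongrightarrow> f x"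
        by (simp add: integral_gaussian)
    qed
    show "AE x in lborel. norm (f x * (\<integral>z. f (x - ?t n *\<^sub>R z) * gaussian z \<partial>lborel)) \<le> \<bar>f x\<bar> * M" for n
    proof (rule AE_I2)
      fix x
      have "norm (\<integral>z. f (x - ?t n *\<^sub>R z) * gaussian z \<partial>lborel) \<le> (\<integral>z. M * gaussian (z::'a) \<partial>lborel)"
        using bd by (intro Bochner_Integration.integral_norm_bound_integral int Bochner_Integration.integrable_bound[OF int])
          (auto simp: abs_mult intro!: mult_right_mono order_trans[OF bd abs_ge_self])
      then show "norm (f x * (\<integral>z. f (x - ?t n *\<^sub>R z) * gaussian z \<partial>lborel)) \<le> \<bar>f x\<bar> * M"
        by (simp add: integral_gaussian abs_mult mult_left_mono)
    qed
  qed auto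
  have mono: "mono (\<lambda>n. fourier_density f \<xi> * gaussian (?t n *\<^sub>R \<xi>))" for \<xi>
    by (intro monoI mult_left_mono gaussian_mono_scale) (auto simp: field_simps)
  have plim: "(\<lambda>n. fourier_density f \<xi> * gaussian (?t n *\<^sub>R \<xi>)) \<longlonglongrightarrow> fourier_density f \<xi> * gaussian (0::'a)" for \<xi>
  proof (intro tendsto_mult_left)
    have "(\<lambda>n. gaussian (0::'a) * exp (- (norm (?t n *\<^sub>R \<xi>))\<^sup>2 / 2)) \<longlonglongrightarrow> gaussian (0::'a) * exp (- (norm (0 *\<^sub>R \<xi>))\<^sup>2 / 2)"
      by (intro tendsto_intros tlim) simp
    then show "(\<lambda>n. gaussian (?t n *\<^sub>R \<xi>)) \<longlonglongrightarrow> gaussian (0::'a)"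
      by (subst gaussian_eq) simp
  qed
  note mc = integrable_monotone_convergence[OF Plancherel_gaussian(1)[OF f fm tpos] AE_I2[OF mono] AE_I2[OF plim] lim]
    integral_monotone_convergence[OF Plancherel_gaussian(1)[OF f fm tpos] AE_I2[OF mono] AE_I2[OF plim] lim]
  have "?c * ?c = (2 * pi) powr (real DIM('a) / 2 + real DIM('a) / 2)" by (simp only: powr_add)
  also have "\<dots> = (2 * pi) powr real DIM('a)" by simp
  also have "\<dots> = (2 * pi) ^ DIM('a)" by (rule powr_realpow) simp
  finally have g0: "?c * ?c = (2 * pi) ^ DIM('a)" "gaussian (0::'a) * ?c = 1"
    by (simp_all add: gaussian_0 powr_minus)
  then have "gaussian (0::'a) \<noteq> 0" by auto
  have 1: "integrable lborel (\<lambda>\<xi>. fourier_density f \<xi> * gaussian (0::'a))" by (rule mc(1)) simp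
  have 2: "(\<integral>\<xi>. fourier_density f \<xi> * gaussian (0::'a) \<partial>lborel) = ?c * (\<integral>x. f x * f x \<partial>lborel)" by (rule mc(2)) simp
  show "integrable lborel (fourier_density f)" using 1 \<open>gaussian 0 \<noteq> 0\<close> by simp
  have "(\<integral>\<xi>. fourier_density f \<xi> \<partial>lborel) = (\<integral>\<xi>. fourier_density f \<xi> * gaussian (0::'a) \<partial>lborel) * ?c"
    using g0(2) by (simp add: mult.assoc)
  then show "(\<integral>\<xi>. fourier_density f \<xi> \<partial>lborel) = (2 * pi) ^ DIM('a) * (\<integral>x. (f x)\<^sup>2 \<partial>lborel)"
    unfolding 2 g0(1)[symmetric] by (simp add: power2_eq_square mult_ac)
qed

text \<open>A shift multiplies the transform by a phase, and the squared modulus of (phase - 1) is 2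
  - 2 cos.\<close>

lemma fourier_density_increment:
  fixes f :: "'a::euclidean_space \<Rightarrow> real"
  assumes f: "integrable lborel f"
  shows "fourier_density (\<lambda>x. f (x + h) - f x) \<xi> = (2 - 2 * cos (h \<bullet> \<xi>)) * fourier_density f \<xi>"
proof -
  have [measurable]: "f \<in> borel_measurable borel" using borel_measurable_integrable[OF f] by simp
  have fh: "integrable lborel (\<lambda>x. f (x + h))"
    using f by (subst integrable_lborel_preserving[OF lborel_distr_add]) auto
  note int = integrable_trig_times[OF f, of \<xi>] and inth = integrable_trig_times[OF fh, of \<xi>]
  define C where "C = (\<integral>x. cos (x \<bullet> \<xi>) * f x \<partial>lborel)"
  define S where "S = (\<integral>x. sin (x \<bullet> \<xi>) * f x \<partial>lborel)"
  define a where "a = h \<bullet> \<xi>"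
  have sh: "(\<integral>x. g (x + h) \<partial>lborel) = (\<integral>x. g x \<partial>lborel)" if "g \<in> borel_measurable borel" for g :: "'a \<Rightarrow> real"
    using that by (intro integral_lborel_preserving[OF lborel_distr_add]) auto
  have "(\<integral>x. cos (x \<bullet> \<xi>) * f (x + h) \<partial>lborel) = (\<integral>x. cos ((x + h) \<bullet> \<xi> - a) * f (x + h) \<partial>lborel)"
    by (simp add: a_def inner_add_left)
  also have "\<dots> = (\<integral>x. cos (x \<bullet> \<xi> - a) * f x \<partial>lborel)"
    by (rule sh) measurable
  also have "\<dots> = (\<integral>x. cos a * (cos (x \<bullet> \<xi>) * f x) + sin a * (sin (x \<bullet> \<xi>) * f x) \<partial>lborel)"
    by (simp add: cos_diff algebra_simps)
  also have "\<dots> = cos a * C + sin a * S"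
    unfolding C_def S_def using int by (subst Bochner_Integration.integral_add) auto
  finally have Ch: "(\<integral>x. cos (x \<bullet> \<xi>) * f (x + h) \<partial>lborel) = cos a * C + sin a * S" .
  have "(\<integral>x. sin (x \<bullet> \<xi>) * f (x + h) \<partial>lborel) = (\<integral>x. sin ((x + h) \<bullet> \<xi> - a) * f (x + h) \<partial>lborel)"
    by (simp add: a_def inner_add_left)
  also have "\<dots> = (\<integral>x. sin (x \<bullet> \<xi> - a) * f x \<partial>lborel)"
    by (rule sh) measurable
  also have "\<dots> = (\<integral>x. cos a * (sin (x \<bullet> \<xi>) * f x) - sin a * (cos (x \<bullet> \<xi>) * f x) \<partial>lborel)"
    by (simp add: sin_diff algebra_simps)
  also have "\<dots> = cos a * S - sin a * C"
    unfolding C_def S_def using int by (subst Bochner_Integration.integral_diff) auto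
  finally have Sh: "(\<integral>x. sin (x \<bullet> \<xi>) * f (x + h) \<partial>lborel) = cos a * S - sin a * C" .
  have "fourier_density (\<lambda>x. f (x + h) - f x) \<xi> = (cos a * C + sin a * S - C)\<^sup>2 + (cos a * S - sin a * C - S)\<^sup>2"
    unfolding fourier_density_def using int inth
    by (simp add: right_diff_distrib Ch Sh C_def[symmetric] S_def[symmetric])
  also have "\<dots> = (2 - 2 * cos a) * (C\<^sup>2 + S\<^sup>2)"
    using sin_cos_squared_add[of a] by algebra
  finally show ?thesis by (simp add: fourier_density_def C_def S_def a_def)
qed


text \<open>A rotation takes \<open>\<xi>\<close> to \<open>norm \<xi>\<close> times the fixed unit
  vector \<open>b\<close>; scaling \<open>h\<close> by \<open>1 / norm \<xi>\<close> then brings out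
  the power \<open>2 * s\<close>, by homogeneity of the kernel.\<close>

lemma orthogonal_transformation_multiplier:
  fixes \<xi> b :: "real ^ 'n"
  assumes "norm b = 1" "\<xi> \<noteq> 0"
  shows "(\<integral>\<^sup>+h. ennreal ((2 - 2 * cos (h \<bullet> \<xi>)) * frac_kernel s h) \<partial>lborel) =
    ennreal (norm \<xi> powr (2 * s)) * (\<integral>\<^sup>+h. ennreal ((2 - 2 * cos (h \<bullet> b)) * frac_kernel s h) \<partial>lborel)"
proof -
  let ?r = "norm \<xi>" and ?N = "real CARD('n)"
  have r: "?r > 0" using assms by simp
  obtain T where T: "orthogonal_transformation T" "T b = (1 / ?r) *\<^sub>R \<xi>"
    using orthogonal_transformation_exists[of b "(1 / ?r) *\<^sub>R \<xi>"] assms by auto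
  have lin: "linear T" using T(1) by (simp add: orthogonal_transformation_def)
  have Tm: "T \<in> borel_measurable borel"
    using lin by (simp add: borel_measurable_continuous_onI linear_continuous_on linear_linear)
  have xi: "\<xi> = ?r *\<^sub>R T b" using r T(2) by simp
  let ?F = "\<lambda>\<xi> h. ennreal ((2 - 2 * cos (h \<bullet> \<xi>)) * frac_kernel s h)"
  have "(\<integral>\<^sup>+h. ?F \<xi> h \<partial>lborel) = (\<integral>\<^sup>+h. ?F \<xi> (T h) \<partial>lborel)"
    by (rule nn_integral_lborel_preserving[OF lborel_distr_orthogonal[OF T(1)] Tm, symmetric]) measurable
  also have "\<dots> = (\<integral>\<^sup>+h. ?F (?r *\<^sub>R b) h \<partial>lborel)"
  proof (rule nn_integral_cong)
    fix h
    have "T h \<bullet> \<xi> = ?r * (T h \<bullet> T b)" by (subst xi) simp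
    also have "\<dots> = h \<bullet> (?r *\<^sub>R b)" using T(1) by (simp add: orthogonal_transformation_def)
    finally show "?F \<xi> (T h) = ?F (?r *\<^sub>R b) h"
      using T(1) by (simp add: frac_kernel_def orthogonal_transformation_norm)
  qed
  also have "\<dots> = ennreal ((1 / ?r) ^ CARD('n)) * (\<integral>\<^sup>+h. ?F (?r *\<^sub>R b) ((1 / ?r) *\<^sub>R h) \<partial>lborel)"
    using r by (subst nn_integral_lborel_scaleR[of _ "1 / ?r"]) auto
  also have "\<dots> = ennreal ((1 / ?r) ^ CARD('n)) * (\<integral>\<^sup>+h. ennreal ((1 / ?r) powr (- (?N + 2 * s))) * ?F b h \<partial>lborel)"
  proof -
    have "?F (?r *\<^sub>R b) ((1 / ?r) *\<^sub>R h) = ennreal ((1 / ?r) powr (- (?N + 2 * s))) * ?F b h" for h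
      using r frac_kernel_scaleR[of "1 / ?r" s h]
      by (subst ennreal_mult'[symmetric]) (auto simp: mult_ac)
    then show ?thesis by simp
  qed
  also have "\<dots> = ennreal ((1 / ?r) ^ CARD('n)) * ennreal ((1 / ?r) powr (- (?N + 2 * s))) * (\<integral>\<^sup>+h. ?F b h \<partial>lborel)"
    by (simp add: nn_integral_cmult mult.assoc)
  also have "ennreal ((1 / ?r) ^ CARD('n)) * ennreal ((1 / ?r) powr (- (?N + 2 * s))) = ennreal (?r powr (2 * s))"
  proof -
    have "(1 / ?r) ^ CARD('n) * (1 / ?r) powr (- (?N + 2 * s)) = (1 / ?r) powr (- (2 * s))"
      using r by (simp add: powr_realpow[symmetric] powr_add[symmetric])
    also have "\<dots> = ?r powr (2 * s)" using r by (simp add: powr_divide powr_minus field_simps)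
    finally show ?thesis by (simp add: ennreal_mult[symmetric])
  qed
  finally show ?thesis .
qed

lemma multiplier_finite_positive:
  fixes b :: "'a::euclidean_space"
  assumes s: "0 < s" "s < 1" and b: "norm b = 1"
  obtains m where "m > 0" "(\<integral>\<^sup>+h. ennreal ((2 - 2 * cos (h \<bullet> b)) * frac_kernel s h) \<partial>lborel) = ennreal m"
proof -
  let ?F = "\<lambda>h. (2 - 2 * cos (h \<bullet> b)) * frac_kernel s h"
  have F0: "0 \<le> ?F h" for h using cos_le_one[of "h \<bullet> b"] by simp
  have cosb: "2 - 2 * cos t \<le> t\<^sup>2" for t :: real
  proof -
    have "2 - 2 * cos t = 4 * (sin (t / 2))\<^sup>2"
      using cos_double_sin[of "t / 2"] by simp
    also have "(sin (t / 2))\<^sup>2 \<le> (t / 2)\<^sup>2"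
      by (rule iffD1[OF abs_le_square_iff abs_sin_x_le_abs_x])
    finally show ?thesis by (simp add: power_divide)
  qed
  have int: "integrable lborel ?F"
  proof (rule Bochner_Integration.integrable_bound)
    show "integrable lborel (\<lambda>h::'a. min 4 (1 * (norm h)\<^sup>2) * frac_kernel s h)"
      by (intro frac_kernel_levy_const s) auto
    show "AE h in lborel. norm (?F h) \<le> norm (min 4 (1 * (norm h)\<^sup>2) * frac_kernel s h)"
    proof (rule AE_I2)
      fix h
      have "(h \<bullet> b)\<^sup>2 \<le> (norm h)\<^sup>2"
        using Cauchy_Schwarz_ineq2[of h b] b by (simp add: abs_le_square_iff[symmetric])
      then have "2 - 2 * cos (h \<bullet> b) \<le> min 4 (1 * (norm h)\<^sup>2)"
        unfolding mult_1_left
        by (intro min.boundedI) (use cosb[of "h \<bullet> b"] cos_ge_minus_one[of "h \<bullet> b"] in linarith)+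
      then show "norm (?F h) \<le> norm (min 4 (1 * (norm h)\<^sup>2) * frac_kernel s h)"
        using cos_le_one[of "h \<bullet> b"] by (simp add: abs_mult mult_right_mono del: mult_1_left)
    qed
  qed measurable
  have eq: "(\<integral>\<^sup>+h. ennreal (?F h) \<partial>lborel) = ennreal (\<integral>h. ?F h \<partial>lborel)"
    by (rule nn_integral_eq_integral[OF int]) (use F0 in simp)
  have "(\<integral>h. ?F h \<partial>lborel) \<noteq> 0"
  proof
    assume "(\<integral>h. ?F h \<partial>lborel) = 0"
    then have ae: "AE h in lborel. ?F h = 0"
      using integral_nonneg_eq_0_iff_AE[OF int] F0 by simp
    \<comment> \<open>On this ball \<open>h \<bullet> b\<close> lies between 0 and 2, hence strictly
      inside one half period, where the cosine is below 1 and the kernel is positive.\<close>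
    have "AE h in lborel. h \<notin> ball b 1"
      using ae
    proof eventually_elim
      case (elim h)
      show ?case
      proof
        assume h: "h \<in> ball b 1"
        have "\<bar>(b - h) \<bullet> b\<bar> < 1"
          using Cauchy_Schwarz_ineq2[of "b - h" b] h b by (simp add: dist_norm)
        then have "0 < h \<bullet> b" "h \<bullet> b < 2"
          using b by (auto simp: inner_diff_left norm_eq_1)
        then have "cos (h \<bullet> b) < 1"
          using cos_monotone_0_pi[of 0 "h \<bullet> b"] pi_gt3 by simp
        moreover have "frac_kernel s h > 0"
          using \<open>0 < h \<bullet> b\<close> by (intro frac_kernel_pos) auto
        ultimately show False using elim by auto
      qed
    qed
    then have "emeasure lborel (ball b 1) = 0"
      using AE_iff_null_sets[of "ball b 1" lborel] by auto
    then show False using unit_ball_vol_pos[of "real DIM('a)"]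
      by (auto simp: emeasure_ball simp del: unit_ball_vol_pos)
  qed
  moreover have "0 \<le> (\<integral>h. ?F h \<partial>lborel)" using F0 by simp
  ultimately show thesis using that[of "\<integral>h. ?F h \<partial>lborel"] eq by linarith
qed

text \<open>After the substitution h = x - y, the energy is the integral over \<open>h\<close> of
  the kernel times the squared \<open>L^2\<close> norm of the increment of \<open>f\<close>.
  Plancherel for each \<open>h\<close> and Tonelli leave the multiplier integral
  \<open>m * norm \<xi> powr (2 * s)\<close>. The constant is \<open>m / (2 pi)^N\<close>,
  quantified before \<open>f\<close> because one value must serve all functions. Nonnegative
  integrals are used throughout, so integrability comes out at the end.\<close>

lemma energy_eq_Fourier:
  assumes s: "0 < s" "s < 1"
  shows "\<exists>C>0. \<forall>(f :: real ^ 'n \<Rightarrow> real) L R.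
    (\<forall>x y. \<bar>f x - f y\<bar> \<le> L * norm (x - y)) \<longrightarrow> (\<forall>x. norm x \<ge> R \<longrightarrow> f x = 0) \<longrightarrow>
      integrable lborel (\<lambda>\<xi>. norm \<xi> powr (2 * s) * fourier_density f \<xi>) \<and>
      energy s f f = C * (\<integral>\<xi>. norm \<xi> powr (2 * s) * fourier_density f \<xi> \<partial>lborel)"
proof -
  let ?N = "CARD('n)"
  obtain b :: "real ^ 'n" where b: "norm b = 1" using norm_Basis nonempty_Basis by blast
  obtain m where m: "m > 0" "(\<integral>\<^sup>+h. ennreal ((2 - 2 * cos (h \<bullet> b)) * frac_kernel s h) \<partial>lborel) = ennreal m"
    using multiplier_finite_positive[OF s b] by metis
  define P where "P = (2 * pi) ^ ?N"
  have P: "P > 0" by (simp add: P_def)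
  show ?thesis
  proof (intro exI[of _ "m / P"] conjI[of "m / P > 0"] allI impI)
    show "m / P > 0" using m P by simp
    fix f :: "real ^ 'n \<Rightarrow> real" and L R
    assume *: "\<forall>x y. \<bar>f x - f y\<bar> \<le> L * norm (x - y)" "\<forall>x. norm x \<ge> R \<longrightarrow> f x = 0"
    have lip: "\<And>x y. \<bar>f x - f y\<bar> \<le> L * norm (x - y)" and supp: "\<And>x. norm x \<ge> R \<Longrightarrow> f x = 0"
      using * by auto
    have fe: "finite_energy s f" and cont: "continuous_on UNIV f"
      using finite_energy_Lipschitz[OF s lip supp] by auto
    have [measurable]: "f \<in> borel_measurable borel" using cont by (rule borel_measurable_continuous_onI)
    have "compact (f ` cball 0 R)"
      using cont by (intro compact_continuous_image continuous_on_subset[OF cont]) auto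
    then obtain M where M': "\<forall>y\<in>f ` cball 0 R. norm y \<le> M" and "M > 0"
      using compact_imp_bounded[of "f ` cball 0 R"] unfolding bounded_pos by blast
    have bd: "\<bar>f x\<bar> \<le> M" for x
      using bspec[OF M' imageI[of x]] supp[of x] \<open>M > 0\<close> by (cases "norm x \<le> R") auto
    have fi: "integrable lborel f" by (rule sq_integrable_bounded_support[OF _ bd supp]) simp
    have incr: "(\<integral>\<^sup>+x. ennreal ((f x - f (x - h))\<^sup>2) \<partial>lborel) =
        (\<integral>\<^sup>+\<xi>. ennreal ((2 - 2 * cos (h \<bullet> \<xi>)) * fourier_density f \<xi> / P) \<partial>lborel)" for h
    proof -
      let ?g = "\<lambda>x. f (x + - h) - f x"
      have c: "continuous_on UNIV ?g"
        by (intro continuous_intros continuous_on_compose2[OF cont]) auto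
      have gb: "\<bar>?g x\<bar> \<le> 2 * M" for x using bd[of x] bd[of "x + - h"] by linarith
      have gs: "?g x = 0" if "norm x \<ge> R + norm h" for x
      proof -
        have "norm (x - h) \<ge> norm x - norm h" by (rule norm_triangle_ineq2)
        moreover have "norm x \<ge> R" using that norm_ge_zero[of h] by linarith
        ultimately show ?thesis using that supp[of x] supp[of "x + - h"] by simp
      qed
      note pl = Plancherel[OF c gb gs]
      have "sq_integrable ?g" by (rule sq_integrable_bounded_support[OF _ gb gs]) measurable
      then have "(\<integral>\<^sup>+x. ennreal ((?g x)\<^sup>2) \<partial>lborel) = ennreal (\<integral>x. (?g x)\<^sup>2 \<partial>lborel)"
        by (intro nn_integral_eq_integral sq_integrable_square) auto
      also have "(\<integral>x. (?g x)\<^sup>2 \<partial>lborel) = (\<integral>\<xi>. fourier_density ?g \<xi> / P \<partial>lborel)"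
        using pl(2) P by (simp add: P_def)
      also have "ennreal \<dots> = (\<integral>\<^sup>+\<xi>. ennreal (fourier_density ?g \<xi> / P) \<partial>lborel)"
        using pl(1) P by (intro nn_integral_eq_integral[symmetric]) auto
      also have "(\<lambda>\<xi>. fourier_density ?g \<xi>) = (\<lambda>\<xi>. (2 - 2 * cos (h \<bullet> \<xi>)) * fourier_density f \<xi>)"
        using fourier_density_increment[OF fi, of "- h"] by (simp add: fun_eq_iff)
      finally show ?thesis by (simp add: power2_commute)
    qed
    have fdm[measurable]: "fourier_density f \<in> borel_measurable borel" by measurable
    have "(\<integral>\<^sup>+p. ennreal ((diff_quot s f p)\<^sup>2) \<partial>lborel) =
        (\<integral>\<^sup>+p. ennreal ((f (fst p) - f (fst p - snd p))\<^sup>2 * frac_kernel s (snd p)) \<partial>lborel)"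
    proof -
      let ?H = "\<lambda>p::(real^'n) \<times> (real^'n). ennreal ((f (fst p) - f (fst p - snd p))\<^sup>2 * frac_kernel s (snd p))"
      have "?H \<in> borel_measurable borel" unfolding borel_prod[symmetric] by measurable
      from nn_integral_lborel_preserving[OF lborel_distr_shear measurable_shear this]
      show ?thesis by (simp add: diff_quot_def power_mult_distrib)
    qed
    also have "\<dots> = (\<integral>\<^sup>+h. (\<integral>\<^sup>+x. ennreal ((f x - f (x - h))\<^sup>2 * frac_kernel s h) \<partial>lborel) \<partial>lborel)"
      by (subst nn_integral_lborel_pair_snd) (auto simp: borel_prod[symmetric])
    also have "\<dots> = (\<integral>\<^sup>+h. (\<integral>\<^sup>+\<xi>. ennreal ((2 - 2 * cos (h \<bullet> \<xi>)) * fourier_density f \<xi> / P) * ennreal (frac_kernel s h) \<partial>lborel) \<partial>lborel)"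
    proof (rule nn_integral_cong)
      fix h :: "real ^ 'n"
      have "(\<integral>\<^sup>+x. ennreal ((f x - f (x - h))\<^sup>2 * frac_kernel s h) \<partial>lborel) =
          (\<integral>\<^sup>+x. ennreal ((f x - f (x - h))\<^sup>2) \<partial>lborel) * ennreal (frac_kernel s h)"
        by (simp add: ennreal_mult nn_integral_multc)
      then show "(\<integral>\<^sup>+x. ennreal ((f x - f (x - h))\<^sup>2 * frac_kernel s h) \<partial>lborel) =
          (\<integral>\<^sup>+\<xi>. ennreal ((2 - 2 * cos (h \<bullet> \<xi>)) * fourier_density f \<xi> / P) * ennreal (frac_kernel s h) \<partial>lborel)"
        by (simp add: incr nn_integral_multc)
    qed
    also have "\<dots> = (\<integral>\<^sup>+\<xi>. (\<integral>\<^sup>+h. ennreal ((2 - 2 * cos (h \<bullet> \<xi>)) * fourier_density f \<xi> / P) * ennreal (frac_kernel s h) \<partial>lborel) \<partial>lborel)"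
      by (rule lborel_pair.Fubini') measurable
    also have "\<dots> = (\<integral>\<^sup>+\<xi>. ennreal (m / P * (norm \<xi> powr (2 * s) * fourier_density f \<xi>)) \<partial>lborel)"
    proof (rule nn_integral_cong)
      fix \<xi> :: "real ^ 'n"
      have mult: "(\<integral>\<^sup>+h. ennreal ((2 - 2 * cos (h \<bullet> \<xi>)) * frac_kernel s h) \<partial>lborel) = ennreal (norm \<xi> powr (2 * s) * m)"
        using orthogonal_transformation_multiplier[OF b, of \<xi> s] m
        by (cases "\<xi> = 0") (auto simp: ennreal_mult)
      have "ennreal ((2 - 2 * cos (h \<bullet> \<xi>)) * fourier_density f \<xi> / P) * ennreal (frac_kernel s h) =
          ennreal (fourier_density f \<xi> / P) * ennreal ((2 - 2 * cos (h \<bullet> \<xi>)) * frac_kernel s h)" for h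
        using P cos_le_one[of "h \<bullet> \<xi>"] by (simp add: ennreal_mult[symmetric] mult_ac)
      then have "(\<integral>\<^sup>+h. ennreal ((2 - 2 * cos (h \<bullet> \<xi>)) * fourier_density f \<xi> / P) * ennreal (frac_kernel s h) \<partial>lborel) =
          ennreal (fourier_density f \<xi> / P) * ennreal (norm \<xi> powr (2 * s) * m)"
        by (simp add: nn_integral_cmult mult)
      also have "\<dots> = ennreal (m / P * (norm \<xi> powr (2 * s) * fourier_density f \<xi>))"
        using P m by (simp add: ennreal_mult[symmetric] mult_ac)
      finally show "(\<integral>\<^sup>+h. ennreal ((2 - 2 * cos (h \<bullet> \<xi>)) * fourier_density f \<xi> / P) * ennreal (frac_kernel s h) \<partial>lborel) =
          ennreal (m / P * (norm \<xi> powr (2 * s) * fourier_density f \<xi>))" .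
    qed
    finally have key: "(\<integral>\<^sup>+p. ennreal ((diff_quot s f p)\<^sup>2) \<partial>lborel) =
        (\<integral>\<^sup>+\<xi>. ennreal (m / P * (norm \<xi> powr (2 * s) * fourier_density f \<xi>)) \<partial>lborel)" .
    have en: "(\<integral>\<^sup>+p. ennreal ((diff_quot s f p)\<^sup>2) \<partial>lborel) = ennreal (energy s f f)"
      unfolding energy_self using fe by (intro nn_integral_eq_integral sq_integrable_square finite_energy_diff_quot) auto
    have int: "integrable lborel (\<lambda>\<xi>. m / P * (norm \<xi> powr (2 * s) * fourier_density f \<xi>))"
    proof (rule integrableI_nonneg)
      show "(\<integral>\<^sup>+\<xi>. ennreal (m / P * (norm \<xi> powr (2 * s) * fourier_density f \<xi>)) \<partial>lborel) < \<infinity>"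
        using key[unfolded en, symmetric] by (simp only: ennreal_less_top infinity_ennreal_def)
    qed (use m P in auto)
    have "ennreal (energy s f f) = ennreal (\<integral>\<xi>. m / P * (norm \<xi> powr (2 * s) * fourier_density f \<xi>) \<partial>lborel)"
      unfolding key[unfolded en] by (rule nn_integral_eq_integral[OF int]) (use m P in simp)
    moreover have "0 \<le> (\<integral>\<xi>. m / P * (norm \<xi> powr (2 * s) * fourier_density f \<xi>) \<partial>lborel)"
      using m P by (intro integral_nonneg_AE AE_I2) auto
    ultimately have efe: "energy s f f = m / P * (\<integral>\<xi>. norm \<xi> powr (2 * s) * fourier_density f \<xi> \<partial>lborel)"
      by simp
    show "integrable lborel (\<lambda>\<xi>. norm \<xi> powr (2 * s) * fourier_density f \<xi>) \<and>
      energy s f f = m / P * (\<integral>\<xi>. norm \<xi> powr (2 * s) * fourier_density f \<xi> \<partial>lborel)"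
    proof -
      have eq: "(\<lambda>\<xi>. P / m * (m / P * (norm \<xi> powr (2 * s) * fourier_density f \<xi>))) = (\<lambda>\<xi>. norm \<xi> powr (2 * s) * fourier_density f \<xi>)"
        using m P by (simp add: fun_eq_iff)
      then show ?thesis using integrable_mult_right[OF int, of "P / m"] unfolding eq
        using efe by blast
    qed
  qed
qed

section \<open>Test functions\<close>

lemma Ck_SucI:
  assumes "\<And>x. (f has_derivative D x) (at x)" "\<And>v. Ck k (\<lambda>x. D x v)"
  shows "Ck (Suc k) f"
proof -
  have "frechet_derivative f (at x) = D x" for x
    using frechet_derivative_at[OF assms(1)] by simp
  then show ?thesis using assms by (auto simp: differentiable_def)
qed

lemma Ck_SucD:
  assumes "Ck (Suc k) f"
  shows "(f has_derivative frechet_derivative f (at x)) (at x)" "Ck k (\<lambda>x. frechet_derivative f (at x) v)"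
  using assms by (auto simp: frechet_derivative_works)

lemma Ck_imp_continuous: "Ck k f \<Longrightarrow> continuous_on UNIV f"
  by (cases k) (auto intro!: differentiable_imp_continuous_on simp: differentiable_on_def differentiable_at_withinI)

lemma Ck_decrease: "Ck (Suc k) f \<Longrightarrow> Ck k f"
proof (induction k arbitrary: f)
  case 0
  then show ?case using Ck_imp_continuous by fastforce
next
  case (Suc k)
  show ?case
    using Ck_SucD[OF Suc.prems] by (intro Ck_SucI[of f] Suc.IH)
qed

lemma Ck_const: "Ck k (\<lambda>x. c)"
  by (induction k arbitrary: c) (auto intro: Ck_SucI simp del: Ck.simps(2) intro!: derivative_eq_intros)

lemma Ck_add: "Ck k f \<Longrightarrow> Ck k g \<Longrightarrow> Ck k (\<lambda>x. f x + g x)"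
proof (induction k arbitrary: f g)
  case (Suc k)
  show ?case
    by (rule Ck_SucI[OF has_derivative_add[OF Ck_SucD(1)[OF Suc.prems(1)] Ck_SucD(1)[OF Suc.prems(2)]]])
      (rule Suc.IH[OF Ck_SucD(2)[OF Suc.prems(1)] Ck_SucD(2)[OF Suc.prems(2)]])
qed (auto intro: continuous_intros)

lemma Ck_mult: "Ck k f \<Longrightarrow> Ck k g \<Longrightarrow> Ck k (\<lambda>x. f x * g x)"
proof (induction k arbitrary: f g)
  case (Suc k)
  show ?case
    by (rule Ck_SucI[OF has_derivative_mult[OF Ck_SucD(1)[OF Suc.prems(1)] Ck_SucD(1)[OF Suc.prems(2)]]])
      (rule Ck_add[OF Suc.IH[OF Ck_decrease[OF Suc.prems(1)] Ck_SucD(2)[OF Suc.prems(2)]]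
          Suc.IH[OF Ck_SucD(2)[OF Suc.prems(1)] Ck_decrease[OF Suc.prems(2)]]])
qed (auto intro: continuous_intros)

lemma Ck_scaleR: "Ck k f \<Longrightarrow> Ck k (\<lambda>x. f (c *\<^sub>R x))"
proof (induction k arbitrary: f)
  case 0
  then show ?case by (auto intro!: continuous_on_compose2[of UNIV f] continuous_intros)
next
  case (Suc k)
  have "((\<lambda>x. f (c *\<^sub>R x)) has_derivative (\<lambda>v. frechet_derivative f (at (c *\<^sub>R x)) (c *\<^sub>R v))) (at x)" for x
    by (rule has_derivative_compose[OF _ Ck_SucD(1)[OF Suc.prems]]) (auto intro!: derivative_eq_intros)
  then show ?case
    by (rule Ck_SucI) (rule Suc.IH[OF Ck_SucD(2)[OF Suc.prems]])
qed

lemma test_function_support: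
  assumes "test_function f"
  obtains R where "\<And>x. norm x \<ge> R \<Longrightarrow> f x = 0"
proof -
  have "bounded {x. f x \<noteq> 0}"
    using assms compact_imp_bounded bounded_subset closure_subset unfolding test_function_def by blast
  then obtain R where "\<And>x. f x \<noteq> 0 \<Longrightarrow> norm x \<le> R" unfolding bounded_iff by auto
  then have "\<And>x. norm x \<ge> R + 1 \<Longrightarrow> f x = 0" by force
  then show thesis by (rule that)
qed

lemma test_functionI:
  assumes "\<And>k. Ck k f" "\<And>x. norm x \<ge> R \<Longrightarrow> f x = 0"
  shows "test_function f"
proof -
  have "{x. f x \<noteq> 0} \<subseteq> cball 0 R" using assms(2) by force
  then have "bounded (closure {x. f x \<noteq> 0})"
    by (meson bounded_cball bounded_closure bounded_subset)
  then show ?thesis using assms by (simp add: test_function_def compact_eq_bounded_closed)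
qed

lemma frechet_derivative_outside_support:
  fixes f :: "'a::euclidean_space \<Rightarrow> real"
  assumes supp: "\<And>x. norm x \<ge> R \<Longrightarrow> f x = 0" and x: "norm x > R"
  shows "frechet_derivative f (at x) v = 0"
proof -
  have "\<forall>\<^sub>F y in nhds x. norm y > R"
    using x by (intro eventually_nhds_in_open[of "{y. R < norm y}", THEN eventually_mono])
      (auto intro!: open_Collect_less continuous_intros)
  then have "\<forall>\<^sub>F y in nhds x. 0 = f y" by eventually_elim (use supp in simp)
  moreover have "((\<lambda>y. 0) has_derivative (\<lambda>v. 0)) (at x)" by simp
  ultimately have "(f has_derivative (\<lambda>v. 0)) (at x)"
    using has_derivative_transform_eventually[of "\<lambda>y. 0" "\<lambda>v. 0" x UNIV f]
    by (simp add: eventually_nhds_conv_at supp x less_imp_le)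
  then show ?thesis using frechet_derivative_at by (metis (mono_tags))
qed

lemma continuous_bounded_on_cball:
  fixes f :: "'a::euclidean_space \<Rightarrow> real"
  assumes "continuous_on UNIV f"
  shows "\<exists>M>0. \<forall>x. norm x \<le> R \<longrightarrow> \<bar>f x\<bar> \<le> M"
proof -
  have "compact (f ` cball 0 R)"
    by (rule compact_continuous_image[OF continuous_on_subset[OF assms subset_UNIV] compact_cball])
  then obtain M where "\<forall>y\<in>f ` cball 0 R. norm y \<le> M" and "M > 0"
    using compact_imp_bounded[of "f ` cball 0 R"] unfolding bounded_pos by blast
  then show ?thesis by (intro exI[of _ M]) auto
qed

text \<open>\<open>Ck\<close> gives continuity of each directional derivative separately, not of the
  derivative as an operator. Bounds for the finitely many basis directions combine by
  linearity.\<close>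

lemma Ck1_bounded_derivative:
  fixes f :: "real ^ 'n \<Rightarrow> real"
  assumes f: "Ck (Suc 0) f" and supp: "\<And>x. norm x \<ge> R \<Longrightarrow> f x = 0"
  obtains L where "\<And>x v. \<bar>frechet_derivative f (at x) v\<bar> \<le> L * norm v"
proof -
  let ?D = "\<lambda>x. frechet_derivative f (at x)"
  have lin: "linear (?D x)" for x
    using Ck_SucD(1)[OF f] by (rule has_derivative_linear)
  have zero: "?D x v = 0" if "norm x > R" for x v
    by (rule frechet_derivative_outside_support[of R]) (use supp that in auto)
  have "\<exists>B\<ge>0. \<forall>x. \<bar>?D x b\<bar> \<le> B" for b
  proof -
    have "continuous_on UNIV (\<lambda>x. ?D x b)" using Ck_SucD(2)[OF f, of b] by simp
    then obtain B where B: "B > 0" "\<And>x. norm x \<le> R \<Longrightarrow> \<bar>?D x b\<bar> \<le> B"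
      using continuous_bounded_on_cball by metis
    have "\<bar>?D x b\<bar> \<le> B" for x
      using B(2)[of x] zero[of x b] B(1) by (cases "norm x \<le> R") auto
    then show ?thesis using B(1) by (auto intro!: exI[of _ B])
  qed
  then obtain B where B: "\<And>b. B b \<ge> 0" "\<And>b x. \<bar>?D x b\<bar> \<le> B b" by metis
  show thesis
  proof (rule that)
    fix x v
    have "?D x v = ?D x (\<Sum>b\<in>Basis. (v \<bullet> b) *\<^sub>R b)" by (simp only: euclidean_representation)
    also have "\<dots> = (\<Sum>b\<in>Basis. (v \<bullet> b) * ?D x b)"
      by (simp add: linear_sum[OF lin] linear_scale[OF lin] del: euclidean_representation)
    finally have "\<bar>?D x v\<bar> \<le> (\<Sum>b\<in>Basis. \<bar>(v \<bullet> b) * ?D x b\<bar>)" by simp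
    also have "\<dots> \<le> (\<Sum>b\<in>Basis. norm v * B b)"
      unfolding abs_mult by (intro sum_mono mult_mono B Basis_le_norm) auto
    finally show "\<bar>?D x v\<bar> \<le> (\<Sum>b\<in>Basis. B b) * norm v"
      by (simp add: sum_distrib_left mult.commute)
  qed
qed

lemma Ck1_Lipschitz:
  fixes f :: "real ^ 'n \<Rightarrow> real"
  assumes f: "Ck (Suc 0) f" and supp: "\<And>x. norm x \<ge> R \<Longrightarrow> f x = 0"
  obtains L where "\<And>x y. \<bar>f x - f y\<bar> \<le> L * norm (x - y)"
proof -
  obtain L where L: "\<And>x v. \<bar>frechet_derivative f (at x) v\<bar> \<le> L * norm v"
    using Ck1_bounded_derivative[OF f supp] by metis
  have "\<bar>f x - f y\<bar> \<le> max 0 L * norm (x - y)" for x y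
  proof -
    have "onorm (frechet_derivative f (at z)) \<le> max 0 L" for z
    proof (rule onorm_bound)
      show "norm (frechet_derivative f (at z) v) \<le> max 0 L * norm v" for v
        using L[of z v] mult_right_mono[of L "max 0 L" "norm v"] by simp
    qed simp
    then show ?thesis
      using differentiable_bound[of UNIV f "\<lambda>z. frechet_derivative f (at z)" "max 0 L" y x] Ck_SucD(1)[OF f]
      by (auto simp: norm_minus_commute)
  qed
  then show thesis by (rule that)
qed

lemma test_function_Lipschitz:
  assumes "test_function f"
  obtains L R where "\<And>x y. \<bar>f x - f y\<bar> \<le> L * norm (x - y)" "\<And>x. norm x \<ge> R \<Longrightarrow> f x = 0"
proof -
  obtain R where R: "\<And>x. norm x \<ge> R \<Longrightarrow> f x = 0" using test_function_support[OF assms] by metis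
  have "Ck (Suc 0) f" using assms unfolding test_function_def by (rule conjunct1[THEN spec])
  then show thesis
  proof (rule Ck1_Lipschitz)
    show "\<And>x. norm x \<ge> R \<Longrightarrow> f x = 0" by (rule R)
  qed (rule that[OF _ R])
qed

lemma test_function_continuous: "test_function f \<Longrightarrow> continuous_on UNIV f"
  unfolding test_function_def using Ck_imp_continuous by blast

lemma test_function_measurable: "test_function f \<Longrightarrow> f \<in> borel_measurable borel"
  by (rule borel_measurable_continuous_onI[OF test_function_continuous])

lemma test_function_bounded:
  assumes "test_function f"
  obtains M R where "\<And>x. \<bar>f x\<bar> \<le> M" "\<And>x. norm x \<ge> R \<Longrightarrow> f x = 0"
proof -
  obtain L R where LR: "\<And>x y. \<bar>f x - f y\<bar> \<le> L * norm (x - y)" "\<And>x. norm x \<ge> R \<Longrightarrow> f x = 0"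
    using test_function_Lipschitz[OF assms] by metis
  obtain M where M: "M > 0" "\<And>x. norm x \<le> R \<Longrightarrow> \<bar>f x\<bar> \<le> M"
    using continuous_bounded_on_cball[OF test_function_continuous[OF assms]] by metis
  have "\<bar>f x\<bar> \<le> M" for x
    using M(2)[of x] LR(2)[of x] \<open>M > 0\<close> by (cases "norm x \<le> R") auto
  then show thesis by (rule that[OF _ LR(2)])
qed

lemma test_function_integrable: "test_function f \<Longrightarrow> integrable lborel f"
  and test_function_sq_integrable: "test_function f \<Longrightarrow> sq_integrable f"
proof -
  assume f: "test_function f"
  obtain M R where "\<And>x. \<bar>f x\<bar> \<le> M" "\<And>x. norm x \<ge> R \<Longrightarrow> f x = 0"
    using test_function_bounded[OF f] by metis
  note sq_integrable_bounded_support[OF test_function_measurable[OF f] this]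
  then show "integrable lborel f" "sq_integrable f" by auto
qed

lemma test_function_finite_energy:
  assumes "0 < s" "s < 1" "test_function f"
  shows "finite_energy s f"
proof -
  obtain L R where "\<And>x y. \<bar>f x - f y\<bar> \<le> L * norm (x - y)" "\<And>x. norm x \<ge> R \<Longrightarrow> f x = 0"
    using test_function_Lipschitz[OF assms(3)] by metis
  then show ?thesis by (rule finite_energy_Lipschitz(1)[OF assms(1,2)])
qed

lemma test_function_add:
  assumes "test_function f" "test_function g"
  shows "test_function (\<lambda>x. f x + g x)"
proof -
  obtain R where R: "\<And>x. norm x \<ge> R \<Longrightarrow> f x = 0" using test_function_support[OF assms(1)] by metis
  obtain R' where R': "\<And>x. norm x \<ge> R' \<Longrightarrow> g x = 0" using test_function_support[OF assms(2)] by metis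
  show ?thesis
    using assms R R' by (intro test_functionI[of _ "max R R'"] Ck_add) (auto simp: test_function_def)
qed

lemma test_function_cmult:
  assumes "test_function f"
  shows "test_function (\<lambda>x. c * f x)"
proof -
  obtain R where R: "\<And>x. norm x \<ge> R \<Longrightarrow> f x = 0" using test_function_support[OF assms] by metis
  show ?thesis
    using assms R by (intro test_functionI[of _ R] Ck_mult Ck_const) (auto simp: test_function_def)
qed

lemma test_function_diff: "test_function f \<Longrightarrow> test_function g \<Longrightarrow> test_function (\<lambda>x. f x - g x)"
  using test_function_add[OF _ test_function_cmult[of g "- 1"], of f] by simp

lemma fourier_test:
  fixes f :: "real ^ 'n \<Rightarrow> real"
  assumes f: "test_function f"
  shows "fourier f \<xi> = complex_of_real ((2 * pi) powr (- real CARD('n) / 2)) *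
      Complex (\<integral>x. cos (x \<bullet> \<xi>) * f x \<partial>lborel) (- (\<integral>x. sin (x \<bullet> \<xi>) * f x \<partial>lborel))"
proof -
  have [measurable]: "f \<in> borel_measurable borel" using f by (rule test_function_measurable)
  let ?e = "\<lambda>x. exp (- \<i> * complex_of_real (x \<bullet> \<xi>)) * complex_of_real (f x)"
  have e: "?e x = Complex (cos (x \<bullet> \<xi>) * f x) (- (sin (x \<bullet> \<xi>) * f x))" for x
    using cis_conv_exp[of "- (x \<bullet> \<xi>)", symmetric] by (simp add: complex_eq_iff)
  have m: "?e \<in> borel_measurable lborel" by measurable
  have int: "integrable lborel ?e"
    by (rule Bochner_Integration.integrable_bound[OF test_function_integrable[OF f] m])
      (simp add: norm_mult)
  have "(LINT x|lebesgue. ?e x) = (LINT x|lborel. ?e x)" by (rule integral_completion[OF m])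
  also have "\<dots> = Complex (\<integral>x. cos (x \<bullet> \<xi>) * f x \<partial>lborel) (- (\<integral>x. sin (x \<bullet> \<xi>) * f x \<partial>lborel))"
    using integral_Re[OF int] integral_Im[OF int] unfolding e by (simp add: complex_eq_iff)
  finally show ?thesis by (simp add: fourier_def)
qed

lemma cmod_fourier_test:
  fixes f :: "real ^ 'n \<Rightarrow> real"
  assumes f: "test_function f"
  shows "(cmod (fourier f \<xi>))\<^sup>2 = (2 * pi) powr (- real CARD('n)) * fourier_density f \<xi>"
proof -
  have c: "((2 * pi) powr (- real CARD('n) / 2))\<^sup>2 = (2 * pi) powr (- real CARD('n))"
    by (simp add: power2_eq_square powr_add[symmetric] del: powr_mult)
  show ?thesis
    unfolding fourier_test[OF f] norm_mult power_mult_distrib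
    by (simp only: norm_of_real power2_abs c) (simp add: cmod_power2 fourier_density_def)
qed

lemma energy_add_self:
  assumes f: "finite_energy s f" and g: "finite_energy s g"
  shows "energy s (\<lambda>x. f x + g x) (\<lambda>x. f x + g x) = energy s f f + 2 * energy s f g + energy s g g"
proof -
  note fg = finite_energy_add[OF f g]
  have "energy s (\<lambda>x. f x + g x) (\<lambda>x. f x + g x) = energy s (\<lambda>x. f x + g x) f + energy s (\<lambda>x. f x + g x) g"
    using energy_add_left[OF f g fg] energy_commute[of s f "\<lambda>x. f x + g x"] energy_commute[of s g "\<lambda>x. f x + g x"] by linarith
  then show ?thesis
    using energy_add_left[OF f g f] energy_add_left[OF f g g] energy_commute[of s g f] by linarith
qed

lemma energy_diff_self:
  assumes f: "finite_energy s f" and g: "finite_energy s g"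
  shows "energy s (\<lambda>x. f x - g x) (\<lambda>x. f x - g x) = energy s f f - 2 * energy s f g + energy s g g"
proof -
  note fg = finite_energy_diff[OF f g]
  have "energy s (\<lambda>x. f x - g x) (\<lambda>x. f x - g x) = energy s (\<lambda>x. f x - g x) f - energy s (\<lambda>x. f x - g x) g"
    using energy_diff_left[OF f g fg] energy_commute[of s f "\<lambda>x. f x - g x"] energy_commute[of s g "\<lambda>x. f x - g x"] by linarith
  then show ?thesis
    using energy_diff_left[OF f g f] energy_diff_left[OF f g g] energy_commute[of s g f] by linarith
qed

text \<open>Here \<open>\<kappa>\<close> is \<open>(2 pi)^(-N)\<close>, from the unitary
  normalization, divided by the constant of \<open>energy_eq_Fourier\<close>. The norms agree
  directly and the inner products by polarization.\<close>

lemma test_form_eq_energy: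
  assumes s: "0 < s" "s < 1"
  shows "\<exists>\<kappa>>0. \<forall>\<phi> :: real ^ 'n \<Rightarrow> real. test_function \<phi> \<longrightarrow> test_norm s \<phi> = sqrt (\<kappa> * energy s \<phi> \<phi>) \<and>
    (\<forall>\<psi>. test_function \<psi> \<longrightarrow> test_inner s \<phi> \<psi> = \<kappa> * energy s \<phi> \<psi>)"
proof -
  obtain C where C: "C > 0" and
    CE: "\<forall>(f :: real ^ 'n \<Rightarrow> real) L R. (\<forall>x y. \<bar>f x - f y\<bar> \<le> L * norm (x - y)) \<longrightarrow> (\<forall>x. norm x \<ge> R \<longrightarrow> f x = 0) \<longrightarrow>
      integrable lborel (\<lambda>\<xi>. norm \<xi> powr (2 * s) * fourier_density f \<xi>) \<and>
      energy s f f = C * (\<integral>\<xi>. norm \<xi> powr (2 * s) * fourier_density f \<xi> \<partial>lborel)"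
    using energy_eq_Fourier[OF s, where 'n = 'n] by blast
  define P where "P = (2 * pi) powr (- real CARD('n))"
  have P: "P > 0" by (simp add: P_def)
  have main: "integrable lborel (\<lambda>\<xi>. norm \<xi> powr (2 * s) * (cmod (fourier f \<xi>))\<^sup>2)"
      "(\<integral>\<xi>. norm \<xi> powr (2 * s) * (cmod (fourier f \<xi>))\<^sup>2 \<partial>lborel) = P / C * energy s f f"
    if f: "test_function f" for f :: "real ^ 'n \<Rightarrow> real"
  proof -
    obtain L R where LR: "\<And>x y. \<bar>f x - f y\<bar> \<le> L * norm (x - y)" "\<And>x. norm x \<ge> R \<Longrightarrow> f x = 0"
      using test_function_Lipschitz[OF f] by metis
    have CE': "integrable lborel (\<lambda>\<xi>. norm \<xi> powr (2 * s) * fourier_density f \<xi>) \<and>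
      energy s f f = C * (\<integral>\<xi>. norm \<xi> powr (2 * s) * fourier_density f \<xi> \<partial>lborel)"
      using CE[rule_format, of f L R] LR by blast
    have eq: "norm \<xi> powr (2 * s) * (cmod (fourier f \<xi>))\<^sup>2 = P * (norm \<xi> powr (2 * s) * fourier_density f \<xi>)" for \<xi>
      by (simp add: cmod_fourier_test[OF f] P_def)
    show "integrable lborel (\<lambda>\<xi>. norm \<xi> powr (2 * s) * (cmod (fourier f \<xi>))\<^sup>2)"
      unfolding eq using CE' by (intro integrable_mult_right) blast
    show "(\<integral>\<xi>. norm \<xi> powr (2 * s) * (cmod (fourier f \<xi>))\<^sup>2 \<partial>lborel) = P / C * energy s f f"
      unfolding eq using CE' C by simp
  qed
  have fm: "fourier f \<in> borel_measurable borel" if f: "test_function f" for f :: "real ^ 'n \<Rightarrow> real"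
  proof -
    have [measurable]: "f \<in> borel_measurable borel" using f by (rule test_function_measurable)
    show ?thesis
      unfolding fourier_test[OF f, abs_def] Complex_eq by measurable
  qed
  show ?thesis
  proof (intro exI[of _ "P / C"] conjI allI impI)
    show "P / C > 0" using P C by simp
    fix \<phi> :: "real ^ 'n \<Rightarrow> real" assume \<phi>: "test_function \<phi>"
    have [measurable]: "fourier \<phi> \<in> borel_measurable borel" using \<phi> by (rule fm)
    show "test_norm s \<phi> = sqrt (P / C * energy s \<phi> \<phi>)"
      unfolding test_norm_def main(2)[OF \<phi>, symmetric] by (subst integral_completion) measurable
    fix \<psi> :: "real ^ 'n \<Rightarrow> real" assume \<psi>: "test_function \<psi>"
    have [measurable]: "fourier \<psi> \<in> borel_measurable borel" using \<psi> by (rule fm)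
    note fe = test_function_finite_energy[OF s \<phi>] test_function_finite_energy[OF s \<psi>]
    note add = test_function_add[OF \<phi> \<psi>] and diff = test_function_diff[OF \<phi> \<psi>]
    have lin: "fourier (\<lambda>x. \<phi> x + \<psi> x) \<xi> = fourier \<phi> \<xi> + fourier \<psi> \<xi>"
      "fourier (\<lambda>x. \<phi> x - \<psi> x) \<xi> = fourier \<phi> \<xi> - fourier \<psi> \<xi>" for \<xi>
      unfolding fourier_test[OF \<phi>] fourier_test[OF \<psi>] fourier_test[OF add] fourier_test[OF diff]
      using integrable_trig_times[OF test_function_integrable[OF \<phi>], of \<xi>]
        integrable_trig_times[OF test_function_integrable[OF \<psi>], of \<xi>]
      by (auto simp: complex_eq_iff algebra_simps)
    let ?w = "\<lambda>\<xi>::real ^ 'n. norm \<xi> powr (2 * s)"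
    let ?F = "\<lambda>\<xi>. complex_of_real (?w \<xi>) * (fourier \<phi> \<xi> * cnj (fourier \<psi> \<xi>))"
    have cnjm[measurable]: "cnj \<in> borel_measurable borel"
      by (intro borel_measurable_continuous_onI continuous_intros)
    have m: "?F \<in> borel_measurable lborel" by measurable
    have int: "integrable lborel ?F"
    proof (rule Bochner_Integration.integrable_bound[OF _ m])
      show "integrable lborel (\<lambda>\<xi>. ?w \<xi> * (cmod (fourier \<phi> \<xi>))\<^sup>2 + ?w \<xi> * (cmod (fourier \<psi> \<xi>))\<^sup>2)"
        using main(1)[OF \<phi>] main(1)[OF \<psi>] by simp
      show "AE \<xi> in lborel. norm (?F \<xi>) \<le> norm (?w \<xi> * (cmod (fourier \<phi> \<xi>))\<^sup>2 + ?w \<xi> * (cmod (fourier \<psi> \<xi>))\<^sup>2)"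
      proof (rule AE_I2)
        fix \<xi>
        have "cmod (fourier \<phi> \<xi>) * cmod (fourier \<psi> \<xi>) \<le> (cmod (fourier \<phi> \<xi>))\<^sup>2 + (cmod (fourier \<psi> \<xi>))\<^sup>2"
          using sum_squares_bound[of "cmod (fourier \<phi> \<xi>)" "cmod (fourier \<psi> \<xi>)"]
            mult_nonneg_nonneg[OF norm_ge_zero[of "fourier \<phi> \<xi>"] norm_ge_zero[of "fourier \<psi> \<xi>"]] by linarith
        then show "norm (?F \<xi>) \<le> norm (?w \<xi> * (cmod (fourier \<phi> \<xi>))\<^sup>2 + ?w \<xi> * (cmod (fourier \<psi> \<xi>))\<^sup>2)"
          by (simp add: norm_mult mult_left_mono flip: distrib_left)
      qed
    qed
    \<comment> \<open>Polarization under the integral: only quadratic expressions in the sum and the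
      difference of the test functions remain.\<close>
    have pol: "Re (?F \<xi>) = (?w \<xi> * (cmod (fourier (\<lambda>x. \<phi> x + \<psi> x) \<xi>))\<^sup>2 - ?w \<xi> * (cmod (fourier (\<lambda>x. \<phi> x - \<psi> x) \<xi>))\<^sup>2) / 4" for \<xi>
      unfolding lin cmod_power2 by (simp add: power2_eq_square algebra_simps)
    have "test_inner s \<phi> \<psi> = Re (\<integral>\<xi>. ?F \<xi> \<partial>lborel)"
      unfolding test_inner_def by (subst integral_completion[OF m]) simp
    also have "\<dots> = (\<integral>\<xi>. Re (?F \<xi>) \<partial>lborel)" by (rule integral_Re[OF int, symmetric])
    also have "\<dots> = (P / C * energy s (\<lambda>x. \<phi> x + \<psi> x) (\<lambda>x. \<phi> x + \<psi> x) - P / C * energy s (\<lambda>x. \<phi> x - \<psi> x) (\<lambda>x. \<phi> x - \<psi> x)) / 4"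
      unfolding pol using main[OF add] main[OF diff] by simp
    also have "energy s (\<lambda>x. \<phi> x + \<psi> x) (\<lambda>x. \<phi> x + \<psi> x) = energy s \<phi> \<phi> + 2 * energy s \<phi> \<psi> + energy s \<psi> \<psi>"
      by (rule energy_add_self[OF fe])
    also have "energy s (\<lambda>x. \<phi> x - \<psi> x) (\<lambda>x. \<phi> x - \<psi> x) = energy s \<phi> \<phi> - 2 * energy s \<phi> \<psi> + energy s \<psi> \<psi>"
      by (rule energy_diff_self[OF fe])
    finally show "test_inner s \<phi> \<psi> = P / C * energy s \<phi> \<psi>" by (simp add: algebra_simps)
  qed
qed

lemma critical_exponent_ge_2:
  assumes "0 < s" "real CARD('n::finite) > 2 * s"
  shows "critical_exponent TYPE('n) s \<ge> 2"
  using assms by (simp add: critical_exponent_def field_simps)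

lemma abs_diff_powr_le:
  assumes "r \<ge> (0::real)"
  shows "\<bar>a - b\<bar> powr r \<le> 2 powr r * (\<bar>a\<bar> powr r + \<bar>b\<bar> powr r)"
proof -
  have "\<bar>a - b\<bar> powr r \<le> (2 * max \<bar>a\<bar> \<bar>b\<bar>) powr r" using assms by (intro powr_mono2) auto
  also have "\<dots> = 2 powr r * max \<bar>a\<bar> \<bar>b\<bar> powr r" by (simp add: powr_mult)
  also have "max \<bar>a\<bar> \<bar>b\<bar> powr r \<le> \<bar>a\<bar> powr r + \<bar>b\<bar> powr r" by (auto simp: max_def)
  finally show ?thesis by simp
qed

lemma abs_powr_le_square:
  assumes "\<bar>t\<bar> \<le> M" "r \<ge> (2::real)"
  shows "\<bar>t\<bar> powr r \<le> M powr (r - 2) * t\<^sup>2"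
proof (cases "t = 0")
  case False
  have "\<bar>t\<bar> powr r = \<bar>t\<bar> powr (r - 2 + 2)" by simp
  also have "\<dots> = \<bar>t\<bar> powr (r - 2) * \<bar>t\<bar> powr 2" by (rule powr_add)
  also have "\<dots> \<le> M powr (r - 2) * t\<^sup>2"
    using assms False by (intro mult_mono powr_mono2) (auto simp: powr_numeral)
  finally show ?thesis .
qed (use assms in simp)

lemma integrable_powr_of_sq_integrable:
  fixes f :: "'a::euclidean_space \<Rightarrow> real"
  assumes f: "sq_integrable f" and bd: "\<And>x. \<bar>f x\<bar> \<le> M" and r: "r \<ge> 2"
  shows "integrable lborel (\<lambda>x. \<bar>f x\<bar> powr r)"
    and "(\<integral>x. \<bar>f x\<bar> powr r \<partial>lborel) \<le> M powr (r - 2) * (\<integral>x. (f x)\<^sup>2 \<partial>lborel)"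
proof -
  have [measurable]: "f \<in> borel_measurable borel" using f by (rule sq_integrable_measurable)
  have int: "integrable lborel (\<lambda>x. M powr (r - 2) * (f x)\<^sup>2)"
    by (intro integrable_mult_right sq_integrable_square f)
  show *: "integrable lborel (\<lambda>x. \<bar>f x\<bar> powr r)"
    by (rule Bochner_Integration.integrable_bound[OF int])
      (auto intro!: order_trans[OF abs_powr_le_square[OF bd r]])
  have "(\<integral>x. \<bar>f x\<bar> powr r \<partial>lborel) \<le> (\<integral>x. M powr (r - 2) * (f x)\<^sup>2 \<partial>lborel)"
    by (intro integral_mono * int abs_powr_le_square bd r)
  then show "(\<integral>x. \<bar>f x\<bar> powr r \<partial>lborel) \<le> M powr (r - 2) * (\<integral>x. (f x)\<^sup>2 \<partial>lborel)" by simp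
qed

lemma tendsto_of_powr_tendsto_zero:
  fixes X :: "nat \<Rightarrow> real"
  assumes r: "r > 0" and X: "(\<lambda>n. \<bar>X n\<bar> powr r) \<longlonglongrightarrow> 0"
  shows "X \<longlonglongrightarrow> 0"
proof -
  have "(\<lambda>n. (\<bar>X n\<bar> powr r) powr (1 / r)) \<longlonglongrightarrow> 0 powr (1 / r)"
    using r by (intro tendsto_powr' X tendsto_const) auto
  then have "(\<lambda>n. \<bar>X n\<bar>) \<longlonglongrightarrow> 0" using r by (simp add: powr_powr)
  then show ?thesis by (rule tendsto_rabs_zero_cancel)
qed

text \<open>Membership in the completion provides convergence in a Lebesgue space only. The a.e.
  convergent subsequence is what Fatou needs for the difference quotients.\<close>

lemma dotH_approx_AE_subseq:
  fixes \<phi> :: "nat \<Rightarrow> real ^ 'n \<Rightarrow> real"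
  assumes r: "critical_exponent TYPE('n) s \<ge> 2"
    and app: "dotH_approx s \<phi> u"
    and v: "v \<in> borel_measurable borel" "AE x in lebesgue. u x = v x"
  shows "(\<lambda>k. \<integral>x. \<bar>\<phi> k x - v x\<bar> powr critical_exponent TYPE('n) s \<partial>lborel) \<longlonglongrightarrow> 0"
    and "\<exists>\<rho>. strict_mono \<rho> \<and> (AE x in lborel. (\<lambda>n. \<phi> (\<rho> n) x) \<longlonglongrightarrow> v x)"
proof -
  let ?r = "critical_exponent TYPE('n) s"
  have tf: "test_function (\<phi> k)" for k using app by (simp add: dotH_approx_def)
  have [measurable]: "\<phi> k \<in> borel_measurable borel" for k using tf by (rule test_function_measurable)
  have [measurable]: "v \<in> borel_measurable borel" by fact
  have u: "u \<in> borel_measurable lebesgue" "integrable lebesgue (\<lambda>x. \<bar>u x\<bar> powr ?r)"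
    using app by (auto simp: dotH_approx_def in_Lp_def)
  have lm: "g \<in> borel_measurable lebesgue" if "g \<in> borel_measurable borel" for g :: "real ^ 'n \<Rightarrow> real"
    using that by (intro measurable_completion) simp
  have vi: "integrable lborel (\<lambda>x. \<bar>v x\<bar> powr ?r)"
  proof -
    have "integrable lebesgue (\<lambda>x. \<bar>v x\<bar> powr ?r)"
      by (rule integrable_cong_AE_imp[OF u(2)])
        (use v in \<open>auto intro!: lm elim!: eventually_mono\<close>)
    then show ?thesis by (subst (asm) integrable_completion) auto
  qed
  have "(\<integral>x. \<bar>\<phi> k x - v x\<bar> powr ?r \<partial>lborel) = (LINT x|lebesgue. \<bar>\<phi> k x - u x\<bar> powr ?r)" for k
  proof -
    have "(LINT x|lebesgue. \<bar>\<phi> k x - u x\<bar> powr ?r) = (LINT x|lebesgue. \<bar>\<phi> k x - v x\<bar> powr ?r)"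
    proof (rule integral_cong_AE)
      have [measurable]: "u \<in> borel_measurable lebesgue" "\<phi> k \<in> borel_measurable lebesgue" "v \<in> borel_measurable lebesgue"
        by (auto intro: u lm)
      show "(\<lambda>x. \<bar>\<phi> k x - u x\<bar> powr ?r) \<in> borel_measurable lebesgue" "(\<lambda>x. \<bar>\<phi> k x - v x\<bar> powr ?r) \<in> borel_measurable lebesgue"
        by measurable
    qed (use v(2) in \<open>auto elim!: eventually_mono\<close>)
    also have "\<dots> = (LINT x|lborel. \<bar>\<phi> k x - v x\<bar> powr ?r)" by (rule integral_completion) measurable
    finally show ?thesis by simp
  qed
  then show lim: "(\<lambda>k. \<integral>x. \<bar>\<phi> k x - v x\<bar> powr ?r \<partial>lborel) \<longlonglongrightarrow> 0"
    using app by (simp add: dotH_approx_def)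
  have int: "integrable lborel (\<lambda>x. \<bar>\<phi> k x - v x\<bar> powr ?r)" for k
  proof (rule Bochner_Integration.integrable_bound)
    obtain M R where "\<And>x. \<bar>\<phi> k x\<bar> \<le> M" using test_function_bounded[OF tf[of k]] by metis
    then have "integrable lborel (\<lambda>x. \<bar>\<phi> k x\<bar> powr ?r)"
      using integrable_powr_of_sq_integrable(1)[OF test_function_sq_integrable[OF tf]] r by blast
    then show "integrable lborel (\<lambda>x. 2 powr ?r * (\<bar>\<phi> k x\<bar> powr ?r + \<bar>v x\<bar> powr ?r))" using vi by simp
    show "AE x in lborel. norm (\<bar>\<phi> k x - v x\<bar> powr ?r) \<le> norm (2 powr ?r * (\<bar>\<phi> k x\<bar> powr ?r + \<bar>v x\<bar> powr ?r))"
      using r by (intro AE_I2) (simp add: abs_diff_powr_le)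
  qed measurable
  have "\<exists>\<rho>. strict_mono \<rho> \<and> (AE x in lborel. (\<lambda>n. \<bar>\<phi> (\<rho> n) x - v x\<bar> powr ?r) \<longlonglongrightarrow> 0)"
    using tendsto_L1_AE_subseq[of lborel "\<lambda>k x. \<bar>\<phi> k x - v x\<bar> powr ?r"] int lim by simp
  then obtain \<rho> where \<rho>: "strict_mono \<rho>" and ae: "AE x in lborel. (\<lambda>n. \<bar>\<phi> (\<rho> n) x - v x\<bar> powr ?r) \<longlonglongrightarrow> 0"
    by blast
  from ae have "AE x in lborel. (\<lambda>n. \<phi> (\<rho> n) x) \<longlonglongrightarrow> v x"
  proof eventually_elim
    case (elim x)
    have "(\<lambda>n. \<phi> (\<rho> n) x - v x) \<longlonglongrightarrow> 0"
      using r by (intro tendsto_of_powr_tendsto_zero[OF _ elim]) simp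
    then show ?case by (simp add: LIM_zero_iff)
  qed
  with \<rho> show "\<exists>\<rho>. strict_mono \<rho> \<and> (AE x in lborel. (\<lambda>n. \<phi> (\<rho> n) x) \<longlonglongrightarrow> v x)" by blast
qed

text \<open>Identifies abstract limits with functions of finite energy. Along the a.e. convergent
  subsequence the difference quotients converge a.e. on the product space, so Fatou carries the
  Cauchy bound for \<open>\<phi> k - \<phi> l\<close> over to \<open>\<phi> k - v\<close>.\<close>

lemma dotH_approx_energy:
  fixes \<phi> :: "nat \<Rightarrow> real ^ 'n \<Rightarrow> real"
  assumes s: "0 < s" "s < 1" and r: "critical_exponent TYPE('n) s \<ge> 2"
    and \<kappa>: "\<kappa> > 0" "\<And>\<phi> :: real ^ 'n \<Rightarrow> real. test_function \<phi> \<Longrightarrow> test_norm s \<phi> = sqrt (\<kappa> * energy s \<phi> \<phi>)"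
    and app: "dotH_approx s \<phi> u"
    and v: "v \<in> borel_measurable borel" "AE x in lebesgue. u x = v x"
  shows "finite_energy s v"
    and "(\<lambda>k. energy s (\<lambda>x. \<phi> k x - v x) (\<lambda>x. \<phi> k x - v x)) \<longlonglongrightarrow> 0"
proof -
  have tf: "test_function (\<phi> k)" for k using app by (simp add: dotH_approx_def)
  have fe: "finite_energy s (\<phi> k)" for k using test_function_finite_energy[OF s tf] .
  have [measurable]: "\<phi> k \<in> borel_measurable borel" for k using tf by (rule test_function_measurable)
  have [measurable]: "v \<in> borel_measurable borel" by fact
  obtain \<rho> where \<rho>: "strict_mono \<rho>" and ae: "AE x in lborel. (\<lambda>n. \<phi> (\<rho> n) x) \<longlonglongrightarrow> v x"
    using dotH_approx_AE_subseq(2)[OF r app v] by blast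
  have cauchy: "\<exists>M. \<forall>k\<ge>M. \<forall>l\<ge>M. energy s (\<lambda>x. \<phi> k x - \<phi> l x) (\<lambda>x. \<phi> k x - \<phi> l x) \<le> e" if e: "e > 0" for e
  proof -
    have "sqrt (\<kappa> * e) > 0" using e \<kappa>(1) by simp
    then obtain M where "\<forall>k\<ge>M. \<forall>l\<ge>M. test_norm s (\<lambda>x. \<phi> k x - \<phi> l x) < sqrt (\<kappa> * e)"
      using app unfolding dotH_approx_def by blast
    then show ?thesis
      using \<kappa> by (intro exI[of _ M]) (auto simp: test_function_diff[OF tf tf] less_imp_le)
  qed
  have key: "(\<integral>\<^sup>+p. ennreal ((diff_quot s (\<phi> k) p - diff_quot s v p)\<^sup>2) \<partial>lborel) \<le> ennreal e"
    if M: "\<forall>k\<ge>M. \<forall>l\<ge>M. energy s (\<lambda>x. \<phi> k x - \<phi> l x) (\<lambda>x. \<phi> k x - \<phi> l x) \<le> e" and k: "k \<ge> M" for k M e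
  proof -
    have lim: "AE p in lborel. (\<lambda>n. diff_quot s (\<phi> (\<rho> n)) p) \<longlonglongrightarrow> diff_quot s v p"
      using AE_lborel_fst[OF ae] AE_lborel_snd[OF ae]
      by eventually_elim (auto simp: diff_quot_def intro!: tendsto_intros)
    have "(\<integral>\<^sup>+p. ennreal ((diff_quot s (\<phi> k) p - diff_quot s v p)\<^sup>2) \<partial>lborel) =
        (\<integral>\<^sup>+p. liminf (\<lambda>n. ennreal ((diff_quot s (\<phi> k) p - diff_quot s (\<phi> (\<rho> n)) p)\<^sup>2)) \<partial>lborel)"
    proof (rule nn_integral_cong_AE)
      show "AE p in lborel. ennreal ((diff_quot s (\<phi> k) p - diff_quot s v p)\<^sup>2) =
        liminf (\<lambda>n. ennreal ((diff_quot s (\<phi> k) p - diff_quot s (\<phi> (\<rho> n)) p)\<^sup>2))"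
        using lim
      proof eventually_elim
        case (elim p)
        have "(\<lambda>n. ennreal ((diff_quot s (\<phi> k) p - diff_quot s (\<phi> (\<rho> n)) p)\<^sup>2)) \<longlonglongrightarrow>
            ennreal ((diff_quot s (\<phi> k) p - diff_quot s v p)\<^sup>2)"
          by (intro tendsto_ennrealI tendsto_intros elim)
        then show ?case by (rule lim_imp_Liminf[OF trivial_limit_sequentially, symmetric])
      qed
    qed
    also have "\<dots> \<le> liminf (\<lambda>n. \<integral>\<^sup>+p. ennreal ((diff_quot s (\<phi> k) p - diff_quot s (\<phi> (\<rho> n)) p)\<^sup>2) \<partial>lborel)"
      by (rule nn_integral_liminf) measurable
    also have "\<dots> \<le> ennreal e"
    proof (rule Liminf_le)
      have "\<forall>\<^sub>F n in sequentially. n \<ge> M" by (rule eventually_ge_at_top)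
      then show "\<forall>\<^sub>F n in sequentially. (\<integral>\<^sup>+p. ennreal ((diff_quot s (\<phi> k) p - diff_quot s (\<phi> (\<rho> n)) p)\<^sup>2) \<partial>lborel) \<le> ennreal e"
      proof eventually_elim
        case (elim n)
        have "\<rho> n \<ge> M" using elim seq_suble[OF \<rho>, of n] by simp
        then have le: "energy s (\<lambda>x. \<phi> k x - \<phi> (\<rho> n) x) (\<lambda>x. \<phi> k x - \<phi> (\<rho> n) x) \<le> e" using M k by blast
        have "(\<integral>\<^sup>+p. ennreal ((diff_quot s (\<phi> k) p - diff_quot s (\<phi> (\<rho> n)) p)\<^sup>2) \<partial>lborel) =
            ennreal (energy s (\<lambda>x. \<phi> k x - \<phi> (\<rho> n) x) (\<lambda>x. \<phi> k x - \<phi> (\<rho> n) x))"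
          unfolding energy_self diff_quot_diff
          by (intro nn_integral_eq_integral sq_integrable_square sq_integrable_diff finite_energy_diff_quot fe) auto
        then show ?case using le by (simp add: ennreal_leI)
      qed
    qed simp
    finally show ?thesis .
  qed
  have sq: "sq_integrable (\<lambda>p. diff_quot s (\<phi> k) p - diff_quot s v p)" and
    le: "energy s (\<lambda>x. \<phi> k x - v x) (\<lambda>x. \<phi> k x - v x) \<le> e"
    if M: "\<forall>k\<ge>M. \<forall>l\<ge>M. energy s (\<lambda>x. \<phi> k x - \<phi> l x) (\<lambda>x. \<phi> k x - \<phi> l x) \<le> e" and k: "k \<ge> M" and "e > 0" for k M e
  proof -
    have fin: "(\<integral>\<^sup>+p. ennreal ((diff_quot s (\<phi> k) p - diff_quot s v p)\<^sup>2) \<partial>lborel) < \<infinity>"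
      using key[OF M k] by (simp add: le_less_trans)
    have int: "integrable lborel (\<lambda>p. (diff_quot s (\<phi> k) p - diff_quot s v p)\<^sup>2)"
      by (rule integrableI_nonneg[OF _ _ fin]) auto
    then show "sq_integrable (\<lambda>p. diff_quot s (\<phi> k) p - diff_quot s v p)"
      by (simp add: sq_integrable_def)
    have "ennreal (energy s (\<lambda>x. \<phi> k x - v x) (\<lambda>x. \<phi> k x - v x)) \<le> ennreal e"
      unfolding energy_self diff_quot_diff using key[OF M k] nn_integral_eq_integral[OF int] by simp
    then show "energy s (\<lambda>x. \<phi> k x - v x) (\<lambda>x. \<phi> k x - v x) \<le> e"
      using \<open>e > 0\<close> by (simp add: ennreal_le_iff)
  qed
  obtain M where M: "\<forall>k\<ge>M. \<forall>l\<ge>M. energy s (\<lambda>x. \<phi> k x - \<phi> l x) (\<lambda>x. \<phi> k x - \<phi> l x) \<le> 1"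
    using cauchy[of 1] by auto
  show "finite_energy s v"
    using sq_integrable_diff[OF finite_energy_diff_quot[OF fe[of M]] sq[OF M order_refl]]
    by (simp add: finite_energy_def)
  show "(\<lambda>k. energy s (\<lambda>x. \<phi> k x - v x) (\<lambda>x. \<phi> k x - v x)) \<longlonglongrightarrow> 0"
  proof (rule LIMSEQ_I)
    fix e :: real assume e: "e > 0"
    then obtain M where M: "\<forall>k\<ge>M. \<forall>l\<ge>M. energy s (\<lambda>x. \<phi> k x - \<phi> l x) (\<lambda>x. \<phi> k x - \<phi> l x) \<le> e / 2"
      using cauchy[of "e / 2"] by auto
    have "energy s (\<lambda>x. \<phi> k x - v x) (\<lambda>x. \<phi> k x - v x) < e" if "k \<ge> M" for k
      using le[OF M that] e by simp
    then show "\<exists>n0. \<forall>n\<ge>n0. norm (energy s (\<lambda>x. \<phi> n x - v x) (\<lambda>x. \<phi> n x - v x) - 0) < e"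
      by (intro exI[of _ M]) auto
  qed
qed

lemma energy_tendsto:
  assumes f: "\<And>k. finite_energy s (f k)" "finite_energy s F" "(\<lambda>k. energy s (\<lambda>x. f k x - F x) (\<lambda>x. f k x - F x)) \<longlonglongrightarrow> 0"
    and g: "\<And>k. finite_energy s (g k)" "finite_energy s G" "(\<lambda>k. energy s (\<lambda>x. g k x - G x) (\<lambda>x. g k x - G x)) \<longlonglongrightarrow> 0"
  shows "(\<lambda>k. energy s (f k) (g k)) \<longlonglongrightarrow> energy s F G"
proof -
  define a where "a k = sqrt (energy s (\<lambda>x. f k x - F x) (\<lambda>x. f k x - F x))" for k
  define b where "b k = sqrt (energy s (\<lambda>x. g k x - G x) (\<lambda>x. g k x - G x))" for k
  have a: "a \<longlonglongrightarrow> 0" unfolding a_def using tendsto_real_sqrt[OF f(3)] by simp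
  have b: "b \<longlonglongrightarrow> 0" unfolding b_def using tendsto_real_sqrt[OF g(3)] by simp
  note df = finite_energy_diff[OF f(1) f(2)] and dg = finite_energy_diff[OF g(1) g(2)]
  have le: "\<bar>energy s (f k) (g k) - energy s F G\<bar> \<le> a k * b k + a k * sqrt (energy s G G) + sqrt (energy s F F) * b k" for k
  proof -
    have "energy s (f k) (g k) - energy s F G =
        energy s (\<lambda>x. f k x - F x) (\<lambda>x. g k x - G x) + energy s (\<lambda>x. f k x - F x) G + energy s F (\<lambda>x. g k x - G x)"
      using energy_diff_left[OF f(1) f(2) dg, of k k] energy_diff_left[OF f(1) f(2) g(2), of k]
        energy_diff_right[OF g(1) g(2) f(1), of k k] energy_diff_right[OF g(1) g(2) f(2), of k] by linarith
    then show ?thesis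
      using energy_Cauchy_Schwarz[OF df dg, of k k] energy_Cauchy_Schwarz[OF df g(2), of k]
        energy_Cauchy_Schwarz[OF f(2) dg, of k]
      unfolding a_def b_def by linarith
  qed
  have "(\<lambda>k. a k * b k + a k * sqrt (energy s G G) + sqrt (energy s F F) * b k) \<longlonglongrightarrow>
      0 * 0 + 0 * sqrt (energy s G G) + sqrt (energy s F F) * 0"
    by (intro tendsto_intros a b)
  then have lim: "(\<lambda>k. a k * b k + a k * sqrt (energy s G G) + sqrt (energy s F F) * b k) \<longlonglongrightarrow> 0" by simp
  have "(\<lambda>k. energy s (f k) (g k) - energy s F G) \<longlonglongrightarrow> 0"
    by (rule Lim_null_comparison[OF _ lim]) (simp add: le)
  then show ?thesis by (simp add: LIM_zero_iff)
qed

text \<open>All approximating sequences lead to the same limit because the energy is continuous.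
  Uniqueness in the definite description needs at least one such pair of sequences, which membership
  in the space supplies.\<close>

lemma dotH_inner_eq_energy:
  fixes u v u' v' :: "real ^ 'n \<Rightarrow> real"
  assumes s: "0 < s" "s < 1" and r: "critical_exponent TYPE('n) s \<ge> 2"
    and \<kappa>: "\<kappa> > 0" "\<And>\<phi> :: real ^ 'n \<Rightarrow> real. test_function \<phi> \<Longrightarrow> test_norm s \<phi> = sqrt (\<kappa> * energy s \<phi> \<phi>)"
      "\<And>\<phi> \<psi> :: real ^ 'n \<Rightarrow> real. test_function \<phi> \<Longrightarrow> test_function \<psi> \<Longrightarrow> test_inner s \<phi> \<psi> = \<kappa> * energy s \<phi> \<psi>"
    and "in_dotH s u" "in_dotH s v"
    and u': "u' \<in> borel_measurable borel" "AE x in lebesgue. u x = u' x"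
    and v': "v' \<in> borel_measurable borel" "AE x in lebesgue. v x = v' x"
  shows "dotH_inner s u v = \<kappa> * energy s u' v'"
proof -
  obtain \<phi>0 \<psi>0 where 0: "dotH_approx s \<phi>0 u" "dotH_approx s \<psi>0 v"
    using assms by (auto simp: in_dotH_def)
  have lim: "(\<lambda>k. test_inner s (\<phi> k) (\<psi> k)) \<longlonglongrightarrow> \<kappa> * energy s u' v'"
    if "dotH_approx s \<phi> u" "dotH_approx s \<psi> v" for \<phi> \<psi>
  proof -
    have tf: "test_function (\<phi> k)" "test_function (\<psi> k)" for k using that by (auto simp: dotH_approx_def)
    show ?thesis
      unfolding \<kappa>(3)[OF tf]
      by (intro tendsto_mult_left energy_tendsto test_function_finite_energy[OF s] tf
          dotH_approx_energy[OF s r \<kappa>(1,2) that(1) u'] dotH_approx_energy[OF s r \<kappa>(1,2) that(2) v'])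
  qed
  show ?thesis
    unfolding dotH_inner_def
  proof (rule the_equality)
    show "\<forall>\<phi> \<psi>. dotH_approx s \<phi> u \<longrightarrow> dotH_approx s \<psi> v \<longrightarrow> (\<lambda>k. test_inner s (\<phi> k) (\<psi> k)) \<longlonglongrightarrow> \<kappa> * energy s u' v'"
      using lim by blast
    fix c assume "\<forall>\<phi> \<psi>. dotH_approx s \<phi> u \<longrightarrow> dotH_approx s \<psi> v \<longrightarrow> (\<lambda>k. test_inner s (\<phi> k) (\<psi> k)) \<longlonglongrightarrow> c"
    then show "c = \<kappa> * energy s u' v'" using 0 lim[OF 0] LIMSEQ_unique by blast
  qed
qed

section \<open>Density of test functions and the energy form of the equation\<close>

text \<open>Differentiation under the integral by dominated convergence: the remainder quotient is
  bounded by the Lipschitz constant plus the derivative bound of \<open>K\<close>, times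
  \<open>\<bar>g y\<bar>\<close>.\<close>

lemma convolution_has_derivative:
  fixes K g :: "real ^ 'n \<Rightarrow> real"
  assumes K: "test_function K" and g: "integrable lborel g"
  shows "((\<lambda>x. \<integral>y. K (x - y) * g y \<partial>lborel) has_derivative
    (\<lambda>v. \<integral>y. frechet_derivative K (at (x - y)) v * g y \<partial>lborel)) (at x)"
proof -
  obtain R where R: "\<And>x. norm x \<ge> R \<Longrightarrow> K x = 0" using test_function_support[OF K] by metis
  have C1: "Ck (Suc 0) K" using K unfolding test_function_def by (rule conjunct1[THEN spec])
  obtain L where L: "\<And>x v. \<bar>frechet_derivative K (at x) v\<bar> \<le> L * norm v"
    using Ck1_bounded_derivative[OF C1 R] by metis
  obtain L' where L': "\<And>x y. \<bar>K x - K y\<bar> \<le> L' * norm (x - y)"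
    using Ck1_Lipschitz[OF C1 R] by metis
  obtain M where M: "\<And>x. \<bar>K x\<bar> \<le> M" using test_function_bounded[OF K] by metis
  let ?D = "\<lambda>z. frechet_derivative K (at z)"
  have [measurable]: "g \<in> borel_measurable borel" using borel_measurable_integrable[OF g] by simp
  have Kc: "continuous_on UNIV K" using K by (rule test_function_continuous)
  have [measurable]: "K \<in> borel_measurable borel" using K by (rule test_function_measurable)
  have Dm[measurable]: "(\<lambda>z. ?D z v) \<in> borel_measurable borel" for v
    using Ck_SucD(2)[OF C1, of v] by (intro borel_measurable_continuous_onI) simp
  have lin: "linear (?D z)" for z using Ck_SucD(1)[OF C1] by (rule has_derivative_linear)
  have intD: "integrable lborel (\<lambda>y. ?D (x - y) v * g y)" for v
  proof (rule Bochner_Integration.integrable_bound)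
    show "integrable lborel (\<lambda>y. (L * norm v) * g y)" using g by (intro integrable_mult_right)
    show "AE y in lborel. norm (?D (x - y) v * g y) \<le> norm ((L * norm v) * g y)"
      unfolding norm_mult by (intro AE_I2 mult_right_mono) (auto simp: abs_mult intro!: order_trans[OF L] mult_right_mono)
  qed measurable
  have intK: "integrable lborel (\<lambda>y. K (z - y) * g y)" for z
  proof (rule Bochner_Integration.integrable_bound)
    show "integrable lborel (\<lambda>y. M * g y)" using g by (intro integrable_mult_right)
    show "AE y in lborel. norm (K (z - y) * g y) \<le> norm (M * g y)"
      unfolding norm_mult by (intro AE_I2 mult_right_mono) (auto intro!: order_trans[OF M])
  qed measurable
  show ?thesis
    unfolding has_derivative_at
  proof
    show "bounded_linear (\<lambda>v. \<integral>y. ?D (x - y) v * g y \<partial>lborel)"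
    proof (rule bounded_linear_intro)
      fix v w :: "real ^ 'n" and c :: real
      show "(\<integral>y. ?D (x - y) (v + w) * g y \<partial>lborel) = (\<integral>y. ?D (x - y) v * g y \<partial>lborel) + (\<integral>y. ?D (x - y) w * g y \<partial>lborel)"
        by (simp add: linear_add[OF lin] distrib_right intD)
      show "(\<integral>y. ?D (x - y) (c *\<^sub>R v) * g y \<partial>lborel) = c *\<^sub>R (\<integral>y. ?D (x - y) v * g y \<partial>lborel)"
        by (simp add: linear_scale[OF lin] mult.assoc)
      have "norm (\<integral>y. ?D (x - y) v * g y \<partial>lborel) \<le> (\<integral>y. (L * norm v) * \<bar>g y\<bar> \<partial>lborel)"
        by (intro Bochner_Integration.integral_norm_bound_integral intD integrable_mult_right integrable_abs g)
          (auto simp: abs_mult intro!: mult_right_mono L)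
      then show "norm (\<integral>y. ?D (x - y) v * g y \<partial>lborel) \<le> norm v * (L * (\<integral>y. \<bar>g y\<bar> \<partial>lborel))"
        by (simp add: mult_ac)
    qed
    show "(\<lambda>h. norm ((\<integral>y. K (x + h - y) * g y \<partial>lborel) - (\<integral>y. K (x - y) * g y \<partial>lborel) -
        (\<integral>y. ?D (x - y) h * g y \<partial>lborel)) / norm h) \<midarrow>0\<rightarrow> 0"
      unfolding tendsto_at_iff_sequentially o_def
    proof (intro allI impI)
      fix X :: "nat \<Rightarrow> real ^ 'n"
      assume X: "\<forall>i. X i \<in> UNIV - {0}" "X \<longlonglongrightarrow> 0"
      let ?q = "\<lambda>i y. (K (x + X i - y) - K (x - y) - ?D (x - y) (X i)) / norm (X i) * g y"
      have eq: "(\<integral>y. K (x + X i - y) * g y \<partial>lborel) - (\<integral>y. K (x - y) * g y \<partial>lborel) -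
        (\<integral>y. ?D (x - y) (X i) * g y \<partial>lborel) = norm (X i) * (\<integral>y. ?q i y \<partial>lborel)" for i
      proof -
        have "norm (X i) * (\<integral>y. ?q i y \<partial>lborel) = (\<integral>y. norm (X i) * ?q i y \<partial>lborel)" by simp
        also have "\<dots> = (\<integral>y. K (x + X i - y) * g y - K (x - y) * g y - ?D (x - y) (X i) * g y \<partial>lborel)"
          using X(1) by (intro Bochner_Integration.integral_cong) (auto simp: field_simps)
        finally show ?thesis by (simp add: intK intD)
      qed
      have lim: "(\<lambda>i. \<integral>y. ?q i y \<partial>lborel) \<longlonglongrightarrow> (\<integral>y. 0 \<partial>(lborel :: (real ^ 'n) measure))"
      proof (rule integral_dominated_convergence)
        show "integrable lborel (\<lambda>y. (L' + L) * \<bar>g y\<bar>)" using g by (intro integrable_mult_right integrable_abs)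
        show "AE y in lborel. norm (?q i y) \<le> (L' + L) * \<bar>g y\<bar>" for i
        proof (rule AE_I2)
          fix y
          have "\<bar>K (x + X i - y) - K (x - y) - ?D (x - y) (X i)\<bar> \<le> (L' + L) * norm (X i)"
            using L'[of "x + X i - y" "x - y"] L[of "x - y" "X i"] by (simp add: distrib_right)
          then have "\<bar>(K (x + X i - y) - K (x - y) - ?D (x - y) (X i)) / norm (X i)\<bar> \<le> L' + L"
            using X(1) by (simp add: abs_divide divide_le_eq)
          then show "norm (?q i y) \<le> (L' + L) * \<bar>g y\<bar>"
            unfolding real_norm_def abs_mult by (intro mult_right_mono) auto
        qed
        show "AE y in lborel. (\<lambda>i. ?q i y) \<longlonglongrightarrow> 0"
        proof (intro AE_I2 tendsto_mult_left_zero)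
          fix y
          have "(\<lambda>h. norm (K ((x - y) + h) - K (x - y) - ?D (x - y) h) / norm h) \<midarrow>0\<rightarrow> 0"
            using Ck_SucD(1)[OF C1, of "x - y"] unfolding has_derivative_at by blast
          then have "(\<lambda>i. norm (K ((x - y) + X i) - K (x - y) - ?D (x - y) (X i)) / norm (X i)) \<longlonglongrightarrow> 0"
            using X unfolding tendsto_at_iff_sequentially o_def by blast
          then have "(\<lambda>i. norm ((K ((x - y) + X i) - K (x - y) - ?D (x - y) (X i)) / norm (X i))) \<longlonglongrightarrow> 0"
            by simp
          then show "(\<lambda>i. (K (x + X i - y) - K (x - y) - ?D (x - y) (X i)) / norm (X i)) \<longlonglongrightarrow> 0"
            by (subst (asm) tendsto_norm_zero_iff) (simp add: algebra_simps)
        qed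
      qed measurable
      have "(\<lambda>i. norm (norm (X i) * (\<integral>y. ?q i y \<partial>lborel)) / norm (X i)) = (\<lambda>i. norm (\<integral>y. ?q i y \<partial>lborel))"
        using X(1) by (auto simp: abs_mult fun_eq_iff)
      then show "(\<lambda>i. norm ((\<integral>y. K (x + X i - y) * g y \<partial>lborel) - (\<integral>y. K (x - y) * g y \<partial>lborel) -
        (\<integral>y. ?D (x - y) (X i) * g y \<partial>lborel)) / norm (X i)) \<longlonglongrightarrow> 0"
        unfolding eq using tendsto_norm_zero[OF lim[simplified]] by simp
    qed
  qed
qed

lemma test_function_derivative:
  fixes K :: "real ^ 'n \<Rightarrow> real"
  assumes K: "test_function K"
  shows "test_function (\<lambda>x. frechet_derivative K (at x) v)"
proof -
  obtain R where R: "\<And>x. norm x \<ge> R \<Longrightarrow> K x = 0" using test_function_support[OF K] by metis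
  have "Ck (Suc k) K" for k using K unfolding test_function_def by (rule conjunct1[THEN spec])
  from Ck_SucD(2)[OF this] show ?thesis
  proof (rule test_functionI[of _ "R + 1"])
    fix x :: "real ^ 'n" assume "R + 1 \<le> norm x"
    then show "frechet_derivative K (at x) v = 0"
      by (intro frechet_derivative_outside_support[of R]) (use R in auto)
  qed
qed

text \<open>A directional derivative of the convolution is the convolution with a directional
  derivative of \<open>K\<close>, again a test function; hence the induction is over all
  \<open>K\<close> at once.\<close>

lemma Ck_convolution:
  fixes K g :: "real ^ 'n \<Rightarrow> real"
  assumes g: "integrable lborel g"
  shows "test_function K \<Longrightarrow> Ck k (\<lambda>x. \<integral>y. K (x - y) * g y \<partial>lborel)"
proof (induction k arbitrary: K)
  case 0
  have "continuous_on UNIV (\<lambda>x. \<integral>y. K (x - y) * g y \<partial>lborel)"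
    using differentiableI[OF convolution_has_derivative[OF 0 g]]
    by (intro differentiable_imp_continuous_on) (simp add: differentiable_on_def)
  then show ?case by simp
next
  case (Suc k)
  show ?case
    by (rule Ck_SucI[OF convolution_has_derivative[OF Suc.prems g]])
      (rule Suc.IH[OF test_function_derivative[OF Suc.prems]])
qed

text \<open>Substituting y = x - t z turns the average of translates into a convolution with the
  rescaled mollifier \<open>t^(-N) \<rho> (w / t)\<close>.\<close>

lemma test_function_mollify:
  fixes \<rho> g :: "real ^ 'n \<Rightarrow> real"
  assumes \<rho>: "test_function \<rho>" and t: "t > 0"
    and g: "integrable lborel g" "\<And>x. norm x \<ge> S \<Longrightarrow> g x = 0"
  shows "test_function (\<lambda>x. \<integral>z. \<rho> z * g (x - t *\<^sub>R z) \<partial>lborel)"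
proof -
  obtain R where R: "\<And>x. norm x \<ge> R \<Longrightarrow> \<rho> x = 0" using test_function_support[OF \<rho>] by metis
  have [measurable]: "g \<in> borel_measurable borel" using borel_measurable_integrable[OF g(1)] by simp
  have [measurable]: "\<rho> \<in> borel_measurable borel" using \<rho> by (rule test_function_measurable)
  let ?K = "\<lambda>w. (1 / t) ^ CARD('n) * \<rho> ((1 / t) *\<^sub>R w)"
  have K: "test_function ?K"
  proof (rule test_functionI)
    show "Ck k ?K" for k
      using \<rho> by (intro Ck_mult Ck_const Ck_scaleR) (simp add: test_function_def)
    show "?K x = 0" if "norm x \<ge> t * R" for x
      using that t by (subst R) (auto simp: field_simps)
  qed
  have eq: "(\<integral>y. ?K (x - y) * g y \<partial>lborel) = (\<integral>z. \<rho> z * g (x - t *\<^sub>R z) \<partial>lborel)" for x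
  proof -
    have "(\<integral>y. ?K (x - y) * g y \<partial>lborel) = (\<integral>y. ?K (x - (x - y)) * g (x - y) \<partial>lborel)"
      by (rule integral_lborel_preserving[OF lborel_distr_reflect_point, symmetric]) simp_all
    also have "\<dots> = t ^ CARD('n) * (\<integral>z. ?K (x - (x - t *\<^sub>R z)) * g (x - t *\<^sub>R z) \<partial>lborel)"
      using t by (subst integral_lborel_scaleR[of _ t]) auto
    also have "\<dots> = (\<integral>z. t ^ CARD('n) * (?K (x - (x - t *\<^sub>R z)) * g (x - t *\<^sub>R z)) \<partial>lborel)" by simp
    also have "\<dots> = (\<integral>z. \<rho> z * g (x - t *\<^sub>R z) \<partial>lborel)"
      using t by (intro Bochner_Integration.integral_cong) (auto simp: power_one_over)
    finally show ?thesis .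
  qed
  show ?thesis
  proof (rule test_functionI[of _ "S + t * R"])
    show "Ck k (\<lambda>x. \<integral>z. \<rho> z * g (x - t *\<^sub>R z) \<partial>lborel)" for k
      using Ck_convolution[OF g(1) K, of k] unfolding eq .
    fix x :: "real ^ 'n" assume x: "S + t * R \<le> norm x"
    have "\<rho> z * g (x - t *\<^sub>R z) = 0" for z
    proof (cases "norm z \<ge> R")
      case False
      have "norm x \<le> norm (x - t *\<^sub>R z) + t * norm z"
        using norm_triangle_ineq[of "x - t *\<^sub>R z" "t *\<^sub>R z"] t by simp
      moreover have "t * norm z \<le> t * R" using False t by simp
      ultimately show ?thesis using x g(2)[of "x - t *\<^sub>R z"] by simp
    qed (simp add: R)
    then show "(\<integral>z. \<rho> z * g (x - t *\<^sub>R z) \<partial>lborel) = 0"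
      by (simp only: Bochner_Integration.integral_zero)
  qed
qed

text \<open>Jensen for the probability density \<open>\<rho>\<close>, obtained from Cauchy-Schwarz,
  followed by Tonelli. \<open>F\<close> is left abstract because it stands once for increments of a
  function and once for their difference quotients on pairs.\<close>

lemma mollify_L2_bound:
  fixes F :: "'b::euclidean_space \<Rightarrow> 'a::euclidean_space \<Rightarrow> real"
  assumes F[measurable]: "(\<lambda>(p, z). F p z) \<in> borel_measurable (borel \<Otimes>\<^sub>M borel)"
    and \<rho>: "\<And>z. \<rho> z \<ge> 0" "integrable lborel \<rho>" "(\<integral>z. \<rho> z \<partial>lborel) = 1"
    and bound: "\<And>z. \<rho> z \<noteq> 0 \<Longrightarrow> (\<integral>\<^sup>+p. ennreal ((F p z)\<^sup>2) \<partial>lborel) \<le> ennreal e"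
  shows "(\<integral>\<^sup>+p. ennreal ((\<integral>z. \<rho> z * F p z \<partial>lborel)\<^sup>2) \<partial>lborel) \<le> ennreal e"
proof -
  have [measurable]: "\<rho> \<in> borel_measurable borel" using borel_measurable_integrable[OF \<rho>(2)] by simp
  have jensen: "ennreal ((\<integral>z. \<rho> z * F p z \<partial>lborel)\<^sup>2) \<le> (\<integral>\<^sup>+z. ennreal (\<rho> z) * ennreal ((F p z)\<^sup>2) \<partial>lborel)" for p
  proof (cases "(\<integral>\<^sup>+z. ennreal (\<rho> z) * ennreal ((F p z)\<^sup>2) \<partial>lborel) < \<infinity>")
    case True
    have pm: "(\<lambda>z. F p z) \<in> borel_measurable borel" by measurable
    have eq: "ennreal (\<rho> z) * ennreal ((F p z)\<^sup>2) = ennreal ((sqrt (\<rho> z) * F p z)\<^sup>2)" for z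
      using \<rho>(1)[of z] by (simp add: ennreal_mult[symmetric] power_mult_distrib)
    have int: "integrable lborel (\<lambda>z. (sqrt (\<rho> z) * F p z)\<^sup>2)"
      using True pm unfolding eq by (intro integrableI_nonneg) auto
    have sq: "sq_integrable (\<lambda>z. sqrt (\<rho> z) * F p z)" "sq_integrable (\<lambda>z. sqrt (\<rho> z))"
      using int pm \<rho> by (auto simp: sq_integrable_def)
    have "(\<integral>z. \<rho> z * F p z \<partial>lborel) = (\<integral>z. sqrt (\<rho> z) * (sqrt (\<rho> z) * F p z) \<partial>lborel)"
      using \<rho>(1) by (simp flip: mult.assoc)
    then have "(\<integral>z. \<rho> z * F p z \<partial>lborel)\<^sup>2 \<le> (\<integral>z. (sqrt (\<rho> z))\<^sup>2 \<partial>lborel) * (\<integral>z. (sqrt (\<rho> z) * F p z)\<^sup>2 \<partial>lborel)"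
      using L2_Cauchy_Schwarz[OF sq(2,1)] by simp
    also have "\<dots> = (\<integral>z. (sqrt (\<rho> z) * F p z)\<^sup>2 \<partial>lborel)" using \<rho> by simp
    finally show ?thesis
      unfolding eq by (subst nn_integral_eq_integral[OF int]) (auto intro: ennreal_leI)
  qed (simp add: not_less top_unique)
  have "(\<integral>\<^sup>+p. ennreal ((\<integral>z. \<rho> z * F p z \<partial>lborel)\<^sup>2) \<partial>lborel) \<le>
      (\<integral>\<^sup>+p. (\<integral>\<^sup>+z. ennreal (\<rho> z) * ennreal ((F p z)\<^sup>2) \<partial>lborel) \<partial>lborel)"
    by (intro nn_integral_mono jensen)
  also have "\<dots> = (\<integral>\<^sup>+z. (\<integral>\<^sup>+p. ennreal (\<rho> z) * ennreal ((F p z)\<^sup>2) \<partial>lborel) \<partial>lborel)"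
    by (rule lborel_pair.Fubini'[symmetric]) measurable
  also have "\<dots> = (\<integral>\<^sup>+z. ennreal (\<rho> z) * (\<integral>\<^sup>+p. ennreal ((F p z)\<^sup>2) \<partial>lborel) \<partial>lborel)"
    by (intro nn_integral_cong nn_integral_cmult) measurable
  also have "\<dots> \<le> (\<integral>\<^sup>+z. ennreal (\<rho> z) * ennreal e \<partial>lborel)"
  proof (rule nn_integral_mono)
    fix z
    show "ennreal (\<rho> z) * (\<integral>\<^sup>+p. ennreal ((F p z)\<^sup>2) \<partial>lborel) \<le> ennreal (\<rho> z) * ennreal e"
      using bound[of z] by (cases "\<rho> z = 0") (auto intro!: mult_left_mono)
  qed
  also have "\<dots> = ennreal (\<integral>z. \<rho> z \<partial>lborel) * ennreal e"
    by (simp add: nn_integral_multc nn_integral_eq_integral[OF \<rho>(2)] \<rho>(1))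
  finally show ?thesis using \<rho>(3) by simp
qed


section \<open>Approximation by cutoff and mollification\<close>

definition cutoff :: "nat \<Rightarrow> 'a::euclidean_space \<Rightarrow> real" where
  "cutoff n x = max 0 (min 1 (2 - norm x / real (Suc n)))"

lemma cutoff_bounds: "0 \<le> cutoff n x" "cutoff n x \<le> 1"
  by (auto simp: cutoff_def)

lemma cutoff_support: "norm x \<ge> 2 * real (Suc n) \<Longrightarrow> cutoff n x = 0"
  by (simp add: cutoff_def field_simps)

lemma measurable_cutoff [measurable]: "cutoff n \<in> borel_measurable borel"
  unfolding cutoff_def[abs_def] by measurable

lemma cutoff_tendsto: "(\<lambda>n. cutoff n x) \<longlonglongrightarrow> 1"
proof (rule tendsto_eventually)
  show "\<forall>\<^sub>F n in sequentially. cutoff n x = 1"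
    using eventually_ge_at_top[of "nat \<lceil>norm x\<rceil>"]
  proof eventually_elim
    case (elim n)
    then have "norm x \<le> real (Suc n)" by linarith
    then have "norm x / real (Suc n) \<le> 1" by simp
    then show ?case by (simp add: cutoff_def)
  qed
qed

lemma cutoff_Lipschitz: "\<bar>cutoff n x - cutoff n y\<bar> \<le> norm (x - y) / real (Suc n)"
proof -
  have clamp: "\<bar>max 0 (min 1 (2 - a)) - max 0 (min 1 (2 - b))\<bar> \<le> \<bar>a - b\<bar>" for a b :: real
    by (auto simp: max_def min_def abs_if)
  have "\<bar>cutoff n x - cutoff n y\<bar> \<le> \<bar>norm x / real (Suc n) - norm y / real (Suc n)\<bar>"
    unfolding cutoff_def by (rule clamp)
  also have "\<dots> = \<bar>norm x - norm y\<bar> / real (Suc n)" by (simp add: diff_divide_distrib[symmetric])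
  also have "\<dots> \<le> norm (x - y) / real (Suc n)" by (intro divide_right_mono norm_triangle_ineq3) simp
  finally show ?thesis .
qed

text \<open>The error splits by a discrete product rule. One term carries the factor 1 - cutoff and
  is dominated by the energy density of \<open>f\<close>. The other carries the increment of the
  cutoff, whose slope is \<open>1 / (n + 1)\<close>; its total is the \<open>L^2\<close> mass of
  \<open>f\<close> times a kernel integral that tends to 0.\<close>

lemma cutoff_approximation:
  fixes f :: "'a::euclidean_space \<Rightarrow> real"
  assumes s: "0 < s" "s < 1" and f: "sq_integrable f" "finite_energy s f"
  shows "finite_energy s (\<lambda>x. cutoff n x * f x)"
    and "(\<lambda>n. energy s (\<lambda>x. cutoff n x * f x - f x) (\<lambda>x. cutoff n x * f x - f x)) \<longlonglongrightarrow> 0"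
    and "(\<lambda>n. \<integral>x. (cutoff n x * f x - f x)\<^sup>2 \<partial>lborel) \<longlonglongrightarrow> 0"
proof -
  have [measurable]: "f \<in> borel_measurable borel" using f(1) by (rule sq_integrable_measurable)
  let ?K = "\<lambda>n h::'a. min 1 ((1 / real (Suc n))\<^sup>2 * (norm h)\<^sup>2) * frac_kernel s h"
  let ?A = "\<lambda>n p. (1 - cutoff n (snd p))\<^sup>2 * (diff_quot s f p)\<^sup>2"
  let ?B = "\<lambda>n p. (f (fst p))\<^sup>2 * ?K n (fst p - snd p)"
  have K: "integrable lborel (?K n)" for n using s by (intro frac_kernel_levy_const) auto
  have B: "integrable lborel (?B n)" "(\<integral>p. ?B n p \<partial>lborel) = (\<integral>x. (f x)\<^sup>2 \<partial>lborel) * (\<integral>h. ?K n h \<partial>lborel)" for n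
    using integrable_lborel_fst_kernel[OF sq_integrable_square[OF f(1)] K[of n]] by auto
  have cm[measurable]: "(\<lambda>p::'a \<times> 'a. cutoff n (snd p)) \<in> borel_measurable borel" for n
    unfolding borel_prod[symmetric] by measurable
  have cle: "(1 - cutoff n x)\<^sup>2 \<le> 1" for n and x :: 'a
    using cutoff_bounds[of n x] by (simp add: power_le_one)
  have Dm[measurable]: "diff_quot s f \<in> borel_measurable borel" by measurable
  have A: "integrable lborel (?A n)" for n
  proof (rule Bochner_Integration.integrable_bound)
    show "integrable lborel (\<lambda>p. (diff_quot s f p)\<^sup>2)"
      using f(2) by (intro sq_integrable_square finite_energy_diff_quot)
    show "AE p in lborel. norm (?A n p) \<le> norm ((diff_quot s f p)\<^sup>2)"
      using cle by (auto intro!: mult_left_le_one_le)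
  qed measurable
  have pt: "(diff_quot s (\<lambda>x. cutoff n x * f x - f x) p)\<^sup>2 \<le> 2 * ?A n p + 2 * ?B n p" for n and p :: "'a \<times> 'a"
  proof -
    obtain x y where p: "p = (x, y)" by (cases p)
    let ?k = "frac_kernel s (x - y)"
    \<comment> \<open>The product rule for increments, arranged so that the increment of the cutoff
      multiplies \<open>f x\<close> and thus the second term factors over x and h = x - y.\<close>
    define a b where "a = (1 - cutoff n y) * (f x - f y)" and "b = f x * (cutoff n y - cutoff n x)"
    have "(cutoff n x * f x - f x) - (cutoff n y * f y - f y) = - (a + b)"
      by (simp add: a_def b_def algebra_simps)
    then have "((cutoff n x * f x - f x) - (cutoff n y * f y - f y))\<^sup>2 = (a + b)\<^sup>2"
      by (simp only: power2_minus)
    also have "\<dots> \<le> 2 * a\<^sup>2 + 2 * b\<^sup>2" using sum_squares_bound[of a b] by (simp add: power2_sum)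
    finally have le: "((cutoff n x * f x - f x) - (cutoff n y * f y - f y))\<^sup>2 \<le> 2 * a\<^sup>2 + 2 * b\<^sup>2" .
    have "\<bar>cutoff n y - cutoff n x\<bar> \<le> 1" using cutoff_bounds[of n x] cutoff_bounds[of n y] by linarith
    then have "(cutoff n y - cutoff n x)\<^sup>2 \<le> 1" by (simp add: abs_square_le_1)
    moreover have "(cutoff n y - cutoff n x)\<^sup>2 \<le> (norm (x - y) / real (Suc n))\<^sup>2"
      using cutoff_Lipschitz[of n y x] by (intro iffD1[OF abs_le_square_iff]) (simp add: norm_minus_commute)
    ultimately have "(cutoff n y - cutoff n x)\<^sup>2 \<le> min 1 ((1 / real (Suc n))\<^sup>2 * (norm (x - y))\<^sup>2)"
      by (simp add: power_divide)
    then have "b\<^sup>2 * ?k \<le> (f x)\<^sup>2 * (min 1 ((1 / real (Suc n))\<^sup>2 * (norm (x - y))\<^sup>2) * ?k)"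
      unfolding b_def power_mult_distrib mult.assoc by (intro mult_left_mono mult_right_mono) auto
    then have "b\<^sup>2 * ?k \<le> ?B n p" by (simp add: p)
    moreover have "a\<^sup>2 * ?k = ?A n p"
      by (simp add: a_def p diff_quot_def power_mult_distrib)
    moreover have "((cutoff n x * f x - f x) - (cutoff n y * f y - f y))\<^sup>2 * ?k \<le> 2 * (a\<^sup>2 * ?k) + 2 * (b\<^sup>2 * ?k)"
      using mult_right_mono[OF le, of ?k] by (simp add: distrib_right mult.assoc)
    moreover have "(diff_quot s (\<lambda>x. cutoff n x * f x - f x) p)\<^sup>2 =
        ((cutoff n x * f x - f x) - (cutoff n y * f y - f y))\<^sup>2 * ?k"
      by (simp add: p diff_quot_def power_mult_distrib)
    ultimately show ?thesis by linarith
  qed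
  have gm[measurable]: "(\<lambda>x. cutoff n x * f x - f x) \<in> borel_measurable borel" for n by measurable
  have sqg: "sq_integrable (diff_quot s (\<lambda>x. cutoff n x * f x - f x))" for n
    unfolding sq_integrable_def
  proof
    show "integrable lborel (\<lambda>p. (diff_quot s (\<lambda>x. cutoff n x * f x - f x) p)\<^sup>2)"
    proof (rule Bochner_Integration.integrable_bound)
      show "integrable lborel (\<lambda>p. 2 * ?A n p + 2 * ?B n p)"
        by (intro Bochner_Integration.integrable_add integrable_mult_right A B)
      show "AE p in lborel. norm ((diff_quot s (\<lambda>x. cutoff n x * f x - f x) p)\<^sup>2) \<le> norm (2 * ?A n p + 2 * ?B n p)"
        using pt by (intro AE_I2) (auto intro: order_trans[OF pt abs_ge_self])
    qed measurable
  qed measurable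
  then have fg: "finite_energy s (\<lambda>x. cutoff n x * f x - f x)" for n by (simp add: finite_energy_def)
  show "finite_energy s (\<lambda>x. cutoff n x * f x)"
    using finite_energy_add[OF fg f(2)] by simp
  have "(\<lambda>n. \<integral>p. ?A n p \<partial>lborel) \<longlonglongrightarrow> (\<integral>p. 0 \<partial>(lborel :: ('a \<times> 'a) measure))"
  proof (rule integral_dominated_convergence)
    show "integrable lborel (\<lambda>p. (diff_quot s f p)\<^sup>2)"
      using f(2) by (intro sq_integrable_square finite_energy_diff_quot)
    show "AE p in lborel. norm (?A n p) \<le> (diff_quot s f p)\<^sup>2" for n
      using cle by (auto intro!: mult_left_le_one_le)
    show "AE p in lborel. (\<lambda>n. ?A n p) \<longlonglongrightarrow> 0"
    proof (rule AE_I2)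
      fix p :: "'a \<times> 'a"
      have "(\<lambda>n. ?A n p) \<longlonglongrightarrow> (1 - 1)\<^sup>2 * (diff_quot s f p)\<^sup>2"
        by (intro tendsto_intros cutoff_tendsto)
      then show "(\<lambda>n. ?A n p) \<longlonglongrightarrow> 0" by simp
    qed
  qed measurable
  moreover have "(\<lambda>n. \<integral>h. ?K n h \<partial>lborel) \<longlonglongrightarrow> (\<integral>h. 0 \<partial>(lborel :: 'a measure))"
  proof (rule integral_dominated_convergence)
    show "integrable lborel (\<lambda>h::'a. min 1 ((norm h)\<^sup>2) * frac_kernel s h)" by (rule frac_kernel_levy[OF s])
    show "AE h in lborel. norm (?K n h) \<le> min 1 ((norm h)\<^sup>2) * frac_kernel s h" for n
    proof (rule AE_I2)
      fix h :: 'a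
      have "(1 / real (Suc n))\<^sup>2 * (norm h)\<^sup>2 \<le> (norm h)\<^sup>2" by (intro mult_left_le_one_le power_le_one) auto
      then have "min 1 ((1 / real (Suc n))\<^sup>2 * (norm h)\<^sup>2) * frac_kernel s h \<le> min 1 ((norm h)\<^sup>2) * frac_kernel s h"
        by (intro mult_right_mono min.mono) auto
      then show "norm (?K n h) \<le> min 1 ((norm h)\<^sup>2) * frac_kernel s h" by simp
    qed
    show "AE h in lborel. (\<lambda>n. ?K n h) \<longlonglongrightarrow> 0"
    proof (rule AE_I2)
      fix h :: 'a
      have "(\<lambda>n. 1 / real (Suc n)) \<longlonglongrightarrow> 0" using LIMSEQ_inverse_real_of_nat by (simp add: inverse_eq_divide)
      then have "(\<lambda>n. ?K n h) \<longlonglongrightarrow> min 1 (0\<^sup>2 * (norm h)\<^sup>2) * frac_kernel s h"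
        by (intro tendsto_intros)
      then show "(\<lambda>n. ?K n h) \<longlonglongrightarrow> 0" by simp
    qed
  qed measurable
  ultimately have lim: "(\<lambda>n. 2 * (\<integral>p. ?A n p \<partial>lborel) + 2 * ((\<integral>x. (f x)\<^sup>2 \<partial>lborel) * (\<integral>h. ?K n h \<partial>lborel))) \<longlonglongrightarrow> 0"
    by (auto intro!: tendsto_eq_intros)
  have le: "energy s (\<lambda>x. cutoff n x * f x - f x) (\<lambda>x. cutoff n x * f x - f x) \<le>
      2 * (\<integral>p. ?A n p \<partial>lborel) + 2 * ((\<integral>x. (f x)\<^sup>2 \<partial>lborel) * (\<integral>h. ?K n h \<partial>lborel))" for n
  proof -
    have "energy s (\<lambda>x. cutoff n x * f x - f x) (\<lambda>x. cutoff n x * f x - f x) \<le> (\<integral>p. 2 * ?A n p + 2 * ?B n p \<partial>lborel)"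
      unfolding energy_self
      by (intro integral_mono sq_integrable_square sqg Bochner_Integration.integrable_add integrable_mult_right A B pt)
    also have "\<dots> = 2 * (\<integral>p. ?A n p \<partial>lborel) + 2 * (\<integral>p. ?B n p \<partial>lborel)"
      by (subst Bochner_Integration.integral_add) (simp_all only: integrable_mult_right A B integral_mult_right_zero)
    finally show ?thesis unfolding B(2) .
  qed
  show "(\<lambda>n. energy s (\<lambda>x. cutoff n x * f x - f x) (\<lambda>x. cutoff n x * f x - f x)) \<longlonglongrightarrow> 0"
    by (rule Lim_null_comparison[OF _ lim]) (simp only: real_norm_def abs_of_nonneg[OF energy_nonneg] le eventually_True)
  have "(\<lambda>n. \<integral>x. (cutoff n x * f x - f x)\<^sup>2 \<partial>lborel) \<longlonglongrightarrow> (\<integral>x. 0 \<partial>(lborel :: 'a measure))"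
  proof (rule integral_dominated_convergence)
    show "integrable lborel (\<lambda>x. (f x)\<^sup>2)" using f(1) by (rule sq_integrable_square)
    have eq: "(cutoff n x * f x - f x)\<^sup>2 = (1 - cutoff n x)\<^sup>2 * (f x)\<^sup>2" for n x
      by (simp add: power2_eq_square algebra_simps)
    show "AE x in lborel. norm ((cutoff n x * f x - f x)\<^sup>2) \<le> (f x)\<^sup>2" for n
      unfolding eq using cle by (auto intro!: mult_left_le_one_le)
    show "AE x in lborel. (\<lambda>n. (cutoff n x * f x - f x)\<^sup>2) \<longlonglongrightarrow> 0"
    proof (rule AE_I2)
      fix x
      have "(\<lambda>n. (cutoff n x * f x - f x)\<^sup>2) \<longlonglongrightarrow> (1 * f x - f x)\<^sup>2"
        by (intro tendsto_intros cutoff_tendsto)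
      then show "(\<lambda>n. (cutoff n x * f x - f x)\<^sup>2) \<longlonglongrightarrow> 0" by simp
    qed
  qed measurable
  then show "(\<lambda>n. \<integral>x. (cutoff n x * f x - f x)\<^sup>2 \<partial>lborel) \<longlonglongrightarrow> 0" by simp
qed

text \<open>The error is the \<open>\<rho>\<close>-average of the increments
  \<open>g (x - t z) - g x\<close>, and its difference quotient is the same average of theirs. Both
  are small by continuity of translations, once \<open>t\<close> times the radius of the support of
  \<open>\<rho>\<close> is below both moduli \<open>d1\<close> and \<open>d2\<close>.\<close>

lemma mollify_approximation:
  fixes \<rho> g :: "real ^ 'n \<Rightarrow> real"
  assumes s: "0 < s" "s < 1"
    and \<rho>: "test_function \<rho>" "\<And>z. \<rho> z \<ge> 0" "(\<integral>z. \<rho> z \<partial>lborel) = 1"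
    and g: "finite_energy s g" "\<And>x. \<bar>g x\<bar> \<le> M" "\<And>x. norm x \<ge> S \<Longrightarrow> g x = 0" and e: "e > 0"
  shows "\<exists>\<phi>. test_function \<phi> \<and> (\<forall>x. \<bar>\<phi> x\<bar> \<le> M) \<and> (\<integral>x. (\<phi> x - g x)\<^sup>2 \<partial>lborel) \<le> e \<and>
    energy s (\<lambda>x. \<phi> x - g x) (\<lambda>x. \<phi> x - g x) \<le> e"
proof -
  have gm[measurable]: "g \<in> borel_measurable borel" using g(1) by (rule finite_energy_measurable)
  have gs: "sq_integrable g" "integrable lborel g"
    using sq_integrable_bounded_support[OF gm g(2,3)] by auto
  have rm[measurable]: "\<rho> \<in> borel_measurable borel" using \<rho>(1) by (rule test_function_measurable)
  have ri: "integrable lborel \<rho>" using \<rho>(1) by (rule test_function_integrable)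
  obtain R where R: "\<And>x. norm x \<ge> R \<Longrightarrow> \<rho> x = 0" using test_function_support[OF \<rho>(1)] by metis
  obtain d1 where d1: "d1 > 0" "\<And>z. norm z < d1 \<Longrightarrow> (\<integral>x. (g (x + z) - g x)\<^sup>2 \<partial>lborel) < e"
    using L2_translation[OF gs(1) e] by metis
  obtain d2 where d2: "d2 > 0" "\<And>z. norm z < d2 \<Longrightarrow> energy s (\<lambda>x. g (x + z) - g x) (\<lambda>x. g (x + z) - g x) < e"
    using energy_translation_continuous[OF g(1) e] by metis
  define t where "t = min d1 d2 / (\<bar>R\<bar> + 1)"
  have t: "t > 0" using d1(1) d2(1) by (simp add: t_def)
  have small: "norm (- (t *\<^sub>R z)) < d1" "norm (- (t *\<^sub>R z)) < d2" if "\<rho> z \<noteq> 0" for z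
  proof -
    have "norm z < \<bar>R\<bar> + 1" using that R[of z] by force
    then have "t * norm z < t * (\<bar>R\<bar> + 1)" using t by simp
    moreover have "t * (\<bar>R\<bar> + 1) = min d1 d2" by (simp add: t_def)
    moreover have "norm (- (t *\<^sub>R z)) = t * norm z" using t by simp
    ultimately show "norm (- (t *\<^sub>R z)) < d1" "norm (- (t *\<^sub>R z)) < d2" by auto
  qed
  define \<phi> where "\<phi> x = (\<integral>z. \<rho> z * g (x - t *\<^sub>R z) \<partial>lborel)" for x
  have tf: "test_function \<phi>" unfolding \<phi>_def[abs_def] by (rule test_function_mollify[OF \<rho>(1) t gs(2) g(3)])
  have [measurable]: "\<phi> \<in> borel_measurable borel" using tf by (rule test_function_measurable)
  have int: "integrable lborel (\<lambda>z. \<rho> z * g (x - t *\<^sub>R z))" for x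
  proof (rule Bochner_Integration.integrable_bound)
    show "integrable lborel (\<lambda>z. M * \<rho> z)" using ri by (intro integrable_mult_right)
    show "AE z in lborel. norm (\<rho> z * g (x - t *\<^sub>R z)) \<le> norm (M * \<rho> z)"
      using g(2) \<rho>(2) by (auto simp: abs_mult mult.commute[of "\<rho> _"] intro!: mult_right_mono order_trans[OF g(2) abs_ge_self])
  qed measurable
  have bd: "\<bar>\<phi> x\<bar> \<le> M" for x
  proof -
    have "norm (\<phi> x) \<le> (\<integral>z. M * \<rho> z \<partial>lborel)"
      unfolding \<phi>_def using g(2) \<rho>(2)
      by (intro Bochner_Integration.integral_norm_bound_integral int integrable_mult_right ri)
        (auto simp: abs_mult mult.commute[of "\<rho> _"] intro!: mult_right_mono)
    then show ?thesis using \<rho>(3) by simp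
  qed
  have diff: "\<phi> x - g x = (\<integral>z. \<rho> z * (g (x - t *\<^sub>R z) - g x) \<partial>lborel)" for x
    using int[of x] ri \<rho>(3) by (simp add: right_diff_distrib \<phi>_def)
  have sqd: "sq_integrable (\<lambda>x. \<phi> x - g x)"
    by (intro sq_integrable_diff test_function_sq_integrable tf gs)
  have fed: "finite_energy s (\<lambda>x. \<phi> x - g x)"
    by (intro finite_energy_diff test_function_finite_energy[OF s] tf g)
  have L2: "(\<integral>x. (\<phi> x - g x)\<^sup>2 \<partial>lborel) \<le> e"
  proof -
    have "(\<integral>\<^sup>+x. ennreal ((\<integral>z. \<rho> z * (g (x - t *\<^sub>R z) - g x) \<partial>lborel)\<^sup>2) \<partial>lborel) \<le> ennreal e"
    proof (rule mollify_L2_bound[OF _ \<rho>(2) ri \<rho>(3)])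
      fix z assume "\<rho> z \<noteq> 0"
      from d1(2)[OF small(1)[OF this]] have le: "(\<integral>x. (g (x - t *\<^sub>R z) - g x)\<^sup>2 \<partial>lborel) \<le> e" by simp
      have "sq_integrable (\<lambda>x. g (x + - (t *\<^sub>R z)) - g x)"
        by (intro sq_integrable_diff gs sq_integrable_comp[OF lborel_distr_add]) measurable
      then have "integrable lborel (\<lambda>x. (g (x - t *\<^sub>R z) - g x)\<^sup>2)"
        using sq_integrable_square by fastforce
      from nn_integral_eq_integral[OF this] le
      show "(\<integral>\<^sup>+x. ennreal ((g (x - t *\<^sub>R z) - g x)\<^sup>2) \<partial>lborel) \<le> ennreal e"
        by (simp add: ennreal_leI)
    qed measurable
    then have "(\<integral>\<^sup>+x. ennreal ((\<phi> x - g x)\<^sup>2) \<partial>lborel) \<le> ennreal e" unfolding diff .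
    then show ?thesis
      using nn_integral_eq_integral[OF sq_integrable_square[OF sqd]] e by (simp add: ennreal_le_iff)
  qed
  have en: "energy s (\<lambda>x. \<phi> x - g x) (\<lambda>x. \<phi> x - g x) \<le> e"
  proof -
    let ?F = "\<lambda>p z. diff_quot s (\<lambda>x. g (x - t *\<^sub>R z) - g x) p"
    have Fint: "(\<integral>z. \<rho> z * ?F p z \<partial>lborel) = diff_quot s (\<lambda>x. \<phi> x - g x) p" for p
    proof -
      have i: "integrable lborel (\<lambda>z. \<rho> z * (g (x - t *\<^sub>R z) - g x))" for x
        using int[of x] ri by (simp add: right_diff_distrib)
      have "(\<integral>z. \<rho> z * ?F p z \<partial>lborel) = (\<integral>z. (\<rho> z * (g (fst p - t *\<^sub>R z) - g (fst p)) -
          \<rho> z * (g (snd p - t *\<^sub>R z) - g (snd p))) * sqrt (frac_kernel s (fst p - snd p)) \<partial>lborel)"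
        by (simp add: diff_quot_def algebra_simps)
      also have "\<dots> = diff_quot s (\<lambda>x. \<phi> x - g x) p"
        using i by (simp add: diff_quot_def diff)
      finally show ?thesis .
    qed
    have "(\<integral>\<^sup>+p. ennreal ((\<integral>z. \<rho> z * ?F p z \<partial>lborel)\<^sup>2) \<partial>lborel) \<le> ennreal e"
    proof (rule mollify_L2_bound[OF _ \<rho>(2) ri \<rho>(3)])
      have "(\<lambda>(p, z). ?F p z) \<in> borel_measurable ((borel \<Otimes>\<^sub>M borel) \<Otimes>\<^sub>M borel)"
        unfolding diff_quot_def by measurable
      then show "(\<lambda>(p, z). ?F p z) \<in> borel_measurable (borel \<Otimes>\<^sub>M borel)" by (simp add: borel_prod)
      fix z assume "\<rho> z \<noteq> 0"
      from d2(2)[OF small(2)[OF this]]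
      have le: "energy s (\<lambda>x. g (x - t *\<^sub>R z) - g x) (\<lambda>x. g (x - t *\<^sub>R z) - g x) \<le> e" by simp
      have "finite_energy s (\<lambda>x. g (x + - (t *\<^sub>R z)) - g x)"
        by (intro finite_energy_diff g finite_energy_translate)
      then have "integrable lborel (\<lambda>p. (?F p z)\<^sup>2)"
        using sq_integrable_square[OF finite_energy_diff_quot] by fastforce
      from nn_integral_eq_integral[OF this] le
      show "(\<integral>\<^sup>+p. ennreal ((?F p z)\<^sup>2) \<partial>lborel) \<le> ennreal e"
        by (simp add: ennreal_leI energy_self)
    qed
    then have "(\<integral>\<^sup>+p. ennreal ((diff_quot s (\<lambda>x. \<phi> x - g x) p)\<^sup>2) \<partial>lborel) \<le> ennreal e" unfolding Fint .
    then show ?thesis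
      using nn_integral_eq_integral[OF sq_integrable_square[OF finite_energy_diff_quot[OF fed]]] e
      by (simp add: ennreal_le_iff energy_self)
  qed
  show ?thesis using tf bd L2 en by blast
qed


text \<open>Any nonzero test function \<open>\<eta>\<close> serves as a seed: its normalized square
  is a mollifier, so no explicit smooth bump has to be built. Preserving the bound \<open>M\<close>
  matters, since it later upgrades \<open>L^2\<close> convergence to \<open>L^r\<close>
  convergence.\<close>

lemma test_function_dense:
  fixes f \<eta> :: "real ^ 'n \<Rightarrow> real"
  assumes s: "0 < s" "s < 1"
    and \<eta>: "test_function \<eta>" "\<eta> x0 \<noteq> 0"
    and f: "sq_integrable f" "finite_energy s f" "\<And>x. \<bar>f x\<bar> \<le> M" and e: "e > 0"
  shows "\<exists>\<phi>. test_function \<phi> \<and> (\<forall>x. \<bar>\<phi> x\<bar> \<le> M) \<and> (\<integral>x. (\<phi> x - f x)\<^sup>2 \<partial>lborel) < e \<and>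
    energy s (\<lambda>x. \<phi> x - f x) (\<lambda>x. \<phi> x - f x) < e"
proof -
  define I where "I = (\<integral>x. (\<eta> x)\<^sup>2 \<partial>lborel)"
  have \<eta>c: "continuous_on UNIV \<eta>" using \<eta>(1) by (rule test_function_continuous)
  have [measurable]: "\<eta> \<in> borel_measurable borel" using \<eta>(1) by (rule test_function_measurable)
  have "I \<noteq> 0"
  proof
    assume "I = 0"
    then have "AE x in lborel. (\<eta> x)\<^sup>2 = 0"
      unfolding I_def
      by (subst (asm) integral_nonneg_eq_0_iff_AE[OF sq_integrable_square[OF test_function_sq_integrable[OF \<eta>(1)]]]) auto
    then have "AE x in lborel. x \<notin> {x. \<eta> x \<noteq> 0}" by eventually_elim simp
    moreover have op: "open {x. \<eta> x \<noteq> 0}" using \<eta>c by (intro open_Collect_neq continuous_intros)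
    ultimately have "{x. \<eta> x \<noteq> 0} \<in> null_sets lborel" using AE_iff_null_sets[of "{x. \<eta> x \<noteq> 0}" lborel] by auto
    moreover obtain d where "d > 0" "ball x0 d \<subseteq> {x. \<eta> x \<noteq> 0}" using op \<eta>(2) by (force simp: open_contains_ball)
    ultimately have "ball x0 d \<in> null_sets lborel" by (auto intro: null_sets_subset)
    then show False using \<open>d > 0\<close> unit_ball_vol_pos[of "real DIM(real ^ 'n)"]
      by (auto simp: null_sets_def emeasure_ball simp del: unit_ball_vol_pos)
  qed
  then have I: "I > 0" by (simp add: I_def less_le)
  let ?\<rho> = "\<lambda>x. 1 / I * (\<eta> x * \<eta> x)"
  have \<rho>: "test_function ?\<rho>" "\<And>z. ?\<rho> z \<ge> 0" "(\<integral>z. ?\<rho> z \<partial>lborel) = 1"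
  proof -
    obtain R where R: "\<And>x. norm x \<ge> R \<Longrightarrow> \<eta> x = 0" using test_function_support[OF \<eta>(1)] by metis
    show "test_function ?\<rho>"
    proof (rule test_functionI[of _ R])
      show "Ck k ?\<rho>" for k using \<eta>(1) by (intro Ck_mult Ck_const) (auto simp: test_function_def)
    qed (simp add: R)
    show "?\<rho> z \<ge> 0" for z using I by simp
    show "(\<integral>z. ?\<rho> z \<partial>lborel) = 1" using I by (simp add: I_def power2_eq_square)
  qed
  have e4: "e / 4 > 0" using e by simp
  have ev1: "\<forall>\<^sub>F n in sequentially. energy s (\<lambda>x. cutoff n x * f x - f x) (\<lambda>x. cutoff n x * f x - f x) < e / 4"
    using cutoff_approximation(2)[OF s f(1,2)] e4 by (rule order_tendstoD(2))
  have ev2: "\<forall>\<^sub>F n in sequentially. (\<integral>x. (cutoff n x * f x - f x)\<^sup>2 \<partial>lborel) < e / 4"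
    using cutoff_approximation(3)[OF s f(1,2)] e4 by (rule order_tendstoD(2))
  obtain n where n: "energy s (\<lambda>x. cutoff n x * f x - f x) (\<lambda>x. cutoff n x * f x - f x) < e / 4"
    "(\<integral>x. (cutoff n x * f x - f x)\<^sup>2 \<partial>lborel) < e / 4"
    using eventually_happens[OF eventually_conj[OF ev1 ev2]] by auto
  let ?g = "\<lambda>x. cutoff n x * f x"
  have fm[measurable]: "f \<in> borel_measurable borel" using f(1) by (rule sq_integrable_measurable)
  have gb: "\<bar>?g x\<bar> \<le> M" for x
  proof -
    have "\<bar>?g x\<bar> \<le> \<bar>f x\<bar>" using cutoff_bounds[of n x] by (simp add: abs_mult mult_left_le_one_le)
    then show ?thesis using f(3)[of x] by linarith
  qed
  have gsupp: "?g x = 0" if "norm x \<ge> 2 * real (Suc n)" for x using cutoff_support[OF that] by simp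
  have gfe: "finite_energy s ?g" by (rule cutoff_approximation(1)[OF s f(1,2)])
  have gsq: "sq_integrable ?g" by (rule sq_integrable_bounded_support(1)[OF _ gb gsupp]) measurable
  have "e / 8 > 0" using e by simp
  from mollify_approximation[OF s \<rho> gfe gb gsupp this]
  obtain \<phi> where \<phi>: "test_function \<phi>" "\<And>x. \<bar>\<phi> x\<bar> \<le> M" "(\<integral>x. (\<phi> x - ?g x)\<^sup>2 \<partial>lborel) \<le> e / 8"
    "energy s (\<lambda>x. \<phi> x - ?g x) (\<lambda>x. \<phi> x - ?g x) \<le> e / 8" by blast
  have split: "(\<lambda>x. \<phi> x - f x) = (\<lambda>x. (\<phi> x - ?g x) + (?g x - f x))" by auto
  have "(\<integral>x. (\<phi> x - f x)\<^sup>2 \<partial>lborel) \<le> 2 * (\<integral>x. (\<phi> x - ?g x)\<^sup>2 \<partial>lborel) + 2 * (\<integral>x. (?g x - f x)\<^sup>2 \<partial>lborel)"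
    using L2_triangle[OF sq_integrable_diff[OF test_function_sq_integrable[OF \<phi>(1)] gsq] sq_integrable_diff[OF gsq f(1)]] by simp
  moreover have "energy s (\<lambda>x. \<phi> x - f x) (\<lambda>x. \<phi> x - f x) \<le>
      2 * energy s (\<lambda>x. \<phi> x - ?g x) (\<lambda>x. \<phi> x - ?g x) + 2 * energy s (\<lambda>x. ?g x - f x) (\<lambda>x. ?g x - f x)"
    unfolding split
    by (rule energy_triangle[OF finite_energy_diff[OF test_function_finite_energy[OF s \<phi>(1)] gfe] finite_energy_diff[OF gfe f(2)]])
  ultimately show ?thesis using \<phi> n e by (intro exI[of _ \<phi>]) auto
qed

lemma in_Lp_of_bounded:
  fixes f :: "real ^ 'n \<Rightarrow> real"
  assumes f: "sq_integrable f" "\<And>x. \<bar>f x\<bar> \<le> M" and r: "r \<ge> 2"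
  shows "in_Lp r f"
proof -
  have [measurable]: "f \<in> borel_measurable borel" using f(1) by (rule sq_integrable_measurable)
  have "integrable lebesgue (\<lambda>x. \<bar>f x\<bar> powr r)"
    by (subst integrable_completion) (use integrable_powr_of_sq_integrable(1)[OF f r] in auto)
  then show ?thesis by (auto simp: in_Lp_def intro: measurable_completion)
qed

lemma energy_cmult_self: "energy s (\<lambda>x. c * f x) (\<lambda>x. c * f x) = c\<^sup>2 * energy s f f"
  by (simp add: energy_self diff_quot_cmult power_mult_distrib)

text \<open>Convergence in the critical Lebesgue space follows without the Sobolev inequality: the
  differences are bounded by \<open>2 * M\<close> and tend to 0 in \<open>L^2\<close>, and the
  critical exponent is at least 2.\<close>

lemma bounded_finite_energy_in_Hs:
  fixes f \<eta> :: "real ^ 'n \<Rightarrow> real"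
  assumes s: "0 < s" "s < 1" and r: "critical_exponent TYPE('n) s \<ge> 2"
    and \<kappa>: "\<kappa> > 0" "\<And>\<phi> :: real ^ 'n \<Rightarrow> real. test_function \<phi> \<Longrightarrow> test_norm s \<phi> = sqrt (\<kappa> * energy s \<phi> \<phi>)"
    and \<eta>: "test_function \<eta>" "\<eta> x0 \<noteq> 0"
    and f: "sq_integrable f" "finite_energy s f" "\<And>x. \<bar>f x\<bar> \<le> M"
  shows "in_Hs s f"
proof -
  let ?r = "critical_exponent TYPE('n) s"
  have "\<forall>k. \<exists>\<phi>. test_function \<phi> \<and> (\<forall>x. \<bar>\<phi> x\<bar> \<le> M) \<and> (\<integral>x. (\<phi> x - f x)\<^sup>2 \<partial>lborel) < 1 / real (Suc k) \<and>
    energy s (\<lambda>x. \<phi> x - f x) (\<lambda>x. \<phi> x - f x) < 1 / real (Suc k)"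
    using test_function_dense[OF s \<eta> f] by simp
  then obtain \<phi> where "\<forall>k. test_function (\<phi> k) \<and> (\<forall>x. \<bar>\<phi> k x\<bar> \<le> M) \<and> (\<integral>x. (\<phi> k x - f x)\<^sup>2 \<partial>lborel) < 1 / real (Suc k) \<and>
    energy s (\<lambda>x. \<phi> k x - f x) (\<lambda>x. \<phi> k x - f x) < 1 / real (Suc k)"
    by (rule choice[THEN exE])
  then have \<phi>: "\<And>k. test_function (\<phi> k)" "\<And>k x. \<bar>\<phi> k x\<bar> \<le> M"
    "\<And>k. (\<integral>x. (\<phi> k x - f x)\<^sup>2 \<partial>lborel) < 1 / real (Suc k)"
    "\<And>k. energy s (\<lambda>x. \<phi> k x - f x) (\<lambda>x. \<phi> k x - f x) < 1 / real (Suc k)" by blast+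
  have [measurable]: "f \<in> borel_measurable borel" using f(1) by (rule sq_integrable_measurable)
  have [measurable]: "\<phi> k \<in> borel_measurable borel" for k using \<phi>(1) by (rule test_function_measurable)
  note fe = test_function_finite_energy[OF s \<phi>(1)]
  have inv0: "(\<lambda>k. 1 / real (Suc k)) \<longlonglongrightarrow> 0" using LIMSEQ_inverse_real_of_nat by (simp add: inverse_eq_divide)
  have cauchy: "\<exists>K. \<forall>k\<ge>K. \<forall>l\<ge>K. test_norm s (\<lambda>x. \<phi> k x - \<phi> l x) < e" if e: "e > 0" for e
  proof -
    have "e\<^sup>2 / (4 * \<kappa>) > 0" using e \<kappa> by simp
    then have "\<forall>\<^sub>F k in sequentially. 1 / real (Suc k) < e\<^sup>2 / (4 * \<kappa>)" using inv0 by (intro order_tendstoD(2))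
    then obtain K where K: "\<And>k. k \<ge> K \<Longrightarrow> 1 / real (Suc k) < e\<^sup>2 / (4 * \<kappa>)" by (auto simp: eventually_sequentially)
    have "test_norm s (\<lambda>x. \<phi> k x - \<phi> l x) < e" if "k \<ge> K" "l \<ge> K" for k l
    proof -
      have "energy s (\<lambda>x. (\<phi> k x - f x) + -1 * (\<phi> l x - f x)) (\<lambda>x. (\<phi> k x - f x) + -1 * (\<phi> l x - f x)) \<le>
          2 * energy s (\<lambda>x. \<phi> k x - f x) (\<lambda>x. \<phi> k x - f x) +
          2 * energy s (\<lambda>x. -1 * (\<phi> l x - f x)) (\<lambda>x. -1 * (\<phi> l x - f x))"
        by (intro energy_triangle finite_energy_cmult finite_energy_diff fe f)
      also have "energy s (\<lambda>x. -1 * (\<phi> l x - f x)) (\<lambda>x. -1 * (\<phi> l x - f x)) = energy s (\<lambda>x. \<phi> l x - f x) (\<lambda>x. \<phi> l x - f x)"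
        by (simp only: energy_cmult_self) simp
      finally have "energy s (\<lambda>x. \<phi> k x - \<phi> l x) (\<lambda>x. \<phi> k x - \<phi> l x) < e\<^sup>2 / \<kappa>"
        using \<phi>(4)[of k] \<phi>(4)[of l] K[OF that(1)] K[OF that(2)] by simp
      then have "\<kappa> * energy s (\<lambda>x. \<phi> k x - \<phi> l x) (\<lambda>x. \<phi> k x - \<phi> l x) < e\<^sup>2"
        using \<kappa>(1) by (simp add: field_simps)
      then have "sqrt (\<kappa> * energy s (\<lambda>x. \<phi> k x - \<phi> l x) (\<lambda>x. \<phi> k x - \<phi> l x)) < e"
        using e real_sqrt_less_mono by fastforce
      then show ?thesis by (simp only: \<kappa>(2)[OF test_function_diff[OF \<phi>(1) \<phi>(1)]])
    qed
    then show ?thesis by blast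
  qed
  have "(\<lambda>k. LINT x|lebesgue. \<bar>\<phi> k x - f x\<bar> powr ?r) \<longlonglongrightarrow> 0"
  proof (rule Lim_null_comparison)
    show "(\<lambda>k. (2 * M) powr (?r - 2) * (1 / real (Suc k))) \<longlonglongrightarrow> 0"
      using tendsto_mult_left[OF inv0, of "(2 * M) powr (?r - 2)"] by simp
    show "\<forall>\<^sub>F k in sequentially. norm (LINT x|lebesgue. \<bar>\<phi> k x - f x\<bar> powr ?r) \<le> (2 * M) powr (?r - 2) * (1 / real (Suc k))"
    proof (intro always_eventually allI)
      fix k
      have bd: "\<bar>\<phi> k x - f x\<bar> \<le> 2 * M" for x using \<phi>(2)[of k x] f(3)[of x] by linarith
      have sq: "sq_integrable (\<lambda>x. \<phi> k x - f x)" by (intro sq_integrable_diff test_function_sq_integrable \<phi> f)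
      have "(LINT x|lebesgue. \<bar>\<phi> k x - f x\<bar> powr ?r) = (LINT x|lborel. \<bar>\<phi> k x - f x\<bar> powr ?r)"
        by (rule integral_completion) measurable
      also have "\<dots> \<le> (2 * M) powr (?r - 2) * (\<integral>x. (\<phi> k x - f x)\<^sup>2 \<partial>lborel)"
        by (rule integrable_powr_of_sq_integrable(2)[OF sq bd r])
      also have "\<dots> \<le> (2 * M) powr (?r - 2) * (1 / real (Suc k))"
        using \<phi>(3)[of k] by (intro mult_left_mono) auto
      finally show "norm (LINT x|lebesgue. \<bar>\<phi> k x - f x\<bar> powr ?r) \<le> (2 * M) powr (?r - 2) * (1 / real (Suc k))"
        by simp
    qed
  qed
  then have "dotH_approx s \<phi> f"
    unfolding dotH_approx_def using \<phi>(1) cauchy in_Lp_of_bounded[OF f(1,3) r] by blast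
  then show ?thesis
    using in_Lp_of_bounded[OF f(1,3), of 2] by (auto simp: in_Hs_def in_dotH_def)
qed

text \<open>Bounded functions of finite energy in \<open>L^2\<close> are admissible in the weak
  formulation whatever \<open>q \<ge> 2\<close> is, and the truncations used later are all of this
  kind.\<close>

lemma weak_solution_energy_form:
  fixes u :: "real ^ 'n \<Rightarrow> real"
  assumes s: "0 < s" "s < 1" "real CARD('n) > 2 * s" and q: "q \<ge> 2"
    and u: "weak_solution s p q \<epsilon> u"
  shows "\<exists>\<kappa> v. \<kappa> > 0 \<and> sq_integrable v \<and> finite_energy s v \<and> integrable lborel (\<lambda>x. \<bar>v x\<bar> powr q) \<and>
    (AE x in lebesgue. u x = v x) \<and> (AE x in lborel. v x \<ge> 0) \<and> \<not> (AE x in lborel. v x = 0) \<and>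
    (\<forall>\<phi> M. sq_integrable \<phi> \<longrightarrow> finite_energy s \<phi> \<longrightarrow> (\<forall>x. \<bar>\<phi> x\<bar> \<le> M) \<longrightarrow>
      \<kappa> * energy s v \<phi> + \<epsilon> * (\<integral>x. v x * \<phi> x \<partial>lborel) =
      (\<integral>x. v x powr (p - 1) * \<phi> x \<partial>lborel) - (\<integral>x. v x powr (q - 1) * \<phi> x \<partial>lborel))"
proof -
  have r: "critical_exponent TYPE('n) s \<ge> 2" using s by (intro critical_exponent_ge_2) auto
  obtain \<kappa> where k0: "\<kappa> > 0" and k1: "\<forall>\<phi> :: real ^ 'n \<Rightarrow> real. test_function \<phi> \<longrightarrow> test_norm s \<phi> = sqrt (\<kappa> * energy s \<phi> \<phi>) \<and>
    (\<forall>\<psi>. test_function \<psi> \<longrightarrow> test_inner s \<phi> \<psi> = \<kappa> * energy s \<phi> \<psi>)"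
    using test_form_eq_energy[OF s(1,2), where 'n = 'n] by blast
  have \<kappa>: "\<kappa> > 0" "\<And>\<phi> :: real ^ 'n \<Rightarrow> real. test_function \<phi> \<Longrightarrow> test_norm s \<phi> = sqrt (\<kappa> * energy s \<phi> \<phi>)"
    "\<And>\<phi> \<psi> :: real ^ 'n \<Rightarrow> real. test_function \<phi> \<Longrightarrow> test_function \<psi> \<Longrightarrow> test_inner s \<phi> \<psi> = \<kappa> * energy s \<phi> \<psi>"
    using k0 k1 by auto
  have uH: "in_dotH s u" "in_Lp 2 u" "in_Lp q u" and unn: "AE x in lebesgue. u x \<ge> 0"
    and unz: "\<not> (AE x in lebesgue. u x = 0)"
    using u by (auto simp: weak_solution_def in_Hs_def)
  have um: "u \<in> borel_measurable lebesgue" using uH(2) by (simp add: in_Lp_def)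
  obtain v where vm: "v \<in> borel_measurable lborel" and "AE x in lborel. u x = v x"
    using completion_ex_borel_measurable_real[OF um] by blast
  then have uv: "AE x in lebesgue. u x = v x" by (simp add: AE_completion_iff)
  have vb[measurable]: "v \<in> borel_measurable borel" using vm by simp
  have vl: "v \<in> borel_measurable lebesgue" using vm by (rule measurable_completion)
  have pow: "integrable lborel (\<lambda>x. \<bar>v x\<bar> powr a)" if "in_Lp a u" for a
  proof -
    have "integrable lebesgue (\<lambda>x. \<bar>v x\<bar> powr a)"
    proof (rule integrable_cong_AE_imp)
      show "integrable lebesgue (\<lambda>x. \<bar>u x\<bar> powr a)" using that by (simp add: in_Lp_def)
      show "(\<lambda>x. \<bar>v x\<bar> powr a) \<in> borel_measurable lebesgue" using vl by measurable
      show "AE x in lebesgue. \<bar>u x\<bar> powr a = \<bar>v x\<bar> powr a" using uv by eventually_elim simp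
    qed
    then show ?thesis by (subst (asm) integrable_completion) auto
  qed
  have "\<bar>v x\<bar> powr 2 = (v x)\<^sup>2" for x by (cases "v x = 0") (auto simp: powr_numeral)
  then have vsq: "sq_integrable v" using pow[OF uH(2)] by (simp add: sq_integrable_def)
  obtain \<phi>0 where \<phi>0: "dotH_approx s \<phi>0 u" using uH(1) by (auto simp: in_dotH_def)
  have vfe: "finite_energy s v" by (rule dotH_approx_energy(1)[OF s(1,2) r \<kappa>(1,2) \<phi>0 vb uv])
  have vnn: "AE x in lborel. v x \<ge> 0"
  proof -
    have "AE x in lebesgue. v x \<ge> 0" using uv unn by eventually_elim simp
    then show ?thesis by (simp add: AE_completion_iff)
  qed
  have vnz: "\<not> (AE x in lborel. v x = 0)"
  proof
    assume "AE x in lborel. v x = 0"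
    then have "AE x in lebesgue. v x = 0" by (simp add: AE_completion_iff)
    with uv have "AE x in lebesgue. u x = 0" by eventually_elim simp
    with unz show False by blast
  qed
  \<comment> \<open>The seed for the mollifier comes from the solution itself: a nonzero function
    cannot be approximated by test functions that all vanish.\<close>
  have "\<exists>k x. \<phi>0 k x \<noteq> 0"
  proof (rule ccontr)
    assume "\<nexists>k x. \<phi>0 k x \<noteq> 0"
    then have z: "\<phi>0 k x = 0" for k x by blast
    obtain \<rho> where "AE x in lborel. (\<lambda>n. \<phi>0 (\<rho> n) x) \<longlonglongrightarrow> v x"
      using dotH_approx_AE_subseq(2)[OF r \<phi>0 vb uv] by blast
    then have "AE x in lborel. v x = 0"
      unfolding z by eventually_elim (simp add: LIMSEQ_const_iff)
    with vnz show False by blast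
  qed
  then obtain k x0 where \<eta>: "test_function (\<phi>0 k)" "\<phi>0 k x0 \<noteq> 0" using \<phi>0 by (auto simp: dotH_approx_def)
  have weak: "\<kappa> * energy s v \<phi> + \<epsilon> * (\<integral>x. v x * \<phi> x \<partial>lborel) =
      (\<integral>x. v x powr (p - 1) * \<phi> x \<partial>lborel) - (\<integral>x. v x powr (q - 1) * \<phi> x \<partial>lborel)"
    if \<phi>: "sq_integrable \<phi>" "finite_energy s \<phi>" "\<forall>x. \<bar>\<phi> x\<bar> \<le> M" for \<phi> M
  proof -
    have bd: "\<And>x. \<bar>\<phi> x\<bar> \<le> M" using \<phi>(3) by blast
    have [measurable]: "\<phi> \<in> borel_measurable borel" using \<phi>(1) by (rule sq_integrable_measurable)
    have Hs: "in_Hs s \<phi>" by (rule bounded_finite_energy_in_Hs[OF s(1,2) r \<kappa>(1,2) \<eta> \<phi>(1,2) bd])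
    have Lq: "in_Lp q \<phi>" by (rule in_Lp_of_bounded[OF \<phi>(1) bd q])
    have inner: "dotH_inner s u \<phi> = \<kappa> * energy s v \<phi>"
      by (rule dotH_inner_eq_energy[OF s(1,2) r \<kappa> uH(1) _ vb uv]) (use Hs in \<open>auto simp: in_Hs_def\<close>)
    have I: "(LINT x|lebesgue. h (u x) * \<phi> x) = (\<integral>x. h (v x) * \<phi> x \<partial>lborel)"
      if [measurable]: "h \<in> borel_measurable borel" for h :: "real \<Rightarrow> real"
    proof -
      have "(LINT x|lebesgue. h (u x) * \<phi> x) = (LINT x|lebesgue. h (v x) * \<phi> x)"
      proof (rule integral_cong_AE)
        have [measurable]: "\<phi> \<in> borel_measurable lebesgue" by (rule measurable_completion) simp
        have [measurable]: "u \<in> borel_measurable lebesgue" "v \<in> borel_measurable lebesgue" by fact+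
        show "(\<lambda>x. h (u x) * \<phi> x) \<in> borel_measurable lebesgue" "(\<lambda>x. h (v x) * \<phi> x) \<in> borel_measurable lebesgue"
          by measurable
        show "AE x in lebesgue. h (u x) * \<phi> x = h (v x) * \<phi> x" using uv by eventually_elim simp
      qed
      also have "\<dots> = (\<integral>x. h (v x) * \<phi> x \<partial>lborel)" by (rule integral_completion) measurable
      finally show ?thesis .
    qed
    have "dotH_inner s u \<phi> + \<epsilon> * (LINT x|lebesgue. u x * \<phi> x) =
        (LINT x|lebesgue. u x powr (p - 1) * \<phi> x) - (LINT x|lebesgue. u x powr (q - 1) * \<phi> x)"
      using u Hs Lq unfolding weak_solution_def by blast
    then show ?thesis
      using I[of "\<lambda>t. t"] I[of "\<lambda>t. t powr (p - 1)"] I[of "\<lambda>t. t powr (q - 1)"] by (simp add: inner)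
  qed
  show ?thesis
    using \<kappa>(1) vsq vfe pow[OF uH(3)] uv vnn vnz weak by blast
qed

section \<open>Bounds and continuity of solutions\<close>

lemma nn_integral_mult_const:
  fixes f :: "'a::euclidean_space \<Rightarrow> real"
  assumes f: "integrable lborel f" "\<And>x. f x \<ge> 0" and c: "c \<ge> 0"
  shows "(\<integral>\<^sup>+x. ennreal (f x) * ennreal c \<partial>lborel) = ennreal (c * (\<integral>x. f x \<partial>lborel))"
proof -
  have "(\<integral>\<^sup>+x. ennreal (f x) * ennreal c \<partial>lborel) = (\<integral>\<^sup>+x. ennreal (f x) \<partial>lborel) * ennreal c"
    by (rule nn_integral_multc) (use borel_measurable_integrable[OF f(1)] in measurable)
  also have "\<dots> = ennreal (c * (\<integral>x. f x \<partial>lborel))"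
    using f c by (simp add: nn_integral_eq_integral ennreal_mult mult.commute)
  finally show ?thesis .
qed

text \<open>Where \<open>\<phi>\<close> does not vanish, \<open>g\<close> records how much energy
  density each partner y contributes at least. By Tonelli a uniform lower bound for the total
  contribution at x becomes a bound by the integral of \<open>\<phi>\<close>.\<close>

lemma energy_lower_bound:
  fixes w \<phi> :: "'a::euclidean_space \<Rightarrow> real"
  assumes w: "finite_energy s w" and \<phi>: "finite_energy s \<phi>" "integrable lborel \<phi>" "\<And>x. \<phi> x \<ge> 0"
    and g: "g \<in> borel_measurable (borel \<Otimes>\<^sub>M borel)" "\<And>p. g p \<ge> (0::real)"
    and pt: "\<And>x y. \<phi> x * g (x, y) \<le> (w x - w y) * (\<phi> x - \<phi> y) * frac_kernel s (x - y)"
    and lb: "\<And>x. \<phi> x \<noteq> 0 \<Longrightarrow> ennreal c \<le> (\<integral>\<^sup>+y. ennreal (g (x, y)) \<partial>lborel)" and c: "c \<ge> 0"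
  shows "c * (\<integral>x. \<phi> x \<partial>lborel) \<le> energy s w \<phi>"
proof -
  have [measurable]: "\<phi> \<in> borel_measurable borel" using \<phi>(1) by (rule finite_energy_measurable)
  have gb[measurable]: "g \<in> borel_measurable (borel \<Otimes>\<^sub>M borel)" by fact
  have int: "integrable lborel (\<lambda>p. diff_quot s w p * diff_quot s \<phi> p)" by (rule energy_integrable[OF w \<phi>(1)])
  have pt': "\<phi> (fst p) * g p \<le> diff_quot s w p * diff_quot s \<phi> p" for p
    using pt[of "fst p" "snd p"] by (simp add: diff_quot_mult)
  have nn: "0 \<le> diff_quot s w p * diff_quot s \<phi> p" for p
    using pt'[of p] mult_nonneg_nonneg[OF \<phi>(3)[of "fst p"] g(2)[of p]] by linarith
  have "ennreal (c * (\<integral>x. \<phi> x \<partial>lborel)) = (\<integral>\<^sup>+x. ennreal (\<phi> x) * ennreal c \<partial>lborel)"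
    by (rule nn_integral_mult_const[OF \<phi>(2,3) c, symmetric])
  also have "\<dots> \<le> (\<integral>\<^sup>+x. ennreal (\<phi> x) * (\<integral>\<^sup>+y. ennreal (g (x, y)) \<partial>lborel) \<partial>lborel)"
  proof (rule nn_integral_mono)
    fix x
    show "ennreal (\<phi> x) * ennreal c \<le> ennreal (\<phi> x) * (\<integral>\<^sup>+y. ennreal (g (x, y)) \<partial>lborel)"
      using lb[of x] by (cases "\<phi> x = 0") (auto intro!: mult_left_mono)
  qed
  also have "\<dots> = (\<integral>\<^sup>+x. (\<integral>\<^sup>+y. ennreal (\<phi> x * g (x, y)) \<partial>lborel) \<partial>lborel)"
    using \<phi>(3) g(2) by (simp add: nn_integral_cmult[symmetric] ennreal_mult)
  also have "\<dots> = (\<integral>\<^sup>+p. ennreal (\<phi> (fst p) * g p) \<partial>lborel)"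
    by (subst nn_integral_lborel_pair) (auto simp: borel_prod[symmetric])
  also have "\<dots> \<le> (\<integral>\<^sup>+p. ennreal (diff_quot s w p * diff_quot s \<phi> p) \<partial>lborel)"
    by (intro nn_integral_mono ennreal_leI pt')
  also have "\<dots> = ennreal (energy s w \<phi>)"
    unfolding energy_def by (rule nn_integral_eq_integral[OF int]) (use nn in simp)
  finally have "ennreal (c * (\<integral>x. \<phi> x \<partial>lborel)) \<le> ennreal (energy s w \<phi>)" .
  moreover have "0 \<le> energy s w \<phi>" unfolding energy_def using nn by (intro integral_nonneg_AE) simp
  ultimately show ?thesis by (simp add: ennreal_le_iff)
qed

text \<open>If \<open>a\<close> exceeds the volume of the ball, the left side is
  \<open>ennreal\<close> of a negative number, hence 0.\<close>

lemma measure_ball_diff_lower: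
  fixes A :: "'a::euclidean_space set"
  assumes A: "A \<in> sets borel" "emeasure lborel A \<le> ennreal a" "a \<ge> 0" and r: "r \<ge> 0"
  shows "ennreal (unit_ball_vol (real DIM('a)) * r ^ DIM('a) - a) \<le> emeasure lborel (ball x r - A)"
proof -
  let ?V = "unit_ball_vol (real DIM('a)) * r ^ DIM('a)"
  have [measurable]: "A \<in> sets borel" by fact
  have "ennreal ?V = emeasure lborel (ball x r)" using r by (simp add: emeasure_ball)
  also have "\<dots> \<le> emeasure lborel ((ball x r - A) \<union> A)" by (intro emeasure_mono) auto
  also have "\<dots> \<le> emeasure lborel (ball x r - A) + emeasure lborel A" by (intro emeasure_subadditive) auto
  also have "\<dots> \<le> emeasure lborel (ball x r - A) + ennreal a" using A(2) by (intro add_left_mono)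
  finally have *: "ennreal ?V \<le> emeasure lborel (ball x r - A) + ennreal a" .
  have "ennreal (?V - a) = ennreal ?V - ennreal a" using A(3) by (rule ennreal_minus[symmetric])
  also have "\<dots> \<le> emeasure lborel (ball x r - A)"
    using * by (simp add: ennreal_minus_le_iff add.commute)
  finally show ?thesis .
qed

text \<open>Compare \<open>\<phi>\<close> at a point of \<open>A\<close> with its values on the part of a ball of radius \<open>r\<close> outside \<open>A\<close>.\<close>

lemma small_set_inequality:
  fixes \<phi> :: "'a::euclidean_space \<Rightarrow> real"
  assumes s: "s > 0" and \<phi>: "sq_integrable \<phi>" "finite_energy s \<phi>"
    and A: "A \<in> sets borel" "emeasure lborel A \<le> ennreal a" "a \<ge> 0" and r: "r > 0"
  shows "(unit_ball_vol (real DIM('a)) * r ^ DIM('a) - a) * (\<integral>x. indicator A x * (\<phi> x)\<^sup>2 \<partial>lborel) \<le>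
    2 * r powr (real DIM('a) + 2 * s) * energy s \<phi> \<phi> + 2 * a * (\<integral>x. indicator (- A) x * (\<phi> x)\<^sup>2 \<partial>lborel)"
proof (cases "unit_ball_vol (real DIM('a)) * r ^ DIM('a) - a \<le> 0")
  case True
  have "(unit_ball_vol (real DIM('a)) * r ^ DIM('a) - a) * (\<integral>x. indicator A x * (\<phi> x)\<^sup>2 \<partial>lborel) \<le> 0"
    using True by (intro mult_nonpos_nonneg integral_nonneg_AE) auto
  moreover have "0 \<le> 2 * r powr (real DIM('a) + 2 * s) * energy s \<phi> \<phi> + 2 * a * (\<integral>x. indicator (- A) x * (\<phi> x)\<^sup>2 \<partial>lborel)"
    using A(3) by (intro add_nonneg_nonneg mult_nonneg_nonneg integral_nonneg_AE) auto
  ultimately show ?thesis by linarith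
next
  case False
  let ?W = "unit_ball_vol (real DIM('a)) * r ^ DIM('a) - a"
  let ?k = "r powr (real DIM('a) + 2 * s)"
  have [measurable]: "A \<in> sets borel" by fact
  have [measurable]: "\<phi> \<in> borel_measurable borel" using \<phi>(1) by (rule sq_integrable_measurable)
  define I where "I B = (\<integral>x. indicator B x * (\<phi> x)\<^sup>2 \<partial>lborel)" for B
  have Iint: "integrable lborel (\<lambda>x. indicator B x * (\<phi> x)\<^sup>2)" if [measurable]: "B \<in> sets borel" for B
    using sq_integrable_square[OF \<phi>(1)] by (rule Bochner_Integration.integrable_bound) (auto simp: indicator_def)
  have I: "(\<integral>\<^sup>+x. ennreal (indicator B x * (\<phi> x)\<^sup>2) \<partial>lborel) = ennreal (I B)" "I B \<ge> 0"
    if "B \<in> sets borel" for B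
    unfolding I_def using nn_integral_eq_integral[OF Iint[OF that]] by auto
  define G where "G p = (if fst p \<in> A \<and> snd p \<notin> A \<and> dist (fst p) (snd p) < r then 1 else 0 :: real)" for p :: "'a \<times> 'a"
  have [measurable]: "G \<in> borel_measurable (borel \<Otimes>\<^sub>M borel)"
    unfolding G_def by measurable
  have [measurable]: "diff_quot s \<phi> \<in> borel_measurable (borel \<Otimes>\<^sub>M borel)"
    using measurable_diff_quot[of \<phi> s] by (simp add: borel_prod)
  have G01: "0 \<le> G p" "G p \<le> 1" for p by (auto simp: G_def)
  \<comment> \<open>For distance below \<open>r\<close> the kernel is at least
    \<open>r powr (- (N + 2 s))\<close>, so the squared increment is at most \<open>?k\<close> times
    the energy density.\<close>
  have pt: "G p * (\<phi> (fst p))\<^sup>2 \<le> 2 * ?k * (diff_quot s \<phi> p)\<^sup>2 + 2 * (G p * (\<phi> (snd p))\<^sup>2)" for p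
  proof (cases "G p = 0")
    case False
    obtain x y where p: "p = (x, y)" by (cases p)
    from False have xy: "x \<noteq> y" "dist x y < r" and G1: "G p = 1" by (auto simp: G_def p split: if_splits)
    have "(r powr (real DIM('a) + 2 * s)) * frac_kernel s (x - y) \<ge>
        (norm (x - y) powr (real DIM('a) + 2 * s)) * frac_kernel s (x - y)"
      using xy s by (intro mult_right_mono powr_mono2) (auto simp: dist_norm)
    also have "(norm (x - y) powr (real DIM('a) + 2 * s)) * frac_kernel s (x - y) = 1"
      using xy(1) by (simp add: frac_kernel_def powr_add[symmetric])
    finally have "1 \<le> ?k * frac_kernel s (x - y)" .
    then have "(\<phi> x - \<phi> y)\<^sup>2 \<le> ?k * frac_kernel s (x - y) * (\<phi> x - \<phi> y)\<^sup>2"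
      using mult_right_mono[of 1 "?k * frac_kernel s (x - y)" "(\<phi> x - \<phi> y)\<^sup>2"] by simp
    moreover have "(\<phi> x)\<^sup>2 \<le> 2 * (\<phi> x - \<phi> y)\<^sup>2 + 2 * (\<phi> y)\<^sup>2"
      using sum_squares_bound[of "\<phi> x - \<phi> y" "\<phi> y"] power2_sum[of "\<phi> x - \<phi> y" "\<phi> y"] by simp
    moreover have "(diff_quot s \<phi> p)\<^sup>2 = (\<phi> x - \<phi> y)\<^sup>2 * frac_kernel s (x - y)"
      by (simp add: p diff_quot_def power_mult_distrib)
    ultimately show ?thesis by (simp add: G1) (simp add: p mult_ac)
  qed simp
  have "ennreal (?W * I A) = (\<integral>\<^sup>+x. ennreal (indicator A x * (\<phi> x)\<^sup>2) * ennreal ?W \<partial>lborel)"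
    unfolding I_def using False by (intro nn_integral_mult_const[symmetric] Iint) auto
  also have "\<dots> \<le> (\<integral>\<^sup>+x. ennreal (indicator A x * (\<phi> x)\<^sup>2) * emeasure lborel (ball x r - A) \<partial>lborel)"
    using measure_ball_diff_lower[OF A] r by (intro nn_integral_mono mult_left_mono) auto
  also have "\<dots> = (\<integral>\<^sup>+x. (\<integral>\<^sup>+y. ennreal (G (x, y) * (\<phi> x)\<^sup>2) \<partial>lborel) \<partial>lborel)"
  proof (rule nn_integral_cong)
    fix x :: 'a
    have [measurable]: "ball x r \<in> sets borel" by simp
    have "(\<integral>\<^sup>+y. ennreal (G (x, y) * (\<phi> x)\<^sup>2) \<partial>lborel) =
        (\<integral>\<^sup>+y. ennreal (indicator A x * (\<phi> x)\<^sup>2) * indicator (ball x r - A) y \<partial>lborel)"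
      by (intro nn_integral_cong) (auto simp: G_def indicator_def)
    then show "ennreal (indicator A x * (\<phi> x)\<^sup>2) * emeasure lborel (ball x r - A) =
        (\<integral>\<^sup>+y. ennreal (G (x, y) * (\<phi> x)\<^sup>2) \<partial>lborel)"
      by (simp add: nn_integral_cmult_indicator)
  qed
  also have "\<dots> = (\<integral>\<^sup>+p. ennreal (G p * (\<phi> (fst p))\<^sup>2) \<partial>lborel)"
    by (subst nn_integral_lborel_pair) (auto simp: borel_prod[symmetric])
  also have "\<dots> \<le> (\<integral>\<^sup>+p. ennreal (2 * ?k) * ennreal ((diff_quot s \<phi> p)\<^sup>2) + 2 * ennreal (G p * (\<phi> (snd p))\<^sup>2) \<partial>lborel)"
  proof (rule nn_integral_mono)
    fix p
    have "ennreal (G p * (\<phi> (fst p))\<^sup>2) \<le> ennreal (2 * ?k * (diff_quot s \<phi> p)\<^sup>2 + 2 * (G p * (\<phi> (snd p))\<^sup>2))"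
      by (intro ennreal_leI pt)
    also have "\<dots> = ennreal (2 * ?k) * ennreal ((diff_quot s \<phi> p)\<^sup>2) + 2 * ennreal (G p * (\<phi> (snd p))\<^sup>2)"
      using G01(1)[of p] by (subst ennreal_plus) (auto simp: ennreal_mult)
    finally show "ennreal (G p * (\<phi> (fst p))\<^sup>2) \<le> ennreal (2 * ?k) * ennreal ((diff_quot s \<phi> p)\<^sup>2) + 2 * ennreal (G p * (\<phi> (snd p))\<^sup>2)" .
  qed
  also have "\<dots> = ennreal (2 * ?k) * (\<integral>\<^sup>+p. ennreal ((diff_quot s \<phi> p)\<^sup>2) \<partial>lborel) + 2 * (\<integral>\<^sup>+p. ennreal (G p * (\<phi> (snd p))\<^sup>2) \<partial>lborel)"
    by (subst nn_integral_add) (auto simp: nn_integral_cmult borel_prod[symmetric])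
  also have "(\<integral>\<^sup>+p. ennreal ((diff_quot s \<phi> p)\<^sup>2) \<partial>lborel) = ennreal (energy s \<phi> \<phi>)"
    unfolding energy_self using \<phi>(2) by (intro nn_integral_eq_integral sq_integrable_square finite_energy_diff_quot) auto
  also have "(\<integral>\<^sup>+p. ennreal (G p * (\<phi> (snd p))\<^sup>2) \<partial>lborel) = (\<integral>\<^sup>+y. (\<integral>\<^sup>+x. ennreal (G (x, y) * (\<phi> y)\<^sup>2) \<partial>lborel) \<partial>lborel)"
    by (subst nn_integral_lborel_pair_snd) (auto simp: borel_prod[symmetric])
  \<comment> \<open>Here x is integrated first: for fixed y outside \<open>A\<close> it ranges over
    a part of \<open>A\<close>, which produces the small factor \<open>a\<close>.\<close>
  also have "\<dots> \<le> (\<integral>\<^sup>+y. ennreal (indicator (- A) y * (\<phi> y)\<^sup>2) * ennreal a \<partial>lborel)"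
  proof (rule nn_integral_mono)
    fix y
    have "(\<integral>\<^sup>+x. ennreal (G (x, y) * (\<phi> y)\<^sup>2) \<partial>lborel) \<le>
        (\<integral>\<^sup>+x. ennreal (indicator (- A) y * (\<phi> y)\<^sup>2) * indicator A x \<partial>lborel)"
      by (intro nn_integral_mono) (auto simp: G_def indicator_def)
    also have "\<dots> = ennreal (indicator (- A) y * (\<phi> y)\<^sup>2) * emeasure lborel A"
      by (simp add: nn_integral_cmult_indicator)
    also have "\<dots> \<le> ennreal (indicator (- A) y * (\<phi> y)\<^sup>2) * ennreal a"
      using A(2) by (intro mult_left_mono) auto
    finally show "(\<integral>\<^sup>+x. ennreal (G (x, y) * (\<phi> y)\<^sup>2) \<partial>lborel) \<le> ennreal (indicator (- A) y * (\<phi> y)\<^sup>2) * ennreal a" .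
  qed
  also have "\<dots> = ennreal (a * I (- A))"
    unfolding I_def using A(3) by (intro nn_integral_mult_const Iint) auto
  finally have "ennreal (?W * I A) \<le> ennreal (2 * ?k) * ennreal (energy s \<phi> \<phi>) + 2 * ennreal (a * I (- A))"
    by (simp add: add_left_mono mult_left_mono)
  also have "\<dots> = ennreal (2 * ?k * energy s \<phi> \<phi> + 2 * a * I (- A))"
    using I(2)[of "- A"] A(3) by (subst ennreal_plus) (auto simp: ennreal_mult mult_ac)
  finally show ?thesis
    unfolding I_def[symmetric] using I(2)[of "- A"] A(3) by (subst (asm) ennreal_le_iff) auto
qed

section \<open>The nonlinearity and the upper bound for the solution\<close>

lemma powr_difference_bounds:
  fixes a :: real
  assumes a: "a > 1" and xy: "0 \<le> x" "x \<le> y"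
  shows "0 \<le> y powr a - x powr a" "y powr a - x powr a \<le> a * y powr (a - 1) * (y - x)"
proof -
  show "0 \<le> y powr a - x powr a" using a xy by (simp add: powr_mono2)
  show "y powr a - x powr a \<le> a * y powr (a - 1) * (y - x)"
  proof (cases "x = y")
    case False
    then have "x < y" using xy by simp
    have "\<exists>l z. x < z \<and> z < y \<and> ((\<lambda>t. t powr a) has_real_derivative l) (at z) \<and> y powr a - x powr a = (y - x) * l"
    proof (rule MVT[OF \<open>x < y\<close>])
      show "continuous_on {x..y} (\<lambda>t. t powr a)"
        using a xy by (intro continuous_on_powr' continuous_intros) auto
      show "(\<lambda>t. t powr a) differentiable (at z)" if "x < z" "z < y" for z
        using has_real_derivative_powr[of z a] that xy unfolding real_differentiable_def by auto
    qed
    then obtain l z where z: "x < z" "z < y" "((\<lambda>t. t powr a) has_real_derivative l) (at z)"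
      "y powr a - x powr a = (y - x) * l" by blast
    have "l = a * z powr (a - 1)"
      using z xy by (intro DERIV_unique[OF z(3)]) (auto intro!: derivative_eq_intros)
    also have "\<dots> \<le> a * y powr (a - 1)" using z xy a by (intro mult_left_mono powr_mono2) auto
    finally have "(y - x) * l \<le> (y - x) * (a * y powr (a - 1))" using \<open>x < y\<close> by (intro mult_left_mono) auto
    then show ?thesis using z(4) by (simp add: mult_ac)
  qed simp
qed

definition nonlin :: "real \<Rightarrow> real \<Rightarrow> real \<Rightarrow> real \<Rightarrow> real" where
  "nonlin p q \<epsilon> t = t powr (p - 1) - t powr (q - 1) - \<epsilon> * t"

lemma measurable_nonlin [measurable]: "nonlin p q \<epsilon> \<in> borel_measurable borel"
  unfolding nonlin_def[abs_def] by measurable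

lemma nonlin_Lipschitz:
  assumes pq: "p > 2" "q > 2" "\<epsilon> > 0" and ab: "a \<in> {0..1}" "b \<in> {0..1}"
  shows "\<bar>nonlin p q \<epsilon> a - nonlin p q \<epsilon> b\<bar> \<le> (p + q + \<epsilon>) * \<bar>a - b\<bar>"
proof -
  have *: "\<bar>nonlin p q \<epsilon> y - nonlin p q \<epsilon> x\<bar> \<le> (p + q + \<epsilon>) * (y - x)" if xy: "0 \<le> x" "x \<le> y" "y \<le> 1" for x y
  proof -
    have le: "r * y powr (r - 1) * (y - x) \<le> r * (y - x)" if "r > 1" for r
      using that xy by (intro mult_right_mono mult_left_le powr_le1) auto
    note P = powr_difference_bounds[of "p - 1" x y] le[of "p - 1"] and Q = powr_difference_bounds[of "q - 1" x y] le[of "q - 1"]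
    have "\<bar>nonlin p q \<epsilon> y - nonlin p q \<epsilon> x\<bar> \<le> (p - 1) * (y - x) + (q - 1) * (y - x) + \<epsilon> * (y - x)"
      using P Q xy pq mult_nonneg_nonneg[of \<epsilon> "y - x"] unfolding nonlin_def right_diff_distrib[of \<epsilon>] by linarith
    also have "\<dots> \<le> (p + q + \<epsilon>) * (y - x)" using xy by (simp add: algebra_simps)
    finally show ?thesis .
  qed
  show ?thesis
  proof (cases "a \<le> b")
    case True
    then show ?thesis using *[of a b] ab by (simp add: abs_minus_commute)
  next
    case False
    then show ?thesis using *[of b a] ab by simp
  qed
qed

lemma nonlin_decreasing_near_0:
  assumes pq: "p > 2" "q > 2" "\<epsilon> > 0"
  shows "\<exists>d>0. \<forall>x y. 0 \<le> x \<longrightarrow> x \<le> y \<longrightarrow> y \<le> d \<longrightarrow> nonlin p q \<epsilon> y - nonlin p q \<epsilon> x \<le> - (\<epsilon> / 2) * (y - x)"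
proof -
  \<comment> \<open>\<open>d\<close> solves
    \<open>(p - 1) * d powr (p - 2) = \<epsilon> / 2\<close>: on \<open>[0, d]\<close> the
    \<open>p\<close>-term takes away at most half of the decrease of the linear term, and the
    \<open>q\<close>-term only helps.\<close>
  define d where "d = (\<epsilon> / (2 * (p - 1))) powr (1 / (p - 2))"
  have d: "d > 0" using pq by (simp add: d_def)
  have dp: "(p - 1) * d powr (p - 2) = \<epsilon> / 2" using pq by (simp add: d_def powr_powr) (simp add: field_simps)
  have "nonlin p q \<epsilon> y - nonlin p q \<epsilon> x \<le> - (\<epsilon> / 2) * (y - x)" if xy: "0 \<le> x" "x \<le> y" "y \<le> d" for x y
  proof -
    have "y powr (p - 1) - x powr (p - 1) \<le> (p - 1) * y powr (p - 1 - 1) * (y - x)"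
      using powr_difference_bounds(2)[of "p - 1" x y] pq xy by simp
    also have "\<dots> \<le> (p - 1) * d powr (p - 2) * (y - x)"
      using pq xy by (intro mult_right_mono mult_left_mono powr_mono2') (auto intro!: powr_mono2)
    finally have "y powr (p - 1) - x powr (p - 1) \<le> \<epsilon> / 2 * (y - x)" unfolding dp .
    moreover have "0 \<le> y powr (q - 1) - x powr (q - 1)" using powr_difference_bounds(1)[of "q - 1" x y] pq xy by simp
    moreover have "\<epsilon> / 2 * (y - x) = \<epsilon> * y / 2 - \<epsilon> * x / 2" "- (\<epsilon> / 2) * (y - x) = \<epsilon> * x / 2 - \<epsilon> * y / 2"
      by (simp_all add: field_simps)
    ultimately show ?thesis unfolding nonlin_def by linarith
  qed
  then show ?thesis using d by blast
qed

lemma nonlin_0 [simp]: "p > 1 \<Longrightarrow> q > 1 \<Longrightarrow> nonlin p q \<epsilon> 0 = 0"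
  by (simp add: nonlin_def)

lemma nonlin_bound:
  assumes "p > 2" "q > 2" "\<epsilon> > 0" "t \<in> {0..1}"
  shows "\<bar>nonlin p q \<epsilon> t\<bar> \<le> (p + q + \<epsilon>) * \<bar>t\<bar>"
  using nonlin_Lipschitz[of p q \<epsilon> t 0] assms by simp

lemma AE_lborel_zero_of_integral:
  fixes f :: "'a::euclidean_space \<Rightarrow> real"
  assumes "integrable lborel f" "AE x in lborel. 0 \<le> f x" "(\<integral>x. f x \<partial>lborel) \<le> 0"
  shows "AE x in lborel. f x = 0"
proof -
  have "(\<integral>x. f x \<partial>lborel) = 0" using integral_nonneg_AE[OF assms(2)] assms(3) by simp
  then show ?thesis using integral_nonneg_eq_0_iff_AE[OF assms(1,2)] by simp
qed

text \<open>Test with \<open>T\<close>, the part of \<open>v\<close> above 1 truncated at height 1.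
  It is a nondecreasing function of \<open>v\<close>, so the energy term is nonnegative. Where
  \<open>T\<close> is nonzero, \<open>v > 1\<close> makes the \<open>q\<close>-term outweigh the
  \<open>p\<close>-term. What remains is that the integral of \<open>v * T\<close> is at most
  0.\<close>

lemma energy_solution_le_1:
  fixes v :: "'a::euclidean_space \<Rightarrow> real"
  assumes pq: "p > 2" "q > p" "\<epsilon> > 0" and \<kappa>: "\<kappa> > 0"
    and v: "sq_integrable v" "finite_energy s v" "integrable lborel (\<lambda>x. \<bar>v x\<bar> powr q)" "AE x in lborel. v x \<ge> 0"
    and weak: "\<And>\<phi> M. sq_integrable \<phi> \<Longrightarrow> finite_energy s \<phi> \<Longrightarrow> (\<forall>x. \<bar>\<phi> x\<bar> \<le> M) \<Longrightarrow>
      \<kappa> * energy s v \<phi> + \<epsilon> * (\<integral>x. v x * \<phi> x \<partial>lborel) =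
      (\<integral>x. v x powr (p - 1) * \<phi> x \<partial>lborel) - (\<integral>x. v x powr (q - 1) * \<phi> x \<partial>lborel)"
  shows "AE x in lborel. v x \<le> 1"
proof -
  have [measurable]: "v \<in> borel_measurable borel" using v(1) by (rule sq_integrable_measurable)
  define T where "T x = min 1 (max 0 (v x - 1))" for x
  have [measurable]: "T \<in> borel_measurable borel" unfolding T_def[abs_def] by measurable
  have Tb: "0 \<le> T x" "T x \<le> 1" "T x \<noteq> 0 \<Longrightarrow> v x > 1" for x by (auto simp: T_def max_def split: if_splits)
  have Tsq: "sq_integrable T" by (rule sq_integrable_bound[OF v(1), of _ 1]) (auto simp: T_def max_def min_def)
  have Tfe: "finite_energy s T" by (rule finite_energy_contraction[OF v(2)]) (auto simp: T_def max_def min_def)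
  have "0 \<le> (v x - v y) * (T x - T y)" for x y
  proof (cases "v x \<le> v y")
    case True
    then have "T x \<le> T y" unfolding T_def by (intro min.mono max.mono) auto
    then show ?thesis using True by (intro mult_nonpos_nonpos) auto
  next
    case False
    then have "T y \<le> T x" unfolding T_def by (intro min.mono max.mono) auto
    then show ?thesis using False by (intro mult_nonneg_nonneg) auto
  qed
  from mult_nonneg_nonneg[OF this frac_kernel_nonneg] have E: "0 \<le> energy s v T"
    unfolding energy_def diff_quot_mult by (intro integral_nonneg_AE AE_I2)
  \<comment> \<open>Since \<open>v > 1\<close> where \<open>T\<close> is nonzero, every power up to
    \<open>q\<close> is dominated there by the integrable \<open>q\<close>-th power; no growth
    restriction on \<open>q\<close> enters.\<close>
  have pw: "\<bar>v x powr a * T x\<bar> \<le> \<bar>v x\<bar> powr q" if "a \<le> q" for x a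
  proof (cases "T x = 0")
    case False
    then have 1: "v x > 1" by (rule Tb)
    have "\<bar>v x powr a * T x\<bar> \<le> v x powr a * 1" using Tb[of x] by (simp add: abs_mult mult_left_le)
    also have "\<dots> \<le> v x powr q" using that 1 by (simp add: powr_mono)
    finally show ?thesis using 1 by simp
  qed simp
  have int: "integrable lborel (\<lambda>x. v x powr a * T x)" if "a \<le> q" for a
    by (rule Bochner_Integration.integrable_bound[OF v(3)]) (use pw[OF that] in auto)
  have "(\<integral>x. v x powr (p - 1) * T x \<partial>lborel) \<le> (\<integral>x. v x powr (q - 1) * T x \<partial>lborel)"
  proof (intro integral_mono int)
    show "v x powr (p - 1) * T x \<le> v x powr (q - 1) * T x" for x
      using Tb[of x] pq by (cases "T x = 0") (auto intro!: mult_right_mono powr_mono)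
  qed (use pq in auto)
  moreover have "\<kappa> * energy s v T + \<epsilon> * (\<integral>x. v x * T x \<partial>lborel) =
      (\<integral>x. v x powr (p - 1) * T x \<partial>lborel) - (\<integral>x. v x powr (q - 1) * T x \<partial>lborel)"
    using Tb by (intro weak[OF Tsq Tfe, of 1]) auto
  moreover have "0 \<le> \<kappa> * energy s v T" using E \<kappa> by simp
  ultimately have "\<epsilon> * (\<integral>x. v x * T x \<partial>lborel) \<le> 0" by linarith
  then have "(\<integral>x. v x * T x \<partial>lborel) \<le> 0" using pq(3) by (simp add: mult_le_0_iff)
  moreover have "AE x in lborel. 0 \<le> v x * T x" using v(4) by eventually_elim (use Tb in auto)
  ultimately have "AE x in lborel. v x * T x = 0"
    using AE_lborel_zero_of_integral[OF sq_integrable_mult[OF v(1) Tsq]] by blast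
  then show ?thesis
    by eventually_elim (use Tb in \<open>auto simp: T_def max_def min_def split: if_splits\<close>)
qed

text \<open>The increment \<open>w\<close> solves an equation with right side bounded by
  \<open>2 * B\<close>. Test with the part of \<open>w\<close> above 3/4 of \<open>\<eta>\<close>:
  where it is positive, \<open>w\<close> exceeds by \<open>\<eta> / 4\<close> its values at all
  points within \<open>r\<close> outside the set \<open>w > \<eta> / 2\<close>. That set is small by
  continuity of translations in \<open>L^2\<close>, so the energy is at least a multiple of the
  integral of \<open>\<phi>\<close> that beats \<open>2 * B\<close>, and \<open>\<phi>\<close> must
  vanish.\<close>

lemma bounded_solution_increment:
  fixes u b :: "'a::euclidean_space \<Rightarrow> real"
  assumes s: "s > 0" and \<kappa>: "\<kappa> > 0"
    and u: "sq_integrable u" "finite_energy s u" "\<And>x. u x \<in> {0..1}"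
    and b: "b \<in> borel_measurable borel" "\<And>x. \<bar>b x\<bar> \<le> B"
    and weak: "\<And>\<phi> M. sq_integrable \<phi> \<Longrightarrow> finite_energy s \<phi> \<Longrightarrow> (\<forall>x. \<bar>\<phi> x\<bar> \<le> M) \<Longrightarrow>
      \<kappa> * energy s u \<phi> = (\<integral>x. b x * \<phi> x \<partial>lborel)"
    and \<eta>: "\<eta> > 0"
  shows "\<exists>d>0. \<forall>z. norm z < d \<longrightarrow> (AE x in lborel. u (x + z) - u x \<le> \<eta>)"
proof -
  let ?N = "real DIM('a)"
  define V where "V = unit_ball_vol ?N"
  have V: "V > 0" by (simp add: V_def)
  have B: "B \<ge> 0" using b(2)[of 0] by linarith
  have [measurable]: "u \<in> borel_measurable borel" "b \<in> borel_measurable borel"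
    using u(1) b by (auto dest: sq_integrable_measurable)
  \<comment> \<open>Chosen so that the lower bound for the energy, multiplied by
    \<open>\<kappa>\<close>, has the constant \<open>2 * B + 1\<close>, just more than the right
    side allows.\<close>
  define r where "r = ((2 * B + 1) / (\<kappa> * \<eta> / 8 * V)) powr (- 1 / (2 * s))"
  have r: "r > 0" using B \<kappa> \<eta> V by (simp add: r_def)
  have rr: "\<kappa> * (\<eta> / 4 * (V / 2) * r powr (- (2 * s))) = 2 * B + 1"
  proof -
    have "r powr (- (2 * s)) = (2 * B + 1) / (\<kappa> * \<eta> / 8 * V)"
      using s B \<kappa> \<eta> V by (simp add: r_def powr_powr)
    then show ?thesis using \<kappa> \<eta> V by simp
  qed
  \<comment> \<open>Half the volume of the ball: the exceptional set may fill at most half of the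
    partners.\<close>
  define m where "m = V * r ^ DIM('a) / 2"
  have m: "m > 0" using V r by (simp add: m_def)
  have "(\<eta> / 2)\<^sup>2 * m > 0" using \<eta> m by simp
  then obtain d where d: "d > 0" "\<And>z. norm z < d \<Longrightarrow> (\<integral>x. (u (x + z) - u x)\<^sup>2 \<partial>lborel) < (\<eta> / 2)\<^sup>2 * m"
    using L2_translation[OF u(1)] by metis
  have "AE x in lborel. u (x + z) - u x \<le> \<eta>" if z: "norm z < d" for z
  proof -
    define w where "w x = u (x + z) - u x" for x
    define \<phi> where "\<phi> x = max 0 (w x - 3 * \<eta> / 4)" for x
    have uz: "sq_integrable (\<lambda>x. u (x + z))" "finite_energy s (\<lambda>x. u (x + z))"
      using sq_integrable_comp[OF lborel_distr_add _ u(1), of z] finite_energy_translate[OF u(2), of z] by simp_all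
    have wsq: "sq_integrable w" unfolding w_def[abs_def] by (intro sq_integrable_diff uz u)
    have wfe: "finite_energy s w" unfolding w_def[abs_def] by (intro finite_energy_diff uz u)
    have [measurable]: "w \<in> borel_measurable borel" using wsq by (rule sq_integrable_measurable)
    have [measurable]: "\<phi> \<in> borel_measurable borel" unfolding \<phi>_def[abs_def] by measurable
    have \<phi>sq: "sq_integrable \<phi>" by (rule sq_integrable_bound[OF wsq, of _ 1]) (use \<eta> in \<open>auto simp: \<phi>_def\<close>)
    have \<phi>fe: "finite_energy s \<phi>" by (rule finite_energy_contraction[OF wfe]) (auto simp: \<phi>_def)
    have \<phi>0: "0 \<le> \<phi> x" for x by (simp add: \<phi>_def)
    have \<phi>b: "\<bar>\<phi> x\<bar> \<le> 1" for x using u(3)[of x] u(3)[of "x + z"] \<eta> by (auto simp: \<phi>_def w_def)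
    have \<phi>i: "integrable lborel \<phi>"
    proof (rule Bochner_Integration.integrable_bound)
      show "integrable lborel (\<lambda>x. (4 / (3 * \<eta>)) * (w x)\<^sup>2)" using wsq by (intro integrable_mult_right sq_integrable_square)
      show "AE x in lborel. norm (\<phi> x) \<le> norm ((4 / (3 * \<eta>)) * (w x)\<^sup>2)"
      proof (rule AE_I2)
        fix x
        show "norm (\<phi> x) \<le> norm ((4 / (3 * \<eta>)) * (w x)\<^sup>2)"
        proof (cases "w x \<ge> 3 * \<eta> / 4")
          case True
          then have "w x * (3 * \<eta> / 4) \<le> w x * w x" using \<eta> by (intro mult_left_mono) auto
          then have "w x \<le> (4 / (3 * \<eta>)) * (w x)\<^sup>2" using \<eta> by (simp add: field_simps power2_eq_square)
          then show ?thesis using True \<eta> by (simp add: \<phi>_def)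
        qed (simp add: \<phi>_def)
      qed
    qed measurable
    have upper: "\<kappa> * energy s w \<phi> \<le> 2 * B * (\<integral>x. \<phi> x \<partial>lborel)"
    proof -
      let ?\<phi>z = "\<lambda>x. \<phi> (x + - z)"
      have fz: "finite_energy s ?\<phi>z" "sq_integrable ?\<phi>z"
        using finite_energy_translate[OF \<phi>fe, of "- z"] sq_integrable_comp[OF lborel_distr_add _ \<phi>sq, of "- z"] by simp_all
      have "energy s (\<lambda>x. u (x + z)) \<phi> = energy s (\<lambda>x. u (x + z)) (\<lambda>x. ?\<phi>z (x + z))" by simp
      also have "\<dots> = energy s u ?\<phi>z" by (rule energy_translate[OF u(2) fz(1)])
      finally have "\<kappa> * energy s w \<phi> = \<kappa> * energy s u ?\<phi>z - \<kappa> * energy s u \<phi>"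
        unfolding w_def[abs_def] using energy_diff_left[OF uz(2) u(2) \<phi>fe] by (simp add: right_diff_distrib)
      also have "\<dots> = (\<integral>x. b x * ?\<phi>z x \<partial>lborel) - (\<integral>x. b x * \<phi> x \<partial>lborel)"
        using \<phi>b weak[OF fz(2,1), of 1] weak[OF \<phi>sq \<phi>fe, of 1] by simp
      also have "(\<integral>x. b x * ?\<phi>z x \<partial>lborel) = (\<integral>x. b (x + z) * ?\<phi>z (x + z) \<partial>lborel)"
        by (rule integral_lborel_preserving[OF lborel_distr_add, symmetric]) measurable
      also have "\<dots> - (\<integral>x. b x * \<phi> x \<partial>lborel) = (\<integral>x. b (x + z) * \<phi> x - b x * \<phi> x \<partial>lborel)"
      proof -
        have "integrable lborel (\<lambda>x. b' x * \<phi> x)" if "\<And>x. \<bar>b' x\<bar> \<le> B" "b' \<in> borel_measurable borel" for b'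
          by (rule Bochner_Integration.integrable_bound[OF integrable_mult_right[OF \<phi>i, of B]])
            (use that \<phi>0 B in \<open>auto simp: abs_mult intro!: mult_right_mono\<close>)
        from this[of b] this[of "\<lambda>x. b (x + z)"] show ?thesis using b(2) by simp
      qed
      also have "\<dots> \<le> (\<integral>x. 2 * B * \<phi> x \<partial>lborel)"
      proof (rule integral_mono')
        show "b (x + z) * \<phi> x - b x * \<phi> x \<le> 2 * B * \<phi> x" for x
        proof -
          have "b (x + z) - b x \<le> 2 * B" using b(2)[of x] b(2)[of "x + z"] by linarith
          from mult_right_mono[OF this \<phi>0[of x]] show ?thesis by (simp add: left_diff_distrib)
        qed
      qed (use \<phi>i \<phi>0 B in auto)
      finally show ?thesis by simp
    qed
    define A where "A = {x. w x > \<eta> / 2}"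
    have [measurable]: "A \<in> sets borel" unfolding A_def by measurable
    have Ameas: "emeasure lborel A \<le> ennreal m"
    proof -
      have "ennreal ((\<eta> / 2)\<^sup>2) * emeasure lborel A = (\<integral>\<^sup>+x. ennreal ((\<eta> / 2)\<^sup>2) * indicator A x \<partial>lborel)"
        by (simp add: nn_integral_cmult_indicator)
      also have "\<dots> \<le> (\<integral>\<^sup>+x. ennreal ((w x)\<^sup>2) \<partial>lborel)"
        using \<eta> by (intro nn_integral_mono) (auto simp: A_def indicator_def intro!: ennreal_leI power_mono)
      also have "\<dots> = ennreal (\<integral>x. (w x)\<^sup>2 \<partial>lborel)"
        by (intro nn_integral_eq_integral sq_integrable_square wsq) auto
      also have "\<dots> \<le> ennreal ((\<eta> / 2)\<^sup>2 * m)" using d(2)[OF z] by (intro ennreal_leI) (simp add: w_def)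
      also have "\<dots> = ennreal ((\<eta> / 2)\<^sup>2) * ennreal m" using m by (intro ennreal_mult) auto
      finally show ?thesis
        using \<eta> by (subst (asm) ennreal_mult_le_mult_iff) auto
    qed
    define g where "g p = (if snd p \<notin> A \<and> dist (fst p) (snd p) < r then \<eta> / 4 * r powr (- (?N + 2 * s)) else 0)" for p :: "'a \<times> 'a"
    have lower: "(\<eta> / 4 * (V / 2) * r powr (- (2 * s))) * (\<integral>x. \<phi> x \<partial>lborel) \<le> energy s w \<phi>"
    proof (rule energy_lower_bound[OF wfe \<phi>fe \<phi>i \<phi>0])
      show "g \<in> borel_measurable (borel \<Otimes>\<^sub>M borel)" unfolding g_def by measurable
      show "0 \<le> g p" for p using \<eta> by (simp add: g_def)
      show "0 \<le> \<eta> / 4 * (V / 2) * r powr (- (2 * s))" using \<eta> V by simp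
      fix x y
      show "\<phi> x * g (x, y) \<le> (w x - w y) * (\<phi> x - \<phi> y) * frac_kernel s (x - y)"
      proof (cases "\<phi> x = 0 \<or> y \<in> A \<or> r \<le> dist x y")
        case True
        then have zero: "\<phi> x * g (x, y) = 0" by (auto simp: g_def)
        have "0 \<le> (w x - w y) * (\<phi> x - \<phi> y)" by (auto simp: \<phi>_def max_def zero_le_mult_iff)
        from mult_nonneg_nonneg[OF this frac_kernel_nonneg] show ?thesis unfolding zero .
      next
        case False
        then have wx: "w x > 3 * \<eta> / 4" and wy: "w y \<le> \<eta> / 2" and xy: "dist x y < r"
          by (auto simp: \<phi>_def A_def max_def split: if_splits)
        then have "x \<noteq> y" using \<eta> by auto
        have "\<phi> y = 0" using wy \<eta> by (simp add: \<phi>_def)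
        have "r powr (- (?N + 2 * s)) \<le> frac_kernel s (x - y)"
          unfolding frac_kernel_def using xy \<open>x \<noteq> y\<close> s by (intro powr_mono2') (auto simp: dist_norm)
        then have "\<eta> / 4 * r powr (- (?N + 2 * s)) \<le> (w x - w y) * frac_kernel s (x - y)"
          using wx wy \<eta> by (intro mult_mono) auto
        from mult_left_mono[OF this \<phi>0[of x]] show ?thesis
          using False \<open>\<phi> y = 0\<close> by (simp add: g_def mult_ac)
      qed
    next
      fix x :: 'a
      have [measurable]: "ball x r \<in> sets borel" by simp
      have cpos: "0 \<le> \<eta> / 4 * r powr (- (?N + 2 * s))" using \<eta> by simp
      have "(\<integral>\<^sup>+y. ennreal (g (x, y)) \<partial>lborel) =
          (\<integral>\<^sup>+y. ennreal (\<eta> / 4 * r powr (- (?N + 2 * s))) * indicator (ball x r - A) y \<partial>lborel)"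
        by (intro nn_integral_cong) (auto simp: g_def indicator_def)
      also have "\<dots> = ennreal (\<eta> / 4 * r powr (- (?N + 2 * s))) * emeasure lborel (ball x r - A)"
        by (simp add: nn_integral_cmult_indicator)
      also have "\<dots> \<ge> ennreal (\<eta> / 4 * r powr (- (?N + 2 * s))) * ennreal (V * r ^ DIM('a) - m)"
        using measure_ball_diff_lower[OF _ Ameas, of r x, folded V_def] m r by (intro mult_left_mono) auto
      also have "ennreal (\<eta> / 4 * r powr (- (?N + 2 * s))) * ennreal (V * r ^ DIM('a) - m) =
          ennreal (\<eta> / 4 * (V / 2) * r powr (- (2 * s)))"
      proof -
        have "r powr (- (?N + 2 * s)) * r ^ DIM('a) = r powr (- (2 * s))"
          using r by (simp add: powr_realpow[symmetric] powr_add[symmetric])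
        then have eq1: "\<eta> / 4 * r powr (- (?N + 2 * s)) * (V * r ^ DIM('a) - m) = \<eta> / 4 * (V / 2) * r powr (- (2 * s))"
          by (simp add: m_def algebra_simps)
        have m0: "0 \<le> V * r ^ DIM('a) - m" using m by (simp add: m_def)
        show ?thesis by (simp only: ennreal_mult[OF cpos m0, symmetric] eq1)
      qed
      finally show "ennreal (\<eta> / 4 * (V / 2) * r powr (- (2 * s))) \<le> (\<integral>\<^sup>+y. ennreal (g (x, y)) \<partial>lborel)" .
    qed
    have "(2 * B + 1) * (\<integral>x. \<phi> x \<partial>lborel) \<le> 2 * B * (\<integral>x. \<phi> x \<partial>lborel)"
    proof -
      have "(2 * B + 1) * (\<integral>x. \<phi> x \<partial>lborel) = \<kappa> * ((\<eta> / 4 * (V / 2) * r powr (- (2 * s))) * (\<integral>x. \<phi> x \<partial>lborel))"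
        unfolding rr[symmetric] by (simp only: mult.assoc)
      also have "\<dots> \<le> \<kappa> * energy s w \<phi>" using lower \<kappa> by (intro mult_left_mono) auto
      finally show ?thesis using upper by linarith
    qed
    then have "(\<integral>x. \<phi> x \<partial>lborel) \<le> 0" by (simp add: distrib_right)
    then have "AE x in lborel. \<phi> x = 0" using AE_lborel_zero_of_integral[OF \<phi>i] \<phi>0 by simp
    then show ?thesis by eventually_elim (use \<eta> in \<open>auto simp: \<phi>_def w_def\<close>)
  qed
  then show ?thesis using d(1) by blast
qed


section \<open>From almost everywhere statements to a continuous representative\<close>

lemma AE_open_witness:
  fixes U :: "'a::euclidean_space set"
  assumes "AE x in lborel. P x" "open U" "x0 \<in> U"
  shows "\<exists>x\<in>U. P x"
proof (rule ccontr)
  assume no: "\<not> (\<exists>x\<in>U. P x)"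
  obtain d where d: "d > 0" "ball x0 d \<subseteq> U" using assms(2,3) open_contains_ball by blast
  have "AE x in lborel. x \<notin> ball x0 d" using assms(1) by eventually_elim (use no d in blast)
  then have "ball x0 d \<in> null_sets lborel" using AE_iff_null_sets[of "ball x0 d" lborel] by auto
  then show False using d(1) unit_ball_vol_pos[of "real DIM('a)"]
    by (auto simp: null_sets_def emeasure_ball simp del: unit_ball_vol_pos)
qed

lemma AE_lborel_continuous_closed:
  fixes f :: "'a::euclidean_space \<Rightarrow> real"
  assumes "continuous_on UNIV f" "AE x in lborel. f x \<in> C" "closed C"
  shows "f x \<in> C"
proof (rule ccontr)
  assume "f x \<notin> C"
  moreover have "open (f -` (- C))" using assms by (intro open_vimage) auto
  ultimately show False using AE_open_witness[OF assms(2), of "f -` (- C)" x] by auto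
qed

text \<open>Fubini exchanges the quantifiers: for almost every x the increment bound holds for
  almost all small z, simultaneously for all n. Two such points at distance below \<open>d n\<close>
  are compared through a common neighbour p that is good for both. So \<open>u\<close> is uniformly
  continuous on a dense set and extends.\<close>

lemma continuous_representative:
  fixes u :: "'a::euclidean_space \<Rightarrow> real"
  assumes u[measurable]: "u \<in> borel_measurable borel"
    and incr: "\<And>\<eta>. \<eta> > 0 \<Longrightarrow> \<exists>d>0. \<forall>z. norm z < d \<longrightarrow> (AE x in lborel. u (x + z) - u x \<le> \<eta>)"
  shows "\<exists>v. continuous_on UNIV v \<and> (AE x in lborel. u x = v x)"
proof -
  have "\<forall>n. \<exists>d>0. \<forall>z. norm z < d \<longrightarrow> (AE x in lborel. u (x + z) - u x \<le> 1 / real (Suc n))"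
    using incr by simp
  then obtain d where d: "\<And>n. d n > 0"
    "\<And>n z. norm z < d n \<Longrightarrow> AE x in lborel. u (x + z) - u x \<le> 1 / real (Suc n)" by metis
  have both: "AE x in lborel. \<bar>u (x + z) - u x\<bar> \<le> 1 / real (Suc n)" if z: "norm z < d n" for n z
  proof -
    have "AE x in lborel. u (x + z + - z) - u (x + z) \<le> 1 / real (Suc n)"
      using AE_lborel_preserving[OF lborel_distr_add _ d(2)[of "- z" n], of z] z by simp
    with d(2)[OF z] show ?thesis by eventually_elim auto
  qed
  define Z where "Z = {x. \<forall>n. AE z in lborel. norm z < d n \<longrightarrow> \<bar>u (x + z) - u x\<bar> \<le> 1 / real (Suc n)}"
  have "AE x in lborel. AE z in lborel. norm z < d n \<longrightarrow> \<bar>u (x + z) - u x\<bar> \<le> 1 / real (Suc n)" for n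
  proof (subst lborel_pair.AE_commute)
    show "{p \<in> space (lborel \<Otimes>\<^sub>M lborel). norm (snd p) < d n \<longrightarrow> \<bar>u (fst p + snd p) - u (fst p)\<bar> \<le> 1 / real (Suc n)} \<in>
      sets (lborel \<Otimes>\<^sub>M (lborel :: 'a measure))" by measurable
    show "AE z in lborel. AE x in lborel. norm z < d n \<longrightarrow> \<bar>u (x + z) - u x\<bar> \<le> 1 / real (Suc n)"
    proof (rule AE_I2)
      fix z
      show "AE x in lborel. norm z < d n \<longrightarrow> \<bar>u (x + z) - u x\<bar> \<le> 1 / real (Suc n)"
        using both[of z n] by (cases "norm z < d n") auto
    qed
  qed
  then have AEZ: "AE x in lborel. x \<in> Z" unfolding Z_def by (simp add: AE_all_countable)
  have close: "\<bar>u x - u y\<bar> \<le> 2 / real (Suc n)" if xZ: "x \<in> Z" and yZ: "y \<in> Z" and xy: "dist x y < d n" for x y n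
  proof -
    have shift: "AE p in lborel. dist p x < d n \<longrightarrow> \<bar>u p - u x\<bar> \<le> 1 / real (Suc n)" if "x \<in> Z" for x
    proof -
      have "AE z in lborel. norm z < d n \<longrightarrow> \<bar>u (x + z) - u x\<bar> \<le> 1 / real (Suc n)"
        using that by (simp add: Z_def)
      from AE_lborel_preserving[OF lborel_distr_add _ this, of "- x"]
      show ?thesis by (simp add: dist_norm)
    qed
    have "AE p in lborel. (dist p x < d n \<longrightarrow> \<bar>u p - u x\<bar> \<le> 1 / real (Suc n)) \<and> (dist p y < d n \<longrightarrow> \<bar>u p - u y\<bar> \<le> 1 / real (Suc n))"
      using shift[OF xZ] shift[OF yZ] by eventually_elim simp
    then have "\<exists>p\<in>ball x (d n) \<inter> ball y (d n). (dist p x < d n \<longrightarrow> \<bar>u p - u x\<bar> \<le> 1 / real (Suc n)) \<and> (dist p y < d n \<longrightarrow> \<bar>u p - u y\<bar> \<le> 1 / real (Suc n))"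
      by (rule AE_open_witness[where ?x0.0 = x]) (use xy d(1)[of n] in \<open>auto simp: dist_commute\<close>)
    then obtain p where "p \<in> ball x (d n) \<inter> ball y (d n)"
      "dist p x < d n \<longrightarrow> \<bar>u p - u x\<bar> \<le> 1 / real (Suc n)" "dist p y < d n \<longrightarrow> \<bar>u p - u y\<bar> \<le> 1 / real (Suc n)"
      by blast
    then have "\<bar>u p - u x\<bar> \<le> 1 / real (Suc n)" "\<bar>u p - u y\<bar> \<le> 1 / real (Suc n)" by (auto simp: dist_commute)
    then show ?thesis by (simp add: abs_le_iff)
  qed
  have "uniformly_continuous_on Z u"
    unfolding uniformly_continuous_on_def
  proof (intro allI impI)
    fix e :: real assume e: "e > 0"
    obtain n0 :: nat where "2 / e < real n0" using reals_Archimedean2 by blast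
    then obtain n where n: "2 / e < real (Suc n)" by (intro that[of n0]) simp
    then have "2 / real (Suc n) < e" using e by (simp add: field_simps)
    then show "\<exists>d>0. \<forall>x\<in>Z. \<forall>x'\<in>Z. dist x' x < d \<longrightarrow> dist (u x') (u x) < e"
      using close d(1)[of n] by (intro exI[of _ "d n"]) (auto simp: dist_real_def intro: le_less_trans)
  qed
  then obtain v where v: "uniformly_continuous_on (closure Z) v" "\<And>x. x \<in> Z \<Longrightarrow> u x = v x"
    using uniformly_continuous_on_extension_on_closure by metis
  have "closure Z = UNIV"
  proof (rule ccontr)
    assume "closure Z \<noteq> UNIV"
    then obtain x where "x \<in> - closure Z" by auto
    from AE_open_witness[OF AEZ _ this] show False using closure_subset[of Z] by auto
  qed
  then have "continuous_on UNIV v" using v(1) uniformly_continuous_imp_continuous by auto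
  moreover have "AE x in lborel. u x = v x" using AEZ by eventually_elim (rule v(2))
  ultimately show ?thesis by blast
qed

section \<open>Antisymmetric functions and barriers\<close>

text \<open>The sign of the product tells whether y or its mirror image is nearer to x; all kernel
  comparisons rest on this identity.\<close>

lemma norm_hyp_reflect_sq:
  assumes e: "norm e = 1"
  shows "(norm (x - hyp_reflect e l y))\<^sup>2 = (norm (x - y))\<^sup>2 + 4 * ((x \<bullet> e - l) * (y \<bullet> e - l))"
proof -
  have ee: "e \<bullet> e = 1" using e by (simp add: norm_eq_1)
  have expand: "(z - c *\<^sub>R e) \<bullet> (z - c *\<^sub>R e) = z \<bullet> z - 2 * c * (z \<bullet> e) + c\<^sup>2" for z c
    by (simp add: inner_diff_left inner_diff_right inner_commute[of e z] ee power2_eq_square right_diff_distrib)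
  have "x - hyp_reflect e l y = (x - y) - (2 * (l - y \<bullet> e)) *\<^sub>R e" by (simp add: hyp_reflect_def)
  then have "(norm (x - hyp_reflect e l y))\<^sup>2 = ((x - y) - (2 * (l - y \<bullet> e)) *\<^sub>R e) \<bullet> ((x - y) - (2 * (l - y \<bullet> e)) *\<^sub>R e)"
    by (simp only: power2_norm_eq_inner)
  also have "\<dots> = (x - y) \<bullet> (x - y) - 2 * (2 * (l - y \<bullet> e)) * ((x - y) \<bullet> e) + (2 * (l - y \<bullet> e))\<^sup>2"
    by (rule expand)
  also have "\<dots> = (norm (x - y))\<^sup>2 + 4 * ((x \<bullet> e - l) * (y \<bullet> e - l))"
    unfolding power2_norm_eq_inner[symmetric] inner_diff_left by (simp add: power2_eq_square algebra_simps)
  finally show ?thesis .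
qed

lemma frac_kernel_reflect_same:
  assumes e: "norm e = 1" and s: "s > 0" and xy: "0 \<le> (x \<bullet> e - l) * (y \<bullet> e - l)" "x \<noteq> y"
  shows "frac_kernel s (x - hyp_reflect e l y) \<le> frac_kernel s (x - y)"
proof (rule frac_kernel_mono[OF s])
  have "(norm (x - y))\<^sup>2 \<le> (norm (x - hyp_reflect e l y))\<^sup>2"
    using xy(1) unfolding norm_hyp_reflect_sq[OF e] by linarith
  then show "norm (x - y) \<le> norm (x - hyp_reflect e l y)" by (rule power2_le_imp_le) simp
qed (use xy in simp)

lemma frac_kernel_reflect_opposite:
  assumes e: "norm e = 1" and s: "s > 0" and xy: "(x \<bullet> e - l) * (y \<bullet> e - l) \<le> 0" "x \<noteq> hyp_reflect e l y"
  shows "frac_kernel s (x - y) \<le> frac_kernel s (x - hyp_reflect e l y)"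
proof (rule frac_kernel_mono[OF s])
  have "(norm (x - hyp_reflect e l y))\<^sup>2 \<le> (norm (x - y))\<^sup>2"
    using xy(1) unfolding norm_hyp_reflect_sq[OF e] by linarith
  then show "norm (x - hyp_reflect e l y) \<le> norm (x - y)" by (rule power2_le_imp_le) simp
qed (use xy in simp)

text \<open>Here \<open>a\<close>, \<open>b\<close> are values oriented to be compared on one side,
  \<open>k\<close> weighs the pair on the same side and \<open>k'\<close> the mirrored pair. If the
  signs are mixed, the two sides of the first estimate differ by \<open>- a * b * (k - k')\<close>,
  or by 0 when both are negative or both nonnegative. The alternative \<open>a = b\<close> covers
  coinciding points, where the kernel has the value 0 and cannot be compared.\<close>

lemma four_point:
  fixes a b k k' :: real
  assumes k: "0 \<le> k'" "0 \<le> k" "k' \<le> k \<or> a = b"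
  defines "A \<equiv> max 0 a" and "B \<equiv> max 0 b"
  shows "(A - B)\<^sup>2 * k + (A + B)\<^sup>2 * k' \<le> (a - b) * (A - B) * k + (a + b) * (A + B) * k'"
    and "(A - B)\<^sup>2 * k + (A + B)\<^sup>2 * k' \<le> 2 * ((a - b)\<^sup>2 * k + (a + b)\<^sup>2 * k')"
proof -
  have mixed: "a\<^sup>2 * k + a\<^sup>2 * k' \<le> (a - b) * a * k + (a + b) * a * k'"
      "a\<^sup>2 * k + a\<^sup>2 * k' \<le> 2 * ((a - b)\<^sup>2 * k + (a + b)\<^sup>2 * k')"
    if "a \<ge> 0" "b \<le> 0" "k' \<le> k" for a b
  proof -
    have "0 \<le> (a * - b) * (k - k')" using that by (intro mult_nonneg_nonneg) auto
    then show "a\<^sup>2 * k + a\<^sup>2 * k' \<le> (a - b) * a * k + (a + b) * a * k'"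
      by (simp add: power2_eq_square algebra_simps)
    have "a\<^sup>2 * k + a\<^sup>2 * k' \<le> 2 * (a\<^sup>2 * k)" using mult_left_mono[OF that(3), of "a\<^sup>2"] by (simp add: mult.commute)
    also have "\<dots> \<le> 2 * ((a - b)\<^sup>2 * k)"
      using that k by (intro mult_left_mono mult_right_mono power_mono) auto
    also have "\<dots> \<le> 2 * ((a - b)\<^sup>2 * k + (a + b)\<^sup>2 * k')" using k by simp
    finally show "a\<^sup>2 * k + a\<^sup>2 * k' \<le> 2 * ((a - b)\<^sup>2 * k + (a + b)\<^sup>2 * k')" .
  qed
  have nn: "0 \<le> (a - b)\<^sup>2 * k + (a + b)\<^sup>2 * k'" using k by simp
  have dbl: "X \<le> 2 * X" if "0 \<le> X" for X :: real using that by simp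
  consider "a \<ge> 0" "b \<ge> 0" | "a \<ge> 0" "b < 0" | "a < 0" "b \<ge> 0" | "a < 0" "b < 0" by linarith
  then have "(A - B)\<^sup>2 * k + (A + B)\<^sup>2 * k' \<le> (a - b) * (A - B) * k + (a + b) * (A + B) * k' \<and>
    (A - B)\<^sup>2 * k + (A + B)\<^sup>2 * k' \<le> 2 * ((a - b)\<^sup>2 * k + (a + b)\<^sup>2 * k')"
  proof cases
    case 1
    then have AB: "A = a" "B = b" by (auto simp: A_def B_def)
    show ?thesis
    proof
      show "(A - B)\<^sup>2 * k + (A + B)\<^sup>2 * k' \<le> (a - b) * (A - B) * k + (a + b) * (A + B) * k'"
        unfolding AB by (simp add: power2_eq_square)
      show "(A - B)\<^sup>2 * k + (A + B)\<^sup>2 * k' \<le> 2 * ((a - b)\<^sup>2 * k + (a + b)\<^sup>2 * k')"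
        unfolding AB by (rule dbl[OF nn])
    qed
  next
    case 2
    then show ?thesis using mixed[of a b] k by (auto simp: A_def B_def)
  next
    case 3
    then have "k' \<le> k" using k by auto
    with mixed[of b a] 3 have "b\<^sup>2 * k + b\<^sup>2 * k' \<le> (b - a) * b * k + (b + a) * b * k'"
      "b\<^sup>2 * k + b\<^sup>2 * k' \<le> 2 * ((b - a)\<^sup>2 * k + (b + a)\<^sup>2 * k')" by auto
    then show ?thesis using 3 by (simp add: A_def B_def power2_commute[of a b] add.commute[of a b] left_diff_distrib)
  next
    case 4
    then show ?thesis using nn by (simp add: A_def B_def)
  qed
  then show "(A - B)\<^sup>2 * k + (A + B)\<^sup>2 * k' \<le> (a - b) * (A - B) * k + (a + b) * (A + B) * k'"
    and "(A - B)\<^sup>2 * k + (A + B)\<^sup>2 * k' \<le> 2 * ((a - b)\<^sup>2 * k + (a + b)\<^sup>2 * k')" by auto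
qed

text \<open>For an antisymmetric \<open>v\<close> this is its positive part on the half-space,
  extended antisymmetrically, since the reflection exchanges the two branches.\<close>

definition halfspace_trunc :: "'a::euclidean_space \<Rightarrow> real \<Rightarrow> ('a \<Rightarrow> real) \<Rightarrow> 'a \<Rightarrow> real" where
  "halfspace_trunc e l v x = (if x \<bullet> e > l then max 0 (v x) else min 0 (v x))"

lemma measurable_halfspace_trunc [measurable]:
  assumes [measurable]: "v \<in> borel_measurable borel"
  shows "halfspace_trunc e l v \<in> borel_measurable borel"
  unfolding halfspace_trunc_def[abs_def] by measurable

lemma abs_halfspace_trunc_le: "\<bar>halfspace_trunc e l v x\<bar> \<le> \<bar>v x\<bar>"
  by (auto simp: halfspace_trunc_def)

lemma halfspace_trunc_reflect:
  assumes e: "norm e = 1" and anti: "\<And>x. v (hyp_reflect e l x) = - v x"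
  shows "halfspace_trunc e l v (hyp_reflect e l x) = - halfspace_trunc e l v x"
proof (cases "x \<bullet> e = l")
  case True
  then have "hyp_reflect e l x = x" by (simp add: hyp_reflect_def)
  then have "v x = 0" using anti[of x] by simp
  then show ?thesis using \<open>hyp_reflect e l x = x\<close> by (simp add: halfspace_trunc_def)
next
  case False
  then show ?thesis
    by (auto simp: halfspace_trunc_def hyp_reflect_inner[OF e] anti max_def min_def)
qed

text \<open>The sign \<open>\<sigma>\<close> orients every value towards the upper half-space, which
  reduces the claim to \<open>four_point\<close>. If x and y lie on opposite sides, the mirror image
  of y is the nearer point and the two kernels change roles.\<close>

lemma halfspace_trunc_pointwise:
  fixes v :: "'a::euclidean_space \<Rightarrow> real"
  assumes e: "norm e = 1" and s: "s > 0" and anti: "\<And>x. v (hyp_reflect e l x) = - v x"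
  defines "\<psi> \<equiv> halfspace_trunc e l v"
  shows "(\<psi> x - \<psi> y)\<^sup>2 * frac_kernel s (x - y) + (\<psi> x + \<psi> y)\<^sup>2 * frac_kernel s (x - hyp_reflect e l y) \<le>
      (v x - v y) * (\<psi> x - \<psi> y) * frac_kernel s (x - y) + (v x + v y) * (\<psi> x + \<psi> y) * frac_kernel s (x - hyp_reflect e l y)"
    and "(\<psi> x - \<psi> y)\<^sup>2 * frac_kernel s (x - y) + (\<psi> x + \<psi> y)\<^sup>2 * frac_kernel s (x - hyp_reflect e l y) \<le>
      2 * ((v x - v y)\<^sup>2 * frac_kernel s (x - y) + (v x + v y)\<^sup>2 * frac_kernel s (x - hyp_reflect e l y))"
proof -
  let ?k = "frac_kernel s (x - y)" and ?k' = "frac_kernel s (x - hyp_reflect e l y)"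
  define \<sigma> where "\<sigma> z = (if z \<bullet> e > l then 1 else - 1 :: real)" for z
  have \<psi>: "\<psi> z = \<sigma> z * max 0 (\<sigma> z * v z)" for z
    by (simp add: \<psi>_def halfspace_trunc_def \<sigma>_def max_def min_def)
  define a b where "a = \<sigma> x * v x" and "b = \<sigma> y * v y"
  define A B where "A = max 0 a" and "B = max 0 b"
  have v: "v x = \<sigma> x * a" "v y = \<sigma> y * b" and \<psi>': "\<psi> x = \<sigma> x * A" "\<psi> y = \<sigma> y * B"
    by (auto simp: a_def b_def A_def B_def \<psi> \<sigma>_def)
  have "((\<psi> x - \<psi> y)\<^sup>2 * ?k + (\<psi> x + \<psi> y)\<^sup>2 * ?k' \<le> (v x - v y) * (\<psi> x - \<psi> y) * ?k + (v x + v y) * (\<psi> x + \<psi> y) * ?k') \<and>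
    ((\<psi> x - \<psi> y)\<^sup>2 * ?k + (\<psi> x + \<psi> y)\<^sup>2 * ?k' \<le> 2 * ((v x - v y)\<^sup>2 * ?k + (v x + v y)\<^sup>2 * ?k'))"
  proof (cases "\<sigma> x = \<sigma> y")
    case True
    have "?k' \<le> ?k \<or> a = b"
    proof (cases "x = y")
      case False
      have "0 \<le> (x \<bullet> e - l) * (y \<bullet> e - l)"
        using True by (auto simp: \<sigma>_def zero_le_mult_iff split: if_splits)
      then show ?thesis using frac_kernel_reflect_same[OF e s _ False] by blast
    qed (simp add: a_def b_def)
    note fp = four_point[of ?k' ?k a b, folded A_def B_def]
    have \<sigma>: "\<sigma> y = 1 \<or> \<sigma> y = - 1" by (simp add: \<sigma>_def)
    have "(\<psi> x - \<psi> y)\<^sup>2 = (A - B)\<^sup>2" "(\<psi> x + \<psi> y)\<^sup>2 = (A + B)\<^sup>2"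
      "(v x - v y) * (\<psi> x - \<psi> y) = (a - b) * (A - B)" "(v x + v y) * (\<psi> x + \<psi> y) = (a + b) * (A + B)"
      "(v x - v y)\<^sup>2 = (a - b)\<^sup>2" "(v x + v y)\<^sup>2 = (a + b)\<^sup>2"
      unfolding v \<psi>' True using \<sigma> by (auto simp: power2_eq_square algebra_simps)
    then show ?thesis using fp \<open>?k' \<le> ?k \<or> a = b\<close> by simp
  next
    case False
    have "?k \<le> ?k' \<or> a = b"
    \<comment> \<open>For mirror points the reflected kernel is taken at the origin, where its value
      is 0; antisymmetry provides \<open>a = b\<close> instead.\<close>
    proof (cases "x = hyp_reflect e l y")
      case True
      then have "v x = - v y" using anti by simp
      then show ?thesis using False by (auto simp: a_def b_def \<sigma>_def split: if_splits)
    next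
      case x: False
      have "(x \<bullet> e - l) * (y \<bullet> e - l) \<le> 0"
        using False by (auto simp: \<sigma>_def mult_le_0_iff split: if_splits)
      then show ?thesis using frac_kernel_reflect_opposite[OF e s _ x] by blast
    qed
    note fp = four_point[of ?k ?k' a b, folded A_def B_def]
    have \<sigma>: "\<sigma> x = - \<sigma> y" "\<sigma> y = 1 \<or> \<sigma> y = - 1" using False by (auto simp: \<sigma>_def split: if_splits)
    have "(\<psi> x - \<psi> y)\<^sup>2 = (A + B)\<^sup>2" "(\<psi> x + \<psi> y)\<^sup>2 = (A - B)\<^sup>2"
      "(v x - v y) * (\<psi> x - \<psi> y) = (a + b) * (A + B)" "(v x + v y) * (\<psi> x + \<psi> y) = (a - b) * (A - B)"
      "(v x - v y)\<^sup>2 = (a + b)\<^sup>2" "(v x + v y)\<^sup>2 = (a - b)\<^sup>2"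
      unfolding v \<psi>' \<sigma>(1) using \<sigma>(2) by (auto simp: power2_eq_square algebra_simps)
    then show ?thesis using fp \<open>?k \<le> ?k' \<or> a = b\<close> by (simp add: add.commute)
  qed
  then show "(\<psi> x - \<psi> y)\<^sup>2 * ?k + (\<psi> x + \<psi> y)\<^sup>2 * ?k' \<le> (v x - v y) * (\<psi> x - \<psi> y) * ?k + (v x + v y) * (\<psi> x + \<psi> y) * ?k'"
    and "(\<psi> x - \<psi> y)\<^sup>2 * ?k + (\<psi> x + \<psi> y)\<^sup>2 * ?k' \<le> 2 * ((v x - v y)\<^sup>2 * ?k + (v x + v y)\<^sup>2 * ?k')" by auto
qed

text \<open>Averaging the energy over \<open>(x, y)\<close> and \<open>(x, R y)\<close> turns the nonlocal interaction across the
  hyperplane into a pointwise comparison of the two kernels.\<close>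

lemma halfspace_trunc_energy:
  fixes v :: "'a::euclidean_space \<Rightarrow> real"
  assumes e: "norm e = 1" and s: "s > 0" and v: "finite_energy s v" and anti: "\<And>x. v (hyp_reflect e l x) = - v x"
  shows "finite_energy s (halfspace_trunc e l v)"
    and "energy s (halfspace_trunc e l v) (halfspace_trunc e l v) \<le> energy s v (halfspace_trunc e l v)"
proof -
  define \<psi> where "\<psi> = halfspace_trunc e l v"
  let ?R = "hyp_reflect e l"
  let ?T = "\<lambda>p::'a \<times> 'a. (fst p, ?R (snd p))"
  have [measurable]: "v \<in> borel_measurable borel" using v by (rule finite_energy_measurable)
  have [measurable]: "\<psi> \<in> borel_measurable borel" unfolding \<psi>_def by measurable
  have \<psi>anti: "\<psi> (?R x) = - \<psi> x" for x unfolding \<psi>_def by (rule halfspace_trunc_reflect[where v = v, OF e anti])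
  have T: "distr lborel borel ?T = lborel"
    by (rule lborel_distr_prod[where T = "\<lambda>x. x"]) (auto simp: lborel_distr_hyp_reflect[OF e] distr_id2)
  have Tm: "?T \<in> borel_measurable borel" unfolding borel_prod[symmetric] by measurable
  have DT: "diff_quot s f (?T p) * diff_quot s g (?T p) =
      (f (fst p) + f (snd p)) * (g (fst p) + g (snd p)) * frac_kernel s (fst p - ?R (snd p))"
    if "\<And>x. f (?R x) = - f x" "\<And>x. g (?R x) = - g x" for f g p
    using that by (simp add: diff_quot_mult)
  note pw = halfspace_trunc_pointwise[where v = v, OF e s anti, folded \<psi>_def]
  have vv: "integrable lborel (\<lambda>p. diff_quot s v p * diff_quot s v p)" by (rule energy_integrable[OF v v])
  have vvT: "integrable lborel (\<lambda>p. diff_quot s v (?T p) * diff_quot s v (?T p))"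
    using vv integrable_lborel_preserving[OF T Tm, of "\<lambda>p. diff_quot s v p * diff_quot s v p"] by simp
  have "integrable lborel (\<lambda>p. (diff_quot s \<psi> p)\<^sup>2)"
  proof (rule Bochner_Integration.integrable_bound)
    show "integrable lborel (\<lambda>p. 2 * (diff_quot s v p * diff_quot s v p + diff_quot s v (?T p) * diff_quot s v (?T p)))"
      by (intro integrable_mult_right Bochner_Integration.integrable_add vv vvT)
    show "AE p in lborel. norm ((diff_quot s \<psi> p)\<^sup>2) \<le>
        norm (2 * (diff_quot s v p * diff_quot s v p + diff_quot s v (?T p) * diff_quot s v (?T p)))"
    proof (rule AE_I2)
      fix p
      have "(diff_quot s \<psi> p)\<^sup>2 \<le> diff_quot s \<psi> p * diff_quot s \<psi> p + diff_quot s \<psi> (?T p) * diff_quot s \<psi> (?T p)"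
        by (simp add: power2_eq_square)
      also have "\<dots> \<le> 2 * (diff_quot s v p * diff_quot s v p + diff_quot s v (?T p) * diff_quot s v (?T p))"
        unfolding DT[where f = \<psi> and g = \<psi>, OF \<psi>anti \<psi>anti] DT[where f = v and g = v, OF anti anti] unfolding diff_quot_mult
        using pw(2)[of "fst p" "snd p"] by (simp only: power2_eq_square)
      finally show "norm ((diff_quot s \<psi> p)\<^sup>2) \<le>
        norm (2 * (diff_quot s v p * diff_quot s v p + diff_quot s v (?T p) * diff_quot s v (?T p)))" by simp
    qed
  qed measurable
  then have fe: "finite_energy s \<psi>" by (simp add: finite_energy_def sq_integrable_def)
  then show "finite_energy s (halfspace_trunc e l v)" by (simp add: \<psi>_def)
  have sym: "2 * energy s f g = (\<integral>p. diff_quot s f p * diff_quot s g p + diff_quot s f (?T p) * diff_quot s g (?T p) \<partial>lborel)"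
    and symi: "integrable lborel (\<lambda>p. diff_quot s f p * diff_quot s g p + diff_quot s f (?T p) * diff_quot s g (?T p))"
    if fg: "finite_energy s f" "finite_energy s g" for f g
  proof -
    let ?h = "\<lambda>p. diff_quot s f p * diff_quot s g p"
    have i: "integrable lborel ?h" by (rule energy_integrable[OF fg])
    then have hm: "?h \<in> borel_measurable borel" by (auto dest: borel_measurable_integrable)
    have iT: "integrable lborel (\<lambda>p. ?h (?T p))" using i integrable_lborel_preserving[OF T Tm hm] by simp
    show "integrable lborel (\<lambda>p. ?h p + ?h (?T p))" using i iT by simp
    show "2 * energy s f g = (\<integral>p. ?h p + ?h (?T p) \<partial>lborel)"
      using i iT integral_lborel_preserving[OF T Tm hm] by (simp add: energy_def)
  qed
  have "2 * energy s \<psi> \<psi> \<le> 2 * energy s v \<psi>"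
    unfolding sym[OF fe fe] sym[OF v fe]
  proof (rule integral_mono[OF symi[OF fe fe] symi[OF v fe]])
    show "diff_quot s \<psi> p * diff_quot s \<psi> p + diff_quot s \<psi> (?T p) * diff_quot s \<psi> (?T p) \<le>
        diff_quot s v p * diff_quot s \<psi> p + diff_quot s v (?T p) * diff_quot s \<psi> (?T p)" for p
      unfolding DT[where f = \<psi> and g = \<psi>, OF \<psi>anti \<psi>anti] DT[where f = v and g = \<psi>, OF anti \<psi>anti] unfolding diff_quot_mult
      using pw(1)[of "fst p" "snd p"] by (simp only: power2_eq_square)
  qed
  then show "energy s (halfspace_trunc e l v) (halfspace_trunc e l v) \<le> energy s v (halfspace_trunc e l v)"
    by (simp add: \<psi>_def)
qed

text \<open>The positive part of the paraboloid 1 - |x - c|^2 / r^2. As a maximum of two functions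
  with Hessian at least -2 / r^2 it is semiconvex, and that bounds its fractional Laplacian from
  above.\<close>

definition bump :: "'a::euclidean_space \<Rightarrow> real \<Rightarrow> 'a \<Rightarrow> real" where
  "bump c r x = 1 - (min (norm (x - c)) r)\<^sup>2 / r\<^sup>2"

lemma bump_bounds:
  assumes "r > 0"
  shows "0 \<le> bump c r x" "bump c r x \<le> 1" "norm (x - c) \<ge> r \<Longrightarrow> bump c r x = 0" "bump c r c = 1"
    and "norm (x - c) < r \<Longrightarrow> bump c r x > 0"
proof -
  have "(min (norm (x - c)) r)\<^sup>2 \<le> r\<^sup>2" using assms by (intro power_mono) auto
  then show "0 \<le> bump c r x" using assms by (simp add: bump_def)
  show "bump c r x \<le> 1" by (simp add: bump_def)
  show "bump c r x = 0" if "norm (x - c) \<ge> r" using that assms by (simp add: bump_def min_def)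
  show "bump c r c = 1" using assms by (simp add: bump_def)
  show "bump c r x > 0" if "norm (x - c) < r"
  proof -
    have "(norm (x - c))\<^sup>2 < r\<^sup>2" using that by (intro power_strict_mono) auto
    then show ?thesis using that assms by (simp add: bump_def min_def)
  qed
qed

lemma bump_Lipschitz:
  assumes r: "r > 0"
  shows "\<bar>bump c r x - bump c r y\<bar> \<le> (2 / r) * norm (x - y)"
proof -
  define a b where "a = min (norm (x - c)) r" and "b = min (norm (y - c)) r"
  have ab: "0 \<le> a" "a \<le> r" "0 \<le> b" "b \<le> r" using r by (auto simp: a_def b_def)
  have "\<bar>b - a\<bar> \<le> \<bar>norm (y - c) - norm (x - c)\<bar>" by (auto simp: a_def b_def min_def)
  also have "\<dots> \<le> norm (y - x)" using norm_triangle_ineq3[of "y - c" "x - c"] by simp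
  finally have 1: "\<bar>b - a\<bar> \<le> norm (x - y)" by (simp add: norm_minus_commute)
  have "bump c r x - bump c r y = (b - a) * (b + a) / r\<^sup>2"
    using r by (simp add: bump_def a_def[symmetric] b_def[symmetric] diff_divide_distrib[symmetric] power2_eq_square algebra_simps)
  then have "\<bar>bump c r x - bump c r y\<bar> = \<bar>b - a\<bar> * (b + a) / r\<^sup>2" using ab by (simp add: abs_mult)
  also have "\<dots> \<le> norm (x - y) * (2 * r) / r\<^sup>2"
    using ab 1 by (intro divide_right_mono mult_mono) auto
  also have "\<dots> = (2 / r) * norm (x - y)" using r by (simp add: power2_eq_square)
  finally show ?thesis .
qed

lemma bump_regular:
  fixes c :: "'a::euclidean_space"
  assumes s: "0 < s" "s < 1" and r: "r > 0"
  shows "finite_energy s (bump c r)" "sq_integrable (bump c r)" "continuous_on UNIV (bump c r)" "integrable lborel (bump c r)"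
proof -
  have supp: "bump c r x = 0" if "norm x \<ge> norm c + r" for x
    using that norm_triangle_ineq2[of x c] bump_bounds(3)[OF r, where x = x and c = c] by simp
  show "finite_energy s (bump c r)" "sq_integrable (bump c r)" "continuous_on UNIV (bump c r)"
    using finite_energy_Lipschitz[OF s bump_Lipschitz[OF r] supp] by auto
  then have m: "bump c r \<in> borel_measurable borel" by (intro sq_integrable_measurable)
  have "\<bar>bump c r x\<bar> \<le> 1" for x using bump_bounds(1,2)[OF r, where c = c and x = x] by simp
  from sq_integrable_bounded_support(2)[OF m this supp] show "integrable lborel (bump c r)" .
qed

text \<open>Inside the ball the paraboloid lies below the bump and touches it at x, so the
  parallelogram law gives the quadratic bound. Outside, the bump is at its minimum 0.\<close>

lemma bump_second_difference:
  assumes r: "r > 0"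
  shows "2 * bump c r x - bump c r (x + h) - bump c r (x - h) \<le> min 2 (2 / r\<^sup>2 * (norm h)\<^sup>2)"
proof -
  have lower: "1 - (norm (y - c))\<^sup>2 / r\<^sup>2 \<le> bump c r y" for y
    using r by (auto simp: bump_def intro!: divide_right_mono power_mono)
  note b = bump_bounds(1-3)[OF r, where c = c]
  have "2 * bump c r x - bump c r (x + h) - bump c r (x - h) \<le> 2"
    using b(2)[of x] b(1)[of "x + h"] b(1)[of "x - h"] by linarith
  moreover have "2 * bump c r x - bump c r (x + h) - bump c r (x - h) \<le> 2 / r\<^sup>2 * (norm h)\<^sup>2"
  proof (cases "norm (x - c) < r")
    case True
    have par: "(norm (x + h - c))\<^sup>2 + (norm (x - h - c))\<^sup>2 = 2 * (norm (x - c))\<^sup>2 + 2 * (norm h)\<^sup>2"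
      by (simp add: power2_norm_eq_inner inner_add_left inner_add_right inner_diff_left inner_diff_right inner_commute)
    have x: "bump c r x = 1 - (norm (x - c))\<^sup>2 / r\<^sup>2" using True by (simp add: bump_def)
    have "2 * bump c r x - bump c r (x + h) - bump c r (x - h) \<le>
        ((norm (x + h - c))\<^sup>2 + (norm (x - h - c))\<^sup>2 - 2 * (norm (x - c))\<^sup>2) / r\<^sup>2"
      using lower[of "x + h"] lower[of "x - h"] unfolding x by (simp add: add_divide_distrib diff_divide_distrib)
    then show ?thesis unfolding par by simp
  next
    case False
    then have "bump c r x = 0" using b(3)[of x] by simp
    moreover have "0 \<le> 2 / r\<^sup>2 * (norm h)\<^sup>2" by simp
    ultimately show ?thesis using b(1)[of "x + h"] b(1)[of "x - h"] by linarith
  qed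
  ultimately show ?thesis by simp
qed

lemma integral_lborel_pair_snd:
  fixes f :: "'a::euclidean_space \<times> 'b::euclidean_space \<Rightarrow> real"
  assumes "integrable lborel f"
  shows "(\<integral>p. f p \<partial>lborel) = (\<integral>y. (\<integral>x. f (x, y) \<partial>lborel) \<partial>lborel)"
    and "integrable lborel (\<lambda>y. \<integral>x. f (x, y) \<partial>lborel)"
proof -
  have i: "integrable (lborel \<Otimes>\<^sub>M lborel) (case_prod (\<lambda>x y. f (x, y)))"
    using assms by (simp add: lborel_prod case_prod_unfold)
  show "(\<integral>p. f p \<partial>lborel) = (\<integral>y. (\<integral>x. f (x, y) \<partial>lborel) \<partial>lborel)"
    using lborel_pair.integral_snd[OF i] by (simp add: lborel_prod case_prod_unfold)
  show "integrable lborel (\<lambda>y. \<integral>x. f (x, y) \<partial>lborel)"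
    using lborel_pair.integrable_snd[OF i] .
qed

text \<open>For fixed \<open>h\<close> the inner integral over \<open>x\<close> is a second difference of the bump tested with \<open>\<phi>\<close>,
  so semiconvexity suffices and no principal value is needed.\<close>

lemma energy_bump_upper:
  fixes \<phi> :: "'a::euclidean_space \<Rightarrow> real"
  assumes s: "0 < s" "s < 1" and r: "r > 0"
    and \<phi>: "finite_energy s \<phi>" "integrable lborel \<phi>" "\<And>x. \<phi> x \<ge> 0"
  shows "energy s (bump c r) \<phi> \<le> (\<integral>h. min 2 (2 / r\<^sup>2 * (norm h)\<^sup>2) * frac_kernel s h \<partial>(lborel :: 'a measure)) * (\<integral>x. \<phi> x \<partial>lborel)"
proof -
  let ?\<eta> = "bump c r"
  have [measurable]: "\<phi> \<in> borel_measurable borel" using \<phi>(1) by (rule finite_energy_measurable)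
  have [measurable]: "?\<eta> \<in> borel_measurable borel" using bump_regular(2)[OF s r] by (rule sq_integrable_measurable)
  define G where "G p = (?\<eta> (fst p) - ?\<eta> (fst p - snd p)) * (\<phi> (fst p) - \<phi> (fst p - snd p)) * frac_kernel s (snd p)" for p :: "'a \<times> 'a"
  have Gm: "G \<in> borel_measurable borel" unfolding G_def borel_prod[symmetric] by measurable
  have GE: "G (fst p, fst p - snd p) = diff_quot s ?\<eta> p * diff_quot s \<phi> p" for p
    by (simp add: G_def diff_quot_mult)
  have Gi: "integrable lborel G"
    using integrable_lborel_preserving[OF lborel_distr_shear measurable_shear Gm] energy_integrable[OF bump_regular(1)[OF s r, where c = c] \<phi>(1)]
    unfolding GE by simp
  have E: "energy s ?\<eta> \<phi> = (\<integral>h. (\<integral>x. G (x, h) \<partial>lborel) \<partial>lborel)"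
    using integral_lborel_preserving[OF lborel_distr_shear measurable_shear Gm] integral_lborel_pair_snd(1)[OF Gi]
    unfolding GE by (simp add: energy_def)
  have \<eta>b: "\<bar>?\<eta> x\<bar> \<le> 1" for x using bump_bounds(1,2)[OF r, where c = c and x = x] by simp
  have inner: "(\<integral>x. G (x, h) \<partial>lborel) \<le> (\<integral>x. \<phi> x \<partial>lborel) * (min 2 (2 / r\<^sup>2 * (norm h)\<^sup>2) * frac_kernel s h)" for h
  proof -
    have i1: "integrable lborel (\<lambda>x. ?\<eta> (x + a) * \<phi> (x + b))" for a b
    proof (rule Bochner_Integration.integrable_bound)
      show "integrable lborel (\<lambda>x. \<phi> (x + b))"
        using \<phi>(2) by (subst integrable_lborel_preserving[OF lborel_distr_add]) auto
      show "AE x in lborel. norm (?\<eta> (x + a) * \<phi> (x + b)) \<le> norm (\<phi> (x + b))"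
        using \<eta>b by (auto simp: abs_mult intro!: mult_left_le_one_le)
    qed measurable
    \<comment> \<open>Shifting the variable in the products containing \<open>\<phi> (x - h)\<close>
      moves all increments onto the bump.\<close>
    have sh: "(\<integral>x. ?\<eta> (x + a) * \<phi> (x + - h) \<partial>lborel) = (\<integral>x. ?\<eta> (x + a + h) * \<phi> x \<partial>lborel)" for a
      using integral_lborel_preserving[OF lborel_distr_add, of h "\<lambda>x. ?\<eta> (x + a) * \<phi> (x + - h)"]
      by (simp add: algebra_simps)
    have "(\<integral>x. G (x, h) \<partial>lborel) = (\<integral>x. (?\<eta> x - ?\<eta> (x - h)) * (\<phi> x - \<phi> (x - h)) \<partial>lborel) * frac_kernel s h"
      by (simp add: G_def)
    also have "(\<integral>x. (?\<eta> x - ?\<eta> (x - h)) * (\<phi> x - \<phi> (x - h)) \<partial>lborel) =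
        (\<integral>x. (?\<eta> (x + 0) * \<phi> (x + 0) - ?\<eta> (x + - h) * \<phi> (x + 0)) - (?\<eta> (x + 0) * \<phi> (x + - h) - ?\<eta> (x + - h) * \<phi> (x + - h)) \<partial>lborel)"
      by (intro Bochner_Integration.integral_cong) (auto simp: algebra_simps)
    also have "\<dots> = ((\<integral>x. ?\<eta> (x + 0) * \<phi> (x + 0) \<partial>lborel) - (\<integral>x. ?\<eta> (x + - h) * \<phi> (x + 0) \<partial>lborel)) -
        ((\<integral>x. ?\<eta> (x + 0) * \<phi> (x + - h) \<partial>lborel) - (\<integral>x. ?\<eta> (x + - h) * \<phi> (x + - h) \<partial>lborel))"
      by (simp only: Bochner_Integration.integral_diff Bochner_Integration.integrable_diff i1)
    also have "\<dots> = (\<integral>x. (2 * ?\<eta> x - ?\<eta> (x + h) - ?\<eta> (x - h)) * \<phi> x \<partial>lborel)"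
    proof -
      have "(\<integral>x. (2 * ?\<eta> x - ?\<eta> (x + h) - ?\<eta> (x - h)) * \<phi> x \<partial>lborel) =
          (\<integral>x. 2 * (?\<eta> (x + 0) * \<phi> (x + 0)) - ?\<eta> (x + h) * \<phi> (x + 0) - ?\<eta> (x + - h) * \<phi> (x + 0) \<partial>lborel)"
        by (intro Bochner_Integration.integral_cong) (auto simp: algebra_simps)
      also have "\<dots> = 2 * (\<integral>x. ?\<eta> (x + 0) * \<phi> (x + 0) \<partial>lborel) - (\<integral>x. ?\<eta> (x + h) * \<phi> (x + 0) \<partial>lborel) - (\<integral>x. ?\<eta> (x + - h) * \<phi> (x + 0) \<partial>lborel)"
        by (simp only: Bochner_Integration.integral_diff Bochner_Integration.integrable_diff i1 integrable_mult_right integral_mult_right_zero)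
      finally show ?thesis using sh[of 0] sh[of "- h"] by simp
    qed
    also have "\<dots> \<le> (\<integral>x. min 2 (2 / r\<^sup>2 * (norm h)\<^sup>2) * \<phi> x \<partial>lborel)"
    proof (rule integral_mono')
      show "integrable lborel (\<lambda>x. min 2 (2 / r\<^sup>2 * (norm h)\<^sup>2) * \<phi> x)" using \<phi>(2) by (rule integrable_mult_right)
      show "(2 * ?\<eta> x - ?\<eta> (x + h) - ?\<eta> (x - h)) * \<phi> x \<le> min 2 (2 / r\<^sup>2 * (norm h)\<^sup>2) * \<phi> x" for x
        by (intro mult_right_mono bump_second_difference r \<phi>)
      show "0 \<le> min 2 (2 / r\<^sup>2 * (norm h)\<^sup>2) * \<phi> x" for x using \<phi>(3) by simp
    qed
    finally have "(\<integral>x. G (x, h) \<partial>lborel) \<le> min 2 (2 / r\<^sup>2 * (norm h)\<^sup>2) * (\<integral>x. \<phi> x \<partial>lborel) * frac_kernel s h"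
      by (simp add: mult_right_mono)
    then show ?thesis by (simp add: mult_ac)
  qed
  have "energy s ?\<eta> \<phi> \<le> (\<integral>h. (\<integral>x. \<phi> x \<partial>lborel) * (min 2 (2 / r\<^sup>2 * (norm h)\<^sup>2) * frac_kernel s (h::'a)) \<partial>lborel)"
    unfolding E
  proof (rule integral_mono[OF integral_lborel_pair_snd(2)[OF Gi] _ inner])
    show "integrable lborel (\<lambda>h. (\<integral>x. \<phi> x \<partial>lborel) * (min 2 (2 / r\<^sup>2 * (norm h)\<^sup>2) * frac_kernel s (h::'a)))"
      using s by (intro integrable_mult_right frac_kernel_levy_const) auto
  qed
  then show ?thesis by (simp add: mult.commute)
qed

text \<open>With disjoint supports only the cross terms of the product of increments survive; they
  are equal after swapping the variables and have a negative sign.\<close>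

lemma energy_disjoint:
  fixes f g :: "'a::euclidean_space \<Rightarrow> real"
  assumes f: "finite_energy s f" "\<And>x. f x \<ge> 0" and g: "finite_energy s g" "\<And>x. g x \<ge> 0"
    and disj: "\<And>x. f x = 0 \<or> g x = 0"
  shows "integrable lborel (\<lambda>p. f (fst p) * g (snd p) * frac_kernel s (fst p - snd p))"
    and "energy s f g = - 2 * (\<integral>p. f (fst p) * g (snd p) * frac_kernel s (fst p - snd p) \<partial>lborel)"
proof -
  let ?h = "\<lambda>p. f (fst p) * g (snd p) * frac_kernel s (fst p - snd p)"
  have [measurable]: "f \<in> borel_measurable borel" "g \<in> borel_measurable borel"
    using f g by (auto dest: finite_energy_measurable)
  have hm: "?h \<in> borel_measurable borel" unfolding borel_prod[symmetric] by measurable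
  have eq: "diff_quot s f p * diff_quot s g p = - (?h p + ?h (prod.swap p))" for p
  proof -
    have "(f (fst p) - f (snd p)) * (g (fst p) - g (snd p)) = - (f (fst p) * g (snd p) + f (snd p) * g (fst p))"
      using disj[of "fst p"] disj[of "snd p"] by (auto simp: algebra_simps)
    then show ?thesis by (simp add: diff_quot_mult frac_kernel_commute[of s "snd p" "fst p"] distrib_right left_diff_distrib)
  qed
  have i: "integrable lborel (\<lambda>p. diff_quot s f p * diff_quot s g p)" by (rule energy_integrable[OF f(1) g(1)])
  show hi: "integrable lborel ?h"
  proof (rule Bochner_Integration.integrable_bound[OF i])
    show "AE p in lborel. norm (?h p) \<le> norm (diff_quot s f p * diff_quot s g p)"
    proof (rule AE_I2)
      fix p
      have "0 \<le> ?h p" "0 \<le> ?h (prod.swap p)" using f g by simp_all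
      then show "norm (?h p) \<le> norm (diff_quot s f p * diff_quot s g p)" unfolding eq by simp
    qed
  qed (use hm in simp)
  have hs: "integrable lborel (\<lambda>p. ?h (prod.swap p))"
    using hi integrable_lborel_preserving[OF lborel_distr_swap measurable_swap hm] by simp
  have "energy s f g = - ((\<integral>p. ?h p \<partial>lborel) + (\<integral>p. ?h (prod.swap p) \<partial>lborel))"
    unfolding energy_def eq using hi hs by simp
  then show "energy s f g = - 2 * (\<integral>p. ?h p \<partial>lborel)"
    using integral_lborel_preserving[OF lborel_distr_swap measurable_swap hm] by simp
qed

lemma integral_kernel_bounds:
  fixes f g :: "'a::euclidean_space \<Rightarrow> real"
  assumes f: "integrable lborel f" "\<And>x. f x \<ge> 0" and g: "integrable lborel g" "\<And>x. g x \<ge> 0"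
    and i: "integrable lborel (\<lambda>p. f (fst p) * g (snd p) * K p)"
  shows "(\<And>x y. f x \<noteq> 0 \<Longrightarrow> g y \<noteq> 0 \<Longrightarrow> c \<le> K (x, y)) \<Longrightarrow>
      c * ((\<integral>x. f x \<partial>lborel) * (\<integral>x. g x \<partial>lborel)) \<le> (\<integral>p. f (fst p) * g (snd p) * K p \<partial>lborel)"
    and "(\<And>x y. f x \<noteq> 0 \<Longrightarrow> g y \<noteq> 0 \<Longrightarrow> K (x, y) \<le> c) \<Longrightarrow>
      (\<integral>p. f (fst p) * g (snd p) * K p \<partial>lborel) \<le> c * ((\<integral>x. f x \<partial>lborel) * (\<integral>x. g x \<partial>lborel))"
proof -
  have fg: "integrable lborel (\<lambda>p. f (fst p) * g (snd p))" by (rule integrable_lborel_fst_times_snd[OF f(1) g(1)])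
  have fgI: "(\<integral>p. c * (f (fst p) * g (snd p)) \<partial>lborel) = c * ((\<integral>x. f x \<partial>lborel) * (\<integral>x. g x \<partial>lborel))"
    using integral_lborel_pair[OF fg] by simp
  have pos: "0 \<le> f x * g y" for x y using f(2) g(2) by simp
  show "c * ((\<integral>x. f x \<partial>lborel) * (\<integral>x. g x \<partial>lborel)) \<le> (\<integral>p. f (fst p) * g (snd p) * K p \<partial>lborel)"
    if K: "\<And>x y. f x \<noteq> 0 \<Longrightarrow> g y \<noteq> 0 \<Longrightarrow> c \<le> K (x, y)"
    unfolding fgI[symmetric]
  proof (rule integral_mono[OF integrable_mult_right[OF fg] i])
    fix p :: "'a \<times> 'a"
    show "c * (f (fst p) * g (snd p)) \<le> f (fst p) * g (snd p) * K p"
      using K[of "fst p" "snd p"] mult_left_mono[OF _ pos, of c "K p" "fst p" "snd p"]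
      by (cases "f (fst p) = 0 \<or> g (snd p) = 0") (auto simp: mult_ac)
  qed
  show "(\<integral>p. f (fst p) * g (snd p) * K p \<partial>lborel) \<le> c * ((\<integral>x. f x \<partial>lborel) * (\<integral>x. g x \<partial>lborel))"
    if K: "\<And>x y. f x \<noteq> 0 \<Longrightarrow> g y \<noteq> 0 \<Longrightarrow> K (x, y) \<le> c"
    unfolding fgI[symmetric]
  proof (rule integral_mono[OF i integrable_mult_right[OF fg]])
    fix p :: "'a \<times> 'a"
    show "f (fst p) * g (snd p) * K p \<le> c * (f (fst p) * g (snd p))"
      using K[of "fst p" "snd p"] mult_left_mono[OF _ pos, of "K p" c "fst p" "snd p"]
      by (cases "f (fst p) = 0 \<or> g (snd p) = 0") (auto simp: mult_ac)
  qed
qed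

text \<open>For two points strictly on the same side the mirrored kernel is strictly smaller.
  Compactness of the product of the balls, which avoids both singularities, makes the gap
  uniform.\<close>

lemma frac_kernel_gap:
  fixes e x1 x2 :: "'a::euclidean_space"
  assumes e: "norm e = 1" and s: "s > 0"
    and H1: "\<And>y. y \<in> cball x1 r1 \<Longrightarrow> y \<bullet> e > l" and H2: "\<And>x. x \<in> cball x2 r2 \<Longrightarrow> x \<bullet> e > l"
    and disj: "cball x1 r1 \<inter> cball x2 r2 = {}" and r: "r1 \<ge> 0" "r2 \<ge> 0"
  shows "\<exists>c>0. \<forall>x\<in>cball x2 r2. \<forall>y\<in>cball x1 r1. c \<le> frac_kernel s (x - y) - frac_kernel s (x - hyp_reflect e l y)"
proof -
  let ?K = "cball x2 r2 \<times> cball x1 r1"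
  let ?f = "\<lambda>p. frac_kernel s (fst p - snd p) - frac_kernel s (fst p - hyp_reflect e l (snd p))"
  have ne: "x - y \<noteq> 0" "x - hyp_reflect e l y \<noteq> 0" if "x \<in> cball x2 r2" "y \<in> cball x1 r1" for x y
  proof -
    show "x - y \<noteq> 0" using that disj by auto
    have "hyp_reflect e l y \<bullet> e < l" using H1[OF that(2)] by (simp add: hyp_reflect_inner[OF e])
    then show "x - hyp_reflect e l y \<noteq> 0" using H2[OF that(1)] by auto
  qed
  have "continuous_on ?K ?f"
    unfolding frac_kernel_def hyp_reflect_def
    by (intro continuous_intros) (use ne in \<open>auto simp: hyp_reflect_def\<close>)
  moreover have "compact ?K" by (intro compact_Times compact_cball)
  moreover have "?K \<noteq> {}" using r by auto
  ultimately obtain p0 where p0: "p0 \<in> ?K" "\<And>p. p \<in> ?K \<Longrightarrow> ?f p0 \<le> ?f p"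
    using continuous_attains_inf[of ?K ?f] by blast
  obtain x0 y0 where xy: "p0 = (x0, y0)" "x0 \<in> cball x2 r2" "y0 \<in> cball x1 r1" using p0(1) by (cases p0) auto
  have "(norm (x0 - y0))\<^sup>2 < (norm (x0 - hyp_reflect e l y0))\<^sup>2"
    using mult_pos_pos[of "x0 \<bullet> e - l" "y0 \<bullet> e - l"] H1[OF xy(3)] H2[OF xy(2)] unfolding norm_hyp_reflect_sq[OF e] by simp
  then have "norm (x0 - y0) < norm (x0 - hyp_reflect e l y0)" by (rule power2_less_imp_less) simp
  then have "?f p0 > 0" using frac_kernel_strict_mono[OF s ne(1)[OF xy(2,3)]] by (simp add: xy)
  moreover have "?f p0 \<le> frac_kernel s (x - y) - frac_kernel s (x - hyp_reflect e l y)"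
    if "x \<in> cball x2 r2" "y \<in> cball x1 r1" for x y using p0(2)[of "(x, y)"] that by simp
  ultimately show ?thesis by blast
qed

section \<open>Moving planes\<close>

text \<open>The linear term is absorbed into \<open>nonlin\<close>, and continuity together with the
  range \<open>[0, 1]\<close> everywhere permits pointwise reasoning from here on.\<close>

locale continuous_solution =
  fixes s p q \<epsilon> \<kappa> :: real and u :: "'a::euclidean_space \<Rightarrow> real"
  assumes s: "0 < s" "s < 1" and pq: "p > 2" "q > p" "\<epsilon> > 0" and \<kappa>: "\<kappa> > 0"
    and cont: "continuous_on UNIV u" and range01: "\<And>x. u x \<in> {0..1}"
    and usq: "sq_integrable u" and ufe: "finite_energy s u"
    and weak: "\<And>\<phi> M. sq_integrable \<phi> \<Longrightarrow> finite_energy s \<phi> \<Longrightarrow> (\<forall>x. \<bar>\<phi> x\<bar> \<le> M) \<Longrightarrow>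
      \<kappa> * energy s u \<phi> = (\<integral>x. nonlin p q \<epsilon> (u x) * \<phi> x \<partial>lborel)"
    and nonzero: "\<exists>x. u x \<noteq> 0"
begin

abbreviation F :: "real \<Rightarrow> real" where "F \<equiv> nonlin p q \<epsilon>"
abbreviation L :: real where "L \<equiv> p + q + \<epsilon>"
abbreviation R :: "'a \<Rightarrow> real \<Rightarrow> 'a \<Rightarrow> 'a" where "R \<equiv> hyp_reflect"

lemma umeas [measurable]: "u \<in> borel_measurable borel"
  using usq by (rule sq_integrable_measurable)

lemma L_pos: "L > 0" using pq by simp

lemma F_Lipschitz: "\<bar>F (u x) - F (u y)\<bar> \<le> L * \<bar>u x - u y\<bar>"
  using pq by (intro nonlin_Lipschitz range01) auto

lemma F_sq: "sq_integrable (\<lambda>x. F (u x))"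
  by (rule sq_integrable_bound[OF usq, of _ L]) (use pq in \<open>auto intro!: nonlin_bound range01\<close>)

lemma reflect_sq: "norm e = 1 \<Longrightarrow> sq_integrable f \<Longrightarrow> sq_integrable (\<lambda>x. f (R e l x))"
  by (rule sq_integrable_comp[OF lborel_distr_hyp_reflect]) auto

lemma reflect_fe: "norm e = 1 \<Longrightarrow> finite_energy s f \<Longrightarrow> finite_energy s (\<lambda>x. f (R e l x))"
  by (rule finite_energy_comp(1)[OF lborel_distr_hyp_reflect measurable_hyp_reflect norm_hyp_reflect_diff])

lemma reflect_energy:
  "norm e = 1 \<Longrightarrow> finite_energy s f \<Longrightarrow> finite_energy s g \<Longrightarrow>
    energy s (\<lambda>x. f (R e l x)) (\<lambda>x. g (R e l x)) = energy s f g"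
  by (rule finite_energy_comp(2)[OF lborel_distr_hyp_reflect measurable_hyp_reflect norm_hyp_reflect_diff])

text \<open>The reflection leaves the energy unchanged and reverses the sign of
  \<open>\<psi>\<close>, so the reflected term contributes the same amount again.\<close>

lemma reflect_energy_antisymmetric:
  assumes e: "norm e = 1" and f: "finite_energy s f" and \<psi>: "finite_energy s \<psi>" "\<And>x. \<psi> (R e l x) = - \<psi> x"
  shows "energy s (\<lambda>x. f x - f (R e l x)) \<psi> = 2 * energy s f \<psi>"
proof -
  have "energy s (\<lambda>x. f (R e l x)) (\<lambda>x. \<psi> (R e l x)) = energy s f \<psi>" by (rule reflect_energy[OF e f \<psi>(1)])
  moreover have "(\<lambda>x. \<psi> (R e l x)) = (\<lambda>x. - 1 * \<psi> x)" using \<psi>(2) by auto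
  ultimately have "energy s (\<lambda>x. f (R e l x)) \<psi> = - energy s f \<psi>"
    using energy_cmult_left[of s "- 1" \<psi> "\<lambda>x. f (R e l x)"]
    by (simp add: energy_commute[of s "\<lambda>x. f (R e l x)"])
  then show ?thesis using energy_diff_left[OF f reflect_fe[OF e f, of l] \<psi>(1)] by simp
qed

lemma reflect_weak:
  assumes e: "norm e = 1" and \<psi>: "sq_integrable \<psi>" "finite_energy s \<psi>" "\<forall>x. \<bar>\<psi> x\<bar> \<le> M" "\<And>x. \<psi> (R e l x) = - \<psi> x"
  shows "\<kappa> * energy s (\<lambda>x. u x - u (R e l x)) \<psi> = (\<integral>x. (F (u x) - F (u (R e l x))) * \<psi> x \<partial>lborel)"
    and "integrable lborel (\<lambda>x. (F (u x) - F (u (R e l x))) * \<psi> x)"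
proof -
  have [measurable]: "\<psi> \<in> borel_measurable borel" using \<psi>(1) by (rule sq_integrable_measurable)
  have i1: "integrable lborel (\<lambda>x. F (u x) * \<psi> x)" by (rule sq_integrable_mult[OF F_sq \<psi>(1)])
  have i2: "integrable lborel (\<lambda>x. F (u (R e l x)) * \<psi> x)"
    by (rule sq_integrable_mult[OF reflect_sq[OF e F_sq] \<psi>(1)])
  show "integrable lborel (\<lambda>x. (F (u x) - F (u (R e l x))) * \<psi> x)"
    using i1 i2 by (simp add: left_diff_distrib)
  have "(\<integral>x. F (u (R e l x)) * \<psi> x \<partial>lborel) = (\<integral>x. F (u (R e l (R e l x))) * \<psi> (R e l x) \<partial>lborel)"
    by (rule integral_lborel_preserving[OF lborel_distr_hyp_reflect[OF e], symmetric]) measurable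
  also have "\<dots> = - (\<integral>x. F (u x) * \<psi> x \<partial>lborel)" using e \<psi>(4) by simp
  finally have "(\<integral>x. (F (u x) - F (u (R e l x))) * \<psi> x \<partial>lborel) = 2 * (\<integral>x. F (u x) * \<psi> x \<partial>lborel)"
    using i1 i2 by (simp add: left_diff_distrib)
  then show "\<kappa> * energy s (\<lambda>x. u x - u (R e l x)) \<psi> = (\<integral>x. (F (u x) - F (u (R e l x))) * \<psi> x \<partial>lborel)"
    using weak[OF \<psi>(1-3)] reflect_energy_antisymmetric[OF e ufe \<psi>(2) \<psi>(4)] by simp
qed

definition ordered :: "'a \<Rightarrow> real \<Rightarrow> bool" where
  "ordered e l \<longleftrightarrow> (\<forall>x. x \<bullet> e > l \<longrightarrow> u x \<le> u (R e l x))"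

lemma continuous_u_compose: "continuous_on UNIV g \<Longrightarrow> continuous_on UNIV (\<lambda>x. u (g x))"
  by (rule continuous_on_compose2[OF cont]) auto

lemma ordered_of_AE:
  assumes "AE x in lborel. halfspace_trunc e l (\<lambda>x. u x - u (R e l x)) x = 0"
  shows "ordered e l"
  unfolding ordered_def
proof (intro allI impI, rule ccontr)
  fix x assume x: "x \<bullet> e > l" "\<not> u x \<le> u (R e l x)"
  have "open {x. x \<bullet> e > l \<and> u (R e l x) < u x}"
    by (intro open_Collect_conj open_Collect_less continuous_intros cont continuous_u_compose continuous_hyp_reflect)
  from AE_open_witness[OF assms this, of x] x show False by (auto simp: halfspace_trunc_def)
qed

text \<open>A maximum principle for small sets. Let \<open>X\<close> and \<open>Y\<close> be the
  \<open>L^2\<close> masses of the truncated difference on and off the set \<open>A\<close> where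
  one of the compared values exceeds \<open>\<delta>\<close>. The Lipschitz bound on
  \<open>A\<close> and the decrease of \<open>F\<close> off it give
  \<open>\<kappa> * E \<le> L * X - \<epsilon> / 2 * Y\<close>, while
  \<open>small_set_inequality\<close> bounds \<open>X\<close> by \<open>E\<close> and a small
  multiple of \<open>Y\<close>. For small measure both masses vanish. The threshold does not depend
  on \<open>e\<close> or \<open>l\<close>, which is what permits the planes to move.\<close>

lemma small_measure_ordered:
  assumes \<delta>: "\<delta> > 0" "\<And>x y. 0 \<le> x \<Longrightarrow> x \<le> y \<Longrightarrow> y \<le> \<delta> \<Longrightarrow> F y - F x \<le> - (\<epsilon> / 2) * (y - x)"
  shows "\<exists>m>0. \<forall>e l. norm e = 1 \<longrightarrow>
    emeasure lborel {x. x \<bullet> e > l \<and> u x > \<delta> \<and> u x > u (R e l x)} \<le> ennreal m \<longrightarrow> ordered e l"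
proof -
  let ?N = "real DIM('a)"
  define V where "V = unit_ball_vol ?N"
  have V: "V > 0" by (simp add: V_def)
  \<comment> \<open>Fixed so that \<open>2 * Q * L = \<kappa> * (W / 4)\<close>: the energy then
    costs only a quarter of \<open>W * X\<close>.\<close>
  define r where "r = (V * \<kappa> / (8 * L)) powr (1 / (2 * s))"
  have r: "r > 0" using V \<kappa> L_pos by (simp add: r_def)
  have rs: "r powr (2 * s) = V * \<kappa> / (8 * L)" using s V \<kappa> L_pos by (simp add: r_def powr_powr)
  define W where "W = V * r ^ DIM('a)"
  define Q where "Q = r powr (?N + 2 * s)"
  have W: "W > 0" using V r by (simp add: W_def)
  have Q: "Q > 0" using r by (simp add: Q_def)
  have QL: "2 * Q * L = \<kappa> * (W / 4)"
  proof -
    define K where "K = L"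
    have K: "K > 0" using L_pos by (simp add: K_def)
    have "Q = r ^ DIM('a) * (V * \<kappa> / (8 * K))"
      using r rs unfolding K_def[symmetric] by (simp add: Q_def powr_add powr_realpow)
    then show ?thesis using K unfolding K_def[symmetric] by (simp add: W_def)
  qed
  \<comment> \<open>The first bound keeps half of \<open>W * X\<close> on the left; the second lets
    the negative \<open>Y\<close>-term from the equation absorb the one from the small set
    estimate.\<close>
  define m where "m = min (W / 2) (Q * \<epsilon> / (2 * \<kappa>)) / 2"
  have m: "m > 0" "2 * m \<le> W / 2" "2 * m \<le> Q * \<epsilon> / (2 * \<kappa>)" using W Q pq \<kappa> by (auto simp: m_def)
  have "ordered e l" if e: "norm e = 1" and le: "emeasure lborel {x. x \<bullet> e > l \<and> u x > \<delta> \<and> u x > u (R e l x)} \<le> ennreal m" for e l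
  proof -
    define v where "v x = u x - u (R e l x)" for x
    define \<psi> where "\<psi> = halfspace_trunc e l v"
    have anti: "\<And>x. v (R e l x) = - v x" using e by (simp add: v_def)
    have vsq: "sq_integrable v" unfolding v_def[abs_def] by (intro sq_integrable_diff usq reflect_sq e)
    have vfe: "finite_energy s v" unfolding v_def[abs_def] by (intro finite_energy_diff ufe reflect_fe e)
    have [measurable]: "v \<in> borel_measurable borel" using vsq by (rule sq_integrable_measurable)
    have [measurable]: "\<psi> \<in> borel_measurable borel" unfolding \<psi>_def by measurable
    have \<psi>sq: "sq_integrable \<psi>"
      by (rule sq_integrable_bound[OF vsq, of _ 1]) (simp_all add: \<psi>_def abs_halfspace_trunc_le)
    have \<psi>fe: "finite_energy s \<psi>" unfolding \<psi>_def by (rule halfspace_trunc_energy(1)[where v = v, OF e s(1) vfe anti])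
    have v1: "\<bar>v x\<bar> \<le> 1" for x using range01[of x] range01[of "R e l x"] by (auto simp: v_def)
    have \<psi>1: "\<forall>x. \<bar>\<psi> x\<bar> \<le> 1" unfolding \<psi>_def by (intro allI order_trans[OF abs_halfspace_trunc_le[of e l v]] v1)
    have \<psi>anti: "\<And>x. \<psi> (R e l x) = - \<psi> x" unfolding \<psi>_def by (rule halfspace_trunc_reflect[where v = v, OF e anti])
    note rw = reflect_weak[where \<psi> = \<psi>, OF e \<psi>sq \<psi>fe \<psi>1 \<psi>anti, folded v_def]
    define A' where "A' = {x. x \<bullet> e > l \<and> u x > \<delta> \<and> u x > u (R e l x)}"
    define A where "A = {x. \<psi> x \<noteq> 0 \<and> \<delta> < max (u x) (u (R e l x))}"
    have [measurable]: "A' \<in> sets borel" unfolding A'_def by measurable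
    have [measurable]: "A \<in> sets borel" unfolding A_def by measurable
    \<comment> \<open>\<open>A\<close> lies in the given set and its mirror image, hence the factor
      2.\<close>
    have Ameas: "emeasure lborel A \<le> ennreal (2 * m)"
    proof -
      have RA: "R e l -` A' \<in> sets borel" using measurable_sets[OF measurable_hyp_reflect, of A' e l] by simp
      have "A \<subseteq> A' \<union> R e l -` A'"
        using e by (auto simp: A_def A'_def \<psi>_def halfspace_trunc_def v_def hyp_reflect_inner max_def min_def split: if_splits)
           (auto simp: hyp_reflect_def)
      then have "emeasure lborel A \<le> emeasure lborel (A' \<union> R e l -` A')" using RA by (intro emeasure_mono) auto
      also have "\<dots> \<le> emeasure lborel A' + emeasure lborel (R e l -` A')" using RA by (intro emeasure_subadditive) auto
      also have "emeasure lborel (R e l -` A') = emeasure (distr lborel borel (R e l)) A'"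
        by (subst emeasure_distr) auto
      also have "\<dots> = emeasure lborel A'" by (simp add: lborel_distr_hyp_reflect[OF e])
      also have "emeasure lborel A' + emeasure lborel A' \<le> ennreal m + ennreal m"
        using le by (intro add_mono) (auto simp: A'_def)
      also have "\<dots> = ennreal (2 * m)" using m(1) by (simp add: ennreal_plus[symmetric] del: ennreal_plus)
      finally show ?thesis .
    qed
    define X where "X = (\<integral>x. indicator A x * (\<psi> x)\<^sup>2 \<partial>lborel)"
    define Y where "Y = (\<integral>x. indicator (- A) x * (\<psi> x)\<^sup>2 \<partial>lborel)"
    define E where "E = energy s \<psi> \<psi>"
    have ind: "integrable lborel (\<lambda>x. indicator B x * (\<psi> x)\<^sup>2)" if [measurable]: "B \<in> sets borel" for B
      using sq_integrable_square[OF \<psi>sq] by (rule Bochner_Integration.integrable_bound) (auto simp: indicator_def)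
    have XY0: "X \<ge> 0" "Y \<ge> 0" "E \<ge> 0" by (auto simp: X_def Y_def E_def)
    have XY: "(\<integral>x. (\<psi> x)\<^sup>2 \<partial>lborel) = X + Y"
    proof -
      have "X + Y = (\<integral>x. indicator A x * (\<psi> x)\<^sup>2 + indicator (- A) x * (\<psi> x)\<^sup>2 \<partial>lborel)"
        unfolding X_def Y_def by (subst Bochner_Integration.integral_add) (auto intro: ind)
      also have "\<dots> = (\<integral>x. (\<psi> x)\<^sup>2 \<partial>lborel)" by (intro Bochner_Integration.integral_cong) (auto simp: indicator_def)
      finally show ?thesis by simp
    qed
    have pw: "(F (u x) - F (u (R e l x))) * \<psi> x \<le> L * (indicator A x * (\<psi> x)\<^sup>2) - \<epsilon> / 2 * (indicator (- A) x * (\<psi> x)\<^sup>2)" for x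
    proof (cases "\<psi> x = 0")
      case False
      then have \<psi>v: "\<psi> x = v x" by (auto simp: \<psi>_def halfspace_trunc_def max_def min_def split: if_splits)
      show ?thesis
      proof (cases "x \<in> A")
        case True
        have "(F (u x) - F (u (R e l x))) * v x \<le> \<bar>F (u x) - F (u (R e l x))\<bar> * \<bar>v x\<bar>"
          by (metis abs_ge_self abs_mult)
        also have "\<dots> \<le> L * \<bar>v x\<bar> * \<bar>v x\<bar>" using F_Lipschitz[of x "R e l x"] by (intro mult_right_mono) (auto simp: v_def)
        finally show ?thesis using True by (simp add: \<psi>v power2_eq_square mult.assoc)
      next
        case out: False
        then have d: "u x \<le> \<delta>" "u (R e l x) \<le> \<delta>" using False by (auto simp: A_def)
        have "(F (u x) - F (u (R e l x))) * v x \<le> - (\<epsilon> / 2) * (v x)\<^sup>2"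
        proof (cases "u (R e l x) \<le> u x")
          case True
          have "F (u x) - F (u (R e l x)) \<le> - (\<epsilon> / 2) * v x"
            using \<delta>(2)[OF _ True d(1)] range01[of "R e l x"] by (simp add: v_def)
          from mult_right_mono[OF this, of "v x"] True show ?thesis by (simp add: v_def power2_eq_square mult.assoc)
        next
          case False
          then have lt: "u x \<le> u (R e l x)" by simp
          have "F (u (R e l x)) - F (u x) \<le> - (\<epsilon> / 2) * (- v x)"
            using \<delta>(2)[OF _ lt d(2)] range01[of x] by (simp add: v_def)
          from mult_right_mono[OF this, of "- v x"] lt
          have "(F (u (R e l x)) - F (u x)) * - v x \<le> - (\<epsilon> / 2) * (- v x) * (- v x)" by (simp add: v_def)
          then show ?thesis by (simp add: power2_eq_square left_diff_distrib)
        qed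
        then show ?thesis using out by (simp add: \<psi>v)
      qed
    qed simp
    have "\<kappa> * E \<le> \<kappa> * energy s v \<psi>"
      using halfspace_trunc_energy(2)[where v = v, OF e s(1) vfe anti] \<kappa> unfolding E_def \<psi>_def by (intro mult_left_mono) auto
    also have "\<kappa> * energy s v \<psi> = (\<integral>x. (F (u x) - F (u (R e l x))) * \<psi> x \<partial>lborel)"
      using rw(1) unfolding v_def[abs_def] .
    also have "\<dots> \<le> (\<integral>x. L * (indicator A x * (\<psi> x)\<^sup>2) - \<epsilon> / 2 * (indicator (- A) x * (\<psi> x)\<^sup>2) \<partial>lborel)"
      by (intro integral_mono rw(2) pw Bochner_Integration.integrable_diff integrable_mult_right ind) auto
    also have "\<dots> = L * X - \<epsilon> / 2 * Y"
      unfolding X_def Y_def by (subst Bochner_Integration.integral_diff) (auto intro!: integrable_mult_right ind)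
    finally have EXY: "\<kappa> * E \<le> L * X - \<epsilon> / 2 * Y" .
    have small: "(W - 2 * m) * X \<le> 2 * Q * E + 2 * (2 * m) * Y"
      using small_set_inequality[OF s(1) \<psi>sq \<psi>fe _ Ameas _ r] m(1) unfolding V_def[symmetric] W_def[symmetric] Q_def[symmetric] X_def Y_def E_def
      by simp
    have QE: "2 * Q * E \<le> W / 4 * X - Q * \<epsilon> / \<kappa> * Y"
    proof -
      have "\<kappa> * (2 * Q * E) = 2 * Q * (\<kappa> * E)" by simp
      also have "\<dots> \<le> 2 * Q * (L * X - \<epsilon> / 2 * Y)" using EXY Q by (intro mult_left_mono) auto
      also have "\<dots> = (2 * Q * L) * X - Q * \<epsilon> * Y" by (simp add: algebra_simps)
      also have "\<dots> = \<kappa> * (W / 4 * X - Q * \<epsilon> / \<kappa> * Y)" unfolding QL using \<kappa> by (simp add: algebra_simps)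
      finally show ?thesis using \<kappa> by simp
    qed
    \<comment> \<open>Altogether \<open>W / 2 * X \<le> W / 4 * X\<close>, so \<open>X = 0\<close>,
      and then the equation leaves no room for \<open>Y\<close>.\<close>
    have "W / 2 * X \<le> (W - 2 * m) * X" using m(2) XY0 by (intro mult_right_mono) auto
    moreover have "2 * (2 * m) * Y \<le> Q * \<epsilon> / \<kappa> * Y" using m(3) XY0 \<kappa> by (intro mult_right_mono) auto
    ultimately have "W / 4 * X \<le> 0" using small QE by linarith
    then have X0: "X = 0" using W XY0 by (simp add: mult_le_0_iff)
    have "0 \<le> \<kappa> * E" using \<kappa> XY0 by simp
    then have "\<epsilon> / 2 * Y \<le> 0" using EXY X0 by simp
    then have "Y = 0" using pq XY0 by (simp add: mult_le_0_iff)
    then have "(\<integral>x. (\<psi> x)\<^sup>2 \<partial>lborel) \<le> 0" using XY X0 by simp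
    then have "AE x in lborel. (\<psi> x)\<^sup>2 = 0"
      by (intro AE_lborel_zero_of_integral sq_integrable_square \<psi>sq) auto
    then have "AE x in lborel. \<psi> x = 0" by eventually_elim simp
    then show ?thesis by (intro ordered_of_AE) (simp add: \<psi>_def v_def[abs_def])
  qed
  then show ?thesis using m(1) by blast
qed

text \<open>Barrier argument: near a zero \<open>x1\<close> of \<open>w = u \<circ> R - u\<close> compare \<open>w\<close> with a small multiple of
  \<open>bump x1 r1 + M bump x2 r2\<close>, where \<open>w\<close> is positive on the ball around \<open>x2\<close>. For large \<open>M\<close> the second bump
  makes the barrier a strict subsolution on the first ball.\<close>

lemma ordered_imp_strict:
  assumes e: "norm e = 1" and ord: "ordered e l" and ne: "\<exists>x. u (R e l x) \<noteq> u x" and x1: "x1 \<bullet> e > l"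
  shows "u x1 < u (R e l x1)"
proof (rule ccontr)
  assume "\<not> u x1 < u (R e l x1)"
  define w where "w x = u (R e l x) - u x" for x
  have wpos: "0 \<le> w x" if "x \<bullet> e > l" for x using ord that by (simp add: ordered_def w_def)
  have w1: "w x1 = 0" using wpos[OF x1] \<open>\<not> u x1 < u (R e l x1)\<close> by (simp add: w_def)
  have wanti: "w (R e l x) = - w x" for x using e by (simp add: w_def)
  have wcont: "continuous_on UNIV w"
    unfolding w_def[abs_def] by (intro continuous_intros cont continuous_u_compose continuous_hyp_reflect)
  obtain x2 where x2: "x2 \<bullet> e > l" "w x2 > 0"
  proof -
    obtain x where x: "w x \<noteq> 0" using ne by (auto simp: w_def)
    have "x \<bullet> e \<noteq> l"
    proof
      assume "x \<bullet> e = l"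
      then have "R e l x = x" by (simp add: hyp_reflect_def)
      then show False using x by (simp add: w_def)
    qed
    then consider "x \<bullet> e > l" | "R e l x \<bullet> e > l" using hyp_reflect_inner[OF e, of l x] by linarith
    then show thesis
    proof cases
      case 1
      then show thesis using that[of x] wpos[of x] x by (simp add: less_le)
    next
      case 2
      then show thesis using that[of "R e l x"] wpos[of "R e l x"] x wanti[of x] by (simp add: less_le)
    qed
  qed
  have "x1 \<noteq> x2" using w1 x2 by auto
  define m0 where "m0 = w x2 / 2"
  have m0: "m0 > 0" using x2 by (simp add: m0_def)
  have "open {x. w x > m0}" using wcont by (intro open_Collect_less continuous_intros)
  moreover have "x2 \<in> {x. w x > m0}" using x2 by (simp add: m0_def)
  ultimately obtain d where d: "d > 0" "ball x2 d \<subseteq> {x. w x > m0}" by (rule openE)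
  \<comment> \<open>Half the distance to the hyperplane keeps each ball inside the half-space, a
    third of the distance between the centres separates the balls, and \<open>d / 2\<close> keeps
    \<open>w > m0\<close> on the second one.\<close>
  define r1 where "r1 = min ((x1 \<bullet> e - l) / 2) (dist x1 x2 / 3)"
  define r2 where "r2 = min (min ((x2 \<bullet> e - l) / 2) (dist x1 x2 / 3)) (d / 2)"
  have r: "r1 > 0" "r2 > 0" using x1 x2 d \<open>x1 \<noteq> x2\<close> by (auto simp: r1_def r2_def)
  have inner_le: "c \<bullet> e - x \<bullet> e \<le> dist c x" for c x
    using norm_cauchy_schwarz[of "c - x" e] e by (simp add: dist_norm inner_diff_left)
  have B1: "x \<bullet> e - l \<ge> r1" if "x \<in> cball x1 r1" for x
  proof -
    have "r1 \<le> (x1 \<bullet> e - l) / 2" unfolding r1_def by (rule min.cobounded1)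
    then show ?thesis using that inner_le[of x1 x] by simp
  qed
  have B2: "x \<bullet> e > l" "w x > m0" if "x \<in> cball x2 r2" for x
  proof -
    have "r2 \<le> (x2 \<bullet> e - l) / 2" unfolding r2_def by (rule order_trans[OF min.cobounded1 min.cobounded1])
    moreover have "r2 \<le> d / 2" unfolding r2_def by (rule min.cobounded2)
    ultimately have "r2 \<le> (x2 \<bullet> e - l) / 2" "r2 \<le> d / 2" .
    then have "x \<in> ball x2 d" and "x \<bullet> e > l" using that d(1) inner_le[of x2 x] r by auto
    then show "x \<bullet> e > l" "w x > m0" using d(2) by blast+
  qed
  have B12: "cball x1 r1 \<inter> cball x2 r2 = {}"
  proof -
    have "r1 \<le> dist x1 x2 / 3" unfolding r1_def by (rule min.cobounded2)
    moreover have "r2 \<le> dist x1 x2 / 3"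
      unfolding r2_def by (rule order_trans[OF min.cobounded1 min.cobounded2])
    moreover have "dist x1 x2 > 0" using \<open>x1 \<noteq> x2\<close> by simp
    ultimately have "r1 + r2 < dist x1 x2" by linarith
    then show ?thesis by (intro disjoint_cballI)
  qed
  obtain c0 where c0: "c0 > 0"
    "\<forall>x\<in>cball x2 r2. \<forall>y\<in>cball x1 r1. c0 \<le> frac_kernel s (x - y) - frac_kernel s (x - R e l y)"
    using frac_kernel_gap[OF e s(1) _ B2(1) B12] B1 r by force
  let ?\<eta> = "bump x1 r1" and ?\<zeta> = "bump x2 r2"
  note \<eta>r = bump_regular[OF s r(1), where c = x1] and \<zeta>r = bump_regular[OF s r(2), where c = x2]
  note \<eta>b = bump_bounds[OF r(1), where c = x1] and \<zeta>b = bump_bounds[OF r(2), where c = x2]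
  have \<eta>supp: "?\<eta> x \<noteq> 0 \<Longrightarrow> x \<in> cball x1 r1" for x using \<eta>b(3)[of x] by (force simp: dist_norm norm_minus_commute)
  have \<zeta>supp: "?\<zeta> x \<noteq> 0 \<Longrightarrow> x \<in> cball x2 r2" for x using \<zeta>b(3)[of x] by (force simp: dist_norm norm_minus_commute)
  define I\<eta> where "I\<eta> = (\<integral>x. ?\<eta> x \<partial>lborel)"
  define I\<zeta> where "I\<zeta> = (\<integral>x. ?\<zeta> x \<partial>lborel)"
  have I\<zeta>: "I\<zeta> > 0"
  proof (rule ccontr)
    assume "\<not> I\<zeta> > 0"
    then have "AE x in lborel. ?\<zeta> x = 0"
      using \<zeta>b(1) by (intro AE_lborel_zero_of_integral \<zeta>r) (auto simp: I\<zeta>_def)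
    from AE_open_witness[OF this open_ball, of x2 x2 r2] r show False
      using \<zeta>b(5) by (force simp: dist_norm norm_minus_commute)
  qed
  \<comment> \<open>The two losses: \<open>C1\<close> bounds the energy of the first bump against
    the test function, and \<open>k0\<close> bounds the kernel between the first ball and its mirror
    image, which are at least \<open>2 * r1\<close> apart.\<close>
  define C1 where "C1 = (\<integral>h. min 2 (2 / r1\<^sup>2 * (norm h)\<^sup>2) * frac_kernel s h \<partial>(lborel :: 'a measure))"
  define k0 where "k0 = (2 * r1) powr (- (real DIM('a) + 2 * s))"
  \<comment> \<open>The gain \<open>2 * M * c0 * I\<zeta>\<close> from the second bump must outweigh
    both losses and the Lipschitz term \<open>L / \<kappa>\<close>, with a surplus of 1 for the
    final contradiction.\<close>
  define M where "M = max 1 ((C1 + 2 * k0 * I\<eta> + L / \<kappa> + 1) / (2 * c0 * I\<zeta>))"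
  have M: "M \<ge> 1" "C1 + 2 * k0 * I\<eta> + L / \<kappa> + 1 \<le> 2 * M * c0 * I\<zeta>"
  proof -
    show "M \<ge> 1" by (simp add: M_def)
    have "(C1 + 2 * k0 * I\<eta> + L / \<kappa> + 1) / (2 * c0 * I\<zeta>) \<le> M" by (simp add: M_def)
    then show "C1 + 2 * k0 * I\<eta> + L / \<kappa> + 1 \<le> 2 * M * c0 * I\<zeta>" using c0(1) I\<zeta> by (simp add: field_simps)
  qed
  define \<delta> where "\<delta> = m0 / M"
  have \<delta>: "\<delta> > 0" "\<delta> * M = m0" using m0 M by (auto simp: \<delta>_def)
  \<comment> \<open>Since \<open>m0 = \<delta> * M\<close>, this is \<open>\<delta>\<close> times
    (first bump + \<open>M\<close> times second bump), scaled so that the second bump stays below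
    \<open>w\<close> on its ball.\<close>
  define h where "h x = \<delta> * ?\<eta> x + m0 * ?\<zeta> x" for x
  have hfe: "finite_energy s h" unfolding h_def[abs_def] by (intro finite_energy_add finite_energy_cmult \<eta>r \<zeta>r)
  have hsq: "sq_integrable h" unfolding h_def[abs_def] by (intro sq_integrable_add sq_integrable_cmult \<eta>r \<zeta>r)
  have hcont: "continuous_on UNIV h" unfolding h_def[abs_def] by (intro continuous_intros \<eta>r \<zeta>r)
  have hR: "h (R e l x) = 0" if "x \<bullet> e > l" for x
  proof -
    have lt: "R e l x \<bullet> e < l" using that by (simp add: hyp_reflect_inner[OF e])
    have "?\<eta> (R e l x) = 0" using \<eta>supp[of "R e l x"] B1[of "R e l x"] r lt by force
    moreover have "?\<zeta> (R e l x) = 0" using \<zeta>supp[of "R e l x"] B2(1)[of "R e l x"] lt by force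
    ultimately show ?thesis by (simp add: h_def)
  qed
  define v where "v x = (h x - h (R e l x)) - w x" for x
  define \<psi> where "\<psi> = halfspace_trunc e l v"
  define \<phi> where "\<phi> x = max 0 (\<psi> x)" for x
  have wfe: "finite_energy s w" unfolding w_def[abs_def] by (intro finite_energy_diff ufe reflect_fe e)
  have wsq: "sq_integrable w" unfolding w_def[abs_def] by (intro sq_integrable_diff usq reflect_sq e)
  have hhfe: "finite_energy s (\<lambda>x. h x - h (R e l x))" by (intro finite_energy_diff hfe reflect_fe e)
  have hhsq: "sq_integrable (\<lambda>x. h x - h (R e l x))" by (intro sq_integrable_diff hsq reflect_sq e)
  have vfe: "finite_energy s v" unfolding v_def[abs_def] by (intro finite_energy_diff hhfe wfe)
  have vsq: "sq_integrable v" unfolding v_def[abs_def] by (intro sq_integrable_diff hhsq wsq)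
  have anti: "\<And>x. v (R e l x) = - v x" using e wanti by (simp add: v_def)
  have vcont: "continuous_on UNIV v"
    unfolding v_def[abs_def]
    by (intro continuous_intros hcont wcont continuous_on_compose2[OF hcont continuous_hyp_reflect]) auto
  have [measurable]: "v \<in> borel_measurable borel" using vsq by (rule sq_integrable_measurable)
  have [measurable]: "\<psi> \<in> borel_measurable borel" unfolding \<psi>_def by measurable
  have \<psi>sq: "sq_integrable \<psi>"
    by (rule sq_integrable_bound[OF vsq, of _ 1]) (simp_all add: \<psi>_def abs_halfspace_trunc_le)
  have \<psi>fe: "finite_energy s \<psi>" unfolding \<psi>_def by (rule halfspace_trunc_energy(1)[where v = v, OF e s(1) vfe anti])
  have \<psi>anti: "\<And>x. \<psi> (R e l x) = - \<psi> x" unfolding \<psi>_def by (rule halfspace_trunc_reflect[where v = v, OF e anti])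
  define B where "B = 2 * (\<delta> + m0) + 1"
  have vB: "\<bar>v x\<bar> \<le> B" for x
  proof -
    have hb: "0 \<le> h y" "h y \<le> \<delta> + m0" for y
    proof -
      show "0 \<le> h y" using \<delta>(1) m0 \<eta>b(1)[of y] \<zeta>b(1)[of y] by (simp add: h_def)
      have "\<delta> * ?\<eta> y \<le> \<delta>" "m0 * ?\<zeta> y \<le> m0"
        using \<delta>(1) m0 \<eta>b(2)[of y] \<zeta>b(2)[of y] by (simp_all add: mult_left_le)
      then show "h y \<le> \<delta> + m0" by (simp add: h_def)
    qed
    have "\<bar>w x\<bar> \<le> 1" using range01[of x] range01[of "R e l x"] by (auto simp: w_def)
    then show ?thesis using hb[of x] hb[of "R e l x"] by (auto simp: v_def B_def)
  qed
  have \<psi>B: "\<forall>x. \<bar>\<psi> x\<bar> \<le> B" unfolding \<psi>_def by (intro allI order_trans[OF abs_halfspace_trunc_le[of e l v]] vB)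
  \<comment> \<open>On the second ball \<open>h \<le> m0 < w\<close>, and off both balls
    \<open>h = 0 \<le> w\<close>. So in the half-space the barrier can exceed \<open>w\<close> only
    on the first ball, where \<open>h \<le> \<delta>\<close>.\<close>
  have key: "x \<in> cball x1 r1 \<and> w x \<le> \<delta>" if x: "x \<bullet> e > l" "\<psi> x \<noteq> 0" for x
  proof -
    have vx: "v x > 0" using x by (auto simp: \<psi>_def halfspace_trunc_def max_def split: if_splits)
    then have wh: "w x < h x" using hR[OF x(1)] by (simp add: v_def)
    have "?\<zeta> x = 0"
    proof (rule ccontr)
      assume "?\<zeta> x \<noteq> 0"
      then have in2: "x \<in> cball x2 r2" by (rule \<zeta>supp)
      then have "?\<eta> x = 0" using \<eta>supp[of x] B12 by blast
      then have "h x \<le> m0" using m0 \<zeta>b(2)[of x] by (simp add: h_def mult_left_le)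
      then show False using B2(2)[OF in2] wh by simp
    qed
    then have hx: "h x = \<delta> * ?\<eta> x" by (simp add: h_def)
    have "?\<eta> x \<noteq> 0"
    proof
      assume "?\<eta> x = 0"
      then show False using hx wh wpos[OF x(1)] by simp
    qed
    then have "x \<in> cball x1 r1" by (rule \<eta>supp)
    moreover have "h x \<le> \<delta>" unfolding hx using \<delta>(1) \<eta>b(2)[of x] by (simp add: mult_left_le)
    ultimately show ?thesis using wh by simp
  qed
  let ?\<phi>R = "\<lambda>x. \<phi> (R e l x)"
  have \<phi>0: "\<phi> x \<ge> 0" for x by (simp add: \<phi>_def)
  have [measurable]: "\<phi> \<in> borel_measurable borel" unfolding \<phi>_def[abs_def] by measurable
  have \<phi>fe: "finite_energy s \<phi>" by (rule finite_energy_contraction[OF \<psi>fe]) (auto simp: \<phi>_def)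
  have \<phi>supp: "x \<in> cball x1 r1" if "\<phi> x \<noteq> 0" for x
  proof -
    have "\<psi> x > 0" using that by (auto simp: \<phi>_def max_def split: if_splits)
    then have "x \<bullet> e > l" by (auto simp: \<psi>_def halfspace_trunc_def min_def split: if_splits)
    then show ?thesis using key[of x] \<open>\<psi> x > 0\<close> by simp
  qed
  have \<phi>i: "integrable lborel \<phi>"
  proof (rule sq_integrable_bounded_support(2))
    show "\<bar>\<phi> x\<bar> \<le> B" for x using \<psi>B[rule_format, of x] by (auto simp: \<phi>_def)
    show "\<phi> x = 0" if "norm x \<ge> norm x1 + r1 + 1" for x
    proof (rule ccontr)
      assume "\<phi> x \<noteq> 0"
      then have "norm (x - x1) \<le> r1" using \<phi>supp[of x] by (simp add: dist_norm norm_minus_commute)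
      then show False using that norm_triangle_ineq2[of x x1] by simp
    qed
  qed measurable
  have \<phi>Rfe: "finite_energy s ?\<phi>R" by (rule reflect_fe[OF e \<phi>fe])
  have \<phi>Ri: "integrable lborel ?\<phi>R"
    using \<phi>i integrable_lborel_preserving[OF lborel_distr_hyp_reflect[OF e, of l], of \<phi>] by simp
  define \<Phi> where "\<Phi> = (\<integral>x. \<phi> x \<partial>lborel)"
  have \<Phi>R: "(\<integral>x. ?\<phi>R x \<partial>lborel) = \<Phi>"
    unfolding \<Phi>_def by (rule integral_lborel_preserving[OF lborel_distr_hyp_reflect[OF e]]) measurable
  have \<psi>\<phi>: "\<psi> = (\<lambda>x. \<phi> x - ?\<phi>R x)" using \<psi>anti by (auto simp: \<phi>_def fun_eq_iff)
  \<comment> \<open>The truncation inequality for \<open>v\<close>, the barrier minus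
    \<open>w\<close>, compares the two energies without any pointwise evaluation of the
    operator.\<close>
  have upper1: "energy s w \<psi> \<le> 2 * energy s h \<psi>"
  proof -
    have "0 \<le> energy s \<psi> \<psi>" by simp
    also have "\<dots> \<le> energy s v \<psi>"
      unfolding \<psi>_def by (rule halfspace_trunc_energy(2)[where v = v, OF e s(1) vfe anti])
    also have "\<dots> = energy s (\<lambda>x. h x - h (R e l x)) \<psi> - energy s w \<psi>"
      unfolding v_def[abs_def] by (rule energy_diff_left[OF hhfe wfe \<psi>fe])
    also have "energy s (\<lambda>x. h x - h (R e l x)) \<psi> = 2 * energy s h \<psi>"
      by (rule reflect_energy_antisymmetric[OF e hfe \<psi>fe \<psi>anti])
    finally show ?thesis by simp
  qed
  \<comment> \<open>The equation for \<open>w\<close>: on the support of \<open>\<psi>\<close> one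
    has \<open>\<bar>w x\<bar> \<le> \<delta>\<close>, so the right side is of order
    \<open>L * \<delta>\<close>.\<close>
  have lower: "- (2 * L * \<delta> * \<Phi>) \<le> \<kappa> * energy s w \<psi>"
  proof -
    note rw = reflect_weak[where \<psi> = \<psi>, OF e \<psi>sq \<psi>fe \<psi>B \<psi>anti]
    have "energy s w \<psi> = - energy s (\<lambda>x. u x - u (R e l x)) \<psi>"
      using energy_cmult_left[of s "- 1" "\<lambda>x. u x - u (R e l x)" \<psi>] by (simp add: w_def[abs_def])
    then have "\<kappa> * energy s w \<psi> = - (\<integral>x. (F (u x) - F (u (R e l x))) * \<psi> x \<partial>lborel)"
      using rw(1) by simp
    moreover have "(\<integral>x. (F (u x) - F (u (R e l x))) * \<psi> x \<partial>lborel) \<le> (\<integral>x. L * \<delta> * (\<phi> x + ?\<phi>R x) \<partial>lborel)"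
    proof (rule integral_mono[OF rw(2)])
      show "integrable lborel (\<lambda>x. L * \<delta> * (\<phi> x + ?\<phi>R x))"
        by (intro integrable_mult_right Bochner_Integration.integrable_add \<phi>i \<phi>Ri)
      fix x
      have abs\<psi>: "\<bar>\<psi> x\<bar> = \<phi> x + ?\<phi>R x" using \<psi>anti[of x] by (simp add: \<phi>_def)
      have wle: "\<bar>w x\<bar> \<le> \<delta>" if "\<psi> x \<noteq> 0"
      proof -
        consider "x \<bullet> e > l" | "R e l x \<bullet> e > l" | "x \<bullet> e = l" using hyp_reflect_inner[OF e, of l x] by linarith
        then show ?thesis
        proof cases
          case 1
          then show ?thesis using key[of x] that wpos[of x] by simp
        next
          case 2
          then show ?thesis using key[of "R e l x"] that wpos[of "R e l x"] wanti[of x] \<psi>anti[of x] by simp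
        next
          case 3
          then have "R e l x = x" by (simp add: hyp_reflect_def)
          then show ?thesis using \<psi>anti[of x] that by simp
        qed
      qed
      have "(F (u x) - F (u (R e l x))) * \<psi> x \<le> \<bar>F (u x) - F (u (R e l x))\<bar> * \<bar>\<psi> x\<bar>"
        by (metis abs_ge_self abs_mult)
      also have "\<dots> \<le> (L * \<delta>) * \<bar>\<psi> x\<bar>"
      proof (cases "\<psi> x = 0")
        case False
        have "\<bar>F (u x) - F (u (R e l x))\<bar> \<le> L * \<bar>w x\<bar>"
          using F_Lipschitz[of x "R e l x"] by (simp add: w_def abs_minus_commute)
        also have "\<dots> \<le> L * \<delta>" using wle[OF False] L_pos by (intro mult_left_mono) auto
        finally show ?thesis by (intro mult_right_mono) auto
      qed simp
      finally show "(F (u x) - F (u (R e l x))) * \<psi> x \<le> L * \<delta> * (\<phi> x + ?\<phi>R x)" unfolding abs\<psi> .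
    qed
    moreover have "(\<integral>x. L * \<delta> * (\<phi> x + ?\<phi>R x) \<partial>lborel) = 2 * L * \<delta> * \<Phi>"
    proof -
      have "(\<integral>x. L * \<delta> * (\<phi> x + ?\<phi>R x) \<partial>lborel) = L * \<delta> * (\<integral>x. \<phi> x + ?\<phi>R x \<partial>lborel)"
        by (rule integral_mult_right_zero)
      also have "(\<integral>x. \<phi> x + ?\<phi>R x \<partial>lborel) = \<Phi> + \<Phi>"
        by (simp add: Bochner_Integration.integral_add[OF \<phi>i \<phi>Ri] \<Phi>R) (simp add: \<Phi>_def)
      also have "L * \<delta> * (\<Phi> + \<Phi>) = 2 * L * \<delta> * \<Phi>" by algebra
      finally show ?thesis .
    qed
    ultimately show ?thesis by linarith
  qed
  have split: "energy s h f = \<delta> * energy s ?\<eta> f + m0 * energy s ?\<zeta> f" if "finite_energy s f" for f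
    unfolding h_def[abs_def]
    using energy_add_left[OF finite_energy_cmult[OF \<eta>r(1), of \<delta>] finite_energy_cmult[OF \<zeta>r(1), of m0] that]
    by (simp add: energy_cmult_left)
  have refl_side: "l - y \<bullet> e \<ge> r1" if "?\<phi>R y \<noteq> 0" for y
    using B1[OF \<phi>supp[OF that]] by (simp add: hyp_reflect_inner[OF e])
  have E1: "energy s ?\<eta> \<phi> \<le> C1 * \<Phi>"
    unfolding C1_def \<Phi>_def by (rule energy_bump_upper[OF s r(1) \<phi>fe \<phi>i \<phi>0])
  have E2: "- energy s ?\<eta> ?\<phi>R \<le> 2 * k0 * I\<eta> * \<Phi>"
  proof -
    have disj: "?\<eta> x = 0 \<or> ?\<phi>R x = 0" for x
      using B1[OF \<eta>supp, of x] refl_side[of x] r by linarith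
    note ed = energy_disjoint[OF \<eta>r(1) \<eta>b(1) \<phi>Rfe \<phi>0 disj]
    have "(\<integral>p. ?\<eta> (fst p) * ?\<phi>R (snd p) * frac_kernel s (fst p - snd p) \<partial>lborel) \<le>
        k0 * ((\<integral>x. ?\<eta> x \<partial>lborel) * (\<integral>x. ?\<phi>R x \<partial>lborel))"
    proof (rule integral_kernel_bounds(2)[OF \<eta>r(4) \<eta>b(1) \<phi>Ri \<phi>0 ed(1)])
      fix x y assume xy: "?\<eta> x \<noteq> 0" "?\<phi>R y \<noteq> 0"
      have "2 * r1 \<le> x \<bullet> e - y \<bullet> e" using B1[OF \<eta>supp[OF xy(1)]] refl_side[OF xy(2)] by simp
      also have "\<dots> \<le> norm (x - y)" using inner_le[of x y] by (simp add: dist_norm)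
      finally have "norm (x - y) powr (- (real DIM('a) + 2 * s)) \<le> k0"
        unfolding k0_def using r s by (intro powr_mono2') auto
      then show "frac_kernel s (fst (x, y) - snd (x, y)) \<le> k0" by (simp add: frac_kernel_def)
    qed
    then show ?thesis using ed(2) by (simp add: I\<eta>_def \<Phi>R)
  qed
  \<comment> \<open>Reflecting y in the second interaction turns the difference into one integral
    against the kernel gap, which is at least \<open>c0\<close> on the two balls.\<close>
  have E3: "energy s ?\<zeta> \<phi> - energy s ?\<zeta> ?\<phi>R \<le> - (2 * c0 * I\<zeta> * \<Phi>)"
  proof -
    let ?T = "\<lambda>p::'a \<times> 'a. (fst p, R e l (snd p))"
    have T: "distr lborel borel ?T = lborel"
      by (rule lborel_distr_prod[where T = "\<lambda>x. x"]) (auto simp: lborel_distr_hyp_reflect[OF e] distr_id2)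
    have Tm: "?T \<in> borel_measurable borel" unfolding borel_prod[symmetric] by measurable
    have disj1: "?\<zeta> x = 0 \<or> \<phi> x = 0" for x using \<zeta>supp[of x] \<phi>supp[of x] B12 by blast
    have disj2: "?\<zeta> x = 0 \<or> ?\<phi>R x = 0" for x
      using B2(1)[OF \<zeta>supp, of x] refl_side[of x] r by linarith
    note ed1 = energy_disjoint[OF \<zeta>r(1) \<zeta>b(1) \<phi>fe \<phi>0 disj1]
    note ed2 = energy_disjoint[OF \<zeta>r(1) \<zeta>b(1) \<phi>Rfe \<phi>0 disj2]
    let ?g = "\<lambda>p. ?\<zeta> (fst p) * ?\<phi>R (snd p) * frac_kernel s (fst p - snd p)"
    have gm: "?g \<in> borel_measurable borel" using ed2(1) by (auto dest: borel_measurable_integrable)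
    have gT: "?g (?T p) = ?\<zeta> (fst p) * \<phi> (snd p) * frac_kernel s (fst p - R e l (snd p))" for p
      using e by simp
    have i2: "integrable lborel (\<lambda>p. ?\<zeta> (fst p) * \<phi> (snd p) * frac_kernel s (fst p - R e l (snd p)))"
      using ed2(1) integrable_lborel_preserving[OF T Tm gm] unfolding gT by simp
    have I2: "(\<integral>p. ?g p \<partial>lborel) = (\<integral>p. ?\<zeta> (fst p) * \<phi> (snd p) * frac_kernel s (fst p - R e l (snd p)) \<partial>lborel)"
      using integral_lborel_preserving[OF T Tm gm] unfolding gT by simp
    let ?K = "\<lambda>p. frac_kernel s (fst p - snd p) - frac_kernel s (fst p - R e l (snd p))"
    have iK: "integrable lborel (\<lambda>p. ?\<zeta> (fst p) * \<phi> (snd p) * ?K p)"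
      using Bochner_Integration.integrable_diff[OF ed1(1) i2] by (simp add: right_diff_distrib)
    have "c0 * ((\<integral>x. ?\<zeta> x \<partial>lborel) * (\<integral>x. \<phi> x \<partial>lborel)) \<le> (\<integral>p. ?\<zeta> (fst p) * \<phi> (snd p) * ?K p \<partial>lborel)"
    proof (rule integral_kernel_bounds(1)[OF \<zeta>r(4) \<zeta>b(1) \<phi>i \<phi>0 iK])
      show "c0 \<le> ?K (x, y)" if "?\<zeta> x \<noteq> 0" "\<phi> y \<noteq> 0" for x y
        using c0(2) \<zeta>supp[OF that(1)] \<phi>supp[OF that(2)] by simp
    qed
    also have "(\<integral>p. ?\<zeta> (fst p) * \<phi> (snd p) * ?K p \<partial>lborel) =
        (\<integral>p. ?\<zeta> (fst p) * \<phi> (snd p) * frac_kernel s (fst p - snd p) \<partial>lborel) - (\<integral>p. ?g p \<partial>lborel)"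
      unfolding I2 using Bochner_Integration.integral_diff[OF ed1(1) i2] by (simp add: right_diff_distrib)
    finally show ?thesis using ed1(2) ed2(2) by (simp add: I\<zeta>_def \<Phi>_def)
  qed
  have "energy s h \<psi> \<le> - (\<delta> * \<Phi> * (L / \<kappa> + 1))"
  proof -
    have "energy s h \<psi> = energy s h \<phi> - energy s h ?\<phi>R"
      unfolding \<psi>\<phi> by (rule energy_diff_right[OF \<phi>fe \<phi>Rfe hfe])
    also have "\<dots> = \<delta> * (energy s ?\<eta> \<phi> - energy s ?\<eta> ?\<phi>R) + m0 * (energy s ?\<zeta> \<phi> - energy s ?\<zeta> ?\<phi>R)"
      unfolding split[OF \<phi>fe] split[OF \<phi>Rfe] by (simp add: algebra_simps)
    also have "\<dots> \<le> \<delta> * (C1 * \<Phi> + 2 * k0 * I\<eta> * \<Phi>) + m0 * (- (2 * c0 * I\<zeta> * \<Phi>))"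
      using E1 E2 E3 \<delta>(1) m0 by (intro add_mono mult_left_mono) auto
    also have "\<dots> = \<delta> * \<Phi> * (C1 + 2 * k0 * I\<eta> - 2 * M * c0 * I\<zeta>)"
      unfolding \<delta>(2)[symmetric] by (simp add: algebra_simps)
    also have "\<dots> \<le> \<delta> * \<Phi> * (- (L / \<kappa> + 1))"
      using M(2) \<delta>(1) \<phi>0 by (intro mult_left_mono mult_nonneg_nonneg) (auto simp: \<Phi>_def)
    finally show ?thesis by (simp only: mult_minus_right)
  qed
  then have "energy s w \<psi> \<le> - (2 * \<delta> * \<Phi> * (L / \<kappa> + 1))" using upper1 by simp
  then have "\<kappa> * energy s w \<psi> \<le> \<kappa> * - (2 * \<delta> * \<Phi> * (L / \<kappa> + 1))" using \<kappa> by (intro mult_left_mono) auto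
  also have "\<dots> = - (2 * L * \<delta> * \<Phi>) - 2 * (\<kappa> * \<delta>) * \<Phi>"
  proof -
    have "\<kappa> * - (2 * \<delta> * \<Phi> * (t / \<kappa> + 1)) = - (2 * t * \<delta> * \<Phi>) - 2 * (\<kappa> * \<delta>) * \<Phi>" for t
      using \<kappa> by (simp add: field_simps)
    then show ?thesis .
  qed
  \<comment> \<open>The surplus 1 in \<open>M\<close> leaves the term
    \<open>- 2 * (\<kappa> * \<delta>) * \<Phi>\<close>, so \<open>\<phi>\<close> vanishes a.e.; but
    \<open>v x1 = h x1 \<ge> \<delta>\<close> makes \<open>\<phi>\<close> positive near
    \<open>x1\<close>.\<close>
  finally have "(\<kappa> * \<delta>) * \<Phi> \<le> 0" using lower by linarith
  moreover have "\<kappa> * \<delta> > 0" using \<kappa> \<delta>(1) by simp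
  ultimately have "\<Phi> \<le> 0" by (metis mult_pos_pos not_le)
  then have "AE x in lborel. \<phi> x = 0"
    unfolding \<Phi>_def using \<phi>0 by (intro AE_lborel_zero_of_integral \<phi>i) auto
  moreover have "open {x. x \<bullet> e > l \<and> v x > 0}"
    by (intro open_Collect_conj open_Collect_less continuous_intros vcont)
  moreover have "x1 \<in> {x. x \<bullet> e > l \<and> v x > 0}"
  proof -
    have "v x1 = h x1" using hR[OF x1] w1 by (simp add: v_def)
    also have "\<dots> \<ge> \<delta>" using \<eta>b(4) \<zeta>b(1)[of x1] m0 by (simp add: h_def)
    finally show ?thesis using x1 \<delta>(1) by simp
  qed
  ultimately obtain x where "x \<bullet> e > l" "v x > 0" "\<phi> x = 0" using AE_open_witness by blast
  then show False by (simp add: \<phi>_def \<psi>_def halfspace_trunc_def)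
qed

end

section \<open>Sliding the planes to the position of symmetry\<close>

lemma AE_not_on_hyperplane:
  fixes e :: "'a::euclidean_space"
  assumes "norm e = 1"
  shows "AE x in lborel. x \<bullet> e \<noteq> l"
proof -
  have "e \<noteq> 0" using assms by auto
  then have "negligible {x. e \<bullet> x = l}" by (intro negligible_hyperplane) auto
  then have "AE x in lebesgue. x \<notin> {x. e \<bullet> x = l}" using AE_not_in[of "{x. e \<bullet> x = l}" lebesgue] by (simp only: negligible_iff_null_sets)
  then show ?thesis by (simp add: AE_completion_iff inner_commute)
qed

context continuous_solution
begin

text \<open>Takes the place of decay at infinity: inside \<open>u > \<delta>\<close> all indicators
  are dominated by the integrable \<open>u^2 / \<delta>^2\<close>, so pointwise escape from the sets
  \<open>B n\<close> forces their measures to 0.\<close>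

lemma superlevel_small:
  assumes \<delta>: "\<delta> > 0" and m: "m > 0" and B: "\<And>n. B n \<in> sets borel" "\<And>n. B n \<subseteq> {x. u x > \<delta>}"
    and lim: "AE x in lborel. \<forall>\<^sub>F n in sequentially. x \<notin> B n"
  shows "\<forall>\<^sub>F n in sequentially. emeasure lborel (B n) \<le> ennreal m"
proof -
  have [measurable]: "B n \<in> sets borel" for n by (rule B)
  have le: "indicator (B n) x \<le> 1 / \<delta>\<^sup>2 * (u x)\<^sup>2" for n x
  proof (cases "x \<in> B n")
    case True
    then have "\<delta>\<^sup>2 \<le> (u x)\<^sup>2" using B(2)[of n] \<delta> by (intro power_mono) auto
    then show ?thesis using True \<delta> by simp
  qed simp
  have int: "integrable lborel (\<lambda>x. 1 / \<delta>\<^sup>2 * (u x)\<^sup>2)" by (intro integrable_mult_right sq_integrable_square usq)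
  have Bi: "integrable lborel (indicator (B n) :: 'a \<Rightarrow> real)" for n
    by (rule Bochner_Integration.integrable_bound[OF int]) (use le[of n] in auto)
  have "(\<lambda>n. \<integral>x. indicator (B n) x \<partial>lborel) \<longlonglongrightarrow> (\<integral>x. (0::real) \<partial>(lborel :: 'a measure))"
  proof (rule integral_dominated_convergence[OF _ _ int])
    show "AE x in lborel. (\<lambda>n. indicator (B n) x :: real) \<longlonglongrightarrow> 0"
      using lim
    proof eventually_elim
      case (elim x)
      show ?case by (rule tendsto_eventually) (use elim in \<open>eventually_elim, simp\<close>)
    qed
    show "AE x in lborel. norm (indicator (B n) x :: real) \<le> 1 / \<delta>\<^sup>2 * (u x)\<^sup>2" for n using le[of n] by auto
  qed auto
  then have "\<forall>\<^sub>F n in sequentially. (\<integral>x. indicator (B n) x \<partial>lborel) < m"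
    using m by (intro order_tendstoD(2)[where y = 0]) auto
  then show ?thesis
  proof eventually_elim
    case (elim n)
    have "emeasure lborel (B n) = (\<integral>\<^sup>+x. ennreal (indicator (B n) x) \<partial>lborel)"
      by (simp add: ennreal_indicator)
    also have "\<dots> = ennreal (\<integral>x. indicator (B n) x \<partial>lborel)" by (rule nn_integral_eq_integral[OF Bi]) simp
    finally show ?case using elim by (simp add: ennreal_leI)
  qed
qed

text \<open>Periodicity makes the \<open>L^2\<close> mass of \<open>u\<close> on a ball equal to its
  mass on the ball shifted by any multiple of \<open>\<tau>\<close>; this tends to 0 by dominated
  convergence, although the ball contains a point where \<open>u\<close> is nonzero.\<close>

lemma not_translation_invariant:
  assumes "\<tau> \<noteq> 0" "\<And>x. u (x + \<tau>) = u x"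
  shows False
proof -
  have shift: "u (x + real n *\<^sub>R \<tau>) = u x" for x n
  proof (induction n)
    case (Suc n)
    have "u (x + real (Suc n) *\<^sub>R \<tau>) = u ((x + real n *\<^sub>R \<tau>) + \<tau>)" by (simp add: algebra_simps)
    then show ?case using assms(2)[of "x + real n *\<^sub>R \<tau>"] Suc by simp
  qed simp
  obtain x0 where x0: "u x0 \<noteq> 0" using nonzero by blast
  define \<rho> where "\<rho> = norm x0 + 1"
  let ?I = "indicator (cball (0::'a) \<rho>) :: 'a \<Rightarrow> real"
  have const: "(\<integral>x. (u x)\<^sup>2 * ?I (x + real n *\<^sub>R \<tau>) \<partial>lborel) = (\<integral>x. (u x)\<^sup>2 * ?I x \<partial>lborel)" for n
  proof -
    have "(\<integral>x. (u (x + real n *\<^sub>R \<tau>))\<^sup>2 * ?I (x + real n *\<^sub>R \<tau>) \<partial>lborel) = (\<integral>x. (u x)\<^sup>2 * ?I x \<partial>lborel)"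
      by (rule integral_lborel_preserving[OF lborel_distr_add, where f = "\<lambda>x. (u x)\<^sup>2 * ?I x"])
        (auto intro!: borel_measurable_times borel_measurable_power umeas borel_measurable_indicator)
    then show ?thesis by (simp add: shift)
  qed
  have "(\<lambda>n. \<integral>x. (u x)\<^sup>2 * ?I (x + real n *\<^sub>R \<tau>) \<partial>lborel) \<longlonglongrightarrow> (\<integral>x. 0 \<partial>(lborel :: 'a measure))"
  proof (rule integral_dominated_convergence)
    show "integrable lborel (\<lambda>x. (u x)\<^sup>2)" by (rule sq_integrable_square[OF usq])
    show "AE x in lborel. norm ((u x)\<^sup>2 * ?I (x + real n *\<^sub>R \<tau>)) \<le> (u x)\<^sup>2" for n
      by (auto simp: indicator_def)
    show "AE x in lborel. (\<lambda>n. (u x)\<^sup>2 * ?I (x + real n *\<^sub>R \<tau>)) \<longlonglongrightarrow> 0"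
    proof (rule AE_I2)
      fix x
      have "\<forall>\<^sub>F n in sequentially. (u x)\<^sup>2 * ?I (x + real n *\<^sub>R \<tau>) = 0"
        using eventually_gt_at_top[of "nat \<lceil>(\<rho> + norm x) / norm \<tau>\<rceil>"]
      proof eventually_elim
        case (elim n)
        then have "(\<rho> + norm x) / norm \<tau> < real n" by linarith
        then have "\<rho> + norm x < real n * norm \<tau>" using assms(1) by (simp add: field_simps)
        moreover have "real n * norm \<tau> \<le> norm (x + real n *\<^sub>R \<tau>) + norm x"
          using norm_triangle_ineq4[of "x + real n *\<^sub>R \<tau>" x] by simp
        ultimately show ?case by simp
      qed
      then show "(\<lambda>n. (u x)\<^sup>2 * ?I (x + real n *\<^sub>R \<tau>)) \<longlonglongrightarrow> 0" by (rule tendsto_eventually)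
    qed
  next
    have "{x. x + real n *\<^sub>R \<tau> \<in> cball 0 \<rho>} \<in> sets borel" for n
      unfolding mem_cball_0 by (intro borel_closed closed_Collect_le continuous_intros)
    then have [measurable]: "Measurable.pred borel (\<lambda>x. x + real n *\<^sub>R \<tau> \<in> cball 0 \<rho>)" for n
      by (simp add: pred_def)
    show "(\<lambda>x. (u x)\<^sup>2 * ?I (x + real n *\<^sub>R \<tau>)) \<in> borel_measurable lborel" for n by measurable
  qed simp
  then have "(\<integral>x. (u x)\<^sup>2 * ?I x \<partial>lborel) = 0" unfolding const by (simp add: LIMSEQ_const_iff)
  moreover have "integrable lborel (\<lambda>x. (u x)\<^sup>2 * ?I x)"
    by (rule Bochner_Integration.integrable_bound[OF sq_integrable_square[OF usq]]) (auto simp: indicator_def)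
  ultimately have "AE x in lborel. (u x)\<^sup>2 * ?I x = 0"
    by (intro AE_lborel_zero_of_integral) auto
  moreover have "open (ball 0 \<rho> \<inter> {x. u x \<noteq> 0})"
    using cont by (intro open_Int open_ball open_Collect_neq continuous_intros)
  moreover have "x0 \<in> ball 0 \<rho> \<inter> {x. u x \<noteq> 0}" using x0 by (simp add: \<rho>_def)
  ultimately obtain x where "x \<in> ball 0 \<rho> \<inter> {x. u x \<noteq> 0}" "(u x)\<^sup>2 * ?I x = 0" using AE_open_witness by blast
  then show False by (simp add: indicator_def split: if_splits)
qed

definition symmetric_at :: "'a \<Rightarrow> real \<Rightarrow> bool" where
  "symmetric_at e l \<longleftrightarrow> (\<forall>x. u (R e l x) = u x)"

text \<open>Two reflections in parallel hyperplanes compose to a translation by twice their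
  distance.\<close>

lemma symmetric_at_unique:
  assumes e: "norm e = 1" and "symmetric_at e l" "symmetric_at e m"
  shows "l = m"
proof (rule ccontr)
  assume "l \<noteq> m"
  have RR: "R e m (R e l x) = x + (2 * (m - l)) *\<^sub>R e" for x
    unfolding hyp_reflect_def[of e m] hyp_reflect_inner[OF e]
    by (simp add: hyp_reflect_def scaleR_add_left[symmetric] add.assoc)
  have "u (x + (2 * (m - l)) *\<^sub>R e) = u x" for x
    using assms(2,3) unfolding symmetric_at_def RR[symmetric] by simp
  moreover have "(2 * (m - l)) *\<^sub>R e \<noteq> 0" using \<open>l \<noteq> m\<close> e by auto
  ultimately show False using not_translation_invariant by blast
qed

lemma hyp_reflect_minus: "R (- e) (- l) x = R e l x"
  by (simp add: hyp_reflect_def algebra_simps)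

lemma symmetric_of_ordered_both:
  assumes e: "norm e = 1" and "ordered e l" "ordered (- e) (- l)"
  shows "symmetric_at e l"
proof -
  have le: "u x \<le> u (R e l x)" for x
  proof -
    consider "x \<bullet> e > l" | "x \<bullet> e < l" | "x \<bullet> e = l" by linarith
    then show ?thesis
    proof cases
      case 1
      then show ?thesis using assms(2) by (simp add: ordered_def)
    next
      case 2
      then show ?thesis using assms(3) by (simp add: ordered_def hyp_reflect_minus)
    next
      case 3
      then show ?thesis by (simp add: hyp_reflect_def)
    qed
  qed
  show ?thesis unfolding symmetric_at_def
  proof
    fix x
    show "u (R e l x) = u x" using le[of x] le[of "R e l x"] e by simp
  qed
qed

lemma continuous_reflect_param: "continuous_on UNIV (\<lambda>l. u (R e l x))"
  unfolding hyp_reflect_def by (rule continuous_on_compose2[OF cont]) (auto intro!: continuous_intros)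

text \<open>Serves both at infinity and at the critical position: if the bad sets escape almost
  every point, they become small in measure, and small bad sets are empty.\<close>

lemma eventually_ordered:
  assumes e: "norm e = 1"
    and lim: "AE x in lborel. \<forall>\<^sub>F n in sequentially. \<not> (x \<bullet> e > \<mu> n \<and> u x > u (R e (\<mu> n) x))"
  shows "\<forall>\<^sub>F n in sequentially. ordered e (\<mu> n)"
proof -
  obtain \<delta> where \<delta>: "\<delta> > 0" "\<And>x y. 0 \<le> x \<Longrightarrow> x \<le> y \<Longrightarrow> y \<le> \<delta> \<Longrightarrow> F y - F x \<le> - (\<epsilon> / 2) * (y - x)"
    using nonlin_decreasing_near_0[of p q \<epsilon>] pq by auto
  obtain m where m: "m > 0" "\<And>e l. norm e = 1 \<Longrightarrow>
      emeasure lborel {x. x \<bullet> e > l \<and> u x > \<delta> \<and> u x > u (R e l x)} \<le> ennreal m \<Longrightarrow> ordered e l"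
    using small_measure_ordered[OF \<delta>] by auto
  have "\<forall>\<^sub>F n in sequentially. emeasure lborel {x. x \<bullet> e > \<mu> n \<and> u x > \<delta> \<and> u x > u (R e (\<mu> n) x)} \<le> ennreal m"
  proof (rule superlevel_small[OF \<delta>(1) m(1)])
    show "{x. x \<bullet> e > \<mu> n \<and> u x > \<delta> \<and> u x > u (R e (\<mu> n) x)} \<in> sets borel" for n
      by (intro borel_open open_Collect_conj open_Collect_less continuous_intros cont
          continuous_u_compose continuous_hyp_reflect)
    show "AE x in lborel. \<forall>\<^sub>F n in sequentially. x \<notin> {x. x \<bullet> e > \<mu> n \<and> u x > \<delta> \<and> u x > u (R e (\<mu> n) x)}"
      using lim
    proof eventually_elim
      case (elim x)
      then show ?case by (rule eventually_mono) auto
    qed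
  qed auto
  then show ?thesis by (rule eventually_mono) (rule m(2)[OF e])
qed

lemma ordered_far:
  assumes e: "norm e = 1"
  shows "\<exists>l1. \<forall>l\<ge>l1. ordered e l"
proof (rule ccontr)
  assume "\<not> ?thesis"
  then have "\<forall>n. \<exists>l. l \<ge> real n \<and> \<not> ordered e l" by blast
  then obtain \<mu> where \<mu>: "\<And>n. \<mu> n \<ge> real n" "\<And>n. \<not> ordered e (\<mu> n)" by metis
  have "\<forall>\<^sub>F n in sequentially. ordered e (\<mu> n)"
  proof (rule eventually_ordered[OF e], rule AE_I2)
    fix x :: 'a
    show "\<forall>\<^sub>F n in sequentially. \<not> (x \<bullet> e > \<mu> n \<and> u x > u (R e (\<mu> n) x))"
      using eventually_gt_at_top[of "nat \<lceil>x \<bullet> e\<rceil>"]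
    proof eventually_elim
      case (elim n)
      then have "x \<bullet> e < real n" by linarith
      then show ?case using \<mu>(1)[of n] by linarith
    qed
  qed
  then show False using \<mu>(2) by simp
qed

text \<open>\<open>l0\<close> is the lowest level down to which all planes are ordered; ordering
  passes to \<open>l0\<close> itself by continuity. Failure of symmetry there would make the
  inequality strict and let the plane move further. Above \<open>l0\<close> strictness holds because
  uniqueness excludes symmetry at any other level.\<close>

lemma symmetric_plane:
  assumes e: "norm e = 1"
  shows "\<exists>l. symmetric_at e l \<and> (\<forall>\<mu>>l. \<forall>x. x \<bullet> e > \<mu> \<longrightarrow> u x < u (R e \<mu> x))"
proof -
  define \<Lambda> where "\<Lambda> = {l. \<forall>\<mu>\<ge>l. ordered e \<mu>}"
  obtain l1 where l1: "\<forall>l\<ge>l1. ordered e l" using ordered_far[OF e] by blast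
  obtain l2 where l2: "\<forall>l\<ge>l2. ordered (- e) l" using ordered_far[of "- e"] e by auto
  have ne: "\<Lambda> \<noteq> {}" using l1 by (auto simp: \<Lambda>_def)
  \<comment> \<open>A level below \<open>- l2\<close> would be ordered from both directions, and so
    would \<open>- l2\<close>, giving two parallel planes of symmetry.\<close>
  have lower: "l \<ge> - l2" if "l \<in> \<Lambda>" for l
  proof (rule ccontr)
    assume l: "\<not> l \<ge> - l2"
    have "symmetric_at e l" "symmetric_at e (- l2)"
      using l l2 that by (auto intro!: symmetric_of_ordered_both[OF e] simp: \<Lambda>_def)
    then show False using symmetric_at_unique[OF e] l by fastforce
  qed
  then have bdd: "bdd_below \<Lambda>" by (rule bdd_belowI)
  define l0 where "l0 = Inf \<Lambda>"
  have above: "ordered e \<mu>" if "\<mu> > l0" for \<mu>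
  proof -
    obtain l where "l \<in> \<Lambda>" "l < \<mu>" using cInf_lessD[OF ne, of \<mu>] \<open>\<mu> > l0\<close> unfolding l0_def by auto
    then show ?thesis by (auto simp: \<Lambda>_def)
  qed
  have at: "ordered e l0"
    unfolding ordered_def
  proof (intro allI impI)
    fix x assume x: "x \<bullet> e > l0"
    have "((\<lambda>l. u (R e l x)) \<longlongrightarrow> u (R e l0 x)) (at_right l0)"
      using continuous_reflect_param[of e x]
      by (auto simp: continuous_on_eq_continuous_at isCont_def intro: filterlim_mono[OF _ order_refl at_le])
    moreover have "\<forall>\<^sub>F l in at_right l0. u x \<le> u (R e l x)"
      using eventually_at_right_less[of l0] order_tendstoD(2)[OF tendsto_ident_at x, of "{l0<..}"]
      by eventually_elim (use above in \<open>auto simp: ordered_def\<close>)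
    ultimately show "u x \<le> u (R e l0 x)" by (intro tendsto_lowerbound[of "\<lambda>l. u (R e l x)"]) auto
  qed
  have sym: "symmetric_at e l0"
  proof (rule ccontr)
    assume "\<not> symmetric_at e l0"
    then have ne0: "\<exists>x. u (R e l0 x) \<noteq> u x" by (auto simp: symmetric_at_def)
    have strict: "u x < u (R e l0 x)" if "x \<bullet> e > l0" for x by (rule ordered_imp_strict[OF e at ne0 that])
    \<comment> \<open>Minimality of \<open>l0\<close> yields unordered planes converging to it from
      below. At a fixed point above the plane the strict inequality persists, a point below
      eventually leaves the half-spaces, and the plane itself is a null set; so
      \<open>eventually_ordered\<close> contradicts the choice.\<close>
    have "\<exists>\<mu>. l0 - 1 / real (Suc n) \<le> \<mu> \<and> \<mu> < l0 \<and> \<not> ordered e \<mu>" for n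
    proof (rule ccontr)
      assume *: "\<not> ?thesis"
      have "l0 - 1 / real (Suc n) \<in> \<Lambda>"
        unfolding \<Lambda>_def
      proof (intro CollectI allI impI)
        fix \<mu> assume "l0 - 1 / real (Suc n) \<le> \<mu>"
        then show "ordered e \<mu>" using * above at by (cases \<mu> l0 rule: linorder_cases) blast+
      qed
      then have "l0 \<le> l0 - 1 / real (Suc n)" unfolding l0_def using bdd by (rule cInf_lower)
      then show False by simp
    qed
    then obtain \<mu> where \<mu>: "\<And>n. l0 - 1 / real (Suc n) \<le> \<mu> n" "\<And>n. \<mu> n < l0" "\<And>n. \<not> ordered e (\<mu> n)" by metis
    have lim: "\<mu> \<longlonglongrightarrow> l0"
    proof (rule tendsto_sandwich)
      show "(\<lambda>n. l0 - 1 / real (Suc n)) \<longlonglongrightarrow> l0"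
        using tendsto_diff[OF tendsto_const LIMSEQ_inverse_real_of_nat, of l0] by (simp add: inverse_eq_divide)
    qed (use \<mu> in \<open>auto intro!: always_eventually less_imp_le\<close>)
    have "\<forall>\<^sub>F n in sequentially. ordered e (\<mu> n)"
    proof (rule eventually_ordered[OF e])
      show "AE x in lborel. \<forall>\<^sub>F n in sequentially. \<not> (x \<bullet> e > \<mu> n \<and> u x > u (R e (\<mu> n) x))"
        using AE_not_on_hyperplane[OF e, of l0]
      proof eventually_elim
        case (elim x)
        show ?case
        proof (cases "x \<bullet> e > l0")
          case True
          have "(\<lambda>n. u (R e (\<mu> n) x)) \<longlonglongrightarrow> u (R e l0 x)"
            using continuous_reflect_param[of e x] lim
            by (auto simp: continuous_on_eq_continuous_at intro: isCont_tendsto_compose)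
          then have "\<forall>\<^sub>F n in sequentially. u x < u (R e (\<mu> n) x)" by (rule order_tendstoD) (rule strict[OF True])
          then show ?thesis by (rule eventually_mono) auto
        next
          case False
          then have "x \<bullet> e < l0" using elim by simp
          with lim have "\<forall>\<^sub>F n in sequentially. x \<bullet> e < \<mu> n" by (rule order_tendstoD)
          then show ?thesis by (rule eventually_mono) auto
        qed
      qed
    qed
    then show False using \<mu>(3) by simp
  qed
  have "u x < u (R e \<mu> x)" if "\<mu> > l0" "x \<bullet> e > \<mu>" for \<mu> x
  proof (rule ordered_imp_strict[OF e above[OF that(1)] _ that(2)])
    show "\<exists>x. u (R e \<mu> x) \<noteq> u x"
      using symmetric_at_unique[OF e sym, of \<mu>] that(1) by (auto simp: symmetric_at_def)
  qed
  then show ?thesis using sym by blast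
qed

text \<open>\<open>x0\<close> is the intersection of the symmetric planes of the coordinate
  directions. Composing their reflections shows that \<open>u\<close> is invariant under the point
  reflection in \<open>x0\<close>; conjugating the plane of any direction with it gives a parallel
  plane of symmetry, which uniqueness identifies with the original one.\<close>

lemma symmetric_about_point:
  "\<exists>x0. \<forall>e. norm e = 1 \<longrightarrow> symmetric_at e (x0 \<bullet> e) \<and> (\<forall>\<mu>>x0 \<bullet> e. \<forall>x. x \<bullet> e > \<mu> \<longrightarrow> u x < u (R e \<mu> x))"
proof -
  obtain lam where lam: "\<And>e. norm e = 1 \<Longrightarrow> symmetric_at e (lam e)"
      "\<And>e \<mu> x. norm e = 1 \<Longrightarrow> \<mu> > lam e \<Longrightarrow> x \<bullet> e > \<mu> \<Longrightarrow> u x < u (R e \<mu> x)"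
    using symmetric_plane by metis
  define x0 where "x0 = (\<Sum>b\<in>Basis. lam b *\<^sub>R b)"
  have x0: "x0 \<bullet> b = lam b" if "b \<in> Basis" for b
    using that by (simp add: x0_def)
  have partial: "u (x + (\<Sum>b\<in>B. (2 * (lam b - x \<bullet> b)) *\<^sub>R b)) = u x" if "finite B" "B \<subseteq> Basis" for x B
    using that
  proof (induction B rule: finite_induct)
    case (insert c B)
    define y where "y = x + (\<Sum>b\<in>B. (2 * (lam b - x \<bullet> b)) *\<^sub>R b)"
    have "(\<Sum>b\<in>B. (2 * (lam b - x \<bullet> b)) *\<^sub>R b) \<bullet> c = 0"
      unfolding inner_sum_left
    proof (rule sum.neutral, rule ballI)
      fix b assume "b \<in> B"
      then have "b \<in> Basis" "b \<noteq> c" using insert by auto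
      then show "(2 * (lam b - x \<bullet> b)) *\<^sub>R b \<bullet> c = 0" using insert.prems by (simp add: inner_Basis)
    qed
    then have "y \<bullet> c = x \<bullet> c" by (simp add: y_def inner_add_left)
    then have "x + (\<Sum>b\<in>insert c B. (2 * (lam b - x \<bullet> b)) *\<^sub>R b) = R c (lam c) y"
      using insert by (simp add: hyp_reflect_def y_def algebra_simps)
    moreover have "u (R c (lam c) y) = u y" using lam(1)[of c] insert by (simp add: symmetric_at_def)
    ultimately show ?case using insert by (simp add: y_def)
  qed simp
  have point: "u (2 *\<^sub>R x0 - x) = u x" for x
  proof -
    have "(\<Sum>b\<in>Basis. (2 * (lam b - x \<bullet> b)) *\<^sub>R b) = (\<Sum>b\<in>Basis. ((2 *\<^sub>R (x0 - x)) \<bullet> b) *\<^sub>R b)"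
      by (intro sum.cong) (simp_all add: x0 inner_diff_left)
    also have "\<dots> = 2 *\<^sub>R (x0 - x)" by (rule euclidean_representation)
    finally have "u (x + 2 *\<^sub>R (x0 - x)) = u x" using partial[OF finite_Basis subset_refl, of x] by (simp only:)
    moreover have "2 *\<^sub>R x0 - x = x + 2 *\<^sub>R (x0 - x)" by (simp add: algebra_simps scaleR_2)
    ultimately show ?thesis by (simp only:)
  qed
  have "lam e = x0 \<bullet> e" if e: "norm e = 1" for e
  proof -
    \<comment> \<open>The conjugation: point reflection, reflection at level \<open>lam e\<close>,
      point reflection again.\<close>
    have R: "R e (2 * (x0 \<bullet> e) - lam e) x = 2 *\<^sub>R x0 - R e (lam e) (2 *\<^sub>R x0 - x)" for x
      by (simp add: hyp_reflect_def inner_diff_left algebra_simps)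
    have "symmetric_at e (2 * (x0 \<bullet> e) - lam e)"
      unfolding symmetric_at_def R point using lam(1)[OF e] unfolding symmetric_at_def by (simp only: point simp_thms)
    then show ?thesis using symmetric_at_unique[OF e lam(1)[OF e], of "2 * (x0 \<bullet> e) - lam e"] by simp
  qed
  then show ?thesis using lam by metis
qed

text \<open>Any two distinct points are mirror images in their perpendicular bisector. Its position
  relative to \<open>x0\<close> is governed by the difference of the squared distances to
  \<open>x0\<close>: equal distances give symmetry, unequal ones strict monotonicity.\<close>

lemma radially_decreasing:
  "\<exists>x0 g. strict_antimono_on {0..} g \<and> (\<forall>x. u x = g (norm (x - x0)))"
proof -
  obtain x0 where sym: "\<And>e x. norm e = 1 \<Longrightarrow> u (R e (x0 \<bullet> e) x) = u x"
    and strict: "\<And>e \<mu> x. norm e = 1 \<Longrightarrow> \<mu> > x0 \<bullet> e \<Longrightarrow> x \<bullet> e > \<mu> \<Longrightarrow> u x < u (R e \<mu> x)"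
    using symmetric_about_point unfolding symmetric_at_def by metis
  have key: "\<exists>e l. norm e = 1 \<and> R e l y = x \<and> y \<bullet> e > l \<and>
      2 * norm (y - x) * (l - x0 \<bullet> e) = (norm (y - x0))\<^sup>2 - (norm (x - x0))\<^sup>2" if "x \<noteq> y" for x y
  proof -
    define r where "r = norm (y - x)"
    define e where "e = (1 / r) *\<^sub>R (y - x)"
    define l where "l = ((1 / 2) *\<^sub>R (x + y)) \<bullet> e"
    have r: "r > 0" using that by (simp add: r_def)
    have e: "norm e = 1" using r by (simp add: e_def r_def)
    have yx: "y - x = r *\<^sub>R e" using r by (simp add: e_def)
    have y: "y = x + r *\<^sub>R e" using yx by (simp add: algebra_simps)
    have ee: "e \<bullet> e = 1" using e by (simp add: norm_eq_1)
    have "2 * (l - y \<bullet> e) = - r" by (simp add: l_def y ee algebra_simps inner_add_left)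
    then have "R e l y = x" "y \<bullet> e > l" using r by (auto simp: hyp_reflect_def y)
    moreover have "2 * r * (l - x0 \<bullet> e) = (norm (y - x0))\<^sup>2 - (norm (x - x0))\<^sup>2"
      unfolding l_def y power2_norm_eq_inner
      by (simp add: ee inner_add_left inner_add_right inner_diff_left inner_diff_right inner_commute algebra_simps)
    ultimately show ?thesis using e unfolding r_def by blast
  qed
  have lt: "u y < u x" if xy: "norm (x - x0) < norm (y - x0)" for x y
  proof -
    have ne: "x \<noteq> y" using xy by auto
    obtain e l where el: "norm e = 1" "R e l y = x" "y \<bullet> e > l"
      "2 * norm (y - x) * (l - x0 \<bullet> e) = (norm (y - x0))\<^sup>2 - (norm (x - x0))\<^sup>2"
      using key[OF ne] by blast
    have "(norm (x - x0))\<^sup>2 < (norm (y - x0))\<^sup>2" using xy by (intro power_strict_mono) auto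
    then have "2 * norm (y - x) * (l - x0 \<bullet> e) > 0" using el(4) by simp
    then have "l > x0 \<bullet> e" using ne by (simp add: zero_less_mult_iff)
    then show ?thesis using strict[OF el(1) _ el(3)] el(2) by simp
  qed
  have eq: "u y = u x" if xy: "norm (x - x0) = norm (y - x0)" for x y
  proof (cases "x = y")
    case False
    obtain e l where el: "norm e = 1" "R e l y = x" "y \<bullet> e > l"
      "2 * norm (y - x) * (l - x0 \<bullet> e) = (norm (y - x0))\<^sup>2 - (norm (x - x0))\<^sup>2"
      using key[OF False] by blast
    then have "l = x0 \<bullet> e" using xy False by simp
    then show ?thesis using sym[OF el(1), of y] el(2) by simp
  qed simp
  obtain b :: 'a where b: "b \<in> Basis" using nonempty_Basis by blast
  define g where "g r = u (x0 + r *\<^sub>R b)" for r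
  have "strict_antimono_on {0..} g"
    by (rule monotone_onI) (use b in \<open>auto simp: g_def intro!: lt\<close>)
  moreover have "u x = g (norm (x - x0))" for x
    unfolding g_def by (rule eq) (use b in simp)
  ultimately show ?thesis by blast
qed

end

text \<open>Two changes on null sets are made. Clamping to \<open>[0, 1]\<close> first makes the
  right side bounded everywhere, as the increment estimate requires. The continuous representative
  comes second and inherits the range because \<open>[0, 1]\<close> is closed.\<close>

lemma continuous_solution_exists:
  fixes v :: "'a::euclidean_space \<Rightarrow> real"
  assumes s: "0 < s" "s < 1" and pq: "p > 2" "q > p" "\<epsilon> > 0" and \<kappa>: "\<kappa> > 0"
    and v: "sq_integrable v" "finite_energy s v" "integrable lborel (\<lambda>x. \<bar>v x\<bar> powr q)"
      "AE x in lborel. v x \<ge> 0" "\<not> (AE x in lborel. v x = 0)"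
    and weak: "\<And>\<phi> M. sq_integrable \<phi> \<Longrightarrow> finite_energy s \<phi> \<Longrightarrow> (\<forall>x. \<bar>\<phi> x\<bar> \<le> M) \<Longrightarrow>
      \<kappa> * energy s v \<phi> + \<epsilon> * (\<integral>x. v x * \<phi> x \<partial>lborel) =
      (\<integral>x. v x powr (p - 1) * \<phi> x \<partial>lborel) - (\<integral>x. v x powr (q - 1) * \<phi> x \<partial>lborel)"
  shows "\<exists>w. continuous_solution s p q \<epsilon> \<kappa> w \<and> (AE x in lborel. v x = w x)"
proof -
  have [measurable]: "v \<in> borel_measurable borel" using v(1) by (rule sq_integrable_measurable)
  have transfer: "sq_integrable w \<and> finite_energy s w \<and>
      (\<forall>\<phi> M. sq_integrable \<phi> \<longrightarrow> finite_energy s \<phi> \<longrightarrow> (\<forall>x. \<bar>\<phi> x\<bar> \<le> M) \<longrightarrow>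
        \<kappa> * energy s w \<phi> = (\<integral>x. nonlin p q \<epsilon> (w x) * \<phi> x \<partial>lborel))"
    if w[measurable]: "w \<in> borel_measurable borel" and eq: "AE x in lborel. v x = w x" and w01: "\<And>x. w x \<in> {0..1}" for w
  proof (intro conjI allI impI)
    have "integrable lborel (\<lambda>x. (w x)\<^sup>2) \<longleftrightarrow> integrable lborel (\<lambda>x. (v x)\<^sup>2)"
      using eq by (intro integrable_cong_AE) auto
    then show wsq: "sq_integrable w" using v(1) by (simp add: sq_integrable_def)
    show wfe: "finite_energy s w" by (rule finite_energy_AE_cong[OF v(2) w eq])
    fix \<phi> :: "'a \<Rightarrow> real" and M :: real
    assume \<phi>: "sq_integrable \<phi>" "finite_energy s \<phi>" "\<forall>x. \<bar>\<phi> x\<bar> \<le> M"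
    have [measurable]: "\<phi> \<in> borel_measurable borel" using \<phi>(1) by (rule sq_integrable_measurable)
    have e: "energy s v \<phi> = energy s w \<phi>" by (rule energy_AE_cong) (use eq in auto)
    have i: "(\<integral>x. f (v x) * \<phi> x \<partial>lborel) = (\<integral>x. f (w x) * \<phi> x \<partial>lborel)" if [measurable]: "f \<in> borel_measurable borel" for f
      using eq by (intro integral_cong_AE) auto
    have int: "integrable lborel (\<lambda>x. w x powr a * \<phi> x)" if "a > 1" for a
    proof (rule sq_integrable_mult[OF _ \<phi>(1)])
      have "w x powr a \<le> 1 * w x" for x
        using w01[of x] that powr_mono'[of 1 a "w x"] by auto
      then show "sq_integrable (\<lambda>x. w x powr a)"
        using w01 by (intro sq_integrable_bound[OF wsq, of _ 1]) auto
    qed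
    have "(\<integral>x. nonlin p q \<epsilon> (w x) * \<phi> x \<partial>lborel) = (\<integral>x. w x powr (p - 1) * \<phi> x - w x powr (q - 1) * \<phi> x - \<epsilon> * (w x * \<phi> x) \<partial>lborel)"
      by (simp add: nonlin_def left_diff_distrib mult.assoc)
    also have "\<dots> = (\<integral>x. w x powr (p - 1) * \<phi> x \<partial>lborel) - (\<integral>x. w x powr (q - 1) * \<phi> x \<partial>lborel) - \<epsilon> * (\<integral>x. w x * \<phi> x \<partial>lborel)"
      using int[of "p - 1"] int[of "q - 1"] sq_integrable_mult[OF wsq \<phi>(1)] pq by simp
    finally show "\<kappa> * energy s w \<phi> = (\<integral>x. nonlin p q \<epsilon> (w x) * \<phi> x \<partial>lborel)"
      using weak[OF \<phi>] i[of "\<lambda>t. t"] i[of "\<lambda>t. t powr (p - 1)"] i[of "\<lambda>t. t powr (q - 1)"] e by simp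
  qed
  have le1: "AE x in lborel. v x \<le> 1" by (rule energy_solution_le_1[OF pq \<kappa> v(1-4) weak])
  define c where "c x = min 1 (max 0 (v x))" for x
  have [measurable]: "c \<in> borel_measurable borel" unfolding c_def[abs_def] by measurable
  have c01: "c x \<in> {0..1}" for x by (auto simp: c_def)
  have vc: "AE x in lborel. v x = c x" using v(4) le1 by eventually_elim (simp add: c_def)
  have c: "sq_integrable c" "finite_energy s c"
    and cweak: "\<And>\<phi> M. sq_integrable \<phi> \<Longrightarrow> finite_energy s \<phi> \<Longrightarrow> (\<forall>x. \<bar>\<phi> x\<bar> \<le> M) \<Longrightarrow>
        \<kappa> * energy s c \<phi> = (\<integral>x. nonlin p q \<epsilon> (c x) * \<phi> x \<partial>lborel)"
    using transfer[OF _ vc c01] by auto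
  have bnd: "\<bar>nonlin p q \<epsilon> (c x)\<bar> \<le> p + q + \<epsilon>" for x
  proof -
    have "\<bar>nonlin p q \<epsilon> (c x)\<bar> \<le> (p + q + \<epsilon>) * \<bar>c x\<bar>" by (rule nonlin_bound) (use pq c01 in auto)
    also have "\<dots> \<le> p + q + \<epsilon>" using pq c01[of x] by (intro mult_left_le) auto
    finally show ?thesis .
  qed
  have cm: "(\<lambda>x. nonlin p q \<epsilon> (c x)) \<in> borel_measurable borel" unfolding nonlin_def by measurable
  obtain w where w: "continuous_on UNIV w" "AE x in lborel. c x = w x"
    using continuous_representative[of c] bounded_solution_increment[OF s(1) \<kappa> c c01 cm bnd cweak] by auto
  have vw: "AE x in lborel. v x = w x" using vc w(2) by eventually_elim simp
  have w01: "w x \<in> {0..1}" for x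
  proof (rule AE_lborel_continuous_closed[OF w(1)])
    show "AE x in lborel. w x \<in> {0..1}"
      using w(2)
    proof eventually_elim
      case (elim x)
      then show ?case using c01[of x] by simp
    qed
  qed simp
  have wm: "w \<in> borel_measurable borel" by (rule borel_measurable_continuous_onI[OF w(1)])
  have "\<exists>x. w x \<noteq> 0"
  proof (rule ccontr)
    assume "\<not> ?thesis"
    then have "AE x in lborel. v x = 0" using vw by simp
    then show False using v(5) by blast
  qed
  then have "continuous_solution s p q \<epsilon> \<kappa> w"
    unfolding continuous_solution_def using transfer[OF wm vw w01] s pq \<kappa> w(1) w01 by blast
  then show ?thesis using vw by blast
qed

theorem theorem1p2:
  fixes s p q \<epsilon> :: real and u :: "real ^ 'n \<Rightarrow> real"
  assumes "0 < s" and "s < 1" and "real CARD('n) > 2 * s"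
    and "p > 2" and "q > p" and "\<epsilon> > 0"
    and "weak_solution s p q \<epsilon> u"
  shows "\<exists>v. continuous_on UNIV v \<and> (AE x in lebesgue. v x = u x) \<and>
    (\<exists>x0. radially_strictly_decreasing_about x0 v)"
proof -
  have "q \<ge> 2" using assms(4,5) by simp
  obtain \<kappa> v where \<kappa>: "\<kappa> > 0" and v: "sq_integrable v" "finite_energy s v" "integrable lborel (\<lambda>x. \<bar>v x\<bar> powr q)"
      "AE x in lborel. v x \<ge> 0" "\<not> (AE x in lborel. v x = 0)"
    and uv: "AE x in lebesgue. u x = v x"
    and weak: "\<forall>\<phi> M. sq_integrable \<phi> \<longrightarrow> finite_energy s \<phi> \<longrightarrow> (\<forall>x. \<bar>\<phi> x\<bar> \<le> M) \<longrightarrow>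
      \<kappa> * energy s v \<phi> + \<epsilon> * (\<integral>x. v x * \<phi> x \<partial>lborel) =
      (\<integral>x. v x powr (p - 1) * \<phi> x \<partial>lborel) - (\<integral>x. v x powr (q - 1) * \<phi> x \<partial>lborel)"
    using weak_solution_energy_form[OF assms(1-3) \<open>q \<ge> 2\<close> assms(7)] by blast
  have "\<exists>w. continuous_solution s p q \<epsilon> \<kappa> w \<and> (AE x in lborel. v x = w x)"
    by (rule continuous_solution_exists[OF assms(1,2,4-6) \<kappa> v]) (use weak in blast)
  then obtain w where w: "continuous_solution s p q \<epsilon> \<kappa> w" and vw: "AE x in lborel. v x = w x" by blast
  interpret continuous_solution s p q \<epsilon> \<kappa> w by (rule w)
  have "AE x in lebesgue. v x = w x" using vw by (rule AE_completion)
  with uv have "AE x in lebesgue. w x = u x" by eventually_elim simp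
  then show ?thesis
    using cont radially_decreasing unfolding radially_strictly_decreasing_about_def by blast
qed

end
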